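(* Let $k$ be a field of characteristic zero and let $H$ be an irreducible symmetrically braided bialgebra over $k$. Then $H$ is of PBW type as a $k$-module; that is, the associated braided graded algebra $\operatorname{gr} H$ (with respect to the coradical filtration of $H$) is isomorphic, as a braided graded algebra, to the braided graded symmetric algebra $\mathcal{S}(V)$ of some braided graded vector space $V$.
   Context: All objects are $k$-vector spaces, all maps are $k$-linear, and $\otimes=\otimes_k$. For a map $\mathfrak{c}:V^{\otimes 2}\to V^{\otimes 2}$, $\mathfrak{c}_i:V^{\otimes n}\to V^{\otimes n}$ denotes $\mathrm{id}_{V^{\otimes i-1}}\otimes\mathfrak{c}\otimes \mathrm{id}_{V^{\otimes n-i-1}}$. A braided vector space is a pair $(V,\mathfrak{c})$ with $\mathfrak{c}:V^{\otimes 2}\to V^{\otimes 2}$ satisfying $\mathfrak{c}_1\mathfrak{c}_2\mathfrak{c}_1=\mathfrak{c}_2\mathfrak{c}_1\mathfrak{c}_2$. It is symmetrically braided if $\mathfrak{c}^2=\mathrm{id}$. A morphism $f:(V,\mathfrak{c}_V)\to(W,\mathfrak{c}_W)$ is a linear map with $\mathfrak{c}_W(f\otimes f)=(f\otimes f)\mathfrak{c}_V$. A subspace $X\subseteq V$ is categorical (compatible with the braiding) if $\mathfrak{c}(X\otimes V)\subseteq V\otimes X$ and $\mathfrak{c}(V\otimes X)\subseteq X\otimes V$; a filtration or grading is compatible with the braiding if all its terms are categorical. A braided algebra $(A,\nabla,1,\mathfrak{c})$ is a braided vector space $(A,\mathfrak{c})$ with an associative unital algebra structure $(A,\nabla,1)$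 such that $\mathfrak{c}(\nabla\otimes \mathrm{id})=(\mathrm{id}\otimes\nabla)\mathfrak{c}_1\mathfrak{c}_2$, $\mathfrak{c}(\mathrm{id}\otimes\nabla)=(\nabla\otimes\mathrm{id})\mathfrak{c}_2\mathfrak{c}_1$, $\mathfrak{c}(1\otimes a)=a\otimes 1$, $\mathfrak{c}(a\otimes 1)=1\otimes a$ for all $a\in A$. Morphisms of braided algebras are maps that are morphisms of unital algebras and of braided vector spaces; a braided graded algebra is a braided algebra with an algebra grading compatible with the braiding, and morphisms of such preserve the grading. A braided coalgebra $(C,\Delta,\varepsilon,\mathfrak{c})$ is a braided vector space with a coassociative counital coalgebra structure such that $(\Delta\otimes \mathrm{id})\mathfrak{c}=\mathfrak{c}_2\mathfrak{c}_1(\mathrm{id}\otimes\Delta)$, $(\mathrm{id}\otimes\Delta)\mathfrak{c}=\mathfrak{c}_1\mathfrak{c}_2(\Delta\otimes\mathrm{id})$, and $(\varepsilon\otimes\mathrm{id})\mathfrak{c}(c\otimes d)=\varepsilon(d)c=(\mathrm{id}\otimes\varepsilon)\mathfrak{c}(d\otimes c)$ for all $c,d\in C$. If $A$ is a braided algebra, $A^{\otimes 2}$ is a braided algebra with product $(\nabla\otimes\nabla)\mathfrak{c}_2$, unit $1\otimes 1$ and braiding $\mathfrak{c}_2\mathfrak{c}_1\mathfrak{c}_3\mathfrak{c}_2$. A braided bialgebra $(H,\nabla,1,\Delta,\varepsilon,\mathfrak{c})$ is both a braided algebra and a braided coalgebra (same $\mathfrak{c}$) such that $\Delta:H\to H^{\otimes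 2}$ and $\varepsilon:H\to k$ are algebra morphisms. It is symmetrically braided if $\mathfrak{c}^2=\mathrm{id}$. $\{H_n\}_{n\ge0}$ denotes the coradical filtration of $H$ ($H_0$ the coradical, $H_{-1}=0$). $H$ is irreducible if $H_0=k$. In that case the coradical filtration is a bialgebra filtration compatible with the braiding, and $\operatorname{gr}H=\bigoplus_{n\ge0}H_n/H_{n-1}$ is a braided graded bialgebra with the induced structures. For a braided vector space $(V,\mathfrak{c})$ the tensor algebra $\mathcal{T}(V)$ is a braided algebra with braiding $\bigoplus_{n,m}\mathfrak{c}_{n,m}$, where $\mathfrak{c}_{n,m}=(\mathfrak{c}_m\cdots\mathfrak{c}_{n+m-1})(\mathfrak{c}_{m-1}\cdots\mathfrak{c}_{n+m-2})\cdots(\mathfrak{c}_1\cdots\mathfrak{c}_n):V^{\otimes n}\otimes V^{\otimes m}\to V^{\otimes m}\otimes V^{\otimes n}$. The braided symmetric algebra $\mathcal{S}(V)$ is the quotient of $\mathcal{T}(V)$ by the ideal generated by $(\mathrm{id}_{V^{\otimes 2}}-\mathfrak{c})(V^{\otimes 2})$, with the induced braiding. A braided graded vector space is a braided vector space $V=\bigoplus_{n\ge0}V(n)$ with a grading compatible with the braiding; then $\mathcal{S}(V)$ is regarded as a braided graded algebra with the grading induced from the grading of $V$ (generators in $V(n)$ have degree $n$), and is called the braided graded symmetric algebra of $V$. *)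

theory Defs
  imports "HOL-Algebra.Module" "HOL-Algebra.QuotRing"
begin

text \<open>
  Vector spaces over a field \<open>K\<close> are modules over \<open>K\<close> in the sense of HOL-Algebra. The record
  type of modules extends that of rings, so the same record carries the multiplication and
  unit of a \<open>K\<close>-algebra; for a bare vector space these two fields are ignored.
\<close>

section \<open>Linear algebra\<close>

definition char_zero :: "('k, 'r) ring_scheme \<Rightarrow> bool" where
  "char_zero K \<longleftrightarrow> (\<forall>n::nat. n > 0 \<longrightarrow> [n] \<cdot>\<^bsub>K\<^esub> \<one>\<^bsub>K\<^esub> \<noteq> \<zero>\<^bsub>K\<^esub>)"

definition base_space :: "('k, 'r) ring_scheme \<Rightarrow> ('k, 'k) module" where
  "base_space K = \<lparr>carrier = carrier K, mult = mult K, one = \<one>\<^bsub>K\<^esub>, zero = \<zero>\<^bsub>K\<^esub>,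
     add = add K, smult = mult K\<rparr>"

definition subspan :: "('k, 'r) ring_scheme \<Rightarrow> ('k, 'a) module \<Rightarrow> 'a set \<Rightarrow> 'a set" where
  "subspan K M S = \<Inter>{N. submodule N K M \<and> S \<subseteq> N}"

definition linear_maps ::
    "('k, 'r) ring_scheme \<Rightarrow> ('k, 'a) module \<Rightarrow> ('k, 'b) module \<Rightarrow> ('a \<Rightarrow> 'b) set" where
  "linear_maps K M N = {f \<in> carrier M \<rightarrow> carrier N.
     (\<forall>x\<in>carrier M. \<forall>y\<in>carrier M. f (x \<oplus>\<^bsub>M\<^esub> y) = f x \<oplus>\<^bsub>N\<^esub> f y) \<and>
     (\<forall>a\<in>carrier K. \<forall>x\<in>carrier M. f (a \<odot>\<^bsub>M\<^esub> x) = a \<odot>\<^bsub>N\<^esub> f x)}"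

text \<open>
  The linear map \<open>M \<rightarrow> N\<close> determined by a property; below the property always prescribes the
  values on a spanning set. Extensionality only fixes the values outside the carrier.
\<close>

definition the_linear ::
    "('k, 'r) ring_scheme \<Rightarrow> ('k, 'a) module \<Rightarrow> ('k, 'b) module \<Rightarrow>
     (('a \<Rightarrow> 'b) \<Rightarrow> bool) \<Rightarrow> 'a \<Rightarrow> 'b" where
  "the_linear K M N P = (THE f. f \<in> linear_maps K M N \<and> f \<in> extensional (carrier M) \<and> P f)"

definition unital_algebra :: "('k, 'r) ring_scheme \<Rightarrow> ('k, 'a) module \<Rightarrow> bool" where
  "unital_algebra K A \<longleftrightarrow> ring A \<and> module K A \<and>
     (\<forall>a\<in>carrier K. \<forall>x\<in>carrier A. \<forall>y\<in>carrier A.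
        (a \<odot>\<^bsub>A\<^esub> x) \<otimes>\<^bsub>A\<^esub> y = a \<odot>\<^bsub>A\<^esub> (x \<otimes>\<^bsub>A\<^esub> y) \<and>
        x \<otimes>\<^bsub>A\<^esub> (a \<odot>\<^bsub>A\<^esub> y) = a \<odot>\<^bsub>A\<^esub> (x \<otimes>\<^bsub>A\<^esub> y))"

definition quot_algebra :: "('k, 'a) module \<Rightarrow> 'a set \<Rightarrow> ('k, 'a set) module" where
  "quot_algebra A I = \<lparr>carrier = carrier (A Quot I), mult = mult (A Quot I),
     one = one (A Quot I), zero = zero (A Quot I), add = add (A Quot I),
     smult = (\<lambda>a X. \<Union>x\<in>X. I +>\<^bsub>A\<^esub> (a \<odot>\<^bsub>A\<^esub> x))\<rparr>"

section \<open>The tensor algebra and tensor powers\<close>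

text \<open>
  The tensor algebra of \<open>V\<close> is the free algebra on the elements of \<open>V\<close> (finitely supported
  functions on words, with convolution) modulo the ideal of linearity relations.
\<close>

definition free_algebra ::
    "('k, 'r) ring_scheme \<Rightarrow> 'x set \<Rightarrow> ('k, 'x list \<Rightarrow> 'k) module" where
  "free_algebra K X = \<lparr>
     carrier = {f. (\<forall>w. f w \<in> carrier K) \<and> finite {w. f w \<noteq> \<zero>\<^bsub>K\<^esub>} \<and>
                   (\<forall>w. f w \<noteq> \<zero>\<^bsub>K\<^esub> \<longrightarrow> set w \<subseteq> X)},
     mult = (\<lambda>f g w. \<Oplus>\<^bsub>K\<^esub>i\<in>{..length w}. f (take i w) \<otimes>\<^bsub>K\<^esub> g (drop i w)),
     one = (\<lambda>w. if w = [] then \<one>\<^bsub>K\<^esub> else \<zero>\<^bsub>K\<^esub>),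
     zero = (\<lambda>w. \<zero>\<^bsub>K\<^esub>),
     add = (\<lambda>f g w. f w \<oplus>\<^bsub>K\<^esub> g w),
     smult = (\<lambda>a f w. a \<otimes>\<^bsub>K\<^esub> f w)\<rparr>"

definition word :: "('k, 'r) ring_scheme \<Rightarrow> 'x list \<Rightarrow> 'x list \<Rightarrow> 'k" where
  "word K u = (\<lambda>w. if w = u then \<one>\<^bsub>K\<^esub> else \<zero>\<^bsub>K\<^esub>)"

definition tensor_ideal ::
    "('k, 'r) ring_scheme \<Rightarrow> ('k, 'v) module \<Rightarrow> ('v list \<Rightarrow> 'k) set" where
  "tensor_ideal K V = (let F = free_algebra K (carrier V) in
     Idl\<^bsub>F\<^esub> ({word K [x \<oplus>\<^bsub>V\<^esub> y] \<ominus>\<^bsub>F\<^esub> (word K [x] \<oplus>\<^bsub>F\<^esub> word K [y]) | x y.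
               x \<in> carrier V \<and> y \<in> carrier V} \<union>
            {word K [a \<odot>\<^bsub>V\<^esub> x] \<ominus>\<^bsub>F\<^esub> (a \<odot>\<^bsub>F\<^esub> word K [x]) | a x.
               a \<in> carrier K \<and> x \<in> carrier V}))"

definition tensor_algebra ::
    "('k, 'r) ring_scheme \<Rightarrow> ('k, 'v) module \<Rightarrow> ('k, ('v list \<Rightarrow> 'k) set) module" where
  "tensor_algebra K V = quot_algebra (free_algebra K (carrier V)) (tensor_ideal K V)"

text \<open>The pure tensor \<open>v\<^sub>1 \<otimes> \<dots> \<otimes> v\<^sub>n\<close> of a list of vectors.\<close>

definition tens ::
    "('k, 'r) ring_scheme \<Rightarrow> ('k, 'v) module \<Rightarrow> 'v list \<Rightarrow> ('v list \<Rightarrow> 'k) set" where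
  "tens K V vs = tensor_ideal K V +>\<^bsub>free_algebra K (carrier V)\<^esub> word K vs"

text \<open>
  The tensor power \<open>V\<^sup>\<otimes>\<^sup>n\<close> is the degree \<open>n\<close> part of the tensor algebra; the product of the
  tensor algebra realises the identifications \<open>V\<^sup>\<otimes>\<^sup>m \<otimes> V\<^sup>\<otimes>\<^sup>n = V\<^sup>\<otimes>\<^sup>(\<^sup>m\<^sup>+\<^sup>n\<^sup>)\<close>. In particular \<open>K\<close> is identified
  with \<open>V\<^sup>\<otimes>\<^sup>0\<close> and \<open>V\<close> with \<open>V\<^sup>\<otimes>\<^sup>1\<close>.
\<close>

definition tpow ::
    "('k, 'r) ring_scheme \<Rightarrow> ('k, 'v) module \<Rightarrow> nat \<Rightarrow> ('k, ('v list \<Rightarrow> 'k) set) module" where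
  "tpow K V n = (tensor_algebra K V)\<lparr>carrier :=
     subspan K (tensor_algebra K V) {tens K V vs | vs. length vs = n \<and> set vs \<subseteq> carrier V}\<rparr>"

text \<open>The subspace \<open>X \<otimes> Y\<close> of \<open>V \<otimes> V\<close>, for subspaces \<open>X\<close>, \<open>Y\<close> of \<open>V\<close>.\<close>

definition tprod ::
    "('k, 'r) ring_scheme \<Rightarrow> ('k, 'v) module \<Rightarrow> 'v set \<Rightarrow> 'v set \<Rightarrow> ('v list \<Rightarrow> 'k) set set" where
  "tprod K V X Y = subspan K (tensor_algebra K V) {tens K V [x, y] | x y. x \<in> X \<and> y \<in> Y}"

text \<open>\<open>f \<otimes> g : X \<otimes> Y \<rightarrow> W \<otimes> W\<close> for linear maps \<open>f : X \<rightarrow> W\<close> and \<open>g : Y \<rightarrow> W\<close>.\<close>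

definition tmap ::
    "('k, 'r) ring_scheme \<Rightarrow> ('k, 'v) module \<Rightarrow> 'v set \<Rightarrow> 'v set \<Rightarrow> ('k, 'w) module \<Rightarrow>
     ('v \<Rightarrow> 'w) \<Rightarrow> ('v \<Rightarrow> 'w) \<Rightarrow> ('v list \<Rightarrow> 'k) set \<Rightarrow> ('w list \<Rightarrow> 'k) set" where
  "tmap K V X Y W f g =
     the_linear K ((tensor_algebra K V)\<lparr>carrier := tprod K V X Y\<rparr>) (tpow K W 2)
       (\<lambda>h. \<forall>x\<in>X. \<forall>y\<in>Y. h (tens K V [x, y]) = tens K W [f x, g y])"

text \<open>
  \<open>id\<^sub>i \<otimes> f \<otimes> id\<^sub>j\<close> on \<open>V\<^sup>\<otimes>\<^sup>(\<^sup>i\<^sup>+\<^sup>p\<^sup>+\<^sup>j\<^sup>)\<close>, for a linear map \<open>f\<close> from \<open>V\<^sup>\<otimes>\<^sup>p\<close> to the tensor algebra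
  (in practice to some \<open>V\<^sup>\<otimes>\<^sup>q\<close>).
\<close>

definition amp ::
    "('k, 'r) ring_scheme \<Rightarrow> ('k, 'v) module \<Rightarrow> nat \<Rightarrow> nat \<Rightarrow>
     (('v list \<Rightarrow> 'k) set \<Rightarrow> ('v list \<Rightarrow> 'k) set) \<Rightarrow> nat \<Rightarrow>
     ('v list \<Rightarrow> 'k) set \<Rightarrow> ('v list \<Rightarrow> 'k) set" where
  "amp K V i p f j = the_linear K (tpow K V (i + p + j)) (tensor_algebra K V)
     (\<lambda>h. \<forall>u\<in>carrier (tpow K V i). \<forall>w\<in>carrier (tpow K V p). \<forall>v\<in>carrier (tpow K V j).
        h (u \<otimes>\<^bsub>tensor_algebra K V\<^esub> w \<otimes>\<^bsub>tensor_algebra K V\<^esub> v)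
          = u \<otimes>\<^bsub>tensor_algebra K V\<^esub> f w \<otimes>\<^bsub>tensor_algebra K V\<^esub> v)"

section \<open>Braided vector spaces\<close>

text \<open>\<open>brd K V c n i\<close> is \<open>c\<^sub>i\<close> acting on \<open>V\<^sup>\<otimes>\<^sup>n\<close>, for \<open>1 \<le> i < n\<close>.\<close>

definition brd ::
    "('k, 'r) ring_scheme \<Rightarrow> ('k, 'v) module \<Rightarrow>
     (('v list \<Rightarrow> 'k) set \<Rightarrow> ('v list \<Rightarrow> 'k) set) \<Rightarrow> nat \<Rightarrow> nat \<Rightarrow>
     ('v list \<Rightarrow> 'k) set \<Rightarrow> ('v list \<Rightarrow> 'k) set" where
  "brd K V c n i = amp K V (i - 1) 2 c (n - i - 1)"

definition braided_space ::
    "('k, 'r) ring_scheme \<Rightarrow> ('k, 'v) module \<Rightarrow>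
     (('v list \<Rightarrow> 'k) set \<Rightarrow> ('v list \<Rightarrow> 'k) set) \<Rightarrow> bool" where
  "braided_space K V c \<longleftrightarrow> module K V \<and> c \<in> linear_maps K (tpow K V 2) (tpow K V 2) \<and>
     (\<forall>t\<in>carrier (tpow K V 3).
        brd K V c 3 1 (brd K V c 3 2 (brd K V c 3 1 t))
          = brd K V c 3 2 (brd K V c 3 1 (brd K V c 3 2 t)))"

definition symmetric_braiding ::
    "('k, 'r) ring_scheme \<Rightarrow> ('k, 'v) module \<Rightarrow>
     (('v list \<Rightarrow> 'k) set \<Rightarrow> ('v list \<Rightarrow> 'k) set) \<Rightarrow> bool" where
  "symmetric_braiding K V c \<longleftrightarrow> (\<forall>t\<in>carrier (tpow K V 2). c (c t) = t)"

definition braided_hom ::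
    "('k, 'r) ring_scheme \<Rightarrow>
     ('k, 'v) module \<Rightarrow> (('v list \<Rightarrow> 'k) set \<Rightarrow> ('v list \<Rightarrow> 'k) set) \<Rightarrow>
     ('k, 'w) module \<Rightarrow> (('w list \<Rightarrow> 'k) set \<Rightarrow> ('w list \<Rightarrow> 'k) set) \<Rightarrow> ('v \<Rightarrow> 'w) set" where
  "braided_hom K V cV W cW = {f \<in> linear_maps K V W. \<forall>t\<in>carrier (tpow K V 2).
     cW (tmap K V (carrier V) (carrier V) W f f t)
       = tmap K V (carrier V) (carrier V) W f f (cV t)}"

definition categorical_subspace ::
    "('k, 'r) ring_scheme \<Rightarrow> ('k, 'v) module \<Rightarrow>
     (('v list \<Rightarrow> 'k) set \<Rightarrow> ('v list \<Rightarrow> 'k) set) \<Rightarrow> 'v set \<Rightarrow> bool" where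
  "categorical_subspace K V c X \<longleftrightarrow> submodule X K V \<and>
     c ` tprod K V X (carrier V) \<subseteq> tprod K V (carrier V) X \<and>
     c ` tprod K V (carrier V) X \<subseteq> tprod K V X (carrier V)"

definition grading ::
    "('k, 'r) ring_scheme \<Rightarrow> ('k, 'v) module \<Rightarrow> (nat \<Rightarrow> 'v set) \<Rightarrow> bool" where
  "grading K V G \<longleftrightarrow> (\<forall>n. submodule (G n) K V) \<and>
     (\<forall>x\<in>carrier V. \<exists>!a. (\<forall>n. a n \<in> G n) \<and> finite {n. a n \<noteq> \<zero>\<^bsub>V\<^esub>} \<and>
        x = (\<Oplus>\<^bsub>V\<^esub>n\<in>{n. a n \<noteq> \<zero>\<^bsub>V\<^esub>}. a n))"

definition braided_graded_space ::
    "('k, 'r) ring_scheme \<Rightarrow> ('k, 'v) module \<Rightarrow>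
     (('v list \<Rightarrow> 'k) set \<Rightarrow> ('v list \<Rightarrow> 'k) set) \<Rightarrow> (nat \<Rightarrow> 'v set) \<Rightarrow> bool" where
  "braided_graded_space K V c G \<longleftrightarrow>
     braided_space K V c \<and> grading K V G \<and> (\<forall>n. categorical_subspace K V c (G n))"

section \<open>Braided algebras, coalgebras and bialgebras\<close>

text \<open>The multiplication as a map \<open>A\<^sup>\<otimes>\<^sup>2 \<rightarrow> A\<^sup>\<otimes>\<^sup>1\<close>.\<close>

definition nabla ::
    "('k, 'r) ring_scheme \<Rightarrow> ('k, 'a) module \<Rightarrow>
     ('a list \<Rightarrow> 'k) set \<Rightarrow> ('a list \<Rightarrow> 'k) set" where
  "nabla K A = the_linear K (tpow K A 2) (tpow K A 1)
     (\<lambda>h. \<forall>x\<in>carrier A. \<forall>y\<in>carrier A. h (tens K A [x, y]) = tens K A [x \<otimes>\<^bsub>A\<^esub> y])"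

definition braided_algebra ::
    "('k, 'r) ring_scheme \<Rightarrow> ('k, 'a) module \<Rightarrow>
     (('a list \<Rightarrow> 'k) set \<Rightarrow> ('a list \<Rightarrow> 'k) set) \<Rightarrow> bool" where
  "braided_algebra K A c \<longleftrightarrow> braided_space K A c \<and> unital_algebra K A \<and>
     (\<forall>t\<in>carrier (tpow K A 3).
        c (amp K A 0 2 (nabla K A) 1 t)
          = amp K A 1 2 (nabla K A) 0 (brd K A c 3 1 (brd K A c 3 2 t)) \<and>
        c (amp K A 1 2 (nabla K A) 0 t)
          = amp K A 0 2 (nabla K A) 1 (brd K A c 3 2 (brd K A c 3 1 t))) \<and>
     (\<forall>a\<in>carrier A. c (tens K A [\<one>\<^bsub>A\<^esub>, a]) = tens K A [a, \<one>\<^bsub>A\<^esub>] \<and>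
        c (tens K A [a, \<one>\<^bsub>A\<^esub>]) = tens K A [\<one>\<^bsub>A\<^esub>, a])"

text \<open>The algebra \<open>A \<otimes> A\<close> with product \<open>(\<nabla> \<otimes> \<nabla>) c\<^sub>2\<close>.\<close>

definition tensor_square ::
    "('k, 'r) ring_scheme \<Rightarrow> ('k, 'a) module \<Rightarrow>
     (('a list \<Rightarrow> 'k) set \<Rightarrow> ('a list \<Rightarrow> 'k) set) \<Rightarrow> ('k, ('a list \<Rightarrow> 'k) set) module" where
  "tensor_square K A c = (tpow K A 2)\<lparr>
     mult := (\<lambda>s t. amp K A 0 2 (nabla K A) 1 (amp K A 2 2 (nabla K A) 0
                (brd K A c 4 2 (s \<otimes>\<^bsub>tensor_algebra K A\<^esub> t)))),
     one := tens K A [\<one>\<^bsub>A\<^esub>, \<one>\<^bsub>A\<^esub>]\<rparr>"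

definition braided_graded_algebra ::
    "('k, 'r) ring_scheme \<Rightarrow> ('k, 'a) module \<Rightarrow>
     (('a list \<Rightarrow> 'k) set \<Rightarrow> ('a list \<Rightarrow> 'k) set) \<Rightarrow> (nat \<Rightarrow> 'a set) \<Rightarrow> bool" where
  "braided_graded_algebra K A c G \<longleftrightarrow>
     braided_algebra K A c \<and> braided_graded_space K A c G \<and>
     \<one>\<^bsub>A\<^esub> \<in> G 0 \<and> (\<forall>m n. \<forall>x\<in>G m. \<forall>y\<in>G n. x \<otimes>\<^bsub>A\<^esub> y \<in> G (m + n))"

definition braided_graded_algebra_hom ::
    "('k, 'r) ring_scheme \<Rightarrow>
     ('k, 'a) module \<Rightarrow> (('a list \<Rightarrow> 'k) set \<Rightarrow> ('a list \<Rightarrow> 'k) set) \<Rightarrow> (nat \<Rightarrow> 'a set) \<Rightarrow>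
     ('k, 'b) module \<Rightarrow> (('b list \<Rightarrow> 'k) set \<Rightarrow> ('b list \<Rightarrow> 'k) set) \<Rightarrow> (nat \<Rightarrow> 'b set) \<Rightarrow>
     ('a \<Rightarrow> 'b) set" where
  "braided_graded_algebra_hom K A cA GA B cB GB =
     {f \<in> ring_hom A B. f \<in> braided_hom K A cA B cB \<and> (\<forall>n. f ` GA n \<subseteq> GB n)}"

definition braided_graded_algebra_iso ::
    "('k, 'r) ring_scheme \<Rightarrow>
     ('k, 'a) module \<Rightarrow> (('a list \<Rightarrow> 'k) set \<Rightarrow> ('a list \<Rightarrow> 'k) set) \<Rightarrow> (nat \<Rightarrow> 'a set) \<Rightarrow>
     ('k, 'b) module \<Rightarrow> (('b list \<Rightarrow> 'k) set \<Rightarrow> ('b list \<Rightarrow> 'k) set) \<Rightarrow> (nat \<Rightarrow> 'b set) \<Rightarrow>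
     bool" where
  "braided_graded_algebra_iso K A cA GA B cB GB \<longleftrightarrow>
     braided_graded_algebra K A cA GA \<and> braided_graded_algebra K B cB GB \<and>
     (\<exists>f\<in>braided_graded_algebra_hom K A cA GA B cB GB.
      \<exists>g\<in>braided_graded_algebra_hom K B cB GB A cA GA.
        (\<forall>x\<in>carrier A. g (f x) = x) \<and> (\<forall>y\<in>carrier B. f (g y) = y))"

text \<open>
  \<open>lift1\<close> regards a linear map on \<open>V\<close> with values in the tensor algebra as a map on \<open>V\<^sup>\<otimes>\<^sup>1\<close>.
  For the counit, \<open>K\<close> is identified with \<open>V\<^sup>\<otimes>\<^sup>0\<close>.
\<close>

definition lift1 ::
    "('k, 'r) ring_scheme \<Rightarrow> ('k, 'v) module \<Rightarrow> ('v \<Rightarrow> ('v list \<Rightarrow> 'k) set) \<Rightarrow>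
     ('v list \<Rightarrow> 'k) set \<Rightarrow> ('v list \<Rightarrow> 'k) set" where
  "lift1 K V f = the_linear K (tpow K V 1) (tensor_algebra K V)
     (\<lambda>h. \<forall>x\<in>carrier V. h (tens K V [x]) = f x)"

definition counit_map ::
    "('k, 'r) ring_scheme \<Rightarrow> ('k, 'v) module \<Rightarrow> ('v \<Rightarrow> 'k) \<Rightarrow>
     ('v list \<Rightarrow> 'k) set \<Rightarrow> ('v list \<Rightarrow> 'k) set" where
  "counit_map K V \<epsilon> =
     lift1 K V (\<lambda>x. \<epsilon> x \<odot>\<^bsub>tensor_algebra K V\<^esub> \<one>\<^bsub>tensor_algebra K V\<^esub>)"

definition coalgebra ::
    "('k, 'r) ring_scheme \<Rightarrow> ('k, 'c) module \<Rightarrow> ('c \<Rightarrow> ('c list \<Rightarrow> 'k) set) \<Rightarrow> ('c \<Rightarrow> 'k) \<Rightarrow>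
     bool" where
  "coalgebra K C \<Delta> \<epsilon> \<longleftrightarrow> module K C \<and>
     \<Delta> \<in> linear_maps K C (tpow K C 2) \<and> \<epsilon> \<in> linear_maps K C (base_space K) \<and>
     (\<forall>x\<in>carrier C.
        amp K C 0 1 (lift1 K C \<Delta>) 1 (\<Delta> x) = amp K C 1 1 (lift1 K C \<Delta>) 0 (\<Delta> x) \<and>
        amp K C 0 1 (counit_map K C \<epsilon>) 1 (\<Delta> x) = tens K C [x] \<and>
        amp K C 1 1 (counit_map K C \<epsilon>) 0 (\<Delta> x) = tens K C [x])"

definition braided_coalgebra ::
    "('k, 'r) ring_scheme \<Rightarrow> ('k, 'c) module \<Rightarrow> ('c \<Rightarrow> ('c list \<Rightarrow> 'k) set) \<Rightarrow> ('c \<Rightarrow> 'k) \<Rightarrow>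
     (('c list \<Rightarrow> 'k) set \<Rightarrow> ('c list \<Rightarrow> 'k) set) \<Rightarrow> bool" where
  "braided_coalgebra K C \<Delta> \<epsilon> c \<longleftrightarrow> braided_space K C c \<and> coalgebra K C \<Delta> \<epsilon> \<and>
     (\<forall>t\<in>carrier (tpow K C 2).
        amp K C 0 1 (lift1 K C \<Delta>) 1 (c t)
          = brd K C c 3 2 (brd K C c 3 1 (amp K C 1 1 (lift1 K C \<Delta>) 0 t)) \<and>
        amp K C 1 1 (lift1 K C \<Delta>) 0 (c t)
          = brd K C c 3 1 (brd K C c 3 2 (amp K C 0 1 (lift1 K C \<Delta>) 1 t))) \<and>
     (\<forall>x\<in>carrier C. \<forall>y\<in>carrier C.
        amp K C 0 1 (counit_map K C \<epsilon>) 1 (c (tens K C [x, y])) = tens K C [\<epsilon> y \<odot>\<^bsub>C\<^esub> x] \<and>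
        amp K C 1 1 (counit_map K C \<epsilon>) 0 (c (tens K C [y, x])) = tens K C [\<epsilon> y \<odot>\<^bsub>C\<^esub> x])"

definition braided_bialgebra ::
    "('k, 'r) ring_scheme \<Rightarrow> ('k, 'h) module \<Rightarrow> ('h \<Rightarrow> ('h list \<Rightarrow> 'k) set) \<Rightarrow> ('h \<Rightarrow> 'k) \<Rightarrow>
     (('h list \<Rightarrow> 'k) set \<Rightarrow> ('h list \<Rightarrow> 'k) set) \<Rightarrow> bool" where
  "braided_bialgebra K H \<Delta> \<epsilon> c \<longleftrightarrow>
     braided_algebra K H c \<and> braided_coalgebra K H \<Delta> \<epsilon> c \<and>
     \<Delta> \<in> ring_hom H (tensor_square K H c) \<and> \<epsilon> \<in> ring_hom H K"

section \<open>The coradical filtration and the associated graded algebra\<close>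

definition subcoalgebra ::
    "('k, 'r) ring_scheme \<Rightarrow> ('k, 'c) module \<Rightarrow> ('c \<Rightarrow> ('c list \<Rightarrow> 'k) set) \<Rightarrow> 'c set \<Rightarrow>
     bool" where
  "subcoalgebra K C \<Delta> D \<longleftrightarrow> submodule D K C \<and> \<Delta> ` D \<subseteq> tprod K C D D"

definition simple_subcoalgebra ::
    "('k, 'r) ring_scheme \<Rightarrow> ('k, 'c) module \<Rightarrow> ('c \<Rightarrow> ('c list \<Rightarrow> 'k) set) \<Rightarrow> 'c set \<Rightarrow>
     bool" where
  "simple_subcoalgebra K C \<Delta> D \<longleftrightarrow> subcoalgebra K C \<Delta> D \<and> D \<noteq> {\<zero>\<^bsub>C\<^esub>} \<and>
     (\<forall>E. subcoalgebra K C \<Delta> E \<and> E \<subseteq> D \<longrightarrow> E = {\<zero>\<^bsub>C\<^esub>} \<or> E = D)"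

definition coradical ::
    "('k, 'r) ring_scheme \<Rightarrow> ('k, 'c) module \<Rightarrow> ('c \<Rightarrow> ('c list \<Rightarrow> 'k) set) \<Rightarrow> 'c set" where
  "coradical K C \<Delta> = subspan K C (\<Union>{D. simple_subcoalgebra K C \<Delta> D})"

primrec coradical_filtration ::
    "('k, 'r) ring_scheme \<Rightarrow> ('k, 'c) module \<Rightarrow> ('c \<Rightarrow> ('c list \<Rightarrow> 'k) set) \<Rightarrow> nat \<Rightarrow>
     'c set" where
  "coradical_filtration K C \<Delta> 0 = coradical K C \<Delta>"
| "coradical_filtration K C \<Delta> (Suc n) = {x \<in> carrier C.
     \<Delta> x \<in> tprod K C (carrier C) (coradical_filtration K C \<Delta> n)
            <+>\<^bsub>tensor_algebra K C\<^esub> tprod K C (coradical K C \<Delta>) (carrier C)}"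

definition irreducible_bialgebra ::
    "('k, 'r) ring_scheme \<Rightarrow> ('k, 'h) module \<Rightarrow> ('h \<Rightarrow> ('h list \<Rightarrow> 'k) set) \<Rightarrow> bool" where
  "irreducible_bialgebra K H \<Delta> \<longleftrightarrow>
     coradical K H \<Delta> = {a \<odot>\<^bsub>H\<^esub> \<one>\<^bsub>H\<^esub> | a. a \<in> carrier K}"

text \<open>For a filtration \<open>F\<close>, \<open>prev H F n\<close> is \<open>F (n - 1)\<close> with the convention that \<open>F (- 1) = 0\<close>.\<close>

definition prev :: "('k, 'h) module \<Rightarrow> (nat \<Rightarrow> 'h set) \<Rightarrow> nat \<Rightarrow> 'h set" where
  "prev H F n = (case n of 0 \<Rightarrow> {\<zero>\<^bsub>H\<^esub>} | Suc m \<Rightarrow> F m)"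

text \<open>
  An element of \<open>gr H\<close> is the finitely supported sequence of its homogeneous components; the
  component in degree \<open>n\<close> is a coset of \<open>F (n - 1)\<close> represented by an element of \<open>F n\<close>. The
  product is determined by \<open>[x]\<^sub>m [y]\<^sub>n = [x y]\<^sub>m\<^sub>+\<^sub>n\<close>.
\<close>

definition gr :: "('k, 'h) module \<Rightarrow> (nat \<Rightarrow> 'h set) \<Rightarrow> ('k, nat \<Rightarrow> 'h set) module" where
  "gr H F = \<lparr>
     carrier = {a. (\<forall>n. \<exists>x\<in>F n. a n = prev H F n +>\<^bsub>H\<^esub> x) \<and> finite {n. a n \<noteq> prev H F n}},
     mult = (\<lambda>a b n. \<Union>x\<in>{x. \<forall>i. x i \<in> a i}. \<Union>y\<in>{y. \<forall>i. y i \<in> b i}.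
               prev H F n +>\<^bsub>H\<^esub> (\<Oplus>\<^bsub>H\<^esub>i\<in>{..n}. x i \<otimes>\<^bsub>H\<^esub> y (n - i))),
     one = (\<lambda>n. if n = 0 then prev H F 0 +>\<^bsub>H\<^esub> \<one>\<^bsub>H\<^esub> else prev H F n),
     zero = prev H F,
     add = (\<lambda>a b n. a n <+>\<^bsub>H\<^esub> b n),
     smult = (\<lambda>s a n. \<Union>x\<in>a n. prev H F n +>\<^bsub>H\<^esub> (s \<odot>\<^bsub>H\<^esub> x))\<rparr>"

definition gr_grading :: "('k, 'h) module \<Rightarrow> (nat \<Rightarrow> 'h set) \<Rightarrow> nat \<Rightarrow> (nat \<Rightarrow> 'h set) set" where
  "gr_grading H F n = {a \<in> carrier (gr H F). \<forall>m. m \<noteq> n \<longrightarrow> a m = prev H F m}"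

text \<open>The canonical map \<open>F n \<rightarrow> F n / F (n - 1) \<subseteq> gr H\<close>.\<close>

definition gr_class :: "('k, 'h) module \<Rightarrow> (nat \<Rightarrow> 'h set) \<Rightarrow> nat \<Rightarrow> 'h \<Rightarrow> nat \<Rightarrow> 'h set" where
  "gr_class H F n x = (\<lambda>m. if m = n then prev H F n +>\<^bsub>H\<^esub> x else prev H F m)"

text \<open>
  The braiding of \<open>gr H\<close> induced by the restrictions \<open>c : F m \<otimes> F n \<rightarrow> F n \<otimes> F m\<close>.
\<close>

definition gr_braiding ::
    "('k, 'r) ring_scheme \<Rightarrow> ('k, 'h) module \<Rightarrow> (nat \<Rightarrow> 'h set) \<Rightarrow>
     (('h list \<Rightarrow> 'k) set \<Rightarrow> ('h list \<Rightarrow> 'k) set) \<Rightarrow>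
     ((nat \<Rightarrow> 'h set) list \<Rightarrow> 'k) set \<Rightarrow> ((nat \<Rightarrow> 'h set) list \<Rightarrow> 'k) set" where
  "gr_braiding K H F c = the_linear K (tpow K (gr H F) 2) (tpow K (gr H F) 2)
     (\<lambda>h. \<forall>m n. \<forall>x\<in>F m. \<forall>y\<in>F n.
        h (tens K (gr H F) [gr_class H F m x, gr_class H F n y])
          = tmap K H (F n) (F m) (gr H F) (gr_class H F n) (gr_class H F m)
              (c (tens K H [x, y])))"

section \<open>The braided symmetric algebra\<close>

text \<open>
  \<open>braid_nm K V c n m\<close> is
  \<open>(c\<^sub>m \<dots> c\<^sub>n\<^sub>+\<^sub>m\<^sub>-\<^sub>1) \<dots> (c\<^sub>2 \<dots> c\<^sub>n\<^sub>+\<^sub>1) (c\<^sub>1 \<dots> c\<^sub>n)\<close> on \<open>V\<^sup>\<otimes>\<^sup>(\<^sup>n\<^sup>+\<^sup>m\<^sup>)\<close>; the outer \<open>fold\<close> applies the factor with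
  \<open>j = 1\<close> first, the inner \<open>foldr\<close> applies \<open>c\<^sub>j\<^sub>+\<^sub>n\<^sub>-\<^sub>1\<close> first.
\<close>

definition braid_nm ::
    "('k, 'r) ring_scheme \<Rightarrow> ('k, 'v) module \<Rightarrow>
     (('v list \<Rightarrow> 'k) set \<Rightarrow> ('v list \<Rightarrow> 'k) set) \<Rightarrow> nat \<Rightarrow> nat \<Rightarrow>
     ('v list \<Rightarrow> 'k) set \<Rightarrow> ('v list \<Rightarrow> 'k) set" where
  "braid_nm K V c n m t =
     fold (\<lambda>j. foldr (brd K V c (n + m)) [j..<j + n]) [1..<m + 1] t"

text \<open>The map \<open>V\<^sup>\<otimes>\<^sup>(\<^sup>m\<^sup>+\<^sup>n\<^sup>) = V\<^sup>\<otimes>\<^sup>m \<otimes> V\<^sup>\<otimes>\<^sup>n \<rightarrow> T \<otimes> T\<close>, for \<open>T\<close> the tensor algebra of \<open>V\<close>.\<close>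

definition tsplit ::
    "('k, 'r) ring_scheme \<Rightarrow> ('k, 'v) module \<Rightarrow> nat \<Rightarrow> nat \<Rightarrow>
     ('v list \<Rightarrow> 'k) set \<Rightarrow> (('v list \<Rightarrow> 'k) set list \<Rightarrow> 'k) set" where
  "tsplit K V m n = the_linear K (tpow K V (m + n)) (tpow K (tensor_algebra K V) 2)
     (\<lambda>h. \<forall>u\<in>carrier (tpow K V m). \<forall>v\<in>carrier (tpow K V n).
        h (u \<otimes>\<^bsub>tensor_algebra K V\<^esub> v) = tens K (tensor_algebra K V) [u, v])"

definition tensor_braiding ::
    "('k, 'r) ring_scheme \<Rightarrow> ('k, 'v) module \<Rightarrow>
     (('v list \<Rightarrow> 'k) set \<Rightarrow> ('v list \<Rightarrow> 'k) set) \<Rightarrow>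
     (('v list \<Rightarrow> 'k) set list \<Rightarrow> 'k) set \<Rightarrow> (('v list \<Rightarrow> 'k) set list \<Rightarrow> 'k) set" where
  "tensor_braiding K V c =
     the_linear K (tpow K (tensor_algebra K V) 2) (tpow K (tensor_algebra K V) 2)
       (\<lambda>h. \<forall>n m. \<forall>x\<in>carrier (tpow K V n). \<forall>y\<in>carrier (tpow K V m).
          h (tens K (tensor_algebra K V) [x, y])
            = tsplit K V m n (braid_nm K V c n m (x \<otimes>\<^bsub>tensor_algebra K V\<^esub> y)))"

definition sym_ideal ::
    "('k, 'r) ring_scheme \<Rightarrow> ('k, 'v) module \<Rightarrow>
     (('v list \<Rightarrow> 'k) set \<Rightarrow> ('v list \<Rightarrow> 'k) set) \<Rightarrow> ('v list \<Rightarrow> 'k) set set" where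
  "sym_ideal K V c =
     Idl\<^bsub>tensor_algebra K V\<^esub> ((\<lambda>t. t \<ominus>\<^bsub>tensor_algebra K V\<^esub> c t) ` carrier (tpow K V 2))"

definition sym_algebra ::
    "('k, 'r) ring_scheme \<Rightarrow> ('k, 'v) module \<Rightarrow>
     (('v list \<Rightarrow> 'k) set \<Rightarrow> ('v list \<Rightarrow> 'k) set) \<Rightarrow> ('k, ('v list \<Rightarrow> 'k) set set) module" where
  "sym_algebra K V c = quot_algebra (tensor_algebra K V) (sym_ideal K V c)"

definition sym_proj ::
    "('k, 'r) ring_scheme \<Rightarrow> ('k, 'v) module \<Rightarrow>
     (('v list \<Rightarrow> 'k) set \<Rightarrow> ('v list \<Rightarrow> 'k) set) \<Rightarrow>
     ('v list \<Rightarrow> 'k) set \<Rightarrow> ('v list \<Rightarrow> 'k) set set" where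
  "sym_proj K V c t = sym_ideal K V c +>\<^bsub>tensor_algebra K V\<^esub> t"

definition sym_braiding ::
    "('k, 'r) ring_scheme \<Rightarrow> ('k, 'v) module \<Rightarrow>
     (('v list \<Rightarrow> 'k) set \<Rightarrow> ('v list \<Rightarrow> 'k) set) \<Rightarrow>
     (('v list \<Rightarrow> 'k) set set list \<Rightarrow> 'k) set \<Rightarrow> (('v list \<Rightarrow> 'k) set set list \<Rightarrow> 'k) set" where
  "sym_braiding K V c = (let T = tensor_algebra K V; S = sym_algebra K V c;
       pp = tmap K T (carrier T) (carrier T) S (sym_proj K V c) (sym_proj K V c) in
     the_linear K (tpow K S 2) (tpow K S 2)
       (\<lambda>h. \<forall>t\<in>carrier (tpow K T 2). h (pp t) = pp (tensor_braiding K V c t)))"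

definition sym_grading ::
    "('k, 'r) ring_scheme \<Rightarrow> ('k, 'v) module \<Rightarrow>
     (('v list \<Rightarrow> 'k) set \<Rightarrow> ('v list \<Rightarrow> 'k) set) \<Rightarrow> (nat \<Rightarrow> 'v set) \<Rightarrow>
     nat \<Rightarrow> ('v list \<Rightarrow> 'k) set set set" where
  "sym_grading K V c G d = subspan K (sym_algebra K V c)
     {sym_proj K V c (tens K V vs) | vs ns.
        list_all2 (\<lambda>v n. v \<in> G n) vs ns \<and> sum_list ns = d}"

section \<open>PBW type\<close>

text \<open>
  The space \<open>V\<close> is sought with elements in the type of elements of \<open>gr H\<close>. This is no
  restriction: \<open>V\<close> embeds in its symmetric algebra (the relations have tensor degree two), hence
  any solution can be transported to a subspace of \<open>gr H\<close>.
\<close>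

definition pbw_type ::
    "('k, 'r) ring_scheme \<Rightarrow> ('k, 'h) module \<Rightarrow> ('h \<Rightarrow> ('h list \<Rightarrow> 'k) set) \<Rightarrow>
     (('h list \<Rightarrow> 'k) set \<Rightarrow> ('h list \<Rightarrow> 'k) set) \<Rightarrow> bool" where
  "pbw_type K H \<Delta> c \<longleftrightarrow> (let F = coradical_filtration K H \<Delta> in
     \<exists>(V :: ('k, nat \<Rightarrow> 'h set) module) cV G. braided_graded_space K V cV G \<and>
       braided_graded_algebra_iso K
         (gr H F) (gr_braiding K H F c) (gr_grading H F)
         (sym_algebra K V cV) (sym_braiding K V cV) (sym_grading K V cV G))"

end

theory Submission
 imports Defs
begin

text \<open>
  The argument is a braided version of Leray's theorem. A commutator of elements of filtration degrees \<open>m\<close> and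
  \<open>n\<close> has degree less than \<open>m + n\<close>, so \<open>A = gr H\<close> is a commutative graded connected bialgebra. The Adams operation
  \<open>\<nabla> \<Delta>\<close> of \<open>A\<close> is an algebra map that commutes with the braiding and acts on \<open>I\<^sup>k / I\<^sup>k\<^sup>+\<^sup>1\<close> as \<open>2\<^sup>k\<close>, where \<open>I\<close> is the
  augmentation ideal. In characteristic zero its eigenvalues are distinct, and the projection \<open>e\<close> onto the
  eigenspace of \<open>2\<close> is a braided idempotent that kills \<open>1\<close> and \<open>I\<^sup>2\<close>. The image \<open>V\<close> of \<open>e\<close> generates \<open>A\<close>, which gives a
  surjection \<open>S(V) \<rightarrow> A\<close>. Iterating \<open>(e \<otimes> id) \<Delta>\<close> and multiplying in \<open>S(V)\<close> recovers from a product of \<open>n\<close> elements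
  of \<open>V\<close> their product in \<open>S(V)\<close> up to the factor \<open>n!\<close>, which gives the injectivity.
\<close>

section \<open>Linear algebra over a field\<close>

\<comment> \<open>Only a filtration is available on \<open>H\<close>, and nothing is finite
  dimensional. In \<open>gr H\<close> connectedness bounds everything: the \<open>k\<close>-th power
  of the augmentation ideal lives in degrees at least \<open>k\<close>, so in degree
  \<open>d\<close> only the eigenvalues \<open>2, 4, ..., 2^d\<close> matter and the projection is a
  finite product. Passing to \<open>gr H\<close> requires that braiding, product, coproduct and
  commutators respect the coradical filtration. This filtration is defined by wedges, that is, by
  membership of \<Delta> x in a sum of two subspaces of \<open>A \<otimes> A\<close>. Complementary
  projections turn such memberships into equations, which can be pushed through coassociativity and
  through the compatibility of \<Delta> with the braiding. The other obstacle is the encoding: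
  tensors are cosets in one tensor algebra, and the induced maps are definite descriptions. These
  are first identified with operators on the whole tensor algebra, and identities are then checked
  on pure tensors. Characteristic zero enters twice: \<open>2\<close> differs from
  \<open>2^k\<close> for \<open>k > 1\<close>, and \<open>n!\<close> is invertible.\<close>
text \<open>A subscript is a shorter form of the index of a structure: \<open>x \<oplus>\<^sub>M y\<close> is addition in \<open>M\<close>. Moreover, \<open>x \<star>\<^sub>V y\<close> is
 the product in the tensor algebra of \<open>V\<close>.\<close>

syntax "_index" :: "logic => index" ("\<^sub>_" [1000] 1000)

abbreviation in_carrier (infix "<:" 50) where "x <: M == x \<in> carrier M"
abbreviation sub_carrier (infix "<<:" 50) where "X <<: M == X \<subseteq> carrier M"

locale kfield = field K for K :: "('k, 'r) ring_scheme"

context kfield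
begin

abbreviation lin where "lin M N == linear_maps K M N"
abbreviation T where "T V == tensor_algebra K V"
abbreviation tmult ("_ \<star>\<^sub>_ _" [70,1000,71] 70) where "x \<star>\<^sub>V y == x \<otimes>\<^sub>(T V) y"
abbreviation sub where "sub X M == submodule X K M"
abbreviation span where "span M S == subspan K M S"

lemma K_closed [simp]:
 "a <: K ==> b <: K ==> a \<oplus>\<^sub>K b <: K"
 "a <: K ==> b <: K ==> a \<otimes>\<^sub>K b <: K"
 "a <: K ==> \<ominus>\<^sub>K a <: K"
 by auto

lemma mod_ag: "module K M ==> abelian_group M"
 by (simp add: module.axioms)

context
 fixes M :: "('k, 'm, 'z) module_scheme"
 assumes M: "module K M"
begin

interpretation m: module K M by (rule M)

lemma mod_closed [simp]:
 "x <: M ==> y <: M ==> x \<oplus>\<^sub>M y <: M"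
  "\<zero>\<^sub>M <: M"
  "x <: M ==> \<ominus>\<^sub>M x <: M"
  "x <: M ==> y <: M ==> x \<ominus>\<^sub>M y <: M"
  "a <: K ==> x <: M ==> a \<odot>\<^sub>M x <: M"
 by auto

lemma mod_simps:
 shows mod_assoc: "x <: M ==> y <: M ==> z <: M ==> x \<oplus>\<^sub>M y \<oplus>\<^sub>M z = x \<oplus>\<^sub>M (y \<oplus>\<^sub>M z)"
  and mod_comm: "x <: M ==> y <: M ==> x \<oplus>\<^sub>M y = y \<oplus>\<^sub>M x"
  and mod_lcomm: "x <: M ==> y <: M ==> z <: M ==> x \<oplus>\<^sub>M (y \<oplus>\<^sub>M z) = y \<oplus>\<^sub>M (x \<oplus>\<^sub>M z)"
  and mod_lzero [simp]: "x <: M ==> \<zero>\<^sub>M \<oplus>\<^sub>M x = x"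
  and mod_rzero [simp]: "x <: M ==> x \<oplus>\<^sub>M \<zero>\<^sub>M = x"
  and mod_rneg [simp]: "x <: M ==> x \<oplus>\<^sub>M \<ominus>\<^sub>M x = \<zero>\<^sub>M"
  and mod_lneg [simp]: "x <: M ==> \<ominus>\<^sub>M x \<oplus>\<^sub>M x = \<zero>\<^sub>M"
  and mod_rneg1 [simp]: "x <: M ==> y <: M ==> x \<oplus>\<^sub>M (\<ominus>\<^sub>M x \<oplus>\<^sub>M y) = y"
  and mod_rneg2 [simp]: "x <: M ==> y <: M ==> \<ominus>\<^sub>M x \<oplus>\<^sub>M (x \<oplus>\<^sub>M y) = y"
  and mod_negneg [simp]: "x <: M ==> \<ominus>\<^sub>M (\<ominus>\<^sub>M x) = x"
  and mod_negadd: "x <: M ==> y <: M ==> \<ominus>\<^sub>M (x \<oplus>\<^sub>M y) = \<ominus>\<^sub>M x \<oplus>\<^sub>M \<ominus>\<^sub>M y"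
  and mod_negzero [simp]: "\<ominus>\<^sub>M \<zero>\<^sub>M = \<zero>\<^sub>M"
  and mod_minus: "x <: M ==> y <: M ==> x \<ominus>\<^sub>M y = x \<oplus>\<^sub>M \<ominus>\<^sub>M y"
  and mod_szero [simp]: "a <: K ==> a \<odot>\<^sub>M \<zero>\<^sub>M = \<zero>\<^sub>M"
  and mod_zeros [simp]: "x <: M ==> \<zero>\<^sub>K \<odot>\<^sub>M x = \<zero>\<^sub>M"
  and mod_ones [simp]: "x <: M ==> \<one>\<^sub>K \<odot>\<^sub>M x = x"
  and mod_sadd: "a <: K ==> x <: M ==> y <: M ==> a \<odot>\<^sub>M (x \<oplus>\<^sub>M y) = a \<odot>\<^sub>M x \<oplus>\<^sub>M a \<odot>\<^sub>M y"
  and mod_adds: "a <: K ==> b <: K ==> x <: M ==> (a \<oplus>\<^sub>K b) \<odot>\<^sub>M x = a \<odot>\<^sub>M x \<oplus>\<^sub>M b \<odot>\<^sub>M x"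
  and mod_smul: "a <: K ==> b <: K ==> x <: M ==> a \<odot>\<^sub>M (b \<odot>\<^sub>M x) = (a \<otimes>\<^sub>K b) \<odot>\<^sub>M x"
  and mod_sneg: "a <: K ==> x <: M ==> a \<odot>\<^sub>M (\<ominus>\<^sub>M x) = \<ominus>\<^sub>M (a \<odot>\<^sub>M x)"
  and mod_negs: "a <: K ==> x <: M ==> (\<ominus>\<^sub>K a) \<odot>\<^sub>M x = \<ominus>\<^sub>M (a \<odot>\<^sub>M x)"
  and mod_selfminus [simp]: "x <: M ==> x \<ominus>\<^sub>M x = \<zero>\<^sub>M"
 by (simp_all add: m.M.r_neg m.M.l_neg m.M.r_neg1 m.M.r_neg2 m.M.minus_add m.M.minus_eq m.smult_r_distr
  m.smult_l_distr m.smult_assoc1 m.smult_r_minus m.smult_l_minus) (simp_all add: m.a_ac)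

end

lemma mod_eqI: "module K M ==> x <: M ==> y <: M ==> x \<ominus>\<^sub>M y = \<zero>\<^sub>M ==> x = y"
 by (metis mod_minus mod_closed(3) mod_lneg mod_negneg mod_rneg2 mod_rzero)

lemmas mod_ac = mod_assoc mod_comm mod_lcomm

lemma mod_neg_smult: "module K M ==> x <: M ==> \<ominus>\<^sub>M x = (\<ominus>\<^sub>K \<one>\<^sub>K) \<odot>\<^sub>M x"
 by (simp add: mod_negs)

lemma linI:
 "[|!!x. x <: M ==> f x <: N;
  !!x y. x <: M ==> y <: M ==> f (x \<oplus>\<^sub>M y) = f x \<oplus>\<^sub>N f y;
  !!a x. a <: K ==> x <: M ==> f (a \<odot>\<^sub>M x) = a \<odot>\<^sub>N f x|] ==> f \<in> lin M N"
 by (auto simp: linear_maps_def)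

lemma lin_cl: "f \<in> lin M N ==> x <: M ==> f x <: N"
 and lin_add: "f \<in> lin M N ==> x <: M ==> y <: M ==> f (x \<oplus>\<^sub>M y) = f x \<oplus>\<^sub>N f y"
 and lin_smult: "f \<in> lin M N ==> a <: K ==> x <: M ==> f (a \<odot>\<^sub>M x) = a \<odot>\<^sub>N f x"
 by (auto simp: linear_maps_def)

lemma lin_zero: "f \<in> lin M N ==> module K M ==> module K N ==> f \<zero>\<^sub>M = \<zero>\<^sub>N"
 by (metis lin_cl lin_smult mod_zeros mod_closed(2) zero_closed)

lemma lin_neg: "f \<in> lin M N ==> module K M ==> module K N ==> x <: M ==> f (\<ominus>\<^sub>M x) = \<ominus>\<^sub>N f x"
 by (simp add: mod_neg_smult lin_smult lin_cl)

lemma lin_minus: "f \<in> lin M N ==> module K M ==> module K N ==> x <: M ==> y <: M ==>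
  f (x \<ominus>\<^sub>M y) = f x \<ominus>\<^sub>N f y"
 by (simp add: mod_minus lin_add lin_neg lin_cl)

lemmas lin_simps = lin_cl lin_add lin_smult lin_zero lin_neg lin_minus

lemma lin_o: "f \<in> lin N P ==> g \<in> lin M N ==> (%x. f (g x)) \<in> lin M P"
 by (auto intro!: linI simp: lin_simps)

lemma lin_id: "(%x. x) \<in> lin M M"
 by (auto intro!: linI)

lemma lin_0: "module K N ==> (%x. \<zero>\<^sub>N) \<in> lin M N"
 by (auto intro!: linI)

lemma lin_plus: "module K N ==> f \<in> lin M N ==> g \<in> lin M N ==> (%x. f x \<oplus>\<^sub>N g x) \<in> lin M N"
 by (auto intro!: linI simp: lin_simps mod_ac mod_sadd)

lemma lin_sm: "module K N ==> f \<in> lin M N ==> a <: K ==> (%x. a \<odot>\<^sub>N f x) \<in> lin M N"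
 by (auto intro!: linI simp: lin_simps mod_sadd mod_smul m_comm)

lemma lin_sub: "module K N ==> f \<in> lin M N ==> g \<in> lin M N ==> (%x. f x \<ominus>\<^sub>N g x) \<in> lin M N"
 by (auto intro!: linI simp: lin_simps mod_ac mod_sadd mod_minus mod_negadd mod_sneg)

lemma lin_restr: "f \<in> lin M N ==> X <<: M ==> f \<in> lin (M\<lparr>carrier := X\<rparr>) N"
 by (auto simp: linear_maps_def subset_iff)

lemma lin_restr_cod: "f \<in> lin M N ==> (!!x. x <: M ==> f x \<in> Y) ==> f \<in> lin M (N\<lparr>carrier := Y\<rparr>)"
 by (auto simp: linear_maps_def)

lemma lin_cong: "f \<in> lin M N ==> module K M ==> (!!x. x <: M ==> g x = f x) ==> g \<in> lin M N"
 by (rule linI) (auto simp: lin_simps)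

lemma lin_restrict: "f \<in> lin M N ==> module K M ==> restrict f (carrier M) \<in> lin M N"
 by (erule lin_cong) auto

subsection \<open>Submodules and spans\<close>

lemma subI:
 assumes "module K M" "X <<: M" "\<zero>\<^sub>M \<in> X" "!!x y. x \<in> X ==> y \<in> X ==> x \<oplus>\<^sub>M y \<in> X"
  "!!a x. a <: K ==> x \<in> X ==> a \<odot>\<^sub>M x \<in> X"
 shows "sub X M"
 using assms
 by (intro module.submoduleI) (auto simp: mod_neg_smult subset_iff)

lemma sub_simps:
 assumes "module K M" "sub X M"
 shows sub_carr: "X <<: M"
  and sub_mem: "x \<in> X ==> x <: M"
  and sub_zero: "\<zero>\<^sub>M \<in> X"
  and sub_add: "x \<in> X ==> y \<in> X ==> x \<oplus>\<^sub>M y \<in> X"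
  and sub_smult: "a <: K ==> x \<in> X ==> a \<odot>\<^sub>M x \<in> X"
  and sub_neg: "x \<in> X ==> \<ominus>\<^sub>M x \<in> X"
  and sub_minus: "x \<in> X ==> y \<in> X ==> x \<ominus>\<^sub>M y \<in> X"
proof -
 show "\<zero>\<^sub>M \<in> X"
  using module.submoduleE(1,2,4)[OF assms] assms(1) by (metis ex_in_conv mod_zeros subsetD zero_closed)
qed (use module.submoduleE[OF assms] mod_minus[OF assms(1)] in \<open>auto simp: subset_iff\<close>)

lemma sub_carrier: "module K M ==> sub (carrier M) M"
 by (rule module.carrier_is_submodule)

lemma sub_0: "module K M ==> sub {\<zero>\<^sub>M} M"
 by (rule subI) auto

lemma sub_module: "module K M ==> sub X M ==> module K (M\<lparr>carrier := X\<rparr>)"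
 by (rule submodule.submodule_is_module)

lemma sub_Int: "module K M ==> sub X M ==> sub Y M ==> sub (X \<inter> Y) M"
 by (rule subI) (auto simp: sub_simps dest: sub_mem)

lemma span_sub: assumes "module K M" "S <<: M" shows "sub (span M S) M"
proof (rule subI)
 show "span M S <<: M"
  using assms sub_carrier[of M] by (auto simp: subspan_def)
qed (use assms in \<open>auto simp: subspan_def sub_simps\<close>)

lemma span_base: "x \<in> S ==> x \<in> span M S"
 by (auto simp: subspan_def)

lemma span_minimal: "sub N M ==> S \<subseteq> N ==> span M S \<subseteq> N"
 by (auto simp: subspan_def)

lemma span_mono: "S \<subseteq> S' ==> span M S \<subseteq> span M S'"
 by (auto simp: subspan_def)

lemma span_carr: "module K M ==> S <<: M ==> span M S <<: M"
 by (simp add: span_minimal sub_carrier)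

lemma span_induct [consumes 3, case_names base zero add smult]:
 assumes x: "x \<in> span M S" and M: "module K M" and S: "S <<: M"
  and b: "!!s. s \<in> S ==> P s" and z: "P \<zero>\<^sub>M"
  and a: "!!x y. x <: M ==> y <: M ==> P x ==> P y ==> P (x \<oplus>\<^sub>M y)"
  and s: "!!a x. a <: K ==> x <: M ==> P x ==> P (a \<odot>\<^sub>M x)"
 shows "P x"
proof -
 have "sub {x \<in> carrier M. P x} M"
  using M z a s by (intro subI) auto
 then have "span M S \<subseteq> {x \<in> carrier M. P x}"
  using b S by (intro span_minimal) auto
 then show ?thesis using x by auto
qed

lemma lin_span_image:
 assumes "f \<in> lin M N" "module K M" "module K N" "S <<: M" "sub X N" "!!s. s \<in> S ==> f s \<in> X"
  "x \<in> span M S"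
 shows "f x \<in> X"
 using assms(7,2,4)
 by (induct rule: span_induct) (use assms in \<open>auto simp: lin_simps sub_simps\<close>)

lemma lin_eq_span:
 assumes "f \<in> lin M N" "g \<in> lin M N" "module K M" "module K N" "S <<: M"
  "!!s. s \<in> S ==> f s = g s" "x \<in> span M S"
 shows "f x = g x"
 using assms(7,3,5)
 by (induct rule: span_induct) (use assms in \<open>auto simp: lin_simps\<close>)

lemma sub_vimage:
 assumes "f \<in> lin M N" "module K M" "module K N" "sub X N"
 shows "sub {x \<in> carrier M. f x \<in> X} M"
 using assms by (intro subI) (auto simp: lin_simps sub_simps)

lemma sub_image:
 assumes f: "f \<in> lin M N" and M: "module K M" and N: "module K N" and X: "sub X M"
 shows "sub (f ` X) N"
proof (rule subI[OF N])
 note c = sub_carr[OF M X]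
 show "f ` X <<: N" using c f by (auto simp: lin_simps)
 show "\<zero>\<^sub>N \<in> f ` X" using lin_zero[OF f M N] sub_zero[OF M X] by (metis image_eqI)
 show "x \<oplus>\<^sub>N y \<in> f ` X" if "x \<in> f ` X" "y \<in> f ` X" for x y
  using that c sub_add[OF M X] lin_add[OF f] by (auto simp: subset_iff) (metis image_eqI)
 show "a \<odot>\<^sub>N x \<in> f ` X" if "a <: K" "x \<in> f ` X" for x a
  using that c sub_smult[OF M X] lin_smult[OF f] by (auto simp: subset_iff) (metis image_eqI)
qed

lemma sub_setadd:
 assumes M: "module K M" and X: "sub X M" and Y: "sub Y M"
 shows "sub (X <+>\<^sub>M Y) M" "x \<in> X ==> x \<in> X <+>\<^sub>M Y" "y \<in> Y ==> y \<in> X <+>\<^sub>M Y"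
  "z \<in> X <+>\<^sub>M Y \<longleftrightarrow> (\<exists>x\<in>X. \<exists>y\<in>Y. z = x \<oplus>\<^sub>M y)"
proof -
 show *: "z \<in> X <+>\<^sub>M Y \<longleftrightarrow> (\<exists>x\<in>X. \<exists>y\<in>Y. z = x \<oplus>\<^sub>M y)" for z
  by (auto simp: set_add_def set_mult_def)
 note c = sub_carr[OF M X] sub_carr[OF M Y]
 show "x \<in> X ==> x \<in> X <+>\<^sub>M Y" unfolding *
  using c sub_zero[OF M Y] mod_rzero[OF M] by (metis subsetD)
 show "y \<in> Y ==> y \<in> X <+>\<^sub>M Y" unfolding *
  using c sub_zero[OF M X] mod_lzero[OF M] by (metis subsetD)
 show "sub (X <+>\<^sub>M Y) M"
 proof (rule subI[OF M])
  show "X <+>\<^sub>M Y <<: M" using c M by (auto simp: * subset_iff)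
  show "\<zero>\<^sub>M \<in> X <+>\<^sub>M Y" unfolding * using sub_zero[OF M X] sub_zero[OF M Y] M
   by (metis mod_closed(2) mod_lzero)
  show "u \<oplus>\<^sub>M v \<in> X <+>\<^sub>M Y" if uv: "u \<in> X <+>\<^sub>M Y" "v \<in> X <+>\<^sub>M Y" for u v
  proof -
   obtain x y x' y' where h: "x \<in> X" "y \<in> Y" "x' \<in> X" "y' \<in> Y" "u = x \<oplus>\<^sub>M y" "v = x' \<oplus>\<^sub>M y'"
    using uv unfolding * by blast
   then have "u \<oplus>\<^sub>M v = (x \<oplus>\<^sub>M x') \<oplus>\<^sub>M (y \<oplus>\<^sub>M y')"
    using c M by (simp add: subset_iff mod_ac)
   then show ?thesis unfolding * using h sub_add[OF M X] sub_add[OF M Y] by blast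
  qed
  show "a \<odot>\<^sub>M u \<in> X <+>\<^sub>M Y" if u: "a <: K" "u \<in> X <+>\<^sub>M Y" for u a
  proof -
   obtain x y where h: "x \<in> X" "y \<in> Y" "u = x \<oplus>\<^sub>M y"
    using u unfolding * by blast
   then have "a \<odot>\<^sub>M u = (a \<odot>\<^sub>M x) \<oplus>\<^sub>M (a \<odot>\<^sub>M y)"
    using c M u by (simp add: subset_iff mod_sadd)
   then show ?thesis unfolding * using h sub_smult[OF M X u(1)] sub_smult[OF M Y u(1)] by blast
  qed
 qed
qed

lemma lin_setadd:
 assumes "f \<in> lin M N" "module K M" "module K N" "sub X M" "sub Y M" "sub Z N"
  "!!x. x \<in> X ==> f x \<in> Z" "!!y. y \<in> Y ==> f y \<in> Z" "t \<in> X <+>\<^sub>M Y"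
 shows "f t \<in> Z"
 using assms(9) sub_setadd(4)[OF assms(2,4,5)] assms sub_mem[OF assms(2)]
 by (auto simp: lin_simps sub_simps)

text \<open>Induced maps are definite descriptions over linear maps. A concrete linear map with the
  prescribed property, to which every competitor is equal on the domain, evaluates such a
  description; the restriction comes from extensionality.\<close>

lemma the_linear_eq:
 assumes D: "module K D" and f: "f \<in> lin D N" and P: "P (restrict f (carrier D))"
  and uniq: "!!h x. h \<in> lin D N ==> P h ==> x <: D ==> h x = f x"
 shows "the_linear K D N P = restrict f (carrier D)"
 unfolding the_linear_def
proof (rule the_equality)
 show "restrict f (carrier D) \<in> lin D N \<and> restrict f (carrier D) \<in> extensional (carrier D) \<and>
   P (restrict f (carrier D))"
  using lin_restrict[OF f D] P by simp
 fix h assume "h \<in> lin D N \<and> h \<in> extensional (carrier D) \<and> P h"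
 then show "h = restrict f (carrier D)" using uniq[of h] by (auto simp: extensional_def)
qed

subsection \<open>Finite sums and complements\<close>

lemma lin_finsum:
 assumes "f \<in> lin M N" "module K M" "module K N" "finite A" "!!i. i \<in> A ==> g i <: M"
 shows "f (\<Oplus>\<^sub>M i\<in>A. g i) = (\<Oplus>\<^sub>N i\<in>A. f (g i))"
proof -
 interpret M: module K M by fact
 interpret N: module K N by fact
 from assms(4,5) show ?thesis
 proof (induct A)
  case empty then show ?case using assms by (simp add: lin_zero)
 next
  case (insert i A) then show ?case using assms(1) by (simp add: Pi_def lin_simps)
 qed
qed

lemma sub_finsum:
 assumes "module K M" "sub X M" "!!i. i \<in> A ==> g i \<in> X"
 shows "(\<Oplus>\<^sub>M i\<in>A. g i) \<in> X"
proof (cases "finite A")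
 interpret M: module K M by fact
 case False then show ?thesis using assms by (simp add: M.finsum_infinite sub_zero)
next
 interpret M: module K M by fact
 case True
 then show ?thesis using assms(3)
 proof (induct A)
  case (insert i A)
  then show ?case using assms(1,2) by (simp add: Pi_def sub_simps[OF assms(1,2)])
 qed (use assms in \<open>simp add: sub_zero\<close>)
qed

lemma finsum_lin:
 assumes "module K N" "finite A" "!!i. i \<in> A ==> f i \<in> lin M N" and M: "module K M"
 shows "(%x. \<Oplus>\<^sub>N i\<in>A. f i x) \<in> lin M N"
proof -
 interpret N: module K N by fact
 from assms(2,3) show ?thesis
 proof (induct A)
  case empty then show ?case using assms by (simp add: lin_0)
 next
  case (insert i A)
  have "(%x. f i x \<oplus>\<^sub>N (\<Oplus>\<^sub>N i\<in>A. f i x)) \<in> lin M N" using insert assms by (auto intro: lin_plus)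
  moreover have "(\<Oplus>\<^sub>N i\<in>insert i A. f i x) = f i x \<oplus>\<^sub>N (\<Oplus>\<^sub>N i\<in>A. f i x)" if "x <: M" for x
   using insert that by (subst N.finsum_insert) (auto intro: lin_cl)
  ultimately show ?case unfolding linear_maps_def using M by auto
 qed
qed

lemma finsum_superset:
 assumes "module K N" "finite B" "A \<subseteq> B" "!!i. i \<in> B ==> f i <: N" "!!i. i \<in> B - A ==> f i = \<zero>\<^sub>N"
 shows "(\<Oplus>\<^sub>N i\<in>A. f i) = (\<Oplus>\<^sub>N i\<in>B. f i)"
proof -
 interpret N: module K N by fact
 show ?thesis using assms by (intro N.add.finprod_mono_neutral_cong_left) auto
qed

text \<open>The index set of the sum depends on the argument. Additivity is checked over the union
  of the supports of the two summands, where the added terms vanish.\<close>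

lemma lin_locfin_sum:
 assumes M: "module K M" and N: "module K N" and f: "!!i. f i \<in> lin M N"
  and fin: "!!x. x <: M ==> finite {i. f i x \<noteq> \<zero>\<^sub>N}"
 shows "(%x. \<Oplus>\<^sub>N i\<in>{i. f i x \<noteq> \<zero>\<^sub>N}. f i x) \<in> lin M N" (is "?g \<in> _")
proof (rule linI)
 interpret N: module K N by fact
 have *: "?g x = (\<Oplus>\<^sub>N i\<in>A. f i x)" if "finite A" "{i. f i x \<noteq> \<zero>\<^sub>N} \<subseteq> A" "x <: M" for x A
  using that N by (intro finsum_superset) (auto simp: lin_cl[OF f])
 show "?g x <: N" if "x <: M" for x
  using f that by (auto intro!: N.finsum_closed simp: lin_cl[OF f])
 show "?g (x \<oplus>\<^sub>M y) = ?g x \<oplus>\<^sub>N ?g y" if "x <: M" "y <: M" for x y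
 proof -
  let ?A = "{i. f i x \<noteq> \<zero>\<^sub>N} \<union> {i. f i y \<noteq> \<zero>\<^sub>N}"
  have "?g (x \<oplus>\<^sub>M y) = (\<Oplus>\<^sub>N i\<in>?A. f i (x \<oplus>\<^sub>M y))"
   using that fin f M N by (intro *) (auto simp: lin_add[OF f])
  also have "\<dots> = (\<Oplus>\<^sub>N i\<in>?A. f i x) \<oplus>\<^sub>N (\<Oplus>\<^sub>N i\<in>?A. f i y)"
   using that f by (simp add: lin_add[OF f] lin_cl[OF f])
  also have "\<dots> = ?g x \<oplus>\<^sub>N ?g y" using that fin by (subst (1 2) *[of ?A]) auto
  finally show ?thesis .
 qed
 show "?g (a \<odot>\<^sub>M x) = a \<odot>\<^sub>N ?g x" if "a <: K" "x <: M" for x a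
 proof -
  let ?A = "{i. f i x \<noteq> \<zero>\<^sub>N}"
  have "?g (a \<odot>\<^sub>M x) = (\<Oplus>\<^sub>N i\<in>?A. f i (a \<odot>\<^sub>M x))"
   using that fin f M N by (intro *) (auto simp: lin_smult[OF f])
  also have "\<dots> = a \<odot>\<^sub>N (\<Oplus>\<^sub>N i\<in>?A. f i x)"
   using that f fin by (simp add: lin_smult[OF f] lin_cl[OF f] N.finsum_smult_ldistr)
  finally show ?thesis .
 qed
qed

text \<open>By Zorn's lemma some subspace \<open>Y\<close> is maximal among those that meet
  \<open>X\<close> only in zero; maximality forces \<open>X + Y\<close> to be everything, and the
  projection along \<open>Y\<close> is linear. Such projections replace bases in all later
  statements about tensor products of subspaces.\<close>

lemma exists_projection:
 assumes M: "module K M" and X: "sub X M"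
 shows "\<exists>R\<in>lin M M. (\<forall>x\<in>carrier M. R x \<in> X) \<and> (\<forall>x\<in>X. R x = x)"
proof -
 note c = sub_carr[OF M X]
 let ?S = "{Y. sub Y M \<and> X \<inter> Y = {\<zero>\<^sub>M}}"
 have "\<exists>Y\<in>?S. \<forall>Z\<in>?S. Y \<subseteq> Z --> Z = Y"
 proof (rule subset_Zorn)
  fix C assume C: "subset.chain ?S C"
  show "\<exists>U\<in>?S. \<forall>Y\<in>C. Y \<subseteq> U"
  proof (cases "C = {}")
   case True then show ?thesis
    using sub_0[OF M] sub_zero[OF M X] by (intro bexI[of _ "{\<zero>\<^sub>M}"]) auto
  next
   case False
   have CS: "sub Y M" "X \<inter> Y = {\<zero>\<^sub>M}" if "Y \<in> C" for Y
    using C that by (auto simp: subset.chain_def)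
   have "sub (\<Union>C) M"
   proof (rule subI[OF M])
    show "\<Union>C <<: M" using CS sub_carr[OF M] by blast
    show "\<zero>\<^sub>M \<in> \<Union>C" using CS False sub_zero[OF M] by blast
    show "x \<oplus>\<^sub>M y \<in> \<Union>C" if xy: "x \<in> \<Union>C" "y \<in> \<Union>C" for x y
    proof -
     obtain Y Z where YZ: "Y \<in> C" "x \<in> Y" "Z \<in> C" "y \<in> Z" using xy by blast
     have "Y \<subseteq> Z \<or> Z \<subseteq> Y" using C YZ(1,3) by (auto simp: subset.chain_def)
     then show ?thesis using YZ CS sub_add[OF M] by blast
    qed
    show "a \<odot>\<^sub>M x \<in> \<Union>C" if "a <: K" "x \<in> \<Union>C" for a x
     using that CS sub_smult[OF M] by blast
   qed
   moreover have "X \<inter> \<Union>C = {\<zero>\<^sub>M}" using CS(2) False by blast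
   ultimately show ?thesis by blast
  qed
 qed
 then obtain Y where YS: "Y \<in> ?S" and max': "\<forall>Z\<in>?S. Y \<subseteq> Z --> Z = Y" by (elim bexE)
 then have Y: "sub Y M" and XY: "X \<inter> Y = {\<zero>\<^sub>M}" by auto
 have max: "Z = Y" if "sub Z M" "X \<inter> Z = {\<zero>\<^sub>M}" "Y \<subseteq> Z" for Z using max' that by simp
 note cY = sub_carr[OF M Y]
 have ex: "\<exists>x\<in>X. \<exists>y\<in>Y. z = x \<oplus>\<^sub>M y" if z: "z <: M" for z
 proof (rule ccontr)
  assume neg: "\<not> ?thesis"
  let ?L = "(%a. a \<odot>\<^sub>M z) ` carrier K"
  have L: "sub ?L M"
  proof (rule subI[OF M])
   show "\<zero>\<^sub>M \<in> ?L" using z M by (intro image_eqI[of _ _ "\<zero>\<^sub>K"]) auto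
   show "x \<oplus>\<^sub>M y \<in> ?L" if "x \<in> ?L" "y \<in> ?L" for x y
    using that z M by (auto simp flip: mod_adds)
   show "a \<odot>\<^sub>M x \<in> ?L" if "a <: K" "x \<in> ?L" for a x
    using that z M by (auto simp: mod_smul)
  qed (use z M in auto)
  let ?Z = "Y <+>\<^sub>M ?L"
  have z1: "z \<in> ?L" using z M by (intro image_eqI[of _ _ "\<one>\<^sub>K"]) auto
  have zZ: "z \<in> ?Z" using sub_setadd(3)[OF M Y L z1] .
  have "z \<notin> Y" using neg sub_zero[OF M X] mod_lzero[OF M] z by metis
  then have "?Z \<noteq> Y" using zZ by auto
  \<comment> \<open>By maximality of \<open>Y\<close>, the larger subspace \<open>Y + K z\<close>
    meets \<open>X\<close> in a nonzero \<open>x\<close>; solving \<open>x = y + a z\<close> for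
    \<open>z\<close> contradicts the choice of \<open>z\<close>.\<close>
  then obtain x where x: "x \<in> X" "x \<in> ?Z" "x \<noteq> \<zero>\<^sub>M"
   using max[of ?Z] sub_setadd(1)[OF M Y L] sub_setadd(2)[OF M Y L] sub_zero[OF M X]
    sub_zero[OF M sub_setadd(1)[OF M Y L]] by blast
  then obtain y a where ya: "y \<in> Y" "a <: K" "x = y \<oplus>\<^sub>M a \<odot>\<^sub>M z"
   unfolding sub_setadd(4)[OF M Y L] by blast
  have "a \<noteq> \<zero>\<^sub>K" using x ya XY z cY M by (auto simp: subset_iff)
  then have a: "a \<in> Units K" using ya field_Units by auto
  have "inv\<^bsub>K\<^esub> a \<odot>\<^sub>M x = inv\<^bsub>K\<^esub> a \<odot>\<^sub>M y \<oplus>\<^sub>M z"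
   using ya z a cY M by (simp add: mod_sadd mod_smul subset_iff)
  then have "z = inv\<^bsub>K\<^esub> a \<odot>\<^sub>M x \<oplus>\<^sub>M inv\<^bsub>K\<^esub> a \<odot>\<^sub>M (\<ominus>\<^sub>M y)"
   using x ya z a c cY M by (simp add: subset_iff mod_sneg mod_ac)
  then show False using neg x ya a sub_smult[OF M X] sub_smult[OF M Y] sub_neg[OF M Y]
   by (metis Units_inv_closed)
 qed
 have un: "x = x'" if "x \<in> X" "y \<in> Y" "x' \<in> X" "y' \<in> Y" "x \<oplus>\<^sub>M y = x' \<oplus>\<^sub>M y'" for x y x' y'
 proof -
  have cc: "x <: M" "y <: M" "x' <: M" "y' <: M" using that c cY by auto
  have "x \<ominus>\<^sub>M x' = (x \<oplus>\<^sub>M y) \<oplus>\<^sub>M \<ominus>\<^sub>M y \<ominus>\<^sub>M x'" using cc M by (simp add: mod_assoc)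
  also have "\<dots> = x' \<oplus>\<^sub>M (\<ominus>\<^sub>M x' \<oplus>\<^sub>M (y' \<oplus>\<^sub>M \<ominus>\<^sub>M y))" unfolding that(5) using cc M
   by (simp add: mod_minus mod_ac del: mod_rneg1)
  also have "\<dots> = y' \<ominus>\<^sub>M y" using cc M by (simp add: mod_minus)
  finally have eq: "x \<ominus>\<^sub>M x' = y' \<ominus>\<^sub>M y" .
  have "x \<ominus>\<^sub>M x' \<in> X \<inter> Y"
   using sub_minus[OF M X that(1,3)] sub_minus[OF M Y that(4,2)] unfolding eq by simp
  then show ?thesis using XY cc mod_eqI[OF M] by auto
 qed
 define R where "R z = (THE x. x \<in> X \<and> (\<exists>y\<in>Y. z = x \<oplus>\<^sub>M y))" for z
 have R: "R (x \<oplus>\<^sub>M y) = x" if "x \<in> X" "y \<in> Y" for x y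
  unfolding R_def using that un by (intro the_equality) blast+
 show ?thesis
 proof (intro bexI conjI ballI)
  show "R x \<in> X" if "x <: M" for x using ex[OF that] R by auto
  show "R x = x" if "x \<in> X" for x
   using R[OF that sub_zero[OF M Y]] that c M by (simp add: subset_iff)
  show "R \<in> lin M M"
  proof (rule linI)
   show "R z <: M" if "z <: M" for z using ex[OF that] R c by auto
   show "R (u \<oplus>\<^sub>M v) = R u \<oplus>\<^sub>M R v" if uv: "u <: M" "v <: M" for u v
   proof -
    obtain x y x' y' where h: "x \<in> X" "y \<in> Y" "u = x \<oplus>\<^sub>M y" "x' \<in> X" "y' \<in> Y" "v = x' \<oplus>\<^sub>M y'"
     using ex[OF uv(1)] ex[OF uv(2)] by blast
    have "u \<oplus>\<^sub>M v = (x \<oplus>\<^sub>M x') \<oplus>\<^sub>M (y \<oplus>\<^sub>M y')"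
     using h c cY M by (simp add: subset_iff mod_ac)
    then show ?thesis using h R sub_add[OF M X] sub_add[OF M Y] by simp
   qed
   show "R (a \<odot>\<^sub>M u) = a \<odot>\<^sub>M R u" if au: "a <: K" "u <: M" for a u
   proof -
    obtain x y where h: "x \<in> X" "y \<in> Y" "u = x \<oplus>\<^sub>M y" using ex[OF au(2)] by blast
    have "a \<odot>\<^sub>M u = (a \<odot>\<^sub>M x) \<oplus>\<^sub>M (a \<odot>\<^sub>M y)"
     using h c cY M that by (simp add: subset_iff mod_sadd)
    then show ?thesis using h R sub_smult[OF M X] sub_smult[OF M Y] that by simp
   qed
  qed
 qed
qed

section \<open>The tensor algebra\<close>

subsection \<open>Algebras and quotients\<close>

abbreviation ualg where "ualg A == unital_algebra K A"

context
 fixes A (structure)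
 assumes A: "ualg A"
begin

interpretation A: ring A using A by (simp add: unital_algebra_def)

lemma ua_simps:
 shows ua_ring: "ring A" and ua_mod: "module K A"
  and ua_closed: "x <: A ==> y <: A ==> x \<otimes> y <: A"
  and ua_one: "\<one> <: A"
  and ua_assoc: "x <: A ==> y <: A ==> z <: A ==> x \<otimes> y \<otimes> z = x \<otimes> (y \<otimes> z)"
  and ua_lone: "x <: A ==> \<one> \<otimes> x = x"
  and ua_rone: "x <: A ==> x \<otimes> \<one> = x"
  and ua_ldistr: "x <: A ==> y <: A ==> z <: A ==> (x \<oplus> y) \<otimes> z = x \<otimes> z \<oplus> y \<otimes> z"
  and ua_rdistr: "x <: A ==> y <: A ==> z <: A ==> z \<otimes> (x \<oplus> y) = z \<otimes> x \<oplus> z \<otimes> y"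
  and ua_smultl: "a <: K ==> x <: A ==> y <: A ==> (a \<odot> x) \<otimes> y = a \<odot> (x \<otimes> y)"
  and ua_smultr: "a <: K ==> x <: A ==> y <: A ==> x \<otimes> (a \<odot> y) = a \<odot> (x \<otimes> y)"
  and ua_zerol: "x <: A ==> \<zero> \<otimes> x = \<zero>"
  and ua_zeror: "x <: A ==> x \<otimes> \<zero> = \<zero>"
  and ua_negl: "x <: A ==> y <: A ==> (\<ominus> x) \<otimes> y = \<ominus> (x \<otimes> y)"
  and ua_negr: "x <: A ==> y <: A ==> x \<otimes> (\<ominus> y) = \<ominus> (x \<otimes> y)"
 using A by (auto simp: unital_algebra_def A.m_assoc A.l_distr A.r_distr A.l_minus A.r_minus intro: A.ring_axioms)

end

lemma lin_lmult: "ualg A ==> f \<in> lin M A ==> u <: A ==> (%x. u \<otimes>\<^sub>A f x) \<in> lin M A"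
 by (auto intro!: linI simp: lin_simps ua_simps)

lemma lin_rmult: "ualg A ==> f \<in> lin M A ==> u <: A ==> (%x. f x \<otimes>\<^sub>A u) \<in> lin M A"
 by (auto intro!: linI simp: lin_simps ua_simps)

lemma ideal_submodule:
 assumes "ualg A" "ideal I A" shows "sub I A"
proof (rule subI[OF ua_mod[OF assms(1)]])
 interpret ideal I A by fact
 show "I <<: A" "\<zero>\<^sub>A \<in> I" by (auto simp: additive_subgroup.zero_closed a_Hcarr)
 show "x \<in> I ==> y \<in> I ==> x \<oplus>\<^sub>A y \<in> I" for x y by simp
 show "a \<odot>\<^sub>A x \<in> I" if a: "a <: K" "x \<in> I" for a x
 proof -
  have x: "x <: A" using a by auto
  have "a \<odot>\<^sub>A x = (a \<odot>\<^sub>A \<one>\<^sub>A) \<otimes>\<^sub>A x"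
   using a x assms(1) by (simp add: ua_simps)
  then show ?thesis using a x I_l_closed ua_mod[OF assms(1)] by simp
 qed
qed

lemma submodule_ideal:
 assumes A: "ualg A" and I: "sub I A"
  "!!a x. a <: A ==> x \<in> I ==> a \<otimes>\<^sub>A x \<in> I" "!!a x. a <: A ==> x \<in> I ==> x \<otimes>\<^sub>A a \<in> I"
 shows "ideal I A"
 using assms by (intro idealI) (auto simp: ua_ring submodule_def)

lemma quot_simps:
 assumes A: "ualg A" and I: "ideal I A"
 shows quot_ualg: "ualg (quot_algebra A I)"
  and quot_proj_lin: "(%x. I +>\<^sub>A x) \<in> lin A (quot_algebra A I)"
  and quot_carr: "carrier (quot_algebra A I) = (%x. I +>\<^sub>A x) ` carrier A"
  and quot_mult: "x <: A ==> y <: A ==> (I +>\<^sub>A x) \<otimes>\<^sub>(quot_algebra A I) (I +>\<^sub>A y) = I +>\<^sub>A (x \<otimes>\<^sub>A y)"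
  and quot_one: "\<one>\<^sub>(quot_algebra A I) = I +>\<^sub>A \<one>\<^sub>A"
  and quot_zero: "\<zero>\<^sub>(quot_algebra A I) = I"
  and quot_add: "x <: A ==> y <: A ==> (I +>\<^sub>A x) \<oplus>\<^sub>(quot_algebra A I) (I +>\<^sub>A y) = I +>\<^sub>A (x \<oplus>\<^sub>A y)"
  and quot_smult: "a <: K ==> x <: A ==> a \<odot>\<^sub>(quot_algebra A I) (I +>\<^sub>A x) = I +>\<^sub>A (a \<odot>\<^sub>A x)"
  and quot_eq: "x <: A ==> y <: A ==> I +>\<^sub>A x = I +>\<^sub>A y \<longleftrightarrow> x \<ominus>\<^sub>A y \<in> I"
  and quot_eq0: "x <: A ==> I +>\<^sub>A x = I \<longleftrightarrow> x \<in> I"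
proof -
 interpret I: ideal I A by fact
 note sI = ideal_submodule[OF A I]
 note M = ua_mod[OF A]
 let ?Q = "quot_algebra A I"
 show c: "carrier ?Q = (%x. I +>\<^sub>A x) ` carrier A"
  by (auto simp: quot_algebra_def FactRing_def A_RCOSETS_defs a_r_coset_defs)
 show m: "x <: A ==> y <: A ==> (I +>\<^sub>A x) \<otimes>\<^sub>?Q (I +>\<^sub>A y) = I +>\<^sub>A (x \<otimes>\<^sub>A y)" for x y
  by (simp add: quot_algebra_def FactRing_def I.rcoset_mult_add)
 show o: "\<one>\<^sub>?Q = I +>\<^sub>A \<one>\<^sub>A" "\<zero>\<^sub>?Q = I" by (simp_all add: quot_algebra_def FactRing_def)
 show ad: "x <: A ==> y <: A ==> (I +>\<^sub>A x) \<oplus>\<^sub>?Q (I +>\<^sub>A y) = I +>\<^sub>A (x \<oplus>\<^sub>A y)" for x y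
  by (simp add: quot_algebra_def FactRing_def I.a_rcos_sum)
 show eq: "x <: A ==> y <: A ==> I +>\<^sub>A x = I +>\<^sub>A y \<longleftrightarrow> x \<ominus>\<^sub>A y \<in> I" for x y
  using I.quotient_eq_iff_same_a_r_cos[OF I] by simp
 show eq0: "x <: A ==> I +>\<^sub>A x = I \<longleftrightarrow> x \<in> I" for x
  by (metis I.a_coset_join2 I.a_rcos_self I.is_additive_subgroup additive_subgroup.a_subgroup)
 show sm: "a \<odot>\<^sub>?Q (I +>\<^sub>A x) = I +>\<^sub>A (a \<odot>\<^sub>A x)" if a: "a <: K" "x <: A" for a x
 proof -
  \<comment> \<open>The scalar action on the quotient is a union over all representatives of a
    coset, so all of them must give the same result.\<close>
  have st: "I +>\<^sub>A (a \<odot>\<^sub>A y) = I +>\<^sub>A (a \<odot>\<^sub>A x)" if "y \<in> I +>\<^sub>A x" for y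
  proof -
   have y: "y <: A" using that a I.a_elemrcos_carrier by auto
   have "I +>\<^sub>A y = I +>\<^sub>A x" using that a I.a_repr_independence by (metis I.a_subgroup)
   then have "y \<ominus>\<^sub>A x \<in> I" using eq y a by simp
   then have "a \<odot>\<^sub>A (y \<ominus>\<^sub>A x) \<in> I" using sub_smult[OF M sI] a by blast
   then show ?thesis using y a M by (subst eq) (simp_all add: mod_minus mod_sadd mod_sneg)
  qed
  have "I +>\<^sub>A x \<noteq> {}" using a I.a_rcos_self by auto
  then have "(\<Union>y\<in>I +>\<^sub>A x. I +>\<^sub>A (a \<odot>\<^sub>A y)) = I +>\<^sub>A (a \<odot>\<^sub>A x)"
   using st by (rule SUP_eq_const)
  then show ?thesis by (simp add: quot_algebra_def)
 qed
 show "(%x. I +>\<^sub>A x) \<in> lin A ?Q"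
  using c by (intro linI) (auto simp: ad sm)
 have R: "ring ?Q"
 proof (rule ringI)
  have z: "I = I +>\<^sub>A \<zero>\<^sub>A" using eq0[of "\<zero>\<^sub>A"] sub_zero[OF M sI] M by simp
  show "abelian_group ?Q"
  proof (rule abelian_groupI)
   show "\<exists>y\<in>carrier ?Q. y \<oplus>\<^sub>?Q x = \<zero>\<^sub>?Q" if xQ: "x <: ?Q" for x
   proof -
    obtain y where y: "x = I +>\<^sub>A y" "y <: A" using xQ c by auto
    then have "(I +>\<^sub>A (\<ominus>\<^sub>A y)) \<oplus>\<^sub>?Q x = \<zero>\<^sub>?Q" using M o(2) z by (simp add: ad)
    then show ?thesis unfolding c using y M by blast
   qed
   show "\<zero>\<^sub>?Q <: ?Q" using z o(2) c M by blast
   show "\<zero>\<^sub>?Q \<oplus>\<^sub>?Q x = x" if "x <: ?Q" for x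
    using that M z o(2) c ad[of "\<zero>\<^sub>A"] by auto
  qed (use M in \<open>auto simp: c ad mod_ac\<close>)
  show "Group.monoid ?Q" by (rule monoidI) (auto simp: c m o(1) ua_simps[OF A])
 qed (use M in \<open>auto simp: c ad m ua_simps[OF A]\<close>)
 have "module K ?Q"
 proof (rule moduleI)
  show "cring K" by (rule is_cring)
  show "abelian_group ?Q" using R by (rule ring.is_abelian_group)
 qed (use M in \<open>auto simp: c sm ad mod_adds mod_sadd mod_smul\<close>)
 with R show "ualg ?Q"
  unfolding unital_algebra_def using A by (auto simp: c sm m ua_simps[OF A] M)
qed

lemma quot_lift:
 assumes A: "ualg A" and I: "ideal I A" and N: "module K N" and f: "f \<in> lin A N"
  and kill: "!!x. x \<in> I ==> f x = \<zero>\<^sub>N"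
 shows "\<exists>g\<in>lin (quot_algebra A I) N. \<forall>x\<in>carrier A. g (I +>\<^sub>A x) = f x"
proof -
 note Q = quot_simps[OF A I] and M = ua_mod[OF A]
 define g where "g X = f (SOME x. x <: A \<and> X = I +>\<^sub>A x)" for X
 have g: "g (I +>\<^sub>A x) = f x" if x: "x <: A" for x
 proof -
  define y where "y = (SOME y. y <: A \<and> I +>\<^sub>A x = I +>\<^sub>A y)"
  have y: "y <: A \<and> I +>\<^sub>A x = I +>\<^sub>A y"
   unfolding y_def by (rule someI[of _ x]) (use x in simp)
  then have "x \<ominus>\<^sub>A y \<in> I" using Q(9) x by blast
  then have "f (x \<ominus>\<^sub>A y) = \<zero>\<^sub>N" by (rule kill)
  then have "f x \<ominus>\<^sub>N f y = \<zero>\<^sub>N" using lin_minus[OF f M N, of x y] y x by simp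
  then have "f x = f y" using mod_eqI[OF N lin_cl[OF f, of x] lin_cl[OF f, of y]] y x by simp
  then show ?thesis unfolding g_def y_def by simp
 qed
 have "g \<in> lin (quot_algebra A I) N"
  by (rule linI) (use M f in \<open>auto simp: Q g lin_simps\<close>)
 then show ?thesis using g by blast
qed

subsection \<open>The free algebra\<close>

context
 fixes X :: "'x set"
begin

abbreviation (input) FA where "FA == free_algebra K X"

lemma fa_sel:
 "f <: FA \<longleftrightarrow> (\<forall>w. f w <: K) \<and> finite {w. f w \<noteq> \<zero>\<^sub>K} \<and> (\<forall>w. f w \<noteq> \<zero>\<^sub>K --> set w \<subseteq> X)"
 "(f \<otimes>\<^sub>FA g) w = (\<Oplus>\<^sub>K i\<in>{..length w}. f (take i w) \<otimes>\<^sub>K g (drop i w))"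
 "\<one>\<^sub>FA = word K []" "\<zero>\<^sub>FA = (%w. \<zero>\<^sub>K)" "(f \<oplus>\<^sub>FA g) = (%w. f w \<oplus>\<^sub>K g w)" "(a \<odot>\<^sub>FA f) = (%w. a \<otimes>\<^sub>K f w)"
 by (auto simp: free_algebra_def word_def)

lemma fa_word: "set u \<subseteq> X ==> word K u <: FA"
 by (auto simp: fa_sel word_def)

lemma fa_abgroup: "abelian_group FA"
proof (rule abelian_groupI)
 fix f g h assume f: "f <: FA"
 show "\<exists>y\<in>carrier FA. y \<oplus>\<^sub>FA f = \<zero>\<^sub>FA"
  using f by (intro bexI[of _ "%w. \<ominus>\<^sub>K f w"]) (auto simp: fa_sel l_neg)
 assume g: "g <: FA"
 have s: "{w. f w \<oplus>\<^sub>K g w \<noteq> \<zero>\<^sub>K} \<subseteq> {w. f w \<noteq> \<zero>\<^sub>K} \<union> {w. g w \<noteq> \<zero>\<^sub>K}"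
  using f g by (auto simp: fa_sel)
 then have "finite {w. f w \<oplus>\<^sub>K g w \<noteq> \<zero>\<^sub>K}"
  by (rule finite_subset) (use f g in \<open>auto simp: fa_sel\<close>)
 moreover have "set w \<subseteq> X" if "f w \<oplus>\<^sub>K g w \<noteq> \<zero>\<^sub>K" for w
  using that s f g unfolding fa_sel(1) by blast
 ultimately show "f \<oplus>\<^sub>FA g <: FA" using f g unfolding fa_sel by blast
 show "f \<oplus>\<^sub>FA g = g \<oplus>\<^sub>FA f" using f g by (auto simp: fa_sel a_comm)
 assume h: "h <: FA"
 show "f \<oplus>\<^sub>FA g \<oplus>\<^sub>FA h = f \<oplus>\<^sub>FA (g \<oplus>\<^sub>FA h)" using f g h by (auto simp: fa_sel a_assoc)
qed (auto simp: fa_sel)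

lemma fa_smult: "a <: K ==> f <: FA ==> a \<odot>\<^sub>FA f <: FA"
proof -
 assume a: "a <: K" and f: "f <: FA"
 have s: "{w. a \<otimes>\<^sub>K f w \<noteq> \<zero>\<^sub>K} \<subseteq> {w. f w \<noteq> \<zero>\<^sub>K}"
  using f a by (auto simp: fa_sel)
 then have "finite {w. a \<otimes>\<^sub>K f w \<noteq> \<zero>\<^sub>K}"
  by (rule finite_subset) (use f in \<open>auto simp: fa_sel\<close>)
 moreover have "set w \<subseteq> X" if "a \<otimes>\<^sub>K f w \<noteq> \<zero>\<^sub>K" for w
  using that s f unfolding fa_sel(1) by blast
 ultimately show ?thesis using a f unfolding fa_sel by blast
qed

lemma fa_module: "module K FA"
proof (rule moduleI)
 show "abelian_group FA" by (rule fa_abgroup)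
qed (auto simp: is_cring fa_smult, auto simp: fa_sel l_distr r_distr m_assoc)

lemma fa_mult_closed:
 assumes "f <: FA" "g <: FA" shows "f \<otimes>\<^sub>FA g <: FA"
proof -
 let ?S = "(%(u, v). u @ v) ` ({w. f w \<noteq> \<zero>\<^sub>K} \<times> {w. g w \<noteq> \<zero>\<^sub>K})"
 have c: "f w <: K" "g w <: K" for w using assms by (auto simp: fa_sel)
 have S: "w \<in> ?S" if "(f \<otimes>\<^sub>FA g) w \<noteq> \<zero>\<^sub>K" for w
 proof (rule ccontr)
  assume n: "w \<notin> ?S"
  have "f (take i w) \<otimes>\<^sub>K g (drop i w) = \<zero>\<^sub>K" for i
  proof (rule ccontr)
   assume "f (take i w) \<otimes>\<^sub>K g (drop i w) \<noteq> \<zero>\<^sub>K"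
   then have "f (take i w) \<noteq> \<zero>\<^sub>K" "g (drop i w) \<noteq> \<zero>\<^sub>K" using c by auto
   then have "w \<in> ?S" by (intro image_eqI[of _ _ "(take i w, drop i w)"]) auto
   then show False using n by simp
  qed
  then show False using that by (simp add: fa_sel(2))
 qed
 have "finite ?S" using assms by (auto simp: fa_sel)
 then have "finite {w. (f \<otimes>\<^sub>FA g) w \<noteq> \<zero>\<^sub>K}" using S by (auto elim!: finite_subset[rotated])
 moreover have "set w \<subseteq> X" if w: "(f \<otimes>\<^sub>FA g) w \<noteq> \<zero>\<^sub>K" for w
 proof -
  obtain u v where "w = u @ v" "f u \<noteq> \<zero>\<^sub>K" "g v \<noteq> \<zero>\<^sub>K" using S[OF w] by auto
  then show ?thesis using assms unfolding fa_sel(1) by (metis Un_subset_iff set_append)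
 qed
 moreover have "(f \<otimes>\<^sub>FA g) w <: K" for w using c by (auto simp: fa_sel(2) intro!: finsum_closed)
 ultimately show ?thesis unfolding fa_sel(1) by blast
qed

lemma fa_distr:
 assumes "f <: FA" "g <: FA" "h <: FA"
 shows "(f \<oplus>\<^sub>FA g) \<otimes>\<^sub>FA h = f \<otimes>\<^sub>FA h \<oplus>\<^sub>FA g \<otimes>\<^sub>FA h"
  "h \<otimes>\<^sub>FA (f \<oplus>\<^sub>FA g) = h \<otimes>\<^sub>FA f \<oplus>\<^sub>FA h \<otimes>\<^sub>FA g"
proof -
 have c: "f w <: K" "g w <: K" "h w <: K" for w using assms by (auto simp: fa_sel)
 have A: "(\<Oplus>\<^sub>K i\<in>I. p i) \<oplus>\<^sub>K (\<Oplus>\<^sub>K i\<in>I. q i) = (\<Oplus>\<^sub>K i\<in>I. p i \<oplus>\<^sub>K q i)"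
  if "!!i. p i <: K" "!!i. q i <: K" for p q and I :: "nat set"
  using that by (subst finsum_addf) auto
 show "(f \<oplus>\<^sub>FA g) \<otimes>\<^sub>FA h = f \<otimes>\<^sub>FA h \<oplus>\<^sub>FA g \<otimes>\<^sub>FA h"
  unfolding fa_sel(5) unfolding fa_sel(2) by (rule ext, subst A) (simp_all add: c l_distr)
 show "h \<otimes>\<^sub>FA (f \<oplus>\<^sub>FA g) = h \<otimes>\<^sub>FA f \<oplus>\<^sub>FA h \<otimes>\<^sub>FA g"
  unfolding fa_sel(5) unfolding fa_sel(2) by (rule ext, subst A) (simp_all add: c r_distr)
qed

lemma fa_scal:
 assumes "a <: K" "f <: FA" "g <: FA"
 shows "(a \<odot>\<^sub>FA f) \<otimes>\<^sub>FA g = a \<odot>\<^sub>FA (f \<otimes>\<^sub>FA g)" "f \<otimes>\<^sub>FA (a \<odot>\<^sub>FA g) = a \<odot>\<^sub>FA (f \<otimes>\<^sub>FA g)"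
proof -
 have c: "f w <: K" "g w <: K" for w using assms by (auto simp: fa_sel)
 show "(a \<odot>\<^sub>FA f) \<otimes>\<^sub>FA g = a \<odot>\<^sub>FA (f \<otimes>\<^sub>FA g)"
  by (rule ext) (simp add: fa_sel(2,6) c assms(1) m_assoc finsum_rdistr)
 show "f \<otimes>\<^sub>FA (a \<odot>\<^sub>FA g) = a \<odot>\<^sub>FA (f \<otimes>\<^sub>FA g)"
  by (rule ext) (simp add: fa_sel(2,6) c assms(1) m_lcomm finsum_rdistr)
qed

lemma word_mult: "word K u \<otimes>\<^sub>FA word K v = word K (u @ v)"
proof
 fix w
 \<comment> \<open>The convolution of two words has at most one nonzero term, at the cut after
   \<open>length u\<close> letters.\<close>
 have "word K u (take i w) \<otimes>\<^sub>K word K v (drop i w) =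
   (if length u = i then (if w = u @ v then \<one>\<^sub>K else \<zero>\<^sub>K) else \<zero>\<^sub>K)" if "i \<le> length w" for i
 proof -
  have "take i w = u \<and> drop i w = v \<longleftrightarrow> length u = i \<and> w = u @ v"
   using that by (metis append_eq_conv_conj append_take_drop_id length_take min.absorb2)
  then show ?thesis unfolding word_def by auto
 qed
 then have "(word K u \<otimes>\<^sub>FA word K v) w =
   (\<Oplus>\<^sub>K i\<in>{..length w}. if length u = i then (if w = u @ v then \<one>\<^sub>K else \<zero>\<^sub>K) else \<zero>\<^sub>K)"
  unfolding fa_sel(2) by (intro finsum_cong') auto
 also have "\<dots> = word K (u @ v) w"
 proof (cases "length u \<le> length w")
  case True
  then show ?thesis by (subst finsum_singleton) (auto simp: word_def)
 next
  case False
  then have "(\<Oplus>\<^sub>K i\<in>{..length w}. if length u = i then (if w = u @ v then \<one>\<^sub>K else \<zero>\<^sub>K) else \<zero>\<^sub>K)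
    = (\<Oplus>\<^sub>K i\<in>{..length w}. \<zero>\<^sub>K)"
   by (intro finsum_cong') auto
  then show ?thesis using False by (auto simp: word_def)
 qed
 finally show "(word K u \<otimes>\<^sub>FA word K v) w = word K (u @ v) w" .
qed

lemma fa_span: "carrier FA = span FA (word K ` {u. set u \<subseteq> X})"
proof
 show "span FA (word K ` {u. set u \<subseteq> X}) <<: FA"
  by (rule span_carr[OF fa_module]) (auto simp: fa_word)
 let ?S = "span FA (word K ` {u. set u \<subseteq> X})"
 have S: "sub ?S FA" by (rule span_sub[OF fa_module]) (auto simp: fa_word)
 have "f \<in> ?S" if "card {w. f w \<noteq> \<zero>\<^sub>K} = n" "f <: FA" for f n
  using that
 proof (induct n arbitrary: f)
  case 0
  then have "f = \<zero>\<^sub>FA" by (auto simp: fa_sel)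
  then show ?case using sub_zero[OF fa_module S] by simp
 next
  case (Suc n)
  then obtain u where u: "f u \<noteq> \<zero>\<^sub>K" by (metis (mono_tags) card.empty empty_Collect_eq nat.distinct(1))
  have uX: "set u \<subseteq> X" and fu: "f u <: K" using Suc(3) u by (auto simp: fa_sel)
  \<comment> \<open>Removing the term at \<open>u\<close> makes the support smaller.\<close>
  let ?g = "f(u := \<zero>\<^sub>K)"
  have "{w. ?g w \<noteq> \<zero>\<^sub>K} = {w. f w \<noteq> \<zero>\<^sub>K} - {u}" using u by auto
  then have "card {w. ?g w \<noteq> \<zero>\<^sub>K} = n" "finite {w. ?g w \<noteq> \<zero>\<^sub>K}"
   using Suc(2,3) u by (auto simp: fa_sel)
  moreover have "?g <: FA" using Suc(3) calculation(2) by (auto simp: fa_sel)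
  ultimately have g: "?g \<in> ?S" using Suc(1) by blast
  have w: "f u \<odot>\<^sub>FA word K u \<in> ?S"
   using uX fu by (intro sub_smult[OF fa_module S] span_base) auto
  have "f = ?g \<oplus>\<^sub>FA (f u \<odot>\<^sub>FA word K u)"
   using Suc(3) fu by (auto simp: fa_sel word_def)
  then show ?case using sub_add[OF fa_module S g w] by simp
 qed
 then show "carrier FA \<subseteq> ?S" by blast
qed

lemma fa_induct [consumes 1, case_names word zero add smult]:
 assumes "f <: FA" "!!u. set u \<subseteq> X ==> P (word K u)" "P \<zero>\<^sub>FA"
  "!!f g. f <: FA ==> g <: FA ==> P f ==> P g ==> P (f \<oplus>\<^sub>FA g)"
  "!!a f. a <: K ==> f <: FA ==> P f ==> P (a \<odot>\<^sub>FA f)"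
 shows "P f"
proof -
 have "word K ` {u. set u \<subseteq> X} <<: FA" by (auto simp: fa_word)
 with assms(1)[unfolded fa_span] fa_module show ?thesis
  by (induct rule: span_induct) (use assms in auto)
qed

lemma fa_mult_zero: "f <: FA ==> \<zero>\<^sub>FA \<otimes>\<^sub>FA f = \<zero>\<^sub>FA" "f <: FA ==> f \<otimes>\<^sub>FA \<zero>\<^sub>FA = \<zero>\<^sub>FA"
 by (auto simp: fa_sel)

text \<open>Instead of rearranging double sums, each argument is expanded in words by linearity; for
  words, associativity is that of concatenation.\<close>

lemma fa_assoc:
 assumes f: "f <: FA" and g: "g <: FA" and h: "h <: FA"
 shows "f \<otimes>\<^sub>FA g \<otimes>\<^sub>FA h = f \<otimes>\<^sub>FA (g \<otimes>\<^sub>FA h)"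
proof -
 note S = fa_word fa_mult_closed fa_distr fa_scal fa_mult_zero fa_smult mod_closed[OF fa_module]
 have 1: "word K u \<otimes>\<^sub>FA word K v \<otimes>\<^sub>FA h = word K u \<otimes>\<^sub>FA (word K v \<otimes>\<^sub>FA h)"
  if "set u \<subseteq> X" "set v \<subseteq> X" for u v
  using h by (induct rule: fa_induct) (use that in \<open>simp_all add: S word_mult\<close>)
 have 2: "word K u \<otimes>\<^sub>FA g \<otimes>\<^sub>FA h = word K u \<otimes>\<^sub>FA (g \<otimes>\<^sub>FA h)" if "set u \<subseteq> X" for u
  using g by (induct rule: fa_induct) (use that h in \<open>simp_all add: S 1\<close>)
 show ?thesis
  using f by (induct rule: fa_induct) (use g h in \<open>simp_all add: S 2\<close>)
qed

lemma fa_ualg: "ualg FA"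
proof -
 note S = fa_word fa_mult_closed fa_distr fa_scal fa_mult_zero fa_smult mod_closed[OF fa_module]
 have one: "word K [] \<otimes>\<^sub>FA f = f" "f \<otimes>\<^sub>FA word K [] = f" if "f <: FA" for f
  using that by (induct rule: fa_induct) (simp_all add: S word_mult)
 have "Group.monoid FA"
  by (rule monoidI) (auto simp: fa_mult_closed fa_assoc fa_sel(3) one fa_word)
 then have "ring FA"
  by (intro ringI fa_abgroup) (auto simp: fa_distr)
 then show ?thesis by (simp add: unital_algebra_def fa_module fa_scal)
qed

lemma fa_lift:
 assumes N: "module K N" and F: "!!u. set u \<subseteq> X ==> F u <: N"
 shows "\<exists>g\<in>lin FA N. \<forall>u. set u \<subseteq> X --> g (word K u) = F u"
proof -
 interpret N: module K N by fact
 define h where "h u f = (if set u \<subseteq> X then f u \<odot>\<^sub>N F u else \<zero>\<^sub>N)" for u and f :: "'x list => 'k"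
 have h: "h u \<in> lin FA N" for u
  unfolding h_def using F N by (intro linI) (auto simp: fa_sel mod_adds mod_smul)
 have fin: "finite {u. h u f \<noteq> \<zero>\<^sub>N}" if "f <: FA" for f
  by (rule finite_subset[of _ "{u. f u \<noteq> \<zero>\<^sub>K}"]) (use that F N in \<open>auto simp: h_def fa_sel\<close>)
 let ?g = "%f. \<Oplus>\<^sub>N u\<in>{u. h u f \<noteq> \<zero>\<^sub>N}. h u f"
 have "?g (word K u) = F u" if u: "set u \<subseteq> X" for u
 proof -
  have "?g (word K u) = (\<Oplus>\<^sub>N v\<in>{u}. h v (word K u))"
   using u F N by (intro finsum_superset) (auto simp: h_def word_def split: if_splits)
  also have "\<dots> = F u" using u F by (simp add: h_def word_def)
  finally show ?thesis .
 qed
 moreover have "?g \<in> lin FA N" by (rule lin_locfin_sum[OF fa_module N h fin])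
 ultimately show ?thesis by (intro bexI[of _ ?g]) auto
qed

end

subsection \<open>The universal property\<close>

text \<open>A family of multilinear maps, one on each power of \<open>V\<close>.\<close>

definition multilin :: "('k, 'v) module => ('k, 'w) module => ('v list => 'w) => bool" where
 "multilin V N F \<longleftrightarrow> (\<forall>vs. set vs <<: V --> F vs <: N) \<and>
  (\<forall>us vs x y. set us <<: V --> set vs <<: V --> x <: V --> y <: V -->
    F (us @ (x \<oplus>\<^sub>V y) # vs) = F (us @ x # vs) \<oplus>\<^sub>N F (us @ y # vs)) \<and>
  (\<forall>us vs a x. set us <<: V --> set vs <<: V --> a <: K --> x <: V -->
    F (us @ (a \<odot>\<^sub>V x) # vs) = a \<odot>\<^sub>N F (us @ x # vs))"

lemma multilinI:
 assumes "!!vs. set vs <<: V ==> F vs <: N"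
  "!!us vs x y. set us <<: V ==> set vs <<: V ==> x <: V ==> y <: V ==>
    F (us @ (x \<oplus>\<^sub>V y) # vs) = F (us @ x # vs) \<oplus>\<^sub>N F (us @ y # vs)"
  "!!us vs a x. set us <<: V ==> set vs <<: V ==> a <: K ==> x <: V ==>
    F (us @ (a \<odot>\<^sub>V x) # vs) = a \<odot>\<^sub>N F (us @ x # vs)"
 shows "multilin V N F"
 using assms by (auto simp: multilin_def)

lemma multilinD:
 assumes "multilin V N F"
 shows "set vs <<: V ==> F vs <: N"
  "set us <<: V ==> set vs <<: V ==> x <: V ==> y <: V ==>
    F (us @ (x \<oplus>\<^sub>V y) # vs) = F (us @ x # vs) \<oplus>\<^sub>N F (us @ y # vs)"
  "set us <<: V ==> set vs <<: V ==> a <: K ==> x <: V ==>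
    F (us @ (a \<odot>\<^sub>V x) # vs) = a \<odot>\<^sub>N F (us @ x # vs)"
 using assms unfolding multilin_def by blast+

context
 fixes V :: "('k, 'v) module"
 assumes V [simp]: "module K V"
begin

lemma tensor_ideal_ideal: "ideal (tensor_ideal K V) (free_algebra K (carrier V))"
proof -
 let ?F = "free_algebra K (carrier V)"
 interpret F: ring ?F by (rule ua_ring[OF fa_ualg])
 show ?thesis unfolding tensor_ideal_def Let_def
  by (rule F.genideal_ideal)
   (auto intro!: mod_closed[OF fa_module] fa_word)
qed

lemma T_ualg: "ualg (T V)"
 unfolding tensor_algebra_def by (rule quot_ualg[OF fa_ualg tensor_ideal_ideal])

lemma T_mod [simp]: "module K (T V)"
 by (rule ua_mod[OF T_ualg])

lemma tens_closed [simp]: "set vs <<: V ==> tens K V vs <: (T V)"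
 unfolding tens_def tensor_algebra_def quot_carr[OF fa_ualg tensor_ideal_ideal] by (auto intro: fa_word)

lemma tens_append: "set us <<: V ==> set vs <<: V ==>
  tens K V (us @ vs) = tens K V us \<star>\<^sub>V tens K V vs"
 unfolding tens_def tensor_algebra_def by (simp add: quot_mult[OF fa_ualg tensor_ideal_ideal] fa_word word_mult)

lemma tens_Nil: "tens K V [] = \<one>\<^sub>(T V)"
 unfolding tens_def tensor_algebra_def by (simp add: quot_one[OF fa_ualg tensor_ideal_ideal] fa_sel(3))

lemma tens1_add: "x <: V ==> y <: V ==>
  tens K V [x \<oplus>\<^sub>V y] = tens K V [x] \<oplus>\<^sub>(T V) tens K V [y]"
proof -
 let ?F = "free_algebra K (carrier V)"
 interpret F: ring ?F by (rule ua_ring[OF fa_ualg])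
 assume xy: "x <: V" "y <: V"
 have "word K [x \<oplus>\<^sub>V y] \<ominus>\<^sub>?F (word K [x] \<oplus>\<^sub>?F word K [y]) \<in> tensor_ideal K V"
  unfolding tensor_ideal_def Let_def using xy
  by (intro subsetD[OF F.genideal_self]) (auto intro!: mod_closed[OF fa_module] fa_word)
 then show ?thesis unfolding tens_def tensor_algebra_def
  using xy by (simp add: quot_add[OF fa_ualg tensor_ideal_ideal] quot_eq[OF fa_ualg tensor_ideal_ideal] fa_word)
qed

lemma tens1_smult: "a <: K ==> x <: V ==>
  tens K V [a \<odot>\<^sub>V x] = a \<odot>\<^sub>(T V) tens K V [x]"
proof -
 let ?F = "free_algebra K (carrier V)"
 interpret F: ring ?F by (rule ua_ring[OF fa_ualg])
 assume xy: "a <: K" "x <: V"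
 have "word K [a \<odot>\<^sub>V x] \<ominus>\<^sub>?F (a \<odot>\<^sub>?F word K [x]) \<in> tensor_ideal K V"
  unfolding tensor_ideal_def Let_def using xy
  by (intro subsetD[OF F.genideal_self]) (auto intro!: mod_closed[OF fa_module] fa_word)
 then show ?thesis unfolding tens_def tensor_algebra_def
  using xy by (simp add: quot_smult[OF fa_ualg tensor_ideal_ideal] quot_eq[OF fa_ualg tensor_ideal_ideal]
   fa_word mod_closed[OF fa_module])
qed

lemma tens_Cons: "v <: V ==> set vs <<: V ==> tens K V (v # vs) = tens K V [v] \<star>\<^sub>V tens K V vs"
 using tens_append[of "[v]" vs] by simp

lemma tens_split: "set us <<: V ==> v <: V ==> set vs <<: V ==>
  tens K V (us @ v # vs) = tens K V us \<star>\<^sub>V (tens K V [v] \<star>\<^sub>V tens K V vs)"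
 using tens_append[of us "v # vs"] tens_Cons[of v vs] by simp

lemma tens_multilin: "multilin V (T V) (tens K V)"
 by (intro multilinI) (simp_all add: tens_split tens1_add tens1_smult ua_simps[OF T_ualg])

lemma T_span: "carrier (T V) = span (T V) (tens K V ` {vs. set vs <<: V})"
proof
 let ?F = "free_algebra K (carrier V)"
 note Q = quot_simps[OF fa_ualg tensor_ideal_ideal, folded tensor_algebra_def]
 show "span (T V) (tens K V ` {vs. set vs <<: V}) <<: (T V)"
  by (rule span_carr) auto
 have "tensor_ideal K V +>\<^sub>?F f \<in> span (T V) (tens K V ` {vs. set vs <<: V})" if "f <: ?F" for f
  using Q(2) fa_module T_mod _ span_sub[OF T_mod] _ that[unfolded fa_span]
  by (rule lin_span_image) (auto simp: fa_word simp flip: tens_def intro: span_base)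
 then show "carrier (T V) \<subseteq> span (T V) (tens K V ` {vs. set vs <<: V})"
  unfolding Q(3) by blast
qed

lemma T_induct [consumes 1, case_names tens zero add smult]:
 assumes "t <: (T V)" "!!vs. set vs <<: V ==> P (tens K V vs)" "P \<zero>\<^sub>(T V)"
  "!!f g. f <: (T V) ==> g <: (T V) ==> P f ==> P g ==> P (f \<oplus>\<^sub>(T V) g)"
  "!!a f. a <: K ==> f <: (T V) ==> P f ==> P (a \<odot>\<^sub>(T V) f)"
 shows "P t"
proof -
 have "tens K V ` {vs. set vs <<: V} <<: (T V)" by auto
 with assms(1)[unfolded T_span] T_mod show ?thesis
  by (induct rule: span_induct) (use assms in auto)
qed

lemma T_lin_eq:
 assumes "f \<in> lin (T V) N" "g \<in> lin (T V) N" "module K N"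
  "!!vs. set vs <<: V ==> f (tens K V vs) = g (tens K V vs)" "t <: (T V)"
 shows "f t = g t"
 using assms(5) by (induct rule: T_induct) (use assms in \<open>auto simp: lin_simps\<close>)

text \<open>The values on words extend linearly to the free algebra. This extension need not be
  multiplicative, so its kernel need not be an ideal, and the linearity relations have to be killed
  together with all their two-sided multiples; multilinearity in an arbitrary position provides
  this.\<close>

lemma T_lift:
 assumes N: "module K N" and F: "multilin V N F"
 shows "\<exists>g\<in>lin (T V) N. \<forall>vs. set vs <<: V --> g (tens K V vs) = F vs"
proof -
 let ?F = "free_algebra K (carrier V)"
 let ?I = "tensor_ideal K V"
 note S = mod_closed[OF fa_module] ua_simps[OF fa_ualg] fa_word
 interpret F: ring ?F by (rule ua_ring[OF fa_ualg])
 obtain h where h: "h \<in> lin ?F N" "!!u. set u <<: V ==> h (word K u) = F u"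
  using fa_lift[OF N, of "carrier V" F] multilinD(1)[OF F] by blast
 \<comment> \<open>The largest ideal inside the kernel of \<open>h\<close>.\<close>
 let ?N = "{x \<in> carrier ?F. \<forall>a\<in>carrier ?F. \<forall>b\<in>carrier ?F. h (a \<otimes>\<^sub>?F x \<otimes>\<^sub>?F b) = \<zero>\<^sub>N}"
 have lN: "(%x. h (a \<otimes>\<^sub>?F x \<otimes>\<^sub>?F b)) \<in> lin ?F N" if "a <: ?F" "b <: ?F" for a b
  using that h(1) fa_module N by (intro linI) (simp_all add: S lin_simps)
 have N_ideal: "ideal ?N ?F"
 proof (rule submodule_ideal[OF fa_ualg])
  show "sub ?N ?F"
   using lin_zero[OF lN fa_module N] lin_add[OF lN] lin_smult[OF lN] N
   by (intro subI[OF fa_module]) (auto simp: S)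
  show "a \<otimes>\<^sub>?F x \<in> ?N" if ax: "a <: ?F" "x \<in> ?N" for a x
  proof -
   have "h (c \<otimes>\<^sub>?F (a \<otimes>\<^sub>?F x) \<otimes>\<^sub>?F b) = \<zero>\<^sub>N" if "c <: ?F" "b <: ?F" for c b
   proof -
    have "c \<otimes>\<^sub>?F (a \<otimes>\<^sub>?F x) \<otimes>\<^sub>?F b = (c \<otimes>\<^sub>?F a) \<otimes>\<^sub>?F x \<otimes>\<^sub>?F b" using ax that by (simp add: S)
    then show ?thesis using ax that ua_closed[OF fa_ualg, of c _ a] by auto
   qed
   then show ?thesis using ax by (simp add: S)
  qed
  show "x \<otimes>\<^sub>?F a \<in> ?N" if ax: "a <: ?F" "x \<in> ?N" for a x
  proof -
   have "h (c \<otimes>\<^sub>?F (x \<otimes>\<^sub>?F a) \<otimes>\<^sub>?F b) = \<zero>\<^sub>N" if "c <: ?F" "b <: ?F" for c b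
   proof -
    have "c \<otimes>\<^sub>?F (x \<otimes>\<^sub>?F a) \<otimes>\<^sub>?F b = c \<otimes>\<^sub>?F x \<otimes>\<^sub>?F (a \<otimes>\<^sub>?F b)" using ax that by (simp add: S)
    then show ?thesis using ax that by (auto simp: ua_closed[OF fa_ualg])
   qed
   then show ?thesis using ax by (simp add: S)
  qed
 qed
 \<comment> \<open>By linearity it is enough to multiply with words on both sides.\<close>
 have words: "x \<in> ?N" if x: "x <: ?F"
  and u: "!!u v. set u <<: V ==> set v <<: V ==> h (word K u \<otimes>\<^sub>?F x \<otimes>\<^sub>?F word K v) = \<zero>\<^sub>N" for x
 proof -
  have 1: "h (word K u \<otimes>\<^sub>?F x \<otimes>\<^sub>?F b) = \<zero>\<^sub>N" if u': "set u <<: V" and b: "b <: ?F" for u b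
   using b by (induct rule: fa_induct) (use x N h(1) u' u fa_module in \<open>auto simp: S lin_simps\<close>)
  have "h (a \<otimes>\<^sub>?F x \<otimes>\<^sub>?F b) = \<zero>\<^sub>N" if a: "a <: ?F" and b: "b <: ?F" for a b
   using a by (induct rule: fa_induct) (use x N h(1) b 1 fa_module in \<open>auto simp: S lin_simps\<close>)
  then show ?thesis using x by auto
 qed
 have sub_form: "word K u \<otimes>\<^sub>?F (p \<ominus>\<^sub>?F q) \<otimes>\<^sub>?F word K v =
   (word K u \<otimes>\<^sub>?F p \<otimes>\<^sub>?F word K v) \<ominus>\<^sub>?F (word K u \<otimes>\<^sub>?F q \<otimes>\<^sub>?F word K v)"
  if "set u <<: V" "set v <<: V" "p <: ?F" "q <: ?F" for u v p q
  using that by (simp add: S mod_minus[OF fa_module])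
 have "?I \<subseteq> ?N" unfolding tensor_ideal_def Let_def
 proof (rule F.genideal_minimal[OF N_ideal], rule subsetI)
  fix z assume "z \<in> {word K [x \<oplus>\<^sub>V y] \<ominus>\<^sub>?F (word K [x] \<oplus>\<^sub>?F word K [y]) |x y. x <: V \<and> y <: V} \<union>
     {word K [a \<odot>\<^sub>V x] \<ominus>\<^sub>?F a \<odot>\<^sub>?F word K [x] |a x. a <: K \<and> x <: V}"
  then show "z \<in> ?N"
  proof (elim UnE CollectE exE conjE)
   fix x y assume z: "z = word K [x \<oplus>\<^sub>V y] \<ominus>\<^sub>?F (word K [x] \<oplus>\<^sub>?F word K [y])"
    and xy: "x <: V" "y <: V"
   show ?thesis
   proof (rule words)
    show "z <: ?F" unfolding z using xy by (simp add: S)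
    fix u v assume uv: "set u <<: V" "set v <<: V"
    have "h (word K u \<otimes>\<^sub>?F z \<otimes>\<^sub>?F word K v) =
      F (u @ (x \<oplus>\<^sub>V y) # v) \<ominus>\<^sub>N (F (u @ x # v) \<oplus>\<^sub>N F (u @ y # v))"
     unfolding z using xy uv h(1) N fa_module
     by (subst sub_form) (simp_all add: S word_mult lin_simps h(2))
    then show "h (word K u \<otimes>\<^sub>?F z \<otimes>\<^sub>?F word K v) = \<zero>\<^sub>N"
     using multilinD[OF F] xy uv N by simp
   qed
  next
   fix a x assume z: "z = word K [a \<odot>\<^sub>V x] \<ominus>\<^sub>?F (a \<odot>\<^sub>?F word K [x])"
    and xy: "a <: K" "x <: V"
   show ?thesis
   proof (rule words)
    show "z <: ?F" unfolding z using xy by (simp add: S)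
    fix u v assume uv: "set u <<: V" "set v <<: V"
    have "h (word K u \<otimes>\<^sub>?F z \<otimes>\<^sub>?F word K v) =
      F (u @ (a \<odot>\<^sub>V x) # v) \<ominus>\<^sub>N (a \<odot>\<^sub>N F (u @ x # v))"
     unfolding z using xy uv h(1) N fa_module
     by (subst sub_form) (simp_all add: S word_mult lin_simps h(2))
    then show "h (word K u \<otimes>\<^sub>?F z \<otimes>\<^sub>?F word K v) = \<zero>\<^sub>N"
     using multilinD[OF F] xy uv N by simp
   qed
  qed
 qed
 moreover have "h x = \<zero>\<^sub>N" if "x \<in> ?N" for x
 proof -
  have "h (\<one>\<^sub>?F \<otimes>\<^sub>?F x \<otimes>\<^sub>?F \<one>\<^sub>?F) = \<zero>\<^sub>N" using that ua_one[OF fa_ualg] by blast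
  then show ?thesis using that by (simp add: S)
 qed
 ultimately have "h x = \<zero>\<^sub>N" if "x \<in> ?I" for x using that by blast
 from quot_lift[OF fa_ualg tensor_ideal_ideal N h(1) this]
 obtain g where "g \<in> lin (T V) N" "\<forall>x\<in>carrier ?F. g (?I +>\<^sub>?F x) = h x"
  unfolding tensor_algebra_def by blast
 then show ?thesis using h(2) by (intro bexI[of _ g]) (auto simp: tens_def fa_word)
qed

end

definition tlift :: "('k, 'v) module => ('k, 'w) module => ('v list => 'w) => ('v list => 'k) set => 'w" where
 "tlift V N F = (SOME g. g \<in> lin (T V) N \<and> (\<forall>vs. set vs <<: V --> g (tens K V vs) = F vs))"

lemma tlift:
 assumes "module K V" "module K N" "multilin V N F"
 shows tlift_lin: "tlift V N F \<in> lin (T V) N"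
  and tlift_tens: "set vs <<: V ==> tlift V N F (tens K V vs) = F vs"
proof -
 have "\<exists>g. g \<in> lin (T V) N \<and> (\<forall>vs. set vs <<: V --> g (tens K V vs) = F vs)"
  using T_lift[OF assms] by blast
 from someI_ex[OF this] show "tlift V N F \<in> lin (T V) N"
  "set vs <<: V ==> tlift V N F (tens K V vs) = F vs"
  unfolding tlift_def by blast+
qed

subsection \<open>Tensor powers\<close>

lemma tpow_sel [simp]:
 "zero (tpow K V n) = \<zero>\<^sub>(T V)" "add (tpow K V n) = add (T V)" "smult (tpow K V n) = smult (T V)"
 "mult (tpow K V n) = mult (T V)" "one (tpow K V n) = \<one>\<^sub>(T V)"
 by (simp_all add: tpow_def)

abbreviation tp where "tp V n == carrier (tpow K V n)"

lemma tp_def: "tp V n = span (T V) (tens K V ` {vs. length vs = n \<and> set vs <<: V})"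
 by (auto simp: tpow_def intro!: arg_cong[of _ _ "span (T V)"])

lemma tpow_alt: "tpow K V n = (T V)\<lparr>carrier := tp V n\<rparr>"
 by (simp add: tpow_def)

context
 fixes V :: "('k, 'v) module"
 assumes V [simp]: "module K V"
begin

lemma tp_gens: "tens K V ` {vs. length vs = n \<and> set vs <<: V} <<: (T V)"
 by auto

lemma tp_sub: "sub (tp V n) (T V)"
 unfolding tp_def by (rule span_sub[OF T_mod[OF V] tp_gens])

lemma tpow_mod [simp]: "module K (tpow K V n)"
 by (subst tpow_alt) (rule sub_module[OF T_mod[OF V] tp_sub])

lemma tp_T: "t \<in> tp V n ==> t <: (T V)"
 using sub_mem[OF T_mod[OF V] tp_sub] .

lemma tens_tp: "length vs = n ==> set vs <<: V ==> tens K V vs \<in> tp V n"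
 unfolding tp_def by (rule span_base) auto

lemma tp_induct [consumes 1, case_names tens zero add smult]:
 assumes "t \<in> tp V n" "!!vs. length vs = n ==> set vs <<: V ==> P (tens K V vs)" "P \<zero>\<^sub>(T V)"
  "!!f g. f \<in> tp V n ==> g \<in> tp V n ==> P f ==> P g ==> P (f \<oplus>\<^sub>(T V) g)"
  "!!a f. a <: K ==> f \<in> tp V n ==> P f ==> P (a \<odot>\<^sub>(T V) f)"
 shows "P t"
proof -
 have "t \<in> tp V n \<and> P t"
  using assms(1)[unfolded tp_def] T_mod[OF V] tp_gens
  by (induct rule: span_induct)
   (use assms sub_simps[OF T_mod[OF V] tp_sub] tens_tp in auto)
 then show ?thesis ..
qed

lemma tp2_induct [consumes 1, case_names tens zero add smult]:
 assumes "t \<in> tp V 2" "!!x y. x <: V ==> y <: V ==> P (tens K V [x, y])" "P \<zero>\<^sub>(T V)"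
  "!!f g. f \<in> tp V 2 ==> g \<in> tp V 2 ==> P f ==> P g ==> P (f \<oplus>\<^sub>(T V) g)"
  "!!a f. a <: K ==> f \<in> tp V 2 ==> P f ==> P (a \<odot>\<^sub>(T V) f)"
 shows "P t"
 using assms(1)
proof (induct rule: tp_induct)
 case (tens vs)
 then obtain x y where "vs = [x, y]" by (auto simp: length_Suc_conv numeral_2_eq_2)
 then show ?case using tens assms(2) by auto
qed (use assms in auto)

lemma tp_lin_eq:
 assumes "f \<in> lin (tpow K V n) N" "g \<in> lin (tpow K V n) N" "module K N"
  "!!vs. length vs = n ==> set vs <<: V ==> f (tens K V vs) = g (tens K V vs)" "t \<in> tp V n"
 shows "f t = g t"
 using assms(5) by (induct rule: tp_induct) (use assms lin_simps[OF assms(1)] lin_simps[OF assms(2)] in auto)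

lemma lin_tp: "f \<in> lin (T V) N ==> f \<in> lin (tpow K V n) N"
 by (subst tpow_alt, erule lin_restr) (auto simp: tp_T)

lemmas T_ua = ua_simps[OF T_ualg[OF V]]

lemma tp_mult: "s \<in> tp V m ==> t \<in> tp V n ==> s \<star>\<^sub>V t \<in> tp V (m + n)"
proof (induct rule: tp_induct)
 case (tens us)
 from tens(3) show ?case
  by (induct rule: tp_induct)
   (use tens in \<open>auto simp: T_ua tp_T sub_simps[OF T_mod[OF V] tp_sub] tens_tp simp flip: tens_append[OF V]\<close>)
qed (auto simp: T_ua tp_T sub_simps[OF T_mod[OF V] tp_sub])

lemma tens_Nil_mult [simp]: "t <: (T V) ==> tens K V [] \<star>\<^sub>V t = t"
  "t <: (T V) ==> t \<star>\<^sub>V tens K V [] = t"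
 by (simp_all add: tens_Nil T_ua)

lemma tens1_lin: "(%x. tens K V [x]) \<in> lin V (T V)"
 by (rule linI) (auto simp: tens1_add tens1_smult)

lemma tens1_zero: "tens K V [\<zero>\<^sub>V] = \<zero>\<^sub>(T V)"
 using lin_zero[OF tens1_lin] by simp

lemma tp1: "t \<in> tp V 1 \<longleftrightarrow> (\<exists>v\<in>carrier V. t = tens K V [v])"
proof -
 have "tp V 1 \<subseteq> (%v. tens K V [v]) ` carrier V"
  unfolding tp_def using sub_image[OF tens1_lin V T_mod[OF V] sub_carrier[OF V]]
  by (rule span_minimal) (auto simp: length_Suc_conv)
 then show ?thesis by (auto simp: tens_tp)
qed

lemma tens_add: "set us <<: V ==> set vs <<: V ==> x <: V ==> y <: V ==>
   tens K V (us @ (x \<oplus>\<^sub>V y) # vs) = tens K V (us @ x # vs) \<oplus>\<^sub>(T V) tens K V (us @ y # vs)"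
 and tens_smult: "set us <<: V ==> set vs <<: V ==> a <: K ==> x <: V ==>
   tens K V (us @ (a \<odot>\<^sub>V x) # vs) = a \<odot>\<^sub>(T V) tens K V (us @ x # vs)"
 using multilinD[OF tens_multilin[OF V]] by blast+

lemma tens2_simps:
 "x <: V ==> x' <: V ==> y <: V ==> tens K V [x \<oplus>\<^sub>V x', y] = tens K V [x, y] \<oplus>\<^sub>(T V) tens K V [x', y]"
 "x <: V ==> y <: V ==> y' <: V ==> tens K V [x, y \<oplus>\<^sub>V y'] = tens K V [x, y] \<oplus>\<^sub>(T V) tens K V [x, y']"
 "a <: K ==> x <: V ==> y <: V ==> tens K V [a \<odot>\<^sub>V x, y] = a \<odot>\<^sub>(T V) tens K V [x, y]"
 "a <: K ==> x <: V ==> y <: V ==> tens K V [x, a \<odot>\<^sub>V y] = a \<odot>\<^sub>(T V) tens K V [x, y]"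
 using tens_add[of "[]" "[y]" x x'] tens_add[of "[x]" "[]" y y'] tens_smult[of "[]" "[y]" a x]
  tens_smult[of "[x]" "[]" a y] by auto

lemma tens_ins_lin: "set us <<: V ==> set vs <<: V ==> (%x. tens K V (us @ x # vs)) \<in> lin V (T V)"
 by (rule linI) (auto simp: tens_add tens_smult)

lemma tens2_lin: "y <: V ==> (%x. tens K V [x, y]) \<in> lin V (T V)"
  "x <: V ==> (%y. tens K V [x, y]) \<in> lin V (T V)"
 using tens_ins_lin[of "[]" "[y]"] tens_ins_lin[of "[x]" "[]"] by auto

lemma tens2_zero [simp]: "y <: V ==> tens K V [\<zero>\<^sub>V, y] = \<zero>\<^sub>(T V)" "x <: V ==> tens K V [x, \<zero>\<^sub>V] = \<zero>\<^sub>(T V)"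
 using lin_zero[OF tens2_lin(1)] lin_zero[OF tens2_lin(2)] by auto

subsection \<open>Applying a map to consecutive tensor factors\<close>

text \<open>\<open>opat V i p f\<close> is \<open>id\<^sub>i \<otimes> f \<otimes> id\<close> on all tensor powers at once, where \<open>f\<close> consumes \<open>p\<close> factors; it is zero on
 tensors with fewer than \<open>i + p\<close> factors.\<close>

definition opat ::
  "nat => nat => (('v list => 'k) set => ('v list => 'k) set) => ('v list => 'k) set => ('v list => 'k) set" where
 "opat i p f = tlift V (T V) (%vs. if i + p \<le> length vs
   then tens K V (take i vs) \<star>\<^sub>V (f (tens K V (take p (drop i vs))) \<star>\<^sub>V tens K V (drop (i + p) vs))
   else \<zero>\<^sub>(T V))"

context
 fixes f :: "('v list => 'k) set => ('v list => 'k) set" and p :: nat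
 assumes f: "f \<in> lin (tpow K V p) (T V)"
begin

lemma f_simps:
 "t \<in> tp V p ==> f t <: (T V)"
 "s \<in> tp V p ==> t \<in> tp V p ==> f (s \<oplus>\<^sub>(T V) t) = f s \<oplus>\<^sub>(T V) f t"
 "a <: K ==> t \<in> tp V p ==> f (a \<odot>\<^sub>(T V) t) = a \<odot>\<^sub>(T V) f t"
 "f \<zero>\<^sub>(T V) = \<zero>\<^sub>(T V)"
 using lin_simps[OF f] by auto

text \<open>When one vector varies, either the list is too short, or the vector lies to the left of,
  inside, or to the right of the window of \<open>p\<close> factors that \<open>f\<close> consumes;
  each time the value is a linear function of it.\<close>

lemma opat_multilin:
 "multilin V (T V) (%vs. if i + p \<le> length vs
   then tens K V (take i vs) \<star>\<^sub>V (f (tens K V (take p (drop i vs))) \<star>\<^sub>V tens K V (drop (i + p) vs))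
   else \<zero>\<^sub>(T V))" (is "multilin V _ ?F")
proof -
 have tk: "set (take n vs) <<: V" "set (drop n vs) <<: V" if "set vs <<: V" for n vs
  using that set_take_subset set_drop_subset by (metis subset_trans)+
 have main: "\<exists>g\<in>lin V (T V). \<forall>z\<in>carrier V. ?F (us @ z # vs) = g z"
  if us: "set us <<: V" and vs: "set vs <<: V" for us vs
 proof -
  consider (short) "length (us @ \<zero>\<^sub>V # vs) < i + p" | (l) "length us < i" "i + p \<le> length (us @ \<zero>\<^sub>V # vs)"
   | (m) "i \<le> length us" "length us < i + p" "i + p \<le> length (us @ \<zero>\<^sub>V # vs)" | (r) "i + p \<le> length us"
   by linarith
  then show ?thesis
  proof cases
   case short
   then show ?thesis by (intro bexI[of _ "%z. \<zero>\<^sub>(T V)"]) (auto simp: lin_0)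
  next
   case l
   \<comment> \<open>The number of factors of \<open>vs\<close> that stand before the
     window.\<close>
   define k where "k = i - Suc (length us)"
   have i: "i = Suc (length us + k)" using l by (simp add: k_def)
   let ?w = "f (tens K V (take p (drop k vs))) \<star>\<^sub>V tens K V (drop (k + p) vs)"
   have "?w <: (T V)" using l i vs tk by (intro T_ua f_simps tens_tp tens_closed[OF V]) auto
   then have "(%z. tens K V (us @ z # take k vs) \<star>\<^sub>V ?w) \<in> lin V (T V)"
    using us vs tk by (intro lin_rmult[OF T_ualg[OF V]] tens_ins_lin)
   moreover have "?F (us @ z # vs) = tens K V (us @ z # take k vs) \<star>\<^sub>V ?w" for z
    using l unfolding i by (simp add: drop_Cons' take_Cons')
   ultimately show ?thesis by (intro bexI) auto
  next
   case m
   \<comment> \<open>Here \<open>k\<close> is the number of factors of \<open>vs\<close> that belong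
     to the window.\<close>
   define k where "k = i + p - Suc (length us)"
   have i: "p = length us - i + Suc k" using m by (simp add: k_def)
   have len: "length (drop i us @ z # take k vs) = p" for z using m i by auto
   have ip: "i + p = Suc (length us + k)" using i m by simp
   let ?g = "%z. f (tens K V (drop i us @ z # take k vs)) \<star>\<^sub>V tens K V (drop k vs)"
   have "(%z. tens K V (drop i us @ z # take k vs)) \<in> lin V (tpow K V p)"
    using us vs tk len by (subst tpow_alt, intro lin_restr_cod tens_ins_lin tens_tp) auto
   then have "(%z. f (tens K V (drop i us @ z # take k vs))) \<in> lin V (T V)"
    by (rule lin_o[OF f])
   then have "(%z. tens K V (take i us) \<star>\<^sub>V ?g z) \<in> lin V (T V)"
    using us vs tk by (intro lin_rmult[OF T_ualg[OF V]] lin_lmult[OF T_ualg[OF V]]) auto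
   moreover have "?F (us @ z # vs) = tens K V (take i us) \<star>\<^sub>V ?g z" for z
    using m ip by (simp add: drop_Cons' take_Cons' i)
   ultimately show ?thesis by (intro bexI) auto
  next
   case r
   let ?u = "tens K V (take i us)" and ?w = "f (tens K V (take p (drop i us)))"
   have "?w <: (T V)" using r us tk by (intro f_simps tens_tp) auto
   then have "(%z. ?u \<star>\<^sub>V (?w \<star>\<^sub>V tens K V (drop (i + p) us @ z # vs))) \<in> lin V (T V)"
    using us vs tk by (intro lin_lmult[OF T_ualg[OF V]] tens_ins_lin) auto
   moreover have "?F (us @ z # vs) = ?u \<star>\<^sub>V (?w \<star>\<^sub>V tens K V (drop (i + p) us @ z # vs))" for z
    using r by simp
   ultimately show ?thesis by (intro bexI) auto
  qed
 qed
 show ?thesis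
 proof (rule multilinI)
  show "?F vs <: (T V)" if "set vs <<: V" for vs
  proof (cases "i + p \<le> length vs")
   case True
   then have "f (tens K V (take p (drop i vs))) <: (T V)"
    using that tk by (intro f_simps tens_tp) auto
   then show ?thesis using that tk by (auto intro!: T_ua)
  qed auto
  show "?F (us @ (x \<oplus>\<^sub>V y) # vs) = ?F (us @ x # vs) \<oplus>\<^sub>(T V) ?F (us @ y # vs)"
   if h: "set us <<: V" "set vs <<: V" "x <: V" "y <: V" for us vs x y
  proof -
   from main[OF h(1,2)] obtain g where "g\<in>lin V (T V)" "\<forall>z\<in>carrier V. ?F (us @ z # vs) = g z" by (elim bexE)
   then show ?thesis using h(3,4) V lin_add[of g V "T V" x y] mod_closed(1)[OF V h(3,4)] by (simp only:)
  qed
  show "?F (us @ (a \<odot>\<^sub>V x) # vs) = a \<odot>\<^sub>(T V) ?F (us @ x # vs)"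
   if h: "set us <<: V" "set vs <<: V" "a <: K" "x <: V" for us vs x a
  proof -
   from main[OF h(1,2)] obtain g where "g\<in>lin V (T V)" "\<forall>z\<in>carrier V. ?F (us @ z # vs) = g z" by (elim bexE)
   then show ?thesis using h(3,4) V lin_smult[of g V "T V" a x] mod_closed(5)[OF V h(3,4)] by (simp only:)
  qed
 qed
qed

lemma opat_lin: "opat i p f \<in> lin (T V) (T V)"
 unfolding opat_def by (rule tlift_lin[OF V T_mod[OF V] opat_multilin])

lemma opat_tens: "set vs <<: V ==> opat i p f (tens K V vs) = (if i + p \<le> length vs
   then tens K V (take i vs) \<star>\<^sub>V (f (tens K V (take p (drop i vs))) \<star>\<^sub>V tens K V (drop (i + p) vs))
   else \<zero>\<^sub>(T V))"
 unfolding opat_def by (rule tlift_tens[OF V T_mod[OF V] opat_multilin])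

lemma opat_closed: "t <: (T V) ==> opat i p f t <: (T V)"
 by (rule lin_cl[OF opat_lin])

lemma opat_mult:
 assumes u: "u \<in> tp V i" and w: "w \<in> tp V p" and v: "v <: (T V)"
 shows "opat i p f (u \<star>\<^sub>V (w \<star>\<^sub>V v)) = u \<star>\<^sub>V (f w \<star>\<^sub>V v)"
proof -
 note L = lin_simps[OF opat_lin[of i]]
 have 1: "opat i p f (tens K V us \<star>\<^sub>V (tens K V ws \<star>\<^sub>V v)) = tens K V us \<star>\<^sub>V (f (tens K V ws) \<star>\<^sub>V v)"
  if us: "set us <<: V" "length us = i" "set ws <<: V" "length ws = p" for us ws
 proof -
  have "tens K V ws \<in> tp V p" using that tens_tp by auto
  with v show ?thesis
  proof (induct rule: T_induct[OF V, consumes 1])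
   case (1 vs)
   then show ?case using us f_simps by (simp add: opat_tens flip: tens_append[OF V])
  qed (use that V f_simps in \<open>auto simp: T_ua L\<close>)
 qed
 have 2: "opat i p f (tens K V us \<star>\<^sub>V (w \<star>\<^sub>V v)) = tens K V us \<star>\<^sub>V (f w \<star>\<^sub>V v)"
  if us: "set us <<: V" "length us = i" for us
  using w
  by (induct rule: tp_induct) (use us v 1 f_simps in \<open>auto simp: T_ua L tp_T\<close>)
 show ?thesis
  using u
  by (induct rule: tp_induct) (use w v 2 f_simps in \<open>auto simp: T_ua L tp_T\<close>)
qed

lemma opat_app:
 assumes "length us = i" "w \<in> tp V p" "set us <<: V" "set vs <<: V"
 shows "opat i p f (tens K V us \<star>\<^sub>V (w \<star>\<^sub>V tens K V vs)) = tens K V us \<star>\<^sub>V (f w \<star>\<^sub>V tens K V vs)"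
 using assms by (intro opat_mult tens_tp) auto

lemma opat_0: "w \<in> tp V p ==> opat 0 p f w = f w"
 using opat_app[of "[]" 0 w "[]"] f_simps tp_T by simp

lemma opat_tp:
 assumes "!!w. w \<in> tp V p ==> f w \<in> tp V q" "t \<in> tp V (i + p + j)"
 shows "opat i p f t \<in> tp V (i + q + j)"
 using assms(2)
proof (induct rule: tp_induct)
 case (tens vs)
 have "set (take p (drop i vs)) <<: V" "set (take i vs) <<: V" "set (drop (i + p) vs) <<: V"
  using tens(2) set_take_subset set_drop_subset by (metis subset_trans)+
 moreover have "f (tens K V (take p (drop i vs))) \<in> tp V q"
  using tens(1) calculation by (intro assms(1) tens_tp) auto
 ultimately show ?case unfolding opat_tens[OF tens(2)] add.assoc[of i q j] using tens(1)
  by (auto intro!: tp_mult tens_tp)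
qed (use lin_simps[OF opat_lin[of i]] in \<open>auto simp: tp_T sub_simps[OF T_mod[OF V] tp_sub]\<close>)

text \<open>Composing \<open>amp\<close> requires the number of remaining factors at every stage,
  whereas \<open>opat\<close> acts on all tensor powers at once; so every \<open>amp\<close> is
  traded for an \<open>opat\<close>. Uniqueness holds because each pure tensor of the right length
  splits into the three blocks.\<close>

lemma amp_opat:
 assumes "t \<in> tp V (i + p + j)" shows "amp K V i p f j t = opat i p f t"
proof -
 let ?D = "tpow K V (i + p + j)"
 have "amp K V i p f j = restrict (opat i p f) (carrier ?D)"
  unfolding amp_def
 proof (rule the_linear_eq)
  show oD: "opat i p f \<in> lin ?D (T V)" by (rule lin_tp[OF opat_lin])
  have asc: "u \<star>\<^sub>V w \<star>\<^sub>V v = u \<star>\<^sub>V (w \<star>\<^sub>V v)" if "u \<in> tp V i" "w \<in> tp V p" "v \<in> tp V j" for u w v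
   using that by (simp add: T_ua tp_T)
  show "\<forall>u\<in>tp V i. \<forall>w\<in>tp V p. \<forall>v\<in>tp V j. restrict (opat i p f) (carrier ?D) (u \<star>\<^sub>V w \<star>\<^sub>V v) = u \<star>\<^sub>V f w \<star>\<^sub>V v"
  proof (intro ballI)
   fix u w v assume m: "u \<in> tp V i" "w \<in> tp V p" "v \<in> tp V j"
   have "u \<star>\<^sub>V w \<star>\<^sub>V v <: ?D" by (intro tp_mult m)
   then show "restrict (opat i p f) (carrier ?D) (u \<star>\<^sub>V w \<star>\<^sub>V v) = u \<star>\<^sub>V f w \<star>\<^sub>V v"
    using asc[OF m] opat_mult[OF m(1,2) tp_T[OF m(3)]] m by (simp add: T_ua tp_T f_simps)
  qed
  fix h t assume hl: "h \<in> lin ?D (T V)" and h: "\<forall>u\<in>tp V i. \<forall>w\<in>tp V p. \<forall>v\<in>tp V j. h (u \<star>\<^sub>V w \<star>\<^sub>V v) = u \<star>\<^sub>V f w \<star>\<^sub>V v"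
   and t: "t <: ?D"
  show "h t = opat i p f t"
  proof (rule tp_lin_eq[OF hl oD T_mod[OF V] _ t])
   fix vs assume vs: "length vs = i + p + j" "set vs <<: V"
   have c: "set (take p (drop i vs)) <<: V" "set (take i vs) <<: V" "set (drop (i + p) vs) <<: V"
    using vs(2) set_take_subset set_drop_subset by (metis subset_trans)+
   let ?u = "tens K V (take i vs)" and ?w = "tens K V (take p (drop i vs))" and ?v = "tens K V (drop (i + p) vs)"
   have m: "?u \<in> tp V i" "?w \<in> tp V p" "?v \<in> tp V j" using c vs by (auto intro!: tens_tp)
   have "tens K V vs = tens K V (take i vs @ take p (drop i vs) @ drop (i + p) vs)"
    by (metis add.commute append_take_drop_id drop_drop)
   also have "\<dots> = ?u \<star>\<^sub>V (?w \<star>\<^sub>V ?v)" using c by (simp add: tens_append[OF V])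
   finally show "h (tens K V vs) = opat i p f (tens K V vs)"
    using h m asc opat_mult[OF m(1,2) tp_T[OF m(3)]] by (simp add: T_ua tp_T f_simps)
  qed
 qed auto
 then show ?thesis using assms by simp
qed

end

subsection \<open>Bilinear maps\<close>

text \<open>The linear map on \<open>V \<otimes> V\<close> that belongs to the bilinear map
  \<open>B\<close>. The value zero in all other tensor degrees makes it linear on the whole tensor
  algebra, where compositions and sums need no change of domain.\<close>

definition lift2 :: "('k, 'w) module => ('v => 'v => 'w) => ('v list => 'k) set => 'w" where
 "lift2 N B = tlift V N (%vs. if length vs = 2 then B (vs ! 0) (vs ! 1) else \<zero>\<^sub>N)"

lemma lift2:
 assumes N: "module K N" and B: "!!y. y <: V ==> (%x. B x y) \<in> lin V N" "!!x. x <: V ==> B x \<in> lin V N"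
 shows lift2_lin: "lift2 N B \<in> lin (T V) N"
  and lift2_tens: "x <: V ==> y <: V ==> lift2 N B (tens K V [x, y]) = B x y"
proof -
 have M: "multilin V N (%vs. if length vs = 2 then B (vs ! 0) (vs ! 1) else \<zero>\<^sub>N)"
 proof (rule multilinI, goal_cases)
  case (1 vs) then show ?case using N
   by (auto simp: length_Suc_conv numeral_2_eq_2 lin_cl[OF B(2)])
 next
  case (2 us vs x y)
  have "us = [] \<and> (\<exists>b. vs = [b]) \<or> (\<exists>a. us = [a] \<and> vs = []) \<or> Suc (length us + length vs) \<noteq> 2"
   by (auto simp: length_Suc_conv numeral_2_eq_2 add_is_1)
  then show ?case using 2 N lin_add[OF B(1)] lin_add[OF B(2)] by auto
 next
  case (3 us vs a x)
  have "us = [] \<and> (\<exists>b. vs = [b]) \<or> (\<exists>a. us = [a] \<and> vs = []) \<or> Suc (length us + length vs) \<noteq> 2"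
   by (auto simp: length_Suc_conv numeral_2_eq_2 add_is_1)
  then show ?case using 3 N lin_smult[OF B(1)] lin_smult[OF B(2)] by auto
 qed
 show "lift2 N B \<in> lin (T V) N" unfolding lift2_def by (rule tlift_lin[OF V N M])
 show "x <: V ==> y <: V ==> lift2 N B (tens K V [x, y]) = B x y"
  unfolding lift2_def by (simp add: tlift_tens[OF V N M])
qed

lemma lift2_eq:
 assumes "f \<in> lin (T V) N" "g \<in> lin (T V) N" "module K N"
  "!!x y. x <: V ==> y <: V ==> f (tens K V [x, y]) = g (tens K V [x, y])" "t \<in> tp V 2"
 shows "f t = g t"
 using assms(5) by (induct rule: tp2_induct) (use assms in \<open>auto simp: lin_simps tp_T\<close>)

subsection \<open>Tensor products of subspaces\<close>

lemma tprod_gens: "X <<: V ==> Y <<: V ==> {tens K V [x, y] |x y. x \<in> X \<and> y \<in> Y} <<: (T V)"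
 by (auto simp: subset_iff)

context
 fixes X Y assumes X: "X <<: V" and Y: "Y <<: V"
begin

lemma tprod_sub: "sub (tprod K V X Y) (T V)"
 unfolding tprod_def by (rule span_sub[OF T_mod[OF V] tprod_gens[OF X Y]])

lemma tprod_base: "x \<in> X ==> y \<in> Y ==> tens K V [x, y] \<in> tprod K V X Y"
 unfolding tprod_def by (rule span_base) auto

lemma tprod_tp: "t \<in> tprod K V X Y ==> t \<in> tp V 2"
proof -
 have "tprod K V X Y \<subseteq> tp V 2" unfolding tprod_def
  using X Y by (intro span_minimal tp_sub) (auto intro!: tens_tp)
 then show "t \<in> tprod K V X Y ==> t \<in> tp V 2" by auto
qed

lemma tprod_T: "t \<in> tprod K V X Y ==> t <: (T V)"
 using tprod_tp tp_T by blast

lemma tprod_induct [consumes 1, case_names tens zero add smult]: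
 assumes "t \<in> tprod K V X Y" "!!x y. x \<in> X ==> y \<in> Y ==> P (tens K V [x, y])" "P \<zero>\<^sub>(T V)"
  "!!f g. f \<in> tprod K V X Y ==> g \<in> tprod K V X Y ==> P f ==> P g ==> P (f \<oplus>\<^sub>(T V) g)"
  "!!a f. a <: K ==> f \<in> tprod K V X Y ==> P f ==> P (a \<odot>\<^sub>(T V) f)"
 shows "P t"
proof -
 have "t \<in> tprod K V X Y \<and> P t"
  using assms(1)[unfolded tprod_def] T_mod[OF V] tprod_gens[OF X Y]
  by (induct rule: span_induct)
   (use assms sub_simps[OF T_mod[OF V] tprod_sub] tprod_base in auto)
 then show ?thesis ..
qed

lemma tprod_image:
 assumes "f \<in> lin (T V) N" "module K N" "sub Z N" "!!x y. x \<in> X ==> y \<in> Y ==> f (tens K V [x, y]) \<in> Z"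
  "t \<in> tprod K V X Y"
 shows "f t \<in> Z"
 using assms(5) by (induct rule: tprod_induct) (use assms in \<open>auto simp: lin_simps sub_simps tprod_T\<close>)

lemma tprod_eq:
 assumes "f \<in> lin (T V) N" "g \<in> lin (T V) N" "module K N"
  "!!x y. x \<in> X ==> y \<in> Y ==> f (tens K V [x, y]) = g (tens K V [x, y])"
  "t \<in> tprod K V X Y"
 shows "f t = g t"
 using assms(5) by (induct rule: tprod_induct) (use assms in \<open>auto simp: lin_simps tprod_T\<close>)

end

lemma tprod_full: "tprod K V (carrier V) (carrier V) = tp V 2"
proof -
 have "{tens K V [x, y] |x y. x <: V \<and> y <: V} = tens K V ` {vs. length vs = 2 \<and> set vs <<: V}"
  by (auto simp: length_Suc_conv numeral_2_eq_2 image_iff) blast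
 then show ?thesis by (simp add: tprod_def tp_def)
qed

end

lemmas T_ind = T_induct[consumes 2, case_names tens zero add smult]
lemmas tp_ind = tp_induct[consumes 2, case_names tens zero add smult]
lemmas tp2_ind = tp2_induct[consumes 2, case_names tens zero add smult]
lemmas tprod_ind = tprod_induct[consumes 4, case_names tens zero add smult]

definition tm2 where "tm2 V W f g = lift2 V (T W) (%x y. tens K W [f x, g y])"

context
 fixes V :: "('k, 'v) module" and W :: "('k, 'w) module" and f g
 assumes V [simp]: "module K V" and W [simp]: "module K W" and f: "f \<in> lin V W" and g: "g \<in> lin V W"
begin

lemma tm2_lin: "tm2 V W f g \<in> lin (T V) (T W)"
 and tm2_tens: "x <: V ==> y <: V ==> tm2 V W f g (tens K V [x, y]) = tens K W [f x, g y]"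
 unfolding tm2_def
 using lift2[OF V T_mod[OF W], of "%x y. tens K W [f x, g y]"]
  lin_o[OF tens2_lin(1)[OF W] f] lin_o[OF tens2_lin(2)[OF W] g] lin_cl[OF f] lin_cl[OF g] by auto

lemma tm2_tp: "t \<in> tp V 2 ==> tm2 V W f g t \<in> tp W 2"
 using V
proof (induct rule: tp2_ind)
qed (auto simp: tm2_tens lin_simps[OF tm2_lin] tp_T sub_simps[OF T_mod[OF W] tp_sub] lin_cl[OF f] lin_cl[OF g] intro!: tens_tp)

text \<open>The maps \<open>f'\<close> and \<open>g'\<close> need not be linear on \<open>V\<close>;
  it suffices that they agree with linear maps on \<open>X\<close> and \<open>Y\<close>. The class
  maps of \<open>gr H\<close>, which make sense only on filtration steps, are handled in this
  way.\<close>

lemma tmap_tm2: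
 assumes X: "sub X V" and Y: "sub Y V" and f': "!!x. x \<in> X ==> f' x = f x" and g': "!!y. y \<in> Y ==> g' y = g y"
  and t: "t \<in> tprod K V X Y"
 shows "tmap K V X Y W f' g' t = tm2 V W f g t"
proof -
 note XY = sub_carr[OF V X] sub_carr[OF V Y]
 let ?D = "(T V)\<lparr>carrier := tprod K V X Y\<rparr>"
 have "tmap K V X Y W f' g' = restrict (tm2 V W f g) (carrier ?D)"
  unfolding tmap_def
 proof (rule the_linear_eq)
  show "module K ?D" by (rule sub_module[OF T_mod[OF V] tprod_sub[OF V XY]])
  have L: "tm2 V W f g \<in> lin ?D (T W)" using tprod_T[OF V XY] by (intro lin_restr[OF tm2_lin]) auto
  then show "tm2 V W f g \<in> lin ?D (tpow K W 2)"
   using tprod_tp[OF V XY] tm2_tp by (subst tpow_alt, intro lin_restr_cod) auto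
  show "\<forall>x\<in>X. \<forall>y\<in>Y. restrict (tm2 V W f g) (carrier ?D) (tens K V [x, y]) = tens K W [f' x, g' y]"
   using XY tprod_base[OF V XY] by (auto simp: tm2_tens f' g' subset_iff)
  fix h u assume h: "h \<in> lin ?D (tpow K W 2)" "\<forall>x\<in>X. \<forall>y\<in>Y. h (tens K V [x, y]) = tens K W [f' x, g' y]" and u: "u <: ?D"
  have "u \<in> tprod K V X Y \<and> h u = tm2 V W f g u"
   using V XY u[simplified]
  proof (induct rule: tprod_ind)
   case (tens x y) then show ?case using h(2) XY tprod_base[OF V XY] by (auto simp: tm2_tens f' g' subset_iff)
  next
   case zero
   have "module K ?D" by (rule sub_module[OF T_mod[OF V] tprod_sub[OF V XY]])
   then show ?case using lin_zero[OF h(1)] lin_zero[OF L] sub_zero[OF T_mod[OF V] tprod_sub[OF V XY]] by simp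
  qed (use lin_add[OF h(1)] lin_add[OF L] lin_smult[OF h(1)] lin_smult[OF L] sub_simps[OF T_mod[OF V] tprod_sub[OF V XY]] in auto)
  then show "h u = tm2 V W f g u" ..
 qed
 then show ?thesis using t by simp
qed

end

lemma tm2_tprod:
 assumes V: "module K V" and W: "module K W" and f: "f \<in> lin V W" and g: "g \<in> lin V W"
  and X: "X <<: V" and Y: "Y <<: V" and Z: "Z <<: W" and Z': "Z' <<: W"
  and "!!x. x \<in> X ==> f x \<in> Z" "!!y. y \<in> Y ==> g y \<in> Z'" "t \<in> tprod K V X Y"
 shows "tm2 V W f g t \<in> tprod K W Z Z'"
proof (rule tprod_image[OF V X Y tm2_lin[OF V W f g] T_mod[OF W] tprod_sub[OF W Z Z'] _ assms(11)])
 fix x y assume "x \<in> X" "y \<in> Y"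
 then show "tm2 V W f g (tens K V [x, y]) \<in> tprod K W Z Z'"
  using subsetD[OF X, of x] subsetD[OF Y, of y] assms(9,10) tprod_base[OF W Z Z']
  by (simp add: tm2_tens[OF V W f g])
qed

lemma tm2_comp:
 assumes V: "module K V" and W: "module K W" and U: "module K U"
  and f: "f \<in> lin V W" and g: "g \<in> lin V W" and f': "f' \<in> lin W U" and g': "g' \<in> lin W U" and t: "t \<in> tp V 2"
 shows "tm2 W U f' g' (tm2 V W f g t) = tm2 V U (%x. f' (f x)) (%x. g' (g x)) t"
 using lift2_eq[OF V lin_o[OF tm2_lin[OF W U f' g'] tm2_lin[OF V W f g]] tm2_lin[OF V U lin_o[OF f' f] lin_o[OF g' g]] T_mod[OF U] _ t]
 by (simp add: tm2_tens[OF V W f g] tm2_tens[OF W U f' g'] tm2_tens[OF V U lin_o[OF f' f] lin_o[OF g' g]] lin_cl[OF f] lin_cl[OF g])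

subsection \<open>Tensor products of several maps\<close>

definition tmL :: "('k, 'v) module => ('k, 'w) module => ('v => 'w) list => ('v list => 'k) set => ('w list => 'k) set" where
 "tmL V W fs = tlift V (T W) (%vs. if length vs = length fs then tens K W (map2 (%f v. f v) fs vs) else \<zero>\<^sub>(T W))"

context
 fixes V :: "('k, 'v) module" and W :: "('k, 'w) module"
 assumes V [simp]: "module K V" and W [simp]: "module K W"
begin

lemma map2_closed:
 "\<forall>f\<in>set fs. f \<in> lin V W ==> set vs <<: V ==> set (map2 (%f v. f v) fs vs) <<: W"
proof -
 assume h: "\<forall>f\<in>set fs. f \<in> lin V W" "set vs <<: V"
 have "(fs ! i) (vs ! i) <: W" if "i < length fs" "i < length vs" for i
 proof (rule lin_cl[of "fs ! i" V W "vs ! i"])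
  show "fs ! i \<in> lin V W" using h(1) that(1) nth_mem by blast
  show "vs ! i <: V" using h(2) that(2) nth_mem by blast
 qed
 then show ?thesis by (auto simp: set_zip)
qed

lemma tmL_multilin:
 assumes fs: "\<forall>f\<in>set fs. f \<in> lin V W"
 shows "multilin V (T W) (%vs. if length vs = length fs then tens K W (map2 (%f v. f v) fs vs) else \<zero>\<^sub>(T W))"
  (is "multilin V _ ?F")
proof -
 have main: "\<exists>g\<in>lin V (T W). \<forall>z\<in>carrier V. ?F (us @ z # vs) = g z"
  if us: "set us <<: V" and vs: "set vs <<: V" for us vs
 proof (cases "length us + Suc (length vs) = length fs")
  case False
  then show ?thesis by (intro bexI[of _ "%z. \<zero>\<^sub>(T W)"]) (auto simp: lin_0)
 next
  case True
  define gs where "gs = take (length us) fs"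
  define f where "f = fs ! length us"
  define hs where "hs = drop (Suc (length us)) fs"
  have l: "length us < length fs" using True by simp
  then have d: "fs = gs @ f # hs" unfolding gs_def f_def hs_def by (rule id_take_nth_drop)
  have len: "length gs = length us" using l by (simp add: gs_def)
  have "?F (us @ z # vs) = tens K W (map2 (%f v. f v) gs us @ f z # map2 (%f v. f v) hs vs)" for z
   using True unfolding d by (simp add: len)
  moreover have "(%z. tens K W (map2 (%f v. f v) gs us @ f z # map2 (%f v. f v) hs vs)) \<in> lin V (T W)"
   using fs d us vs by (intro lin_o[OF tens_ins_lin[OF W]] map2_closed) auto
  ultimately show ?thesis by (intro bexI) auto
 qed
 show ?thesis
 proof (rule multilinI)
  show "?F vs <: (T W)" if "set vs <<: V" for vs
   using map2_closed[OF fs that] by (auto intro!: tens_closed[OF W])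
  show "?F (us @ (x \<oplus>\<^sub>V y) # vs) = ?F (us @ x # vs) \<oplus>\<^sub>(T W) ?F (us @ y # vs)"
   if h: "set us <<: V" "set vs <<: V" "x <: V" "y <: V" for us vs x y
  proof -
   from main[OF h(1,2)] obtain g where "g\<in>lin V (T W)" "\<forall>z\<in>carrier V. ?F (us @ z # vs) = g z" by (elim bexE)
   then show ?thesis using h(3,4) V lin_add[of g V "T W" x y] mod_closed(1)[OF V h(3,4)] by (simp only:)
  qed
  show "?F (us @ (a \<odot>\<^sub>V x) # vs) = a \<odot>\<^sub>(T W) ?F (us @ x # vs)"
   if h: "set us <<: V" "set vs <<: V" "a <: K" "x <: V" for us vs x a
  proof -
   from main[OF h(1,2)] obtain g where "g\<in>lin V (T W)" "\<forall>z\<in>carrier V. ?F (us @ z # vs) = g z" by (elim bexE)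
   then show ?thesis using h(3,4) V lin_smult[of g V "T W" a x] mod_closed(5)[OF V h(3,4)] by (simp only:)
  qed
 qed
qed

lemma tmL_lin: "\<forall>f\<in>set fs. f \<in> lin V W ==> tmL V W fs \<in> lin (T V) (T W)"
 unfolding tmL_def by (rule tlift_lin[OF V T_mod[OF W] tmL_multilin])

lemma tmL_tens: "\<forall>f\<in>set fs. f \<in> lin V W ==> set vs <<: V ==> length vs = length fs ==>
  tmL V W fs (tens K V vs) = tens K W (map2 (%f v. f v) fs vs)"
 unfolding tmL_def by (simp add: tlift_tens[OF V T_mod[OF W] tmL_multilin])

lemma tmL_append:
 assumes fs: "\<forall>f\<in>set fs. f \<in> lin V W" and gs: "\<forall>f\<in>set gs. f \<in> lin V W"
  and s: "s \<in> tp V (length fs)" and t: "t \<in> tp V (length gs)"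
 shows "tmL V W (fs @ gs) (s \<star>\<^sub>V t) = tmL V W fs s \<star>\<^sub>W tmL V W gs t"
proof -
 note L = lin_simps[OF tmL_lin[OF fs]] lin_simps[OF tmL_lin[OF gs]] lin_simps[OF tmL_lin[of "fs @ gs"]]
 note U = T_ua[OF V] T_ua[OF W] tp_T[OF V]
 have fg: "\<forall>f\<in>set (fs @ gs). f \<in> lin V W" using fs gs by auto
 from V s show ?thesis
 proof (induct rule: tp_ind)
  case (tens us)
  from V t show ?case
  proof (induct rule: tp_ind)
   case (tens vs)
   have "tens K V us \<star>\<^sub>V tens K V vs = tens K V (us @ vs)"
    using tens \<open>set us <<: V\<close> by (simp add: tens_append[OF V])
   moreover have "tens K W (map2 (%f v. f v) fs us @ map2 (%f v. f v) gs vs) =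
     tens K W (map2 (%f v. f v) fs us) \<star>\<^sub>W tens K W (map2 (%f v. f v) gs vs)"
    using tens \<open>set us <<: V\<close> fs gs by (intro tens_append[OF W] map2_closed) auto
   ultimately show ?case using tens \<open>set us <<: V\<close> \<open>length us = length fs\<close> fs gs fg
    by (simp add: tmL_tens)
  qed (use tens fg in \<open>auto simp: U L\<close>)
 qed (use t fg in \<open>auto simp: U L\<close>)
qed

lemma tm2_tmL:
 assumes f: "f \<in> lin V W" and g: "g \<in> lin V W" and t: "t \<in> tp V 2"
 shows "tm2 V W f g t = tmL V W [f, g] t"
 using f g tm2_tens[OF V W f g] by (intro lift2_eq[OF V tm2_lin[OF V W f g] tmL_lin T_mod[OF W] _ t]) (auto simp: tmL_tens)

lemma tmL3:
 assumes f: "f \<in> lin V W" and g: "g \<in> lin V W" and h: "h \<in> lin V W" and t: "t \<in> tp V 2" and x: "x <: V"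
 shows "tmL V W [f, g, h] (t \<star>\<^sub>V tens K V [x]) = tm2 V W f g t \<star>\<^sub>W tens K W [h x]"
  "tmL V W [f, g, h] (tens K V [x] \<star>\<^sub>V t) = tens K W [f x] \<star>\<^sub>W tm2 V W g h t"
proof -
 have "tmL V W ([f, g] @ [h]) (t \<star>\<^sub>V tens K V [x]) = tmL V W [f, g] t \<star>\<^sub>W tmL V W [h] (tens K V [x])"
  using f g h t x by (intro tmL_append) (auto intro!: tens_tp simp: numeral_2_eq_2)
 then show "tmL V W [f, g, h] (t \<star>\<^sub>V tens K V [x]) = tm2 V W f g t \<star>\<^sub>W tens K W [h x]"
  using f g h t x by (simp add: tm2_tmL tmL_tens)
 have "tmL V W ([f] @ [g, h]) (tens K V [x] \<star>\<^sub>V t) = tmL V W [f] (tens K V [x]) \<star>\<^sub>W tmL V W [g, h] t"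
  using f g h t x by (intro tmL_append) (auto intro!: tens_tp simp: numeral_2_eq_2)
 then show "tmL V W [f, g, h] (tens K V [x] \<star>\<^sub>V t) = tens K W [f x] \<star>\<^sub>W tm2 V W g h t"
  using f g h t x by (simp add: tm2_tmL tmL_tens)
qed

end

context
 fixes V :: "('k, 'v) module" and f p
 assumes V [simp]: "module K V" and f: "f \<in> lin (tpow K V p) (T V)"
begin

lemma opat_left:
 assumes u: "u \<in> tp V i" and t: "t <: (T V)"
 shows "opat V (i + k) p f (u \<star>\<^sub>V t) = u \<star>\<^sub>V opat V k p f t"
proof -
 note L = lin_simps[OF opat_lin[OF V f, of k]] lin_simps[OF opat_lin[OF V f, of "i + k"]]
 note U = T_ua[OF V] tp_T[OF V]
 have 1: "opat V (i + k) p f (tens K V us \<star>\<^sub>V t) = tens K V us \<star>\<^sub>V opat V k p f t"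
  if us: "length us = i" "set us <<: V" for us
  using V t
 proof (induct rule: T_ind)
  case (tens vs)
  have tk: "set (take n vs) <<: V" "set (drop n vs) <<: V" for n
   using tens set_take_subset set_drop_subset by (metis subset_trans)+
  have tk2: "set (take p (drop k vs)) <<: V"
   using tk(2) set_take_subset by (metis subset_trans)
  have e: "tens K V us \<star>\<^sub>V tens K V vs = tens K V (us @ vs)" using us tens by (simp add: tens_append[OF V])
  show ?case
  proof (cases "k + p \<le> length vs")
   case True
   then have "f (tens K V (take p (drop k vs))) <: (T V)"
    using tk2 by (intro f_simps[OF V f] tens_tp[OF V]) auto
   then show ?thesis unfolding e using True us tens tk tk2
    by (subst (1 2) opat_tens[OF V f]) (simp_all add: tens_append[OF V] U add.assoc)
  next
   case False
   then show ?thesis unfolding e using us tens by (simp add: opat_tens[OF V f] U)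
  qed
 qed (use us in \<open>auto simp: L U\<close>)
 from V u show ?thesis
  by (induct rule: tp_ind) (use 1 t in \<open>auto simp: L U\<close>)
qed

lemma opat_right:
 assumes t: "t \<in> tp V n" and v: "v <: (T V)" and n: "k + p \<le> n"
 shows "opat V k p f (t \<star>\<^sub>V v) = opat V k p f t \<star>\<^sub>V v"
proof -
 note L = lin_simps[OF opat_lin[OF V f, of k]]
 note U = T_ua[OF V] tp_T[OF V]
 from V t show ?thesis
 proof (induct rule: tp_ind)
  case (tens vs)
  have tk: "set (take n vs) <<: V" "set (drop n vs) <<: V" for n
   using tens set_take_subset set_drop_subset by (metis subset_trans)+
  have tk2: "set (take p (drop k vs)) <<: V"
   using tk(2) set_take_subset by (metis subset_trans)
  let ?u = "tens K V (take k vs)" and ?w = "tens K V (take p (drop k vs))" and ?v = "tens K V (drop (k + p) vs)"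
  have w: "?w \<in> tp V p" "?u \<in> tp V k" using tk2 tk n tens by (auto intro!: tens_tp[OF V])
  have fw: "f ?w <: (T V)" using f_simps[OF V f] w by auto
  have "tens K V vs = tens K V (take k vs @ take p (drop k vs) @ drop (k + p) vs)"
   by (metis add.commute append_take_drop_id drop_drop)
  also have "\<dots> = ?u \<star>\<^sub>V (?w \<star>\<^sub>V ?v)" using tk tk2 by (simp add: tens_append[OF V])
  finally have e: "tens K V vs = ?u \<star>\<^sub>V (?w \<star>\<^sub>V ?v)" .
  have "opat V k p f (tens K V vs \<star>\<^sub>V v) = opat V k p f (?u \<star>\<^sub>V (?w \<star>\<^sub>V (?v \<star>\<^sub>V v)))"
   unfolding e using tk tk2 v by (simp add: U)
  also have "\<dots> = ?u \<star>\<^sub>V (f ?w \<star>\<^sub>V (?v \<star>\<^sub>V v))"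
   using w tk v by (intro opat_mult[OF V f]) (auto simp: U)
  also have "\<dots> = opat V k p f (?u \<star>\<^sub>V (?w \<star>\<^sub>V ?v)) \<star>\<^sub>V v"
   using w tk v fw by (subst opat_mult[OF V f]) (auto simp: U)
  finally show ?case unfolding e[symmetric] .
 qed (use v in \<open>auto simp: L U\<close>)
qed

end

subsection \<open>Maps out of the first tensor power\<close>

lemma lift1:
 assumes V: "module K V" and f: "f \<in> lin V (T V)"
 shows lift1_lin: "lift1 K V f \<in> lin (tpow K V 1) (T V)"
  and lift1_tens: "x <: V ==> lift1 K V f (tens K V [x]) = f x"
proof -
 have M: "multilin V (T V) (%vs. if length vs = 1 then f (hd vs) else \<zero>\<^sub>(T V))"
  using V T_mod[OF V] lin_simps[OF f] by (intro multilinI) (auto simp: length_Suc_conv)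
 let ?g = "tlift V (T V) (%vs. if length vs = 1 then f (hd vs) else \<zero>\<^sub>(T V))"
 note g = tlift_lin[OF V T_mod[OF V] M]
 have gt: "?g (tens K V [x]) = f x" if "x <: V" for x
  using that by (subst tlift_tens[OF V T_mod[OF V] M]) auto
 have t1: "tens K V [x] \<in> tp V 1" if "x <: V" for x
  using that by (intro tens_tp[OF V]) auto
 have "lift1 K V f = restrict ?g (tp V 1)"
  unfolding lift1_def
 proof (rule the_linear_eq)
  show "?g \<in> lin (tpow K V 1) (T V)" by (rule lin_tp[OF V g])
  show "\<forall>x\<in>carrier V. restrict ?g (tp V 1) (tens K V [x]) = f x"
   using gt t1 by auto
  fix h t assume "\<forall>x\<in>carrier V. h (tens K V [x]) = f x" "t \<in> tp V 1"
  then show "h t = ?g t" using gt tp1[OF V] by auto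
 qed (use V in auto)
 then show "lift1 K V f \<in> lin (tpow K V 1) (T V)" "x <: V ==> lift1 K V f (tens K V [x]) = f x"
  using gt t1 lin_restrict[OF lin_tp[OF V g, of 1]] V by auto
qed

lemma nabla:
 assumes A: "ualg A"
 shows nabla_lin: "nabla K A \<in> lin (tpow K A 2) (T A)"
  and nabla_tens: "x <: A ==> y <: A ==> nabla K A (tens K A [x, y]) = tens K A [x \<otimes>\<^sub>A y]"
  and nabla_tp: "t \<in> tp A 2 ==> nabla K A t \<in> tp A 1"
proof -
 note V = ua_mod[OF A]
 note U = ua_simps[OF A]
 let ?g = "lift2 A (T A) (%x y. tens K A [x \<otimes>\<^sub>A y])"
 have B: "(%x. tens K A [x \<otimes>\<^sub>A y]) \<in> lin A (T A)" "(%y'. tens K A [y \<otimes>\<^sub>A y']) \<in> lin A (T A)" if "y <: A" for y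
  using that by (auto intro!: lin_o[OF tens1_lin[OF V]] lin_rmult[OF A] lin_lmult[OF A] lin_id)
 note g = lift2_lin[OF V T_mod[OF V] B(1,2)]
 note gt = lift2_tens[OF V T_mod[OF V] B(1,2)]
 have t2: "tens K A [x, y] \<in> tp A 2" if "x <: A" "y <: A" for x y
  using that by (intro tens_tp[OF V]) auto
 have g1: "?g t \<in> tp A 1" if "t \<in> tp A 2" for t
  using V that
 proof (induct rule: tp2_ind)
  case (tens x y) then show ?case by (simp add: gt U tens_tp[OF V])
 qed (use lin_simps[OF g] sub_simps[OF T_mod[OF V] tp_sub[OF V]] V in \<open>auto simp: tp_T[OF V]\<close>)
 have "nabla K A = restrict ?g (tp A 2)"
  unfolding nabla_def
 proof (rule the_linear_eq)
  show L: "?g \<in> lin (tpow K A 2) (tpow K A 1)"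
   using g1 by (subst (2) tpow_alt, intro lin_restr_cod lin_tp[OF V g]) auto
  show "\<forall>x\<in>carrier A. \<forall>y\<in>carrier A. restrict ?g (tp A 2) (tens K A [x, y]) = tens K A [x \<otimes>\<^sub>A y]"
   using gt t2 by auto
  fix h t assume h: "h \<in> lin (tpow K A 2) (tpow K A 1)" "\<forall>x\<in>carrier A. \<forall>y\<in>carrier A. h (tens K A [x, y]) = tens K A [x \<otimes>\<^sub>A y]"
   and t: "t \<in> tp A 2"
  show "h t = ?g t"
   by (rule tp_lin_eq[OF V h(1) L _ _ t]) (use gt h(2) V in \<open>auto simp: length_Suc_conv numeral_2_eq_2\<close>)
 qed (use V in auto)
 then show "nabla K A \<in> lin (tpow K A 2) (T A)"
  "x <: A ==> y <: A ==> nabla K A (tens K A [x, y]) = tens K A [x \<otimes>\<^sub>A y]"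
  "t \<in> tp A 2 ==> nabla K A t \<in> tp A 1"
  using gt t2 lin_restrict[OF lin_tp[OF V g, of 2]] V g1 by auto
qed

end

section \<open>Braided algebras and bialgebras\<close>

locale braided_alg = kfield K for K :: "('k, 'r) ring_scheme" +
 fixes A :: "('k, 'a) module" (structure) and c :: "('a list => 'k) set => ('a list => 'k) set"
 assumes braided_algebra: "braided_algebra K A c"
begin

abbreviation C where "C i == opat A i 2 c"
abbreviation N where "N i == opat A i 2 (nabla K A)"
abbreviation te where "te vs == tens K A vs"
abbreviation tmA (infixl "\<star>" 70) where "s \<star> t == s \<star>\<^sub>A t"

lemma A_ualg: "ualg A" and A_space: "braided_space K A c"
 using braided_algebra by (auto simp: braided_algebra_def)

lemma AM [simp]: "module K A" by (rule ua_mod[OF A_ualg])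

lemmas tmA_tens = tm2_tens[OF AM AM] and tmA_lin = tm2_lin[OF AM AM] and tmA_tp = tm2_tp[OF AM AM] and tmA_L3 = tmL3[OF AM AM] and tmA_tprod = tm2_tprod[OF AM AM] and tmA_comp = tm2_comp[OF AM AM]
 and A_lift2_eq = lift2_eq[OF AM] and A_tprod_image = tprod_image[OF AM] and A_lin_tp = lin_tp[OF AM] and A_tprod_sub = tprod_sub[OF AM] and A_tens2_lin = tens2_lin[OF AM] and A_tens_tp = tens_tp[OF AM] and A_amp_opat = amp_opat[OF AM] and A_opat_lin = opat_lin[OF AM] and A_opat_mult = opat_mult[OF AM] and A_tens2_simps = tens2_simps[OF AM] and A_tens1_lin = tens1_lin[OF AM] and A_opat_right = opat_right[OF AM] and A_tp_lin_eq = tp_lin_eq[OF AM] and A_tens2_zero = tens2_zero[OF AM] and A_tprod_base = tprod_base[OF AM] and A_opat_0 = opat_0[OF AM] and A_tens1_zero = tens1_zero[OF AM] and A_opat_left = opat_left[OF AM] and A_opat_tp = opat_tp[OF AM] and A_tens_append = tens_append[OF AM] and A_tens_Nil_mult = tens_Nil_mult[OF AM] and A_tprod_eq = tprod_eq[OF AM] and A_tprod_full = tprod_full[OF AM] and TA_ualg = T_ualg[OF AM]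
lemmas A_ua = ua_simps[OF A_ualg]
lemmas TA_ua = T_ua[OF AM]
lemmas TAM = T_mod[OF AM]
lemmas nabla_lin' = nabla_lin[OF A_ualg] and nabla_tens' = nabla_tens[OF A_ualg] and nabla_tp' = nabla_tp[OF A_ualg]
lemmas tp_T' = tp_T[OF AM]
lemmas tens_closed' = tens_closed[OF AM]

lemma c_lin: "c \<in> lin (tpow K A 2) (T A)" and c_tp: "t \<in> tp A 2 ==> c t \<in> tp A 2"
proof -
 have *: "c \<in> lin (tpow K A 2) (tpow K A 2)" using A_space by (simp add: braided_space_def)
 then show "t \<in> tp A 2 ==> c t \<in> tp A 2" by (rule lin_cl)
 show "c \<in> lin (tpow K A 2) (T A)"
  using * by (auto simp: linear_maps_def Pi_iff tp_T[OF AM])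
qed

lemmas C_lin = A_opat_lin[OF c_lin] and N_lin = A_opat_lin[OF nabla_lin']

lemma C_tp: "t \<in> tp A n ==> i + 2 \<le> n ==> C i t \<in> tp A n"
proof -
 assume h: "t \<in> tp A n" "i + 2 \<le> n"
 then have e: "i + 2 + (n - i - 2) = n" by simp
 show ?thesis using A_opat_tp[OF c_lin c_tp, of t i "n - i - 2", unfolded e] h by simp
qed

lemma N_tp: "t \<in> tp A (Suc n) ==> i + 1 \<le> n ==> N i t \<in> tp A n"
proof -
 assume h: "t \<in> tp A (Suc n)" "i + 1 \<le> n"
 then have e: "i + 2 + (n - i - 1) = Suc n" "i + 1 + (n - i - 1) = n" by simp_all
 show ?thesis using A_opat_tp[OF nabla_lin' nabla_tp', of t i "n - i - 1", unfolded e] h by simp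
qed

lemma t2_tp [simp]: "x <: A ==> y <: A ==> te [x, y] \<in> tp A 2"
 by (intro A_tens_tp) auto

lemma t1_tp [simp]: "x <: A ==> te [x] \<in> tp A 1" "x <: A ==> te [x] \<in> tp A (Suc 0)"
 by (auto intro!: A_tens_tp)

lemma brd_C: "t \<in> tp A n ==> 1 \<le> i ==> i < n ==> brd K A c n i t = C (i - 1) t"
 unfolding brd_def using A_amp_opat[OF c_lin, of t "i - 1" "n - i - 1"] by (simp add: numeral_2_eq_2)

lemma YB: "t \<in> tp A 3 ==> C 0 (C 1 (C 0 t)) = C 1 (C 0 (C 1 t))"
proof -
 assume t: "t \<in> tp A 3"
 have "C i u \<in> tp A 3" if "u \<in> tp A 3" "i \<le> 1" for i u using C_tp[OF that(1), of i] that by simp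
 moreover have "brd K A c 3 1 (brd K A c 3 2 (brd K A c 3 1 t)) = brd K A c 3 2 (brd K A c 3 1 (brd K A c 3 2 t))"
  using A_space t by (simp add: braided_space_def)
 ultimately show ?thesis using t brd_C[of _ 3 1] brd_C[of _ 3 2] by simp
qed

lemma c_nabla:
 assumes t: "t \<in> tp A 3"
 shows cN0: "c (N 0 t) = N 1 (C 0 (C 1 t))" and cN1: "c (N 1 t) = N 0 (C 1 (C 0 t))"
proof -
 have C3: "C i u \<in> tp A 3" if "u \<in> tp A 3" "i \<le> 1" for i u using C_tp[OF that(1), of i] that by simp
 have am: "amp K A 0 2 (nabla K A) 1 u = N 0 u" "amp K A 1 2 (nabla K A) 0 u = N 1 u" if "u \<in> tp A 3" for u
  using A_amp_opat[OF nabla_lin', of u 0 1] A_amp_opat[OF nabla_lin', of u 1 0] that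
  by (simp_all add: numeral_3_eq_3)
 have "c (amp K A 0 2 (nabla K A) 1 t) = amp K A 1 2 (nabla K A) 0 (brd K A c 3 1 (brd K A c 3 2 t))"
  "c (amp K A 1 2 (nabla K A) 0 t) = amp K A 0 2 (nabla K A) 1 (brd K A c 3 2 (brd K A c 3 1 t))"
  using braided_algebra t by (simp_all add: braided_algebra_def)
 then show "c (N 0 t) = N 1 (C 0 (C 1 t))" "c (N 1 t) = N 0 (C 1 (C 0 t))"
  using t am brd_C[of _ 3 1] brd_C[of _ 3 2] C3 by simp_all
qed

lemma c_one: "a <: A ==> c (te [\<one>, a]) = te [a, \<one>]"
  "a <: A ==> c (te [a, \<one>]) = te [\<one>, a]"
 using braided_algebra by (auto simp: braided_algebra_def)

lemma c_closed [simp]: "x <: A ==> y <: A ==> c (te [x, y]) \<in> tp A 2"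
 by (rule c_tp) simp

lemmas c_simps = f_simps[OF AM c_lin]

text \<open>\<open>nabla\<close> takes values in the first tensor power, \<open>mu\<close> in
  \<open>A\<close> itself.\<close>

definition mu where "mu = lift2 A A (%x y. x \<otimes> y)"

lemma mu_lin: "mu \<in> lin (T A) A" and mu_tens: "x <: A ==> y <: A ==> mu (te [x, y]) = x \<otimes> y"
proof -
 have B: "(%x. x \<otimes> y) \<in> lin A A" "(\<otimes>) y \<in> lin A A" if "y <: A" for y
  using that lin_rmult[OF A_ualg lin_id] lin_lmult[OF A_ualg lin_id] by auto
 show "mu \<in> lin (T A) A" "x <: A ==> y <: A ==> mu (te [x, y]) = x \<otimes> y"
  unfolding mu_def using lift2_lin[OF AM AM B] lift2_tens[OF AM AM B] by auto
qed

lemma nabla_mu: "t \<in> tp A 2 ==> nabla K A t = te [mu t]"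
 by (rule A_tp_lin_eq[OF nabla_lin' A_lin_tp[OF lin_o[OF A_tens1_lin mu_lin]] TAM])
  (auto simp: length_Suc_conv numeral_2_eq_2 mu_tens nabla_tens')

end

lemma len1: "length vs = 1 \<longleftrightarrow> (\<exists>x. vs = [x])"
 and len2: "length vs = 2 \<longleftrightarrow> (\<exists>x y. vs = [x, y])"
 and len3: "length vs = 3 \<longleftrightarrow> (\<exists>x y z. vs = [x, y, z])"
 by (auto simp: length_Suc_conv numeral_2_eq_2 numeral_3_eq_3)

text \<open>Positions and tensor degrees are normalised to \<open>1\<close> instead of
  \<open>Suc 0\<close>.\<close>

declare One_nat_def [simp del] One_nat_def [symmetric, simp]

section \<open>Projections, generalized inverses and kernels of tensor products of maps\<close>

context kfield
begin

text \<open>Project the target onto the image, choose a preimage, and remove its component in the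
  kernel. The last step makes the result independent of the preimage and therefore linear.\<close>

lemma exists_generalized_inverse:
 assumes V: "module K V" and M: "module K M" and f: "f \<in> lin V M"
 shows "\<exists>s\<in>lin M V. \<forall>y\<in>carrier V. f (s (f y)) = f y"
proof -
 have k: "sub {x \<in> carrier V. f x \<in> {\<zero>\<^sub>M}} V" by (rule sub_vimage[OF f V M sub_0[OF M]])
 obtain R where R: "R \<in> lin V V" "\<forall>x\<in>carrier V. R x \<in> {x \<in> carrier V. f x \<in> {\<zero>\<^sub>M}}"
  "\<forall>x\<in>{x \<in> carrier V. f x \<in> {\<zero>\<^sub>M}}. R x = x"
  using exists_projection[OF V k] by blast
 obtain P where P: "P \<in> lin M M" "\<forall>x\<in>carrier M. P x \<in> f ` carrier V" "\<forall>x\<in>f ` carrier V. P x = x"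
  using exists_projection[OF M sub_image[OF f V M sub_carrier[OF V]]] by blast
 define s where "s m = (let y = (SOME y. y <: V \<and> f y = P m) in y \<ominus>\<^sub>V R y)" for m
 have s: "s m = y \<ominus>\<^sub>V R y" if m: "y <: V" "f y = P m" for m y
 proof -
  define z where "z = (SOME y. y <: V \<and> f y = P m)"
  have z: "z <: V \<and> f z = P m" unfolding z_def by (rule someI[of _ y]) (use m in simp)
  have "y \<ominus>\<^sub>V z \<in> {x \<in> carrier V. f x \<in> {\<zero>\<^sub>M}}"
   using z m lin_minus[OF f V M, of y z] lin_cl[OF f, of z] V M by simp
  then have "R (y \<ominus>\<^sub>V z) = y \<ominus>\<^sub>V z" using R(3) by blast
  then have e: "R y \<ominus>\<^sub>V R z = y \<ominus>\<^sub>V z" using lin_minus[OF R(1) V V] z m by simp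
  have c: "R y <: V" "R z <: V" using z m lin_cl[OF R(1)] by auto
  have "y \<ominus>\<^sub>V R y = (y \<ominus>\<^sub>V z) \<oplus>\<^sub>V (z \<ominus>\<^sub>V R y)" using c z m V by (simp add: mod_minus mod_assoc)
  also have "\<dots> = z \<ominus>\<^sub>V R z" unfolding e[symmetric] using c z m V
   by (simp add: mod_minus mod_assoc mod_lcomm[of V "\<ominus>\<^sub>V R z" z]) (simp add: mod_ac)
  finally show ?thesis unfolding s_def z_def[symmetric] by (simp add: Let_def)
 qed
 have ex: "\<exists>y\<in>carrier V. f y = P m" if "m <: M" for m
  using P(2) that by (metis imageE)
 have sl: "s \<in> lin M V"
 proof (rule linI)
  show "s m <: V" if "m <: M" for m
   using ex[OF that] s lin_cl[OF R(1)] V by auto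
  show "s (m \<oplus>\<^sub>M n) = s m \<oplus>\<^sub>V s n" if mn: "m <: M" "n <: M" for m n
  proof -
   obtain y z where yz: "y <: V" "z <: V" "f y = P m" "f z = P n"
    using ex[OF mn(1)] ex[OF mn(2)] by blast
   then have "s (m \<oplus>\<^sub>M n) = (y \<oplus>\<^sub>V z) \<ominus>\<^sub>V R (y \<oplus>\<^sub>V z)"
    using V lin_add[OF f] lin_add[OF P(1)] mn by (intro s) simp_all
   then show ?thesis using yz V lin_simps[OF R(1)] s[of y m] s[of z n]
    by (simp add: mod_minus mod_negadd mod_ac)
  qed
  show "s (a \<odot>\<^sub>M m) = a \<odot>\<^sub>V s m" if mn: "a <: K" "m <: M" for a m
  proof -
   obtain y where yz: "y <: V" "f y = P m"
    using ex[OF mn(2)] by blast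
   then have "s (a \<odot>\<^sub>M m) = (a \<odot>\<^sub>V y) \<ominus>\<^sub>V R (a \<odot>\<^sub>V y)"
    using V lin_smult[OF f] lin_smult[OF P(1)] mn by (intro s) simp_all
   then show ?thesis using yz V lin_simps[OF R(1)] s[of y m] mn
    by (simp add: mod_minus mod_sadd mod_sneg)
  qed
 qed
 have "f (s (f y)) = f y" if y: "y <: V" for y
 proof -
  have "s (f y) = y \<ominus>\<^sub>V R y" using P(3) y by (intro s) auto
  moreover have "f (R y) = \<zero>\<^sub>M" "R y <: V" using R(2) y by auto
  ultimately show ?thesis using lin_minus[OF f V M, of y "R y"] y M lin_cl[OF f y] by (simp add: mod_minus)
 qed
 then show ?thesis using sl by blast
qed

definition is_proj where "is_proj V X R \<longleftrightarrow> R \<in> lin V V \<and> (\<forall>x\<in>carrier V. R x \<in> X) \<and> (\<forall>x\<in>X. R x = x)"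

lemma proj_compl_lin: "module K V ==> is_proj V X R ==> (%x. x \<ominus>\<^sub>V R x) \<in> lin V V"
 by (auto simp: is_proj_def intro!: lin_sub lin_id)

lemma proj_compl_zero:
 assumes h: "module K V" "sub X V" "is_proj V X RX" "x <: V"
 shows "x \<ominus>\<^sub>V RX x = \<zero>\<^sub>V \<longleftrightarrow> x \<in> X"
proof
 have R: "RX x \<in> X" using h by (simp add: is_proj_def)
 note R = R sub_mem[OF h(1,2) R]
 show "x \<in> X" if "x \<ominus>\<^sub>V RX x = \<zero>\<^sub>V"
  using mod_eqI[OF h(1,4) R(2) that] R by simp
 show "x \<ominus>\<^sub>V RX x = \<zero>\<^sub>V" if "x \<in> X"
  using that h by (simp add: is_proj_def)
qed

context
 fixes V :: "('k, 'v) module" and X Y RX RY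
 assumes V [simp]: "module K V" and X: "sub X V" and Y: "sub Y V" and RX: "is_proj V X RX" and RY: "is_proj V Y RY"
begin

text \<open>The identity of \<open>V \<otimes> V\<close> is the sum of
  \<open>id \<otimes> RY\<close>, \<open>RX \<otimes> (id - RY)\<close> and
  \<open>(id - RX) \<otimes> (id - RY)\<close>; the first two summands have values in the two
  subspaces. Membership in a wedge thus becomes an equation, to which further operators can be
  applied.\<close>

lemma tensor_kernel:
 assumes t: "t \<in> tp V 2"
 shows "tm2 V V (%x. x \<ominus>\<^sub>V RX x) (%y. y \<ominus>\<^sub>V RY y) t = \<zero>\<^sub>(T V) \<longleftrightarrow>
  t \<in> tprod K V (carrier V) Y <+>\<^sub>(T V) tprod K V X (carrier V)"
proof
 note QX = proj_compl_lin[OF V RX] and QY = proj_compl_lin[OF V RY]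
 note XY = sub_carr[OF V X] sub_carr[OF V Y]
 have R: "RX \<in> lin V V" "RY \<in> lin V V" using RX RY by (auto simp: is_proj_def)
 have cl: "x <: V ==> RX x <: V" "x <: V ==> RY x <: V" for x
  using lin_cl[OF R(1)] lin_cl[OF R(2)] by auto
 note S = tprod_sub[OF V subset_refl XY(2)] tprod_sub[OF V XY(1) subset_refl]
 let ?Q = "tm2 V V (%x. x \<ominus>\<^sub>V RX x) (%y. y \<ominus>\<^sub>V RY y)"
 assume z: "?Q t = \<zero>\<^sub>(T V)"
 have L: "(%t. (tm2 V V (%x. x) RY t \<oplus>\<^sub>(T V) tm2 V V RX (%y. y \<ominus>\<^sub>V RY y) t) \<oplus>\<^sub>(T V) ?Q t) \<in> lin (T V) (T V)"
  using V by (intro lin_plus tm2_lin QX QY R lin_id T_mod) auto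
 have "t = (tm2 V V (%x. x) RY t \<oplus>\<^sub>(T V) tm2 V V RX (%y. y \<ominus>\<^sub>V RY y) t) \<oplus>\<^sub>(T V) ?Q t"
 proof (rule lift2_eq[OF V lin_id L T_mod[OF V] _ t])
  fix x y assume x: "x <: V" and y: "y <: V"
  have "tens K V [x, y] = tens K V [x, RY y] \<oplus>\<^sub>(T V) tens K V [x, y \<ominus>\<^sub>V RY y]"
   using x y cl V by (simp add: mod_ac mod_minus flip: tens2_simps[OF V])
  also have "tens K V [x, y \<ominus>\<^sub>V RY y] = tens K V [RX x, y \<ominus>\<^sub>V RY y] \<oplus>\<^sub>(T V) tens K V [x \<ominus>\<^sub>V RX x, y \<ominus>\<^sub>V RY y]"
   using x y cl V by (simp add: mod_ac mod_minus flip: tens2_simps[OF V])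
  finally have fin: "tens K V [x, y] = tens K V [x, RY y] \<oplus>\<^sub>(T V) (tens K V [RX x, y \<ominus>\<^sub>V RY y] \<oplus>\<^sub>(T V) tens K V [x \<ominus>\<^sub>V RX x, y \<ominus>\<^sub>V RY y])" .
  show "tens K V [x, y] = (tm2 V V (%x. x) RY (tens K V [x, y]) \<oplus>\<^sub>(T V) tm2 V V RX (%y. y \<ominus>\<^sub>V RY y) (tens K V [x, y])) \<oplus>\<^sub>(T V) ?Q (tens K V [x, y])"
   using x y cl V T_mod[OF V] by (subst (1) fin) (simp add: tm2_tens[OF V V] QX QY R lin_id mod_assoc)
 qed
 also have "\<dots> = tm2 V V (%x. x) RY t \<oplus>\<^sub>(T V) tm2 V V RX (%y. y \<ominus>\<^sub>V RY y) t"
  unfolding z using tp_T[OF V t] lin_cl[OF tm2_lin[OF V V lin_id R(2)]]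
    lin_cl[OF tm2_lin[OF V V R(1) QY]] T_mod[OF V] by simp
 finally have e: "t = tm2 V V (%x. x) RY t \<oplus>\<^sub>(T V) tm2 V V RX (%y. y \<ominus>\<^sub>V RY y) t" .
 have t': "t \<in> tprod K V (carrier V) (carrier V)" using t by (simp add: tprod_full)
 have "tm2 V V (%x. x) RY t \<in> tprod K V (carrier V) Y"
  using RY XY by (intro tm2_tprod[OF V V lin_id R(2) _ _ _ _ _ _ t']) (auto simp: is_proj_def)
 moreover have "tm2 V V RX (%y. y \<ominus>\<^sub>V RY y) t \<in> tprod K V X (carrier V)"
  using RX XY cl V by (intro tm2_tprod[OF V V R(1) QY _ _ _ _ _ _ t']) (auto simp: is_proj_def)
 ultimately show "t \<in> tprod K V (carrier V) Y <+>\<^sub>(T V) tprod K V X (carrier V)"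
  unfolding sub_setadd(4)[OF T_mod[OF V] S] using e by blast
next
 note QX = proj_compl_lin[OF V RX] and QY = proj_compl_lin[OF V RY]
 note XY = sub_carr[OF V X] sub_carr[OF V Y]
 note S = tprod_sub[OF V subset_refl XY(2)] tprod_sub[OF V XY(1) subset_refl]
 let ?Q = "tm2 V V (%x. x \<ominus>\<^sub>V RX x) (%y. y \<ominus>\<^sub>V RY y)"
 assume t: "t \<in> tprod K V (carrier V) Y <+>\<^sub>(T V) tprod K V X (carrier V)"
 have "?Q t \<in> {\<zero>\<^sub>(T V)}"
 proof (rule lin_setadd[OF tm2_lin[OF V V QX QY] T_mod[OF V] T_mod[OF V] S sub_0[OF T_mod[OF V]] _ _ t])
  show "?Q s \<in> {\<zero>\<^sub>(T V)}" if "s \<in> tprod K V (carrier V) Y" for s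
  proof (rule tprod_image[OF V subset_refl XY(2) tm2_lin[OF V V QX QY] T_mod[OF V] sub_0[OF T_mod[OF V]] _ that])
   fix x y assume "x <: V" "y \<in> Y"
   then show "?Q (tens K V [x, y]) \<in> {\<zero>\<^sub>(T V)}"
    using subsetD[OF XY(2), of y] proj_compl_zero[OF V Y RY, of y] lin_cl[OF QX, of x]
    by (simp add: tm2_tens[OF V V QX QY] tens2_zero[OF V])
  qed
  show "?Q s \<in> {\<zero>\<^sub>(T V)}" if "s \<in> tprod K V X (carrier V)" for s
  proof (rule tprod_image[OF V XY(1) subset_refl tm2_lin[OF V V QX QY] T_mod[OF V] sub_0[OF T_mod[OF V]] _ that])
   fix x y assume "x \<in> X" "y <: V"
   then show "?Q (tens K V [x, y]) \<in> {\<zero>\<^sub>(T V)}"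
    using subsetD[OF XY(1), of x] proj_compl_zero[OF V X RX, of x] lin_cl[OF QY, of y]
    by (simp add: tm2_tens[OF V V QX QY] tens2_zero[OF V])
  qed
 qed
 then show "?Q t = \<zero>\<^sub>(T V)" by simp
qed

lemma tprod_iff:
 assumes t: "t \<in> tp V 2"
 shows "t \<in> tprod K V X Y \<longleftrightarrow> tm2 V V RX RY t = t"
proof
 note XY = sub_carr[OF V X] sub_carr[OF V Y]
 have R: "RX \<in> lin V V" "RY \<in> lin V V" using RX RY by (auto simp: is_proj_def)
 show "tm2 V V RX RY t = t" if "t \<in> tprod K V X Y"
 proof (rule tprod_eq[OF V XY tm2_lin[OF V V R] lin_id T_mod[OF V] _ that])
  fix x y assume "x \<in> X" "y \<in> Y"
  then show "tm2 V V RX RY (tens K V [x, y]) = tens K V [x, y]"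
   using XY subsetD[OF XY(1), of x] subsetD[OF XY(2), of y] RX RY by (simp add: tm2_tens[OF V V R] is_proj_def)
 qed
 assume e: "tm2 V V RX RY t = t"
 have t': "t \<in> tprod K V (carrier V) (carrier V)" using t by (simp add: tprod_full)
 have "tm2 V V RX RY t \<in> tprod K V X Y"
  using RX RY XY by (intro tm2_tprod[OF V V R _ _ _ _ _ _ t']) (auto simp: is_proj_def)
 then show "t \<in> tprod K V X Y" using e by simp
qed

end

lemma is_proj_id: "is_proj V (carrier V) (%x. x)"
 by (auto simp: is_proj_def lin_id)

text \<open>\<open>RX \<otimes> RY\<close> is the composition of \<open>RX \<otimes> id\<close> and
  \<open>id \<otimes> RY\<close>, and each of these fixes \<open>t\<close>.\<close>

lemma tprod_Int:
 assumes V: "module K V" and X: "sub X V" and Y: "sub Y V"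
  and t: "t \<in> tprod K V X (carrier V)" "t \<in> tprod K V (carrier V) Y"
 shows "t \<in> tprod K V X Y"
proof -
 obtain RX RY where RX: "is_proj V X RX" and RY: "is_proj V Y RY"
  using exists_projection[OF V X] exists_projection[OF V Y] unfolding is_proj_def by blast
 have R: "RX \<in> lin V V" "RY \<in> lin V V" using RX RY by (auto simp: is_proj_def)
 have t2: "t \<in> tp V 2" using tprod_tp[OF V sub_carr[OF V X] subset_refl t(1)] .
 have "tm2 V V RX RY t = tm2 V V RX (%x. x) (tm2 V V (%x. x) RY t)"
  using tm2_comp[OF V V V lin_id R(2) R(1) lin_id t2] by simp
 also have "tm2 V V (%x. x) RY t = t"
  using tprod_iff[OF V sub_carrier[OF V] Y is_proj_id RY t2] t(2) by simp
 also have "tm2 V V RX (%x. x) t = t"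
  using tprod_iff[OF V X sub_carrier[OF V] RX is_proj_id t2] t(1) by simp
 finally show ?thesis using tprod_iff[OF V X Y RX RY t2] by simp
qed

end

section \<open>Symmetrically braided bialgebras\<close>

text \<open>The axioms are rephrased for operators on the whole tensor algebra. Besides
  \<open>H\<close> itself, \<open>gr H\<close> will be an instance.\<close>

locale symm_bialg = braided_alg K A c for K :: "('k, 'r) ring_scheme" and A :: "('k, 'a) module" (structure) and c +
 fixes \<Delta> :: "'a => ('a list => 'k) set" and \<epsilon> :: "'a => 'k"
 assumes Delta_lin: "\<Delta> \<in> lin A (T A)" and Delta_tp: "!!x. x <: A ==> \<Delta> x \<in> tp A 2"
  and eps_closed [simp]: "!!x. x <: A ==> \<epsilon> x <: K"
  and eps_add: "!!x y. x <: A ==> y <: A ==> \<epsilon> (x \<oplus> y) = \<epsilon> x \<oplus>\<^sub>K \<epsilon> y"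
  and eps_smult: "!!a x. a <: K ==> x <: A ==> \<epsilon> (a \<odot> x) = a \<otimes>\<^sub>K \<epsilon> x"
  and eps_mult: "!!x y. x <: A ==> y <: A ==> \<epsilon> (x \<otimes> y) = \<epsilon> x \<otimes>\<^sub>K \<epsilon> y"
  and eps_one: "\<epsilon> \<one> = \<one>\<^sub>K"
  and Delta_one: "\<Delta> \<one> = te [\<one>, \<one>]"
  and Delta_mult: "!!x y. x <: A ==> y <: A ==> \<Delta> (x \<otimes> y) = N 0 (N 2 (C 1 (\<Delta> x \<star> \<Delta> y)))"
  and counit: "!!x. x <: A ==> lift2 A A (%x y. \<epsilon> x \<odot> y) (\<Delta> x) = x"
   "!!x. x <: A ==> lift2 A A (%x y. \<epsilon> y \<odot> x) (\<Delta> x) = x"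
  and D1c: "!!t. t \<in> tp A 2 ==>
   opat A 1 1 (lift1 K A \<Delta>) (c t) = C 0 (C 1 (opat A 0 1 (lift1 K A \<Delta>) t))"
  and c_eps: "!!t. t \<in> tp A 2 ==> lift2 A A (%x y. \<epsilon> x \<odot> y) (c t) = lift2 A A (%x y. \<epsilon> y \<odot> x) t"
  and c_symm: "!!t. t \<in> tp A 2 ==> c (c t) = t"
begin

abbreviation D where "D i == opat A i 1 (lift1 K A \<Delta>)"
abbreviation e0 where "e0 == lift2 A A (%x y. \<epsilon> x \<odot> y)"
abbreviation e1 where "e1 == lift2 A A (%x y. \<epsilon> y \<odot> x)"

lemma eps_simps: "\<epsilon> \<zero> = \<zero>\<^sub>K" "x <: A ==> \<epsilon> (\<ominus> x) = \<ominus>\<^sub>K \<epsilon> x"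
proof -
 show "\<epsilon> \<zero> = \<zero>\<^sub>K" using eps_smult[of "\<zero>\<^sub>K" "\<zero>"] by simp
 show "x <: A ==> \<epsilon> (\<ominus> x) = \<ominus>\<^sub>K \<epsilon> x"
  using eps_smult[of "\<ominus>\<^sub>K \<one>\<^sub>K" x] by (simp add: mod_negs l_minus)
qed

lemma eps_lin: "y <: A ==> (%x. \<epsilon> x \<odot> y) \<in> lin A A" "y <: A ==> (%x. \<epsilon> y \<odot> x) \<in> lin A A"
 by (auto intro!: linI simp: eps_add eps_smult mod_adds mod_smul mod_sadd m_comm)

lemma e0_lin: "e0 \<in> lin (T A) A" and e1_lin: "e1 \<in> lin (T A) A"
 and e0_tens: "x <: A ==> y <: A ==> e0 (te [x, y]) = \<epsilon> x \<odot> y"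
 and e1_tens: "x <: A ==> y <: A ==> e1 (te [x, y]) = \<epsilon> y \<odot> x"
 using lift2[OF AM AM eps_lin(1,2)] lift2[OF AM AM eps_lin(2,1)] by auto

lemma Delta_T [simp]: "x <: A ==> \<Delta> x <: (T A)"
 using Delta_tp tp_T' by blast

lemmas Delta_simps = lin_simps[OF Delta_lin]
lemmas l1_lin = lift1_lin[OF AM Delta_lin] and l1_tens = lift1_tens[OF AM Delta_lin]
lemmas D_lin = A_opat_lin[OF l1_lin]

lemma D0_ap: "x <: A ==> s <: (T A) ==> D 0 (te [x] \<star> s) = \<Delta> x \<star> s"
 using A_opat_mult[OF l1_lin, of "te []" 0 "te [x]" s] tens_tp[OF AM, of "[]" 0]
 by (simp add: l1_tens tens_Nil[OF AM] TA_ua)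

lemma D1_ap: "x <: A ==> a <: A ==> s <: (T A) ==>
  D 1 (te [a] \<star> (te [x] \<star> s)) = te [a] \<star> (\<Delta> x \<star> s)"
 using A_opat_mult[OF l1_lin, of "te [a]" 1 "te [x]" s] by (simp add: l1_tens)

lemma te2: "x <: A ==> y <: A ==> te [x, y] = te [x] \<star> te [y]"
 using tens_Cons[OF AM, of x "[y]"] by simp

lemma D0_2: "x <: A ==> y <: A ==> D 0 (te [x, y]) = \<Delta> x \<star> te [y]"
 by (simp add: te2 D0_ap)

lemma D1_2: "x <: A ==> y <: A ==> D 1 (te [x, y]) = te [x] \<star> \<Delta> y"
 using D1_ap[of y x "te []"] by (simp add: te2)

lemma D_tp: "t \<in> tp A n ==> i < n ==> D i t \<in> tp A (Suc n)"
proof -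
 assume h: "t \<in> tp A n" "i < n"
 have e: "i + 1 + (n - i - 1) = n" "i + 2 + (n - i - 1) = Suc n" using h by auto
 show "D i t \<in> tp A (Suc n)"
  by (rule A_opat_tp[OF l1_lin, of 2 t i "n - i - 1", unfolded e, OF _ h(1)])
   (auto simp: tp1[OF AM] l1_tens Delta_tp)
qed

lemma CC:
 assumes t: "t \<in> tp A n" and i: "i + 2 \<le> n"
 shows "C i (C i t) = t"
 using AM t
proof (induct rule: tp_ind)
 case (tens vs)
 have tk: "set (take n vs) <<: A" "set (drop n vs) <<: A" for n
  using tens set_take_subset set_drop_subset by (metis subset_trans)+
 have tk2: "set (take 2 (drop i vs)) <<: A"
  using tk(2) set_take_subset by (metis subset_trans)
 let ?u = "te (take i vs)" and ?w = "te (take 2 (drop i vs))" and ?v = "te (drop (i + 2) vs)"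
 have w: "?w \<in> tp A 2" "?u \<in> tp A i" "?v <: (T A)" using tk2 tk i tens by (auto intro!: A_tens_tp)
 have "te vs = te (take i vs @ take 2 (drop i vs) @ drop (i + 2) vs)"
  by (metis add.commute append_take_drop_id drop_drop)
 also have "\<dots> = ?u \<star> (?w \<star> ?v)" using tk tk2 by (simp add: A_tens_append)
 finally have e: "te vs = ?u \<star> (?w \<star> ?v)" .
 show ?case unfolding e
  using w c_tp[OF w(1)] by (simp add: A_opat_mult[OF c_lin] c_symm)
qed (use lin_simps[OF C_lin[of i]] tp_T' in auto)

text \<open>The mirror image of \<open>D1c\<close>: as the braiding is an involution, apply
  \<open>D1c\<close> to \<open>c t\<close> and undo the two crossings.\<close>

lemma D0c: assumes t: "t \<in> tp A 2" shows "D 0 (c t) = C 1 (C 0 (D 1 t))"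
proof -
 have "D 1 t = C 0 (C 1 (D 0 (c t)))" using D1c[OF c_tp[OF t]] c_symm[OF t] by simp
 moreover have "D 0 (c t) \<in> tp A 3" using D_tp[OF c_tp[OF t], of 0] by simp
 ultimately show ?thesis using CC[of _ 3] C_tp[of _ 3] by simp
qed

end

lemma (in kfield) tens1_inj:
 assumes V: "module K V" and "x <: V" "y <: V" "tens K V [x] = tens K V [y]"
 shows "x = y"
proof -
 have M: "multilin V V (%vs. if length vs = 1 then hd vs else \<zero>\<^sub>V)"
  using V by (intro multilinI) (auto simp: len1)
 have e: "tlift V V (%vs. if length vs = 1 then hd vs else \<zero>\<^sub>V) (tens K V [z]) = z" if "z <: V" for z
  using that by (subst tlift_tens[OF V V M]) auto
 show ?thesis using e[OF assms(2)] e[OF assms(3)] unfolding assms(4) by (rule trans[OF sym])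
qed

text \<open>Every \<open>amp\<close> and \<open>brd\<close> in the given axioms is traded for an
  \<open>opat\<close>. The counit axioms are equations in the first tensor power and come down to
  \<open>A\<close> by \<open>tens1_inj\<close>.\<close>

lemma symm_bialg_of_bialgebra:
 fixes A (structure)
 assumes "field K" and B: "braided_bialgebra K A \<Delta> \<epsilon> c" and S: "symmetric_braiding K A c"
 shows "symm_bialg K A c \<Delta> \<epsilon>"
proof -
 interpret kfield K using assms(1) by (simp add: kfield_def)
 interpret braided_alg K A c
  by unfold_locales (use B in \<open>simp add: braided_bialgebra_def\<close>)
 have co: "coalgebra K A \<Delta> \<epsilon>" and bc: "braided_coalgebra K A \<Delta> \<epsilon> c" using B by (auto simp: braided_bialgebra_def braided_coalgebra_def)
 have Dl: "\<Delta> \<in> lin A (tpow K A 2)" and el: "\<epsilon> \<in> lin A (base_space K)" using co by (auto simp: coalgebra_def)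
 have Dlin: "\<Delta> \<in> lin A (T A)" using Dl by (auto simp: linear_maps_def Pi_iff tp_T')
 have Dtp: "x <: A ==> \<Delta> x \<in> tp A 2" for x using lin_cl[OF Dl] .
 have bs: "carrier (base_space K) = carrier K" "add (base_space K) = add K" "smult (base_space K) = mult K"
  by (simp_all add: base_space_def)
 have ec: "x <: A ==> \<epsilon> x <: K"
  and ea: "x <: A ==> y <: A ==> \<epsilon> (x \<oplus> y) = \<epsilon> x \<oplus>\<^sub>K \<epsilon> y"
  and es: "a <: K ==> x <: A ==> \<epsilon> (a \<odot> x) = a \<otimes>\<^sub>K \<epsilon> x" for x y a
  using lin_cl[OF el, of x] lin_add[OF el, of x y] lin_smult[OF el, of a x] by (simp_all add: bs)
 have eh: "\<epsilon> \<in> ring_hom A K" and Dh: "\<Delta> \<in> ring_hom A (tensor_square K A c)" using B by (auto simp: braided_bialgebra_def)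
 have El: "(%x. \<epsilon> x \<odot>\<^sub>(T A) \<one>\<^sub>(T A)) \<in> lin A (T A)"
  using TA_ua(4) TAM by (intro linI) (auto simp: ec ea es mod_adds mod_smul)
 have eps_lin: "(%x. \<epsilon> x \<odot> y) \<in> lin A A" "(%x. \<epsilon> y \<odot> x) \<in> lin A A" if "y <: A" for y
  using that by (auto intro!: linI simp: ec ea es mod_adds mod_smul mod_sadd m_comm)
 note l0 = lift2[OF AM AM eps_lin(1,2)] and l1 = lift2[OF AM AM eps_lin(2,1)]
 let ?E = "counit_map K A \<epsilon>"
 have E1: "?E \<in> lin (tpow K A 1) (T A)" "x <: A ==> ?E (te [x]) = \<epsilon> x \<odot>\<^sub>(T A) \<one>\<^sub>(T A)" for x
  unfolding counit_map_def by (rule lift1_lin[OF AM El], rule lift1_tens[OF AM El])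
 have t2: "te [x, y] = te [x] \<star> te [y]" if "x <: A" "y <: A" for x y
  using tens_Cons[OF AM, of x "[y]"] that by simp
 have E_0: "amp K A 0 1 ?E 1 t = te [lift2 A A (%x y. \<epsilon> x \<odot> y) t]" if t: "t \<in> tp A 2" for t
 proof -
  have "amp K A 0 1 ?E 1 t = opat A 0 1 ?E t" using A_amp_opat[OF E1(1), of t 0 1] t by simp
  also have "\<dots> = te [lift2 A A (%x y. \<epsilon> x \<odot> y) t]"
  proof (rule A_lift2_eq[OF A_opat_lin[OF E1(1)] lin_o[OF A_tens1_lin l0(1)] TAM _ t])
   fix x y assume xy: "x <: A" "y <: A"
   have "opat A 0 1 ?E (te [] \<star> (te [x] \<star> te [y])) = te [] \<star> (?E (te [x]) \<star> te [y])"
    using xy by (intro A_opat_mult[OF E1(1)] A_tens_tp) auto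
   then show "opat A 0 1 ?E (te [x, y]) = te [lift2 A A (%x y. \<epsilon> x \<odot> y) (te [x, y])]"
    using xy l0(2) ec by (simp add: t2 E1(2) tens1_smult[OF AM] TA_ua A_tens_Nil_mult)
  qed
  finally show ?thesis .
 qed
 have E_1: "amp K A 1 1 ?E 0 t = te [lift2 A A (%x y. \<epsilon> y \<odot> x) t]" if t: "t \<in> tp A 2" for t
 proof -
  have "amp K A 1 1 ?E 0 t = opat A 1 1 ?E t" using A_amp_opat[OF E1(1), of t 1 0] t by simp
  also have "\<dots> = te [lift2 A A (%x y. \<epsilon> y \<odot> x) t]"
  proof (rule A_lift2_eq[OF A_opat_lin[OF E1(1)] lin_o[OF A_tens1_lin l1(1)] TAM _ t])
   fix x y assume xy: "x <: A" "y <: A"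
   have "opat A 1 1 ?E (te [x] \<star> (te [y] \<star> te [])) = te [x] \<star> (?E (te [y]) \<star> te [])"
    using xy by (intro A_opat_mult[OF E1(1)] A_tens_tp) auto
   then show "opat A 1 1 ?E (te [x, y]) = te [lift2 A A (%x y. \<epsilon> y \<odot> x) (te [x, y])]"
    using xy l1(2) ec by (simp add: t2 E1(2) tens1_smult[OF AM] TA_ua A_tens_Nil_mult)
  qed
  finally show ?thesis .
 qed
 have cl0: "lift2 A A (%x y. \<epsilon> x \<odot> y) t <: A" "lift2 A A (%x y. \<epsilon> y \<odot> x) t <: A" if "t \<in> tp A 2" for t
  using lin_cl[OF l0(1)] lin_cl[OF l1(1)] tp_T'[OF that] by auto
 note L1 = lift1_lin[OF AM Dlin]
 have L1t: "lift1 K A \<Delta> w \<in> tp A 2" if "w \<in> tp A 1" for w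
  using that tp1[OF AM] lift1_tens[OF AM Dlin] Dtp by auto
 show ?thesis
 proof unfold_locales
  show "\<Delta> \<in> lin A (T A)" "!!x. x <: A ==> \<Delta> x \<in> tp A 2" by (rule Dlin, rule Dtp)
  show "\<epsilon> (x \<otimes> y) = \<epsilon> x \<otimes>\<^sub>K \<epsilon> y" if "x <: A" "y <: A" for x y
   by (rule ring_hom_mult[OF eh that])
  show "\<epsilon> \<one> = \<one>\<^sub>K" by (rule ring_hom_one[OF eh])
  show "\<Delta> \<one> = te [\<one>, \<one>]" using ring_hom_one[OF Dh] by (simp add: tensor_square_def)
  show "\<Delta> (x \<otimes> y) = N 0 (N 2 (C 1 (\<Delta> x \<star> \<Delta> y)))" if xy: "x <: A" "y <: A" for x y
  proof -
   have t4: "\<Delta> x \<star> \<Delta> y \<in> tp A 4" using tp_mult[OF AM Dtp[OF xy(1)] Dtp[OF xy(2)]] by simp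
   have c4: "C 1 (\<Delta> x \<star> \<Delta> y) \<in> tp A 4" using C_tp[OF t4, of 1] by simp
   have n3: "N 2 (C 1 (\<Delta> x \<star> \<Delta> y)) \<in> tp A 3" using N_tp[of _ 3 2] c4 by simp
   have "\<Delta> (x \<otimes> y) = amp K A 0 2 (nabla K A) 1 (amp K A 2 2 (nabla K A) 0 (brd K A c 4 2 (\<Delta> x \<star> \<Delta> y)))"
    using ring_hom_mult[OF Dh xy] by (simp add: tensor_square_def)
   also have "brd K A c 4 2 (\<Delta> x \<star> \<Delta> y) = C 1 (\<Delta> x \<star> \<Delta> y)" using brd_C[OF t4, of 2] by simp
   also have "amp K A 2 2 (nabla K A) 0 (C 1 (\<Delta> x \<star> \<Delta> y)) = N 2 (C 1 (\<Delta> x \<star> \<Delta> y))"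
    using A_amp_opat[OF nabla_lin', of _ 2 0] c4 by simp
   also have "amp K A 0 2 (nabla K A) 1 (N 2 (C 1 (\<Delta> x \<star> \<Delta> y))) = N 0 (N 2 (C 1 (\<Delta> x \<star> \<Delta> y)))"
    using A_amp_opat[OF nabla_lin', of _ 0 1] n3 by simp
   finally show ?thesis .
  qed
  show "lift2 A A (%x y. \<epsilon> x \<odot> y) (\<Delta> x) = x" if x: "x <: A" for x
  proof (rule tens1_inj[OF AM _ x])
   show "te [lift2 A A (%x y. \<epsilon> x \<odot> y) (\<Delta> x)] = te [x]"
    using co x E_0[OF Dtp[OF x]] by (simp add: coalgebra_def)
  qed (use cl0 Dtp x in auto)
  show "lift2 A A (%x y. \<epsilon> y \<odot> x) (\<Delta> x) = x" if x: "x <: A" for x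
  proof (rule tens1_inj[OF AM _ x])
   show "te [lift2 A A (%x y. \<epsilon> y \<odot> x) (\<Delta> x)] = te [x]"
    using co x E_1[OF Dtp[OF x]] by (simp add: coalgebra_def)
  qed (use cl0 Dtp x in auto)
  show "opat A 1 1 (lift1 K A \<Delta>) (c t) = C 0 (C 1 (opat A 0 1 (lift1 K A \<Delta>) t))" if t: "t \<in> tp A 2" for t
  proof -
   have d: "opat A 0 1 (lift1 K A \<Delta>) t \<in> tp A 3"
    using A_opat_tp[OF L1 L1t, of t 0 1] t by simp
   have "amp K A 1 1 (lift1 K A \<Delta>) 0 (c t) = brd K A c 3 1 (brd K A c 3 2 (amp K A 0 1 (lift1 K A \<Delta>) 1 t))"
    using bc t by (simp add: braided_coalgebra_def)
   also have "amp K A 1 1 (lift1 K A \<Delta>) 0 (c t) = opat A 1 1 (lift1 K A \<Delta>) (c t)"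
    using A_amp_opat[OF L1, of "c t" 1 0] c_tp[OF t] by simp
   also have "amp K A 0 1 (lift1 K A \<Delta>) 1 t = opat A 0 1 (lift1 K A \<Delta>) t"
    using A_amp_opat[OF L1, of t 0 1] t by simp
   finally show ?thesis using brd_C[OF d, of 2] brd_C[of _ 3 1] C_tp[OF d, of 1] by simp
  qed
  show "lift2 A A (%x y. \<epsilon> x \<odot> y) (c t) = lift2 A A (%x y. \<epsilon> y \<odot> x) t" if t: "t \<in> tp A 2" for t
  proof -
   have g: "(%t. lift2 A A (%x y. \<epsilon> x \<odot> y) (c t)) \<in> lin (tpow K A 2) A"
    by (rule lin_o[OF l0(1) c_lin])
   show ?thesis
   proof (rule A_tp_lin_eq[OF g A_lin_tp[OF l1(1)] AM _ t])
    fix vs assume "length vs = 2" "set vs <<: A"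
    then obtain x y where xy: "vs = [x, y]" "x <: A" "y <: A"
     by (auto simp: len2)
    have "amp K A 0 1 ?E 1 (c (te [x, y])) = te [\<epsilon> y \<odot> x]"
     using bc xy by (simp add: braided_coalgebra_def)
    then have "te [lift2 A A (%x y. \<epsilon> x \<odot> y) (c (te [x, y]))] = te [\<epsilon> y \<odot> x]"
     using E_0[of "c (te [x, y])"] c_tp xy by simp
    then show "lift2 A A (%x y. \<epsilon> x \<odot> y) (c (te vs)) = lift2 A A (%x y. \<epsilon> y \<odot> x) (te vs)"
     using tens1_inj[OF AM cl0(1), of "c (te [x, y])"] xy l1(2) ec by simp
   qed
  qed
  show "c (c t) = t" if "t \<in> tp A 2" for t using S that by (simp add: symmetric_braiding_def)
 qed (auto simp: ec ea es)
qed

section \<open>The coradical filtration\<close>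

locale irr_bialg = symm_bialg K A c \<Delta> \<epsilon>
 for K :: "('k, 'r) ring_scheme" and A :: "('k, 'a) module" (structure) and c and \<Delta> and \<epsilon> +
 assumes coassoc: "!!x. x <: A ==> D 0 (\<Delta> x) = D 1 (\<Delta> x)"
  and irr: "coradical K A \<Delta> = {a \<odot> \<one> |a. a <: K}"
begin

abbreviation F where "F == coradical_filtration K A \<Delta>"

text \<open>\<open>G n\<close> is \<open>F (n - 1)\<close>, so that \<open>G (Suc n)\<close> is the wedge of \<open>G 1\<close> and \<open>G n\<close> for all \<open>n\<close>.\<close>

abbreviation G where "G == prev A F"
abbreviation K1 where "K1 == {a \<odot> \<one> |a. a <: K}"

lemma G_0: "G 0 = {\<zero>}" and G_Suc: "G (Suc n) = F n" and F_0: "F 0 = K1"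
 by (simp_all add: prev_def irr)

lemma one_A: "\<one> <: A" by (rule A_ua(4))

lemma K1_sub: "sub K1 A"
proof (rule subI[OF AM])
 show "K1 <<: A" using one_A by auto
 show "\<zero> \<in> K1" using one_A mod_zeros[OF AM one_A] by force
 show "x \<oplus> y \<in> K1" if xy: "x \<in> K1" "y \<in> K1" for x y
 proof -
  obtain a b where "a <: K" "b <: K" "x = a \<odot> \<one>" "y = b \<odot> \<one>" using xy by blast
  then show ?thesis using mod_adds[OF AM _ _ one_A, of a b] K_closed(1)[of a b]
   by (intro CollectI exI[of _ "a \<oplus>\<^sub>K b"]) simp
 qed
 show "a \<odot> x \<in> K1" if ax: "a <: K" "x \<in> K1" for a x
 proof -
  obtain b where "b <: K" "x = b \<odot> \<one>" using ax by blast
  then show ?thesis using mod_smul[OF AM _ _ one_A, of a b] ax K_closed(2)[of a b]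
   by (intro CollectI exI[of _ "a \<otimes>\<^sub>K b"]) simp
 qed
qed

lemma F_sub: "sub (F n) A"
proof (induct n)
 case 0 then show ?case using K1_sub by (simp add: irr)
next
 case (Suc n)
 have s: "sub (tprod K A (carrier A) (F n) <+>\<^sub>(T A) tprod K A (coradical K A \<Delta>) (carrier A)) (T A)"
  using K1_sub Suc sub_carr[OF AM] by (intro sub_setadd(1) TAM A_tprod_sub) (auto simp: irr)
 show ?case using sub_vimage[OF Delta_lin AM TAM s] by simp
qed

lemma G_sub: "sub (G n) A"
 using F_sub sub_0[OF AM] by (cases n) (auto simp: prev_def)

lemmas F_simps = sub_simps[OF AM F_sub] and G_simps = sub_simps[OF AM G_sub]

definition R where "R n = (SOME R. is_proj A (G n) R)"

lemma R: "is_proj A (G n) (R n)"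
proof -
 have "\<exists>R. is_proj A (G n) R" using exists_projection[OF AM G_sub, of n] unfolding is_proj_def by blast
 then show ?thesis unfolding R_def by (rule someI_ex)
qed

lemma R_lin: "R n \<in> lin A A" and R_mem: "x <: A ==> R n x \<in> G n" and R_id: "x \<in> G n ==> R n x = x"
 using R[of n] by (auto simp: is_proj_def)

text \<open>With kernel \<open>G n\<close>, this map plays the role of the quotient map from
  \<open>A\<close> to \<open>A / G n\<close> without leaving \<open>A\<close>.\<close>

definition Q where "Q n = (%x. x \<ominus> R n x)"

lemma Q_lin: "Q n \<in> lin A A" and Q_zero: "x <: A ==> Q n x = \<zero> \<longleftrightarrow> x \<in> G n"
 unfolding Q_def using proj_compl_lin[OF AM R] proj_compl_zero[OF AM G_sub R] by auto

lemma Q_G: "x \<in> G n ==> Q n x = \<zero>"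
 using Q_zero G_simps(2) by blast

lemma Q_closed: "x <: A ==> Q n x <: A" by (rule lin_cl[OF Q_lin])

lemma one_G1: "\<one> \<in> G 1"
proof -
 have "\<one> \<in> K1" using mod_ones[OF AM one_A] one_closed by force
 then show ?thesis using F_0 G_Suc[of 0] by simp
qed

lemma G1: "x \<in> G 1 \<longleftrightarrow> (\<exists>a\<in>carrier K. x = a \<odot> \<one>)"
 using F_0 G_Suc[of 0] by auto

lemmas Q2_lin = tmA_lin[OF Q_lin Q_lin] and Q2_tens = tmA_tens[OF Q_lin Q_lin]

lemma Q2_zero: "t \<in> tp A 2 ==> tm2 A A (Q i) (Q j) t = \<zero>\<^sub>(T A) \<longleftrightarrow>
  t \<in> tprod K A (carrier A) (G j) <+>\<^sub>(T A) tprod K A (G i) (carrier A)"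
 unfolding Q_def by (rule tensor_kernel[OF AM G_sub G_sub R R])

lemma Delta_G1: "x \<in> G 1 ==> \<exists>a\<in>carrier K. x = a \<odot> \<one> \<and> \<Delta> x = a \<odot>\<^sub>(T A) te [\<one>, \<one>]"
 using G1 Delta_simps(3) Delta_one one_A by auto

lemma Q2_Delta_G1: "x \<in> G 1 ==> i = 1 \<or> j = 1 ==> tm2 A A (Q i) (Q j) (\<Delta> x) = \<zero>\<^sub>(T A)"
 using Delta_G1[of x] Q_G[OF one_G1] one_A lin_smult[OF Q2_lin] tens_closed'[of "[\<one>, \<one>]"]
 by (auto simp: Q2_tens A_tens2_zero Q_closed)

text \<open>For positive \<open>n\<close> this is the definition of the filtration, with the wedge
  written as a kernel. It also holds for \<open>n = 0\<close>, so that the later inductions can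
  start at the zero subspace.\<close>

lemma GSuc: "x <: A ==> x \<in> G (Suc n) \<longleftrightarrow> tm2 A A (Q 1) (Q n) (\<Delta> x) = \<zero>\<^sub>(T A)"
proof (cases n)
 case 0
 assume x: "x <: A"
 show ?thesis
 proof
  show "x \<in> G (Suc n) ==> tm2 A A (Q 1) (Q n) (\<Delta> x) = \<zero>\<^sub>(T A)" using Q2_Delta_G1 0 by simp
  assume z: "tm2 A A (Q 1) (Q n) (\<Delta> x) = \<zero>\<^sub>(T A)"
  have Q0: "Q 0 y = y" if "y <: A" for y
   using that R_mem[of y 0] by (simp add: Q_def G_0 mod_minus)
  \<comment> \<open>As \<open>Q 0\<close> is the identity, applying the counit to the second factor
    recovers \<open>Q 1 x\<close> from the vanishing tensor.\<close>
  have "e1 (tm2 A A (Q 1) (Q n) t) = Q 1 (e1 t)" if t: "t \<in> tp A 2" for t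
   by (rule A_lift2_eq[OF lin_o[OF e1_lin Q2_lin] lin_o[OF Q_lin e1_lin] AM _ t])
    (simp add: Q2_tens e1_tens Q_closed 0 Q0 lin_smult[OF Q_lin])
  from this[OF Delta_tp[OF x]] have "Q 1 x = \<zero>" using z counit(2)[OF x] lin_zero[OF e1_lin] by simp
  then show "x \<in> G (Suc n)" using Q_zero[OF x] 0 by simp
 qed
next
 case (Suc m)
 assume x: "x <: A"
 have K1: "K1 = G 1" using F_0 G_Suc[of 0] by simp
 show ?thesis unfolding Q2_zero[OF Delta_tp[OF x]] G_Suc unfolding Suc
  using x by (simp add: irr G_Suc K1)
qed

lemma G_Delta: "x \<in> G (Suc n) ==> \<Delta> x \<in> tprod K A (carrier A) (G n) <+>\<^sub>(T A) tprod K A (G 1) (carrier A)"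
 using GSuc[of x n] Q2_zero[OF Delta_tp[of x], of 1 n] G_simps(2)[of x "Suc n"] by simp

lemma G_DeltaI: "x <: A ==> \<Delta> x \<in> tprod K A (carrier A) (G n) <+>\<^sub>(T A) tprod K A (G 1) (carrier A) ==> x \<in> G (Suc n)"
 using GSuc[of x n] Q2_zero[OF Delta_tp[of x], of 1 n] by simp

lemma G_Delta_ind:
 assumes x: "x \<in> G (Suc n)" and f: "f \<in> lin (T A) M" and M: "module K M" and Z: "sub Z M"
  and 1: "!!a b. a <: A ==> b \<in> G n ==> f (te [a, b]) \<in> Z"
  and 2: "!!a b. a \<in> G 1 ==> b <: A ==> f (te [a, b]) \<in> Z"
 shows "f (\<Delta> x) \<in> Z"
proof (rule lin_setadd[OF f TAM M _ _ Z _ _ G_Delta[OF x]])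
 note c = subset_refl[of "carrier A"] G_simps(1)
 show "sub (tprod K A (carrier A) (G n)) (T A)" "sub (tprod K A (G 1) (carrier A)) (T A)"
  by (rule A_tprod_sub[OF c(1) c(2)], rule A_tprod_sub[OF c(2) c(1)])
 show "f t \<in> Z" if "t \<in> tprod K A (carrier A) (G n)" for t
  by (rule A_tprod_image[OF c(1) c(2) f M Z 1 that])
 show "f t \<in> Z" if "t \<in> tprod K A (G 1) (carrier A)" for t
  by (rule A_tprod_image[OF c(2) c(1) f M Z 2 that])
qed

lemma GSucG: "x \<in> G n ==> x \<in> G (Suc n)"
proof (induct n arbitrary: x)
 case 0 then show ?case using G_simps(3) by (simp add: G_0)
next
 case (Suc n)
 have "\<Delta> x \<in> tprod K A (carrier A) (G (Suc n)) <+>\<^sub>(T A) tprod K A (G 1) (carrier A)"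
  using Suc G_simps(1)
  by (intro G_Delta_ind[OF Suc(2) lin_id TAM] sub_setadd[OF TAM] A_tprod_sub A_tprod_base) auto
 then show ?case using G_DeltaI G_simps(2)[OF Suc(2)] by blast
qed

lemma G_mono: "i \<le> j ==> x \<in> G i ==> x \<in> G j"
 by (induct rule: dec_induct) (auto intro: GSucG)

subsection \<open>Passing from the comultiplication to membership\<close>

definition S where "S n = (SOME s. s \<in> lin (T A) A \<and> (\<forall>y\<in>carrier A. tm2 A A (Q 1) (Q n) (\<Delta> (s (tm2 A A (Q 1) (Q n) (\<Delta> y)))) = tm2 A A (Q 1) (Q n) (\<Delta> y)))"

lemma QDelta_lin: "(%y. tm2 A A (Q i) (Q j) (\<Delta> y)) \<in> lin A (T A)"
 by (rule lin_o[OF Q2_lin Delta_lin])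

lemma S: "S n \<in> lin (T A) A"
  "y <: A ==> tm2 A A (Q 1) (Q n) (\<Delta> (S n (tm2 A A (Q 1) (Q n) (\<Delta> y)))) = tm2 A A (Q 1) (Q n) (\<Delta> y)"
proof -
 have "\<exists>s. s \<in> lin (T A) A \<and> (\<forall>y\<in>carrier A. tm2 A A (Q 1) (Q n) (\<Delta> (s (tm2 A A (Q 1) (Q n) (\<Delta> y)))) = tm2 A A (Q 1) (Q n) (\<Delta> y))"
  using exists_generalized_inverse[OF AM TAM QDelta_lin[of 1 n]] by blast
 from someI_ex[OF this] show "S n \<in> lin (T A) A"
  "y <: A ==> tm2 A A (Q 1) (Q n) (\<Delta> (S n (tm2 A A (Q 1) (Q n) (\<Delta> y)))) = tm2 A A (Q 1) (Q n) (\<Delta> y)"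
  unfolding S_def by blast+
qed

text \<open>Passing through \<open>S n\<close> changes \<open>y\<close> only by an element on which
  \<open>(Q 1 \<otimes> Q n) \<Delta>\<close> vanishes, that is, by an element of
  \<open>G (Suc n)\<close>. Hence \<open>Q (Suc n)\<close> factors through
  \<open>(Q 1 \<otimes> Q n) \<Delta>\<close>.\<close>

lemma QS: assumes y: "y <: A" shows "Q (Suc n) (S n (tm2 A A (Q 1) (Q n) (\<Delta> y))) = Q (Suc n) y"
proof -
 let ?z = "S n (tm2 A A (Q 1) (Q n) (\<Delta> y))"
 have z: "?z <: A" using lin_cl[OF S(1)] lin_cl[OF QDelta_lin] y by blast
 have "tm2 A A (Q 1) (Q n) (\<Delta> (?z \<ominus> y)) = \<zero>\<^sub>(T A)"
  using lin_minus[OF QDelta_lin AM TAM z y] S(2)[OF y] lin_cl[OF QDelta_lin y] by simp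
 then have "?z \<ominus> y \<in> G (Suc n)" using GSuc z y by simp
 then have "Q (Suc n) ?z \<ominus> Q (Suc n) y = \<zero>"
  using Q_G lin_minus[OF Q_lin AM AM z y] by metis
 then show ?thesis using mod_eqI[OF AM Q_closed[OF z] Q_closed[OF y]] by simp
qed

abbreviation Q3 where "Q3 f g h == tmL A A [f, g, h]"

lemma Q3_lin: "f \<in> lin A A ==> g \<in> lin A A ==> h \<in> lin A A ==> Q3 f g h \<in> lin (T A) (T A)"
 by (rule tmL_lin[OF AM AM]) auto

text \<open>By \<open>QS\<close> a linear map recovers \<open>Q (Suc n) x\<close> from
  \<open>(Q 1 \<otimes> Q n) (\<Delta> x)\<close>; it is applied to the first two of the three
  factors.\<close>

lemma left_kernel:
 assumes h: "h \<in> lin A A" and t: "t \<in> tp A 2" and z: "Q3 (Q 1) (Q n) h (D 0 t) = \<zero>\<^sub>(T A)"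
 shows "tm2 A A (Q (Suc n)) h t = \<zero>\<^sub>(T A)"
proof -
 let ?g = "%w. te [Q (Suc n) (S n w)]"
 have g: "?g \<in> lin (tpow K A 2) (T A)"
  by (rule A_lin_tp[OF lin_o[OF A_tens1_lin lin_o[OF Q_lin S(1)]]])
 note gl = A_opat_lin[OF g, of 0] and q = Q3_lin[OF Q_lin Q_lin h, of 1 n]
 have "opat A 0 2 ?g (Q3 (Q 1) (Q n) h (D 0 t)) = tm2 A A (Q (Suc n)) h t"
 proof (rule A_lift2_eq[OF lin_o[OF gl lin_o[OF q D_lin]] tmA_lin[OF Q_lin h] TAM _ t])
  fix x y assume x: "x <: A" and y: "y <: A"
  have hy: "h y <: A" using lin_cl[OF h y] .
  let ?w = "tm2 A A (Q 1) (Q n) (\<Delta> x)"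
  have w: "?w \<in> tp A 2" by (rule tmA_tp[OF Q_lin Q_lin Delta_tp[OF x]])
  have "Q3 (Q 1) (Q n) h (D 0 (te [x, y])) = ?w \<star> te [h y]"
   using x y by (simp add: D0_2 tmA_L3[OF Q_lin Q_lin h] Delta_tp)
  moreover have "opat A 0 2 ?g (te [] \<star> (?w \<star> te [h y])) = te [] \<star> (?g ?w \<star> te [h y])"
   using w hy by (intro A_opat_mult[OF g] A_tens_tp) auto
  moreover have "?g ?w = te [Q (Suc n) x]" by (simp add: QS[OF x])
  ultimately show "opat A 0 2 ?g (Q3 (Q 1) (Q n) h (D 0 (te [x, y]))) = tm2 A A (Q (Suc n)) h (te [x, y])"
   using x y hy tp_T'[OF w] by (simp add: tmA_tens[OF Q_lin h] Q_closed te2[of "Q (Suc n) x"] TA_ua A_tens_Nil_mult)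
 qed
 then show ?thesis using z lin_zero[OF gl TAM TAM] by simp
qed

lemma right_kernel:
 assumes h: "h \<in> lin A A" and t: "t \<in> tp A 2" and z: "Q3 h (Q 1) (Q n) (D 1 t) = \<zero>\<^sub>(T A)"
 shows "tm2 A A h (Q (Suc n)) t = \<zero>\<^sub>(T A)"
proof -
 let ?g = "%w. te [Q (Suc n) (S n w)]"
 have g: "?g \<in> lin (tpow K A 2) (T A)"
  by (rule A_lin_tp[OF lin_o[OF A_tens1_lin lin_o[OF Q_lin S(1)]]])
 note gl = A_opat_lin[OF g, of 1] and q = Q3_lin[OF h Q_lin Q_lin, of 1 n]
 have "opat A 1 2 ?g (Q3 h (Q 1) (Q n) (D 1 t)) = tm2 A A h (Q (Suc n)) t"
 proof (rule A_lift2_eq[OF lin_o[OF gl lin_o[OF q D_lin]] tmA_lin[OF h Q_lin] TAM _ t])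
  fix y x assume y: "y <: A" and x: "x <: A"
  have hy: "h y <: A" using lin_cl[OF h y] .
  let ?w = "tm2 A A (Q 1) (Q n) (\<Delta> x)"
  have w: "?w \<in> tp A 2" by (rule tmA_tp[OF Q_lin Q_lin Delta_tp[OF x]])
  have "Q3 h (Q 1) (Q n) (D 1 (te [y, x])) = te [h y] \<star> ?w"
   using x y by (simp add: D1_2 tmA_L3[OF h Q_lin Q_lin] Delta_tp)
  moreover have "opat A 1 2 ?g (te [h y] \<star> (?w \<star> te [])) = te [h y] \<star> (?g ?w \<star> te [])"
   using w hy by (intro A_opat_mult[OF g] A_tens_tp) auto
  moreover have "?g ?w = te [Q (Suc n) x]" by (simp add: QS[OF x])
  ultimately show "opat A 1 2 ?g (Q3 h (Q 1) (Q n) (D 1 (te [y, x]))) = tm2 A A h (Q (Suc n)) (te [y, x])"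
   using x y hy tp_T'[OF w] by (simp add: tmA_tens[OF h Q_lin] Q_closed te2[of "h y"] TA_ua A_tens_Nil_mult)
 qed
 then show ?thesis using z lin_zero[OF gl TAM TAM] by simp
qed

text \<open>In terms of subspaces, \<Delta> maps \<open>G n\<close> into
  \<open>A \<otimes> G (n - i) + G i \<otimes> A\<close>; the recursive definition gives only
  \<open>i = 1\<close>. For larger \<open>i\<close> the induction hypothesis handles the second
  factor of \<Delta> x, and coassociativity moves the extra comultiplication to the first factor,
  where \<open>left_kernel\<close> merges \<open>Q 1\<close> and \<open>Q j\<close> into
  \<open>Q (Suc j)\<close>. For \<open>i = 0\<close> the roles of the two sides are
  exchanged.\<close>

lemma Delta_wedge: "x \<in> G n ==> i \<le> n ==> tm2 A A (Q i) (Q (n - i)) (\<Delta> x) = \<zero>\<^sub>(T A)"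
proof (induct n arbitrary: x i)
 case 0
 then show ?case using lin_zero[OF QDelta_lin AM TAM] by (simp add: G_0)
next
 case (Suc n)
 note x = G_simps(2)[OF Suc(2)]
 show ?case
 proof (cases i)
  case 0
  note q = lin_o[OF Q3_lin[OF Q_lin[of 0] Q_lin[of 1] Q_lin[of n]] D_lin[of 0]]
  have "Q3 (Q 0) (Q 1) (Q n) (D 0 (\<Delta> x)) \<in> {\<zero>\<^sub>(T A)}"
  proof (rule G_Delta_ind[OF Suc(2) q TAM sub_0[OF TAM]])
   show "Q3 (Q 0) (Q 1) (Q n) (D 0 (te [a, b])) \<in> {\<zero>\<^sub>(T A)}" if "a <: A" "b \<in> G n" for a b
    using that G_simps(2)[OF that(2)] lin_cl[OF QDelta_lin]
    by (simp add: D0_2 tmA_L3[OF Q_lin Q_lin Q_lin] Delta_tp Q_G A_tens1_zero TA_ua)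
   show "Q3 (Q 0) (Q 1) (Q n) (D 0 (te [a, b])) \<in> {\<zero>\<^sub>(T A)}" if "a \<in> G 1" "b <: A" for a b
    using that G_simps(2)[OF that(1)]
    by (simp add: D0_2 tmA_L3[OF Q_lin Q_lin Q_lin] Delta_tp Q2_Delta_G1 TA_ua Q_closed)
  qed
  then have "Q3 (Q 0) (Q 1) (Q n) (D 1 (\<Delta> x)) = \<zero>\<^sub>(T A)" using coassoc[OF x] by simp
  then show ?thesis using right_kernel[OF Q_lin Delta_tp[OF x]] 0 by simp
 next
  case (Suc j)
  note q = lin_o[OF Q3_lin[OF Q_lin[of 1] Q_lin[of j] Q_lin[of "n - j"]] D_lin[of 1]]
  have "Q3 (Q 1) (Q j) (Q (n - j)) (D 1 (\<Delta> x)) \<in> {\<zero>\<^sub>(T A)}"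
  proof (rule G_Delta_ind[OF \<open>x \<in> G (Suc n)\<close> q TAM sub_0[OF TAM]])
   show "Q3 (Q 1) (Q j) (Q (n - j)) (D 1 (te [a, b])) \<in> {\<zero>\<^sub>(T A)}" if "a <: A" "b \<in> G n" for a b
    using that G_simps(2)[OF that(2)] Suc.hyps[OF that(2), of j] Suc \<open>i \<le> Suc n\<close>
    by (simp add: D1_2 tmA_L3[OF Q_lin Q_lin Q_lin] Delta_tp TA_ua Q_closed)
   show "Q3 (Q 1) (Q j) (Q (n - j)) (D 1 (te [a, b])) \<in> {\<zero>\<^sub>(T A)}" if "a \<in> G 1" "b <: A" for a b
    using that G_simps(2)[OF that(1)] lin_cl[OF QDelta_lin]
    by (simp add: D1_2 tmA_L3[OF Q_lin Q_lin Q_lin] Delta_tp Q_G A_tens1_zero TA_ua)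
  qed
  then have "Q3 (Q 1) (Q j) (Q (n - j)) (D 0 (\<Delta> x)) = \<zero>\<^sub>(T A)" using coassoc[OF x] by simp
  then show ?thesis using left_kernel[OF Q_lin Delta_tp[OF x], of j] Suc by simp
 qed
qed

subsection \<open>Filtered tensors\<close>

text \<open>Step \<open>n\<close> of the tensor product filtration on the \<open>p\<close>-th tensor
  power.\<close>

definition Fil where "Fil p n = span (T A) {te vs |vs. length vs = p \<and> (\<exists>as. list_all2 (%v a. v \<in> F a) vs as \<and> sum_list as = n)}"

lemma list_all2_F: "list_all2 (%v a. v \<in> F a) vs as ==> set vs <<: A"
 by (induct rule: list_all2_induct) (auto simp: F_simps)

lemma Fil_gens: "{te vs |vs. length vs = p \<and> (\<exists>as. list_all2 (%v a. v \<in> F a) vs as \<and> sum_list as = n)} <<: (T A)"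
 using list_all2_F by (auto intro!: tens_closed')

lemma Fil_sub: "sub (Fil p n) (T A)"
 unfolding Fil_def by (rule span_sub[OF TAM Fil_gens])

lemma Fil_base: "list_all2 (%v a. v \<in> F a) vs as ==> te vs \<in> Fil (length vs) (sum_list as)"
 unfolding Fil_def by (rule span_base) auto

lemma Fil_base2: "x \<in> F i ==> y \<in> F j ==> te [x, y] \<in> Fil 2 (i + j)"
 using Fil_base[of "[x, y]" "[i, j]"] by simp

lemma Fil_induct [consumes 1, case_names tens zero add smult]:
 assumes "t \<in> Fil p n" "!!vs as. length vs = p ==> list_all2 (%v a. v \<in> F a) vs as ==> sum_list as = n ==> P (te vs)"
  "P \<zero>\<^sub>(T A)"
  "!!f g. f \<in> Fil p n ==> g \<in> Fil p n ==> P f ==> P g ==> P (f \<oplus>\<^sub>(T A) g)"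
  "!!a f. a <: K ==> f \<in> Fil p n ==> P f ==> P (a \<odot>\<^sub>(T A) f)"
 shows "P t"
proof -
 have "t \<in> Fil p n \<and> P t"
  using assms(1)[unfolded Fil_def] TAM Fil_gens
  by (induct rule: span_induct) (use assms sub_simps[OF TAM Fil_sub] Fil_base in auto)
 then show ?thesis ..
qed

lemma Fil_tp: "t \<in> Fil p n ==> t \<in> tp A p"
 by (induct rule: Fil_induct)
  (use sub_simps[OF TAM tp_sub[OF AM]] in \<open>auto intro!: A_tens_tp dest: list_all2_F\<close>)

lemma Fil_T: "t \<in> Fil p n ==> t <: (T A)" using Fil_tp tp_T' by blast

lemma Fil_image:
 assumes "f \<in> lin (T A) M" "module K M" "sub Z M" "t \<in> Fil p n"
  "!!vs as. length vs = p ==> list_all2 (%v a. v \<in> F a) vs as ==> sum_list as = n ==> f (te vs) \<in> Z"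
 shows "f t \<in> Z"
 using assms(4) by (induct rule: Fil_induct) (use assms in \<open>auto simp: lin_simps sub_simps Fil_T\<close>)

lemma Fil_image2:
 assumes "f \<in> lin (T A) M" "module K M" "sub Z M" "t \<in> Fil 2 n"
  "!!x y i j. x \<in> F i ==> y \<in> F j ==> i + j = n ==> f (te [x, y]) \<in> Z"
 shows "f t \<in> Z"
proof (rule Fil_image[OF assms(1-4)])
 fix vs as assume "length vs = 2" "list_all2 (%v a. v \<in> F a) vs as" "sum_list as = n"
 then show "f (te vs) \<in> Z" using assms(5) by (auto simp: len2 list_all2_Cons1)
qed

lemma Fil_mult: "s \<in> Fil p m ==> t \<in> Fil q n ==> s \<star> t \<in> Fil (p + q) (m + n)"
proof (induct rule: Fil_induct)
 case (tens us as)
 from tens(4) show ?case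
 proof (induct rule: Fil_induct)
  case (tens vs bs)
  then have "te (us @ vs) \<in> Fil (length (us @ vs)) (sum_list (as @ bs))"
   using \<open>list_all2 _ us as\<close> by (intro Fil_base list_all2_appendI)
  then show ?case using tens \<open>length us = p\<close> \<open>sum_list as = m\<close> list_all2_F[OF \<open>list_all2 _ us as\<close>] list_all2_F[OF tens(2)]
   by (simp add: A_tens_append)
 qed (use list_all2_F[OF tens(2)] sub_simps[OF TAM Fil_sub] in \<open>auto simp: TA_ua Fil_T\<close>)
qed (use sub_simps[OF TAM Fil_sub] in \<open>auto simp: TA_ua Fil_T\<close>)

lemma tprod_Fil: "t \<in> tprod K A (F i) (F j) ==> t \<in> Fil 2 (i + j)"
 by (rule A_tprod_image[OF F_simps(1) F_simps(1) lin_id TAM Fil_sub Fil_base2])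

text \<open>A decomposition into a sum is extracted from the family of wedge conditions. The
  differences \<open>R (Suc i) - R i\<close> have values in \<open>F i\<close>; applied to the first
  factor of \<Delta> x they force the second factor into \<open>F (n - i)\<close>, and they add up
  to \<open>R (Suc n)\<close>. What remains is
  \<open>(Q (Suc n) \<otimes> Q 0) (\<Delta> x)\<close>, which vanishes.\<close>

lemma Delta_Fil: assumes x: "x \<in> F n" shows "\<Delta> x \<in> Fil 2 n"
proof -
 let ?t = "\<Delta> x"
 have xG: "x \<in> G (Suc n)" using x by (simp add: G_Suc)
 note xA = F_simps(2)[OF x]
 note t = Delta_tp[OF xA]
 have t': "?t \<in> tprod K A (carrier A) (carrier A)" using t by (simp add: tprod_full)
 note RI = tmA_lin[OF R_lin lin_id] tmA_tens[OF R_lin lin_id]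
 have w: "tm2 A A (Q i) (Q (Suc n - i)) ?t = \<zero>\<^sub>(T A)" if "i \<le> Suc n" for i
  using Delta_wedge[OF xG that] .
 have Q0: "Q 0 y = y" if "y <: A" for y
  using that R_mem[of y 0] by (simp add: Q_def G_0 mod_minus)
 have Rc: "y <: A ==> R i y <: A" for i y by (rule lin_cl[OF R_lin])
 have "i \<le> Suc n ==> tm2 A A (R i) (%x. x) ?t \<in> Fil 2 n" for i
 proof (induct i)
  case 0
  have "tm2 A A (R 0) (%x. x) ?t \<in> {\<zero>\<^sub>(T A)}"
  proof (rule A_tprod_image[OF subset_refl subset_refl RI(1) TAM sub_0[OF TAM] _ t'])
   fix x y assume "x <: A" "y <: A"
   then show "tm2 A A (R 0) (%x. x) (te [x, y]) \<in> {\<zero>\<^sub>(T A)}"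
    using R_mem[of x 0] by (simp add: RI(2) G_0 A_tens2_zero)
  qed
  then show ?case using sub_zero[OF TAM Fil_sub] by simp
 next
  case (Suc i)
  define p where "p = (%x. R (Suc i) x \<ominus> R i x)"
  have pl: "p \<in> lin A A" unfolding p_def by (intro lin_sub R_lin AM)
  have pF: "p x \<in> F i" if "x <: A" for x
   using R_mem[OF that, of "Suc i"] R_mem[OF that, of i] GSucG[of _ i] G_simps(7)[of _ "Suc i"]
   by (simp add: p_def G_Suc)
  have pG: "p x = \<zero>" if "x \<in> G i" for x
   using that R_id GSucG G_simps(2)[OF that] by (simp add: p_def)
  have pQ: "p (Q i x) = p x" if "x <: A" for x
   using pG[OF R_mem[OF that, of i]] lin_minus[OF pl AM AM that Rc[OF that]] that lin_cl[OF pl that]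
   by (simp add: Q_def mod_minus)
  have lin1: "(%t. tm2 A A (R i) (%x. x) t \<oplus>\<^sub>(T A) tm2 A A p (%x. x) t) \<in> lin (T A) (T A)"
   by (intro lin_plus TAM tm2_lin AM R_lin lin_id pl)
  have s: "tm2 A A (R (Suc i)) (%x. x) ?t = tm2 A A (R i) (%x. x) ?t \<oplus>\<^sub>(T A) tm2 A A p (%x. x) ?t"
  proof (rule A_lift2_eq[OF RI(1) lin1 TAM _ t])
   fix x y assume xy: "x <: A" "y <: A"
   have "te [R (Suc i) x, y] = te [R i x \<oplus> p x, y]"
    using xy Rc by (simp add: p_def mod_minus mod_lcomm[OF AM, of "R i x"] mod_rzero[OF AM])
   then show "tm2 A A (R (Suc i)) (%x. x) (te [x, y]) = tm2 A A (R i) (%x. x) (te [x, y]) \<oplus>\<^sub>(T A) tm2 A A p (%x. x) (te [x, y])"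
    using xy Rc lin_cl[OF pl] by (simp add: RI(2) tmA_tens[OF pl lin_id] A_tens2_simps)
  qed
  let ?R' = "R (Suc n - i)"
  \<comment> \<open>\<open>p\<close> vanishes on \<open>G i\<close>, so it factors through
    \<open>Q i\<close>, and the wedge condition applies.\<close>
  have z: "tm2 A A p (Q (Suc n - i)) ?t = \<zero>\<^sub>(T A)"
  proof -
   have "tm2 A A p (%x. x) (tm2 A A (Q i) (Q (Suc n - i)) ?t) = tm2 A A (%x. p (Q i x)) (%x. Q (Suc n - i) x) ?t"
    by (rule tmA_comp[OF AM Q_lin Q_lin pl lin_id t])
   also have "\<dots> = tm2 A A p (Q (Suc n - i)) ?t"
    by (rule A_lift2_eq[OF tmA_lin[OF lin_o[OF pl Q_lin] Q_lin] tmA_lin[OF pl Q_lin] TAM _ t])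
     (simp add: tmA_tens[OF lin_o[OF pl Q_lin] Q_lin] tmA_tens[OF pl Q_lin] pQ)
   finally show ?thesis using w[of i] Suc(2) lin_zero[OF tmA_lin[OF pl lin_id] TAM TAM] by simp
  qed
  have lin2: "(%t. tm2 A A p ?R' t \<oplus>\<^sub>(T A) tm2 A A p (Q (Suc n - i)) t) \<in> lin (T A) (T A)"
   by (intro lin_plus TAM tm2_lin AM R_lin Q_lin pl)
  have "tm2 A A p (%x. x) ?t = tm2 A A p ?R' ?t \<oplus>\<^sub>(T A) tm2 A A p (Q (Suc n - i)) ?t"
  proof (rule A_lift2_eq[OF tmA_lin[OF pl lin_id] lin2 TAM _ t])
   fix x y assume xy: "x <: A" "y <: A"
   have "te [p x, y] = te [p x, ?R' y \<oplus> Q (Suc n - i) y]"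
    using xy Rc by (simp add: Q_def mod_minus mod_lcomm[OF AM, of "?R' y"] mod_rzero[OF AM])
   then show "tm2 A A p (%x. x) (te [x, y]) = tm2 A A p ?R' (te [x, y]) \<oplus>\<^sub>(T A) tm2 A A p (Q (Suc n - i)) (te [x, y])"
    using xy Rc lin_cl[OF pl] Q_closed
    by (simp add: tmA_tens[OF pl] lin_id R_lin Q_lin A_tens2_simps)
  qed
  then have e: "tm2 A A p (%x. x) ?t = tm2 A A p ?R' ?t"
   using z lin_cl[OF tmA_lin[OF pl R_lin] tp_T'[OF t]] by simp
  have "tm2 A A p ?R' ?t \<in> tprod K A (F i) (F (n - i))"
  proof (rule tmA_tprod[OF pl R_lin subset_refl subset_refl F_simps(1) F_simps(1) _ _ t'])
   show "R (Suc n - i) y \<in> F (n - i)" if "y <: A" for y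
    using R_mem[OF that, of "Suc n - i"] Suc(2) G_Suc[of "n - i"] by (simp add: Suc_diff_le)
  qed (rule pF)
  then have "tm2 A A p (%x. x) ?t \<in> Fil 2 n" using tprod_Fil[of _ i "n - i"] Suc(2) e by simp
  then show ?case using s Suc sub_add[OF TAM Fil_sub] by simp
 qed
 from this[of "Suc n"] have a: "tm2 A A (R (Suc n)) (%x. x) ?t \<in> Fil 2 n" by simp
 have lin2: "(%t. tm2 A A (R (Suc n)) (%x. x) t \<oplus>\<^sub>(T A) tm2 A A (Q (Suc n)) (Q 0) t) \<in> lin (T A) (T A)"
  by (intro lin_plus TAM tm2_lin AM R_lin Q_lin lin_id)
 have "?t = tm2 A A (R (Suc n)) (%x. x) ?t \<oplus>\<^sub>(T A) tm2 A A (Q (Suc n)) (Q 0) ?t"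
 proof (rule A_lift2_eq[OF lin_id lin2 TAM _ t])
  fix x y assume xy: "x <: A" "y <: A"
  have e: "R (Suc n) x \<oplus> Q (Suc n) x = x"
   using xy Rc by (simp add: Q_def mod_minus mod_lcomm[OF AM, of "R (Suc n) x"] mod_rzero[OF AM])
  have "tm2 A A (R (Suc n)) (%x. x) (te [x, y]) \<oplus>\<^sub>(T A) tm2 A A (Q (Suc n)) (Q 0) (te [x, y]) = te [R (Suc n) x \<oplus> Q (Suc n) x, y]"
   using xy Rc Q_closed by (simp add: RI(2) Q2_tens Q0 tens2_simps(1)[OF AM, of "R (Suc n) x" "Q (Suc n) x" y])
  then show "te [x, y] = tm2 A A (R (Suc n)) (%x. x) (te [x, y]) \<oplus>\<^sub>(T A) tm2 A A (Q (Suc n)) (Q 0) (te [x, y])"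
   unfolding e by (rule sym)
 qed
 then have "?t = tm2 A A (R (Suc n)) (%x. x) ?t"
  using w[of "Suc n"] lin_cl[OF RI(1) tp_T'[OF t]] by simp
 then show ?thesis using a by simp
qed

end

section \<open>Positions of the braiding and of the product in a braided algebra\<close>

context braided_alg
begin

lemma C0_ap: "w \<in> tp A 2 ==> s <: (T A) ==> C 0 (w \<star> s) = c w \<star> s"
 using A_opat_right[OF c_lin, of w 2 s 0] A_opat_0[OF c_lin] by simp

lemma N0_ap: "w \<in> tp A 2 ==> s <: (T A) ==> N 0 (w \<star> s) = nabla K A w \<star> s"
 using A_opat_right[OF nabla_lin', of w 2 s 0] A_opat_0[OF nabla_lin'] by simp

lemma C_0: "w \<in> tp A 2 ==> C 0 w = c w" and N_0: "w \<in> tp A 2 ==> N 0 w = nabla K A w"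
 using A_opat_0[OF c_lin] A_opat_0[OF nabla_lin'] by auto

lemma C_shift: "u \<in> tp A i ==> t <: (T A) ==> C (i + k) (u \<star> t) = u \<star> C k t"
 and N_shift: "u \<in> tp A i ==> t <: (T A) ==> N (i + k) (u \<star> t) = u \<star> N k t"
 using A_opat_left[OF c_lin, of u i t k] A_opat_left[OF nabla_lin', of u i t k] by auto

lemma C1_ap: "a <: A ==> w \<in> tp A 2 ==> s <: (T A) ==> C 1 (te [a] \<star> (w \<star> s)) = te [a] \<star> (c w \<star> s)"
 using C_shift[of "te [a]" 1 "w \<star> s" 0] by (simp add: C0_ap TA_ua tp_T')

lemma C1_ap': "a <: A ==> w \<in> tp A 2 ==> C 1 (te [a] \<star> w) = te [a] \<star> c w"
 using C_shift[of "te [a]" 1 w 0] by (simp add: C_0 tp_T')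

lemma N1_ap': "a <: A ==> w \<in> tp A 2 ==> N 1 (te [a] \<star> w) = te [a] \<star> nabla K A w"
 using N_shift[of "te [a]" 1 w 0] by (simp add: N_0 tp_T')

lemma te_prods:
 "a <: A ==> b <: A ==> te [a] \<star> te [b] = te [a, b]"
 "a <: A ==> b <: A ==> d <: A ==> te [a] \<star> te [b, d] = te [a, b, d]"
 "a <: A ==> b <: A ==> d <: A ==> te [a, b] \<star> te [d] = te [a, b, d]"
 using tens_append[OF AM, of "[a]" "[b]"] tens_append[OF AM, of "[a]" "[b, d]"] tens_append[OF AM, of "[a, b]" "[d]"]
 by simp_all

lemma te3: "a <: A ==> b <: A ==> d <: A ==> te [a] \<star> te [b, d] = te [a, b] \<star> te [d]"
 by (simp add: te_prods)

lemma C0_3: "a <: A ==> b <: A ==> d <: A ==> C 0 (te [a] \<star> te [b, d]) = c (te [a, b]) \<star> te [d]"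
 by (simp add: te3 C0_ap)

lemma NN_ap:
 assumes "p <: A" "x <: A" "y <: A" "u <: A"
 shows "N 0 (N 2 (te [p] \<star> (te [x, y] \<star> te [u]))) = te [p \<otimes> x, y \<otimes> u]"
proof -
 have "te [p] \<star> (te [x, y] \<star> te [u]) = te [p, x] \<star> te [y, u]"
  using assms tens_append[OF AM, of "[p]" "[x, y, u]"] tens_append[OF AM, of "[x, y]" "[u]"]
   tens_append[OF AM, of "[p, x]" "[y, u]"] by simp
 moreover have "N (2 + 0) (te [p, x] \<star> te [y, u]) = te [p, x] \<star> te [y \<otimes> u]"
  using assms by (subst N_shift) (auto simp: N_0 nabla_tens')
 moreover have "N 0 (te [p, x] \<star> te [y \<otimes> u]) = te [p \<otimes> x, y \<otimes> u]"
  using assms by (subst N0_ap) (auto simp: nabla_tens' A_ua te_prods)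
 ultimately show ?thesis by simp
qed

end

section \<open>The comultiplication of a braided commutator\<close>

context symm_bialg
begin

text \<open>The product of the braided algebra \<open>A \<otimes> A\<close>; positions count from
  zero, so \<open>C 1\<close> braids the two inner factors.\<close>

definition NC where "NC s t = N 0 (N 2 (C 1 (s \<star> t)))"

lemma NC_lin: "t <: (T A) ==> (%s. NC s t) \<in> lin (T A) (T A)" "s <: (T A) ==> NC s \<in> lin (T A) (T A)"
 unfolding NC_def
 using lin_o[OF N_lin lin_o[OF N_lin lin_o[OF C_lin lin_rmult[OF TA_ualg lin_id]]]]
  lin_o[OF N_lin lin_o[OF N_lin lin_o[OF C_lin lin_lmult[OF TA_ualg lin_id]]]] by auto

lemma te_mid: "p <: A ==> q <: A ==> r <: A ==> u <: A ==>
  te [p, q] \<star> te [r, u] = te [p] \<star> (te [q, r] \<star> te [u])"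
 using tens_append[OF AM, of "[p]" "[q, r, u]"] tens_append[OF AM, of "[q, r]" "[u]"]
   tens_append[OF AM, of "[p, q]" "[r, u]"] by simp

lemma C1_mid: "p <: A ==> q <: A ==> r <: A ==> u <: A ==>
  C 1 (te [p, q] \<star> te [r, u]) = te [p] \<star> (c (te [q, r]) \<star> te [u])"
 by (simp add: te_mid C1_ap)

lemma Delta_NC: "x <: A ==> y <: A ==> \<Delta> (x \<otimes> y) = NC (\<Delta> x) (\<Delta> y)"
 by (simp add: NC_def Delta_mult)

text \<open>\<open>DD\<close> is \<open>\<Delta> \<otimes> \<Delta>\<close>.\<close>

definition DD where "DD t = D 2 (D 0 t)"

lemma DD_lin: "DD \<in> lin (T A) (T A)"
 unfolding DD_def by (rule lin_o[OF D_lin D_lin])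

lemma DD_tens: "x <: A ==> y <: A ==> DD (te [x, y]) = \<Delta> x \<star> \<Delta> y"
proof -
 assume xy: "x <: A" "y <: A"
 have "D (2 + 0) (\<Delta> x \<star> te [y]) = \<Delta> x \<star> D 0 (te [y])"
  using xy by (intro A_opat_left[OF l1_lin] Delta_tp) auto
 moreover have "D 0 (te [y]) = \<Delta> y" using A_opat_0[OF l1_lin, of "te [y]"] xy l1_tens by simp
 ultimately show ?thesis unfolding DD_def using xy by (simp add: D0_2)
qed

lemma Delta_mu: "t \<in> tp A 2 ==> \<Delta> (mu t) = N 0 (N 2 (C 1 (DD t)))"
proof (rule A_lift2_eq[OF lin_o[OF Delta_lin mu_lin] lin_o[OF N_lin lin_o[OF N_lin lin_o[OF C_lin DD_lin]]] TAM])
 fix x y assume "x <: A" "y <: A"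
 then show "\<Delta> (mu (te [x, y])) = N 0 (N 2 (C 1 (DD (te [x, y]))))"
  by (simp add: mu_tens DD_tens Delta_mult)
qed

lemma D_shifts:
 assumes s: "s \<in> tp A 3"
 shows "D 2 (C 1 s) = C 1 (C 2 (D 1 s))" "D 1 (C 0 s) = C 0 (C 1 (D 0 s))"
proof -
 have 1: "(%s. D 2 (C 1 s)) \<in> lin (tpow K A 3) (T A)" "(%s. C 1 (C 2 (D 1 s))) \<in> lin (tpow K A 3) (T A)"
  "(%s. D 1 (C 0 s)) \<in> lin (tpow K A 3) (T A)" "(%s. C 0 (C 1 (D 0 s))) \<in> lin (tpow K A 3) (T A)"
  by (intro A_lin_tp lin_o[OF D_lin C_lin] lin_o[OF C_lin lin_o[OF C_lin D_lin]])+

 have t3: "D 0 w \<in> tp A 3" if "w \<in> tp A 2" for w using D_tp[OF that, of 0] by simp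
 show "D 2 (C 1 s) = C 1 (C 2 (D 1 s))"
 proof (rule A_tp_lin_eq[OF 1(1,2) TAM _ s])
  fix vs assume "length vs = 3" "set vs <<: A"
  then obtain a b d where vs: "vs = [a, b, d]" and abd: "a <: A" "b <: A" "d <: A"
   unfolding len3 by auto
  let ?w = "te [b, d]"
  have w: "?w \<in> tp A 2" using abd by simp
  have e: "te vs = te [a] \<star> ?w" using abd vs by (simp add: te_prods)
  have "D 2 (C 1 (te vs)) = D (1 + 1) (te [a] \<star> c ?w)" unfolding e using abd w by (simp add: C1_ap')
  also have "\<dots> = te [a] \<star> D 1 (c ?w)"
   using abd tp_T'[OF c_tp[OF w]] by (intro A_opat_left[OF l1_lin]) auto
  also have "\<dots> = te [a] \<star> C 0 (C 1 (D 0 ?w))" using D1c[OF w] by simp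
  also have "\<dots> = C (1 + 0) (te [a] \<star> C 1 (D 0 ?w))"
   using abd tp_T'[OF C_tp[OF t3[OF w], of 1]] by (intro C_shift[symmetric]) auto
  also have "te [a] \<star> C 1 (D 0 ?w) = C (1 + 1) (te [a] \<star> D 0 ?w)"
   using abd tp_T'[OF t3[OF w]] by (intro C_shift[symmetric]) auto
  also have "te [a] \<star> D 0 ?w = D (1 + 0) (te vs)"
   unfolding e using abd tp_T'[OF w] by (intro A_opat_left[OF l1_lin, symmetric]) auto
  finally show "D 2 (C 1 (te vs)) = C 1 (C 2 (D 1 (te vs)))" by simp
 qed
 show "D 1 (C 0 s) = C 0 (C 1 (D 0 s))"
 proof (rule A_tp_lin_eq[OF 1(3,4) TAM _ s])
  fix vs assume "length vs = 3" "set vs <<: A"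
  then obtain a b d where vs: "vs = [a, b, d]" and abd: "a <: A" "b <: A" "d <: A"
   unfolding len3 by auto
  let ?w = "te [a, b]"
  have w: "?w \<in> tp A 2" using abd by simp
  have e: "te vs = ?w \<star> te [d]" using abd vs by (simp add: te_prods)
  have d: "te [d] <: (T A)" using abd by simp
  have "D 1 (C 0 (te vs)) = D 1 (c ?w \<star> te [d])" unfolding e using abd w by (simp add: C0_ap)
  also have "\<dots> = D 1 (c ?w) \<star> te [d]"
   by (rule A_opat_right[OF l1_lin c_tp[OF w] d]) simp
  also have "\<dots> = C 0 (C 1 (D 0 ?w)) \<star> te [d]" using D1c[OF w] by simp
  also have "\<dots> = C 0 (C 1 (D 0 ?w) \<star> te [d])"
   by (rule A_opat_right[OF c_lin C_tp[OF t3[OF w]] d, symmetric]) simp_all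
  also have "C 1 (D 0 ?w) \<star> te [d] = C 1 (D 0 ?w \<star> te [d])"
   by (rule A_opat_right[OF c_lin t3[OF w] d, symmetric]) simp_all
  also have "D 0 ?w \<star> te [d] = D 0 (te vs)"
   unfolding e by (rule A_opat_right[OF l1_lin w d, symmetric]) simp_all
  finally show "D 1 (C 0 (te vs)) = C 0 (C 1 (D 0 (te vs)))" .
 qed
qed

lemma DD_tp: "t \<in> tp A 2 ==> DD t \<in> tp A 4"
 unfolding DD_def using D_tp[of "D 0 t" 3 2] D_tp[of t 2 0] by simp

text \<open>The four crossings on the right form the braiding of \<open>A \<otimes> A\<close>. They
  arise by comultiplying one factor after the other: each comultiplication passes through a crossing
  and doubles it.\<close>

lemma DD_c: assumes t: "t \<in> tp A 2" shows "DD (c t) = C 1 (C 2 (C 0 (C 1 (DD t))))"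
proof -
 have t3: "D 1 t \<in> tp A 3" "D 0 t \<in> tp A 3" using D_tp[OF t, of 0] D_tp[OF t, of 1] by simp_all
 have DDe: "D 0 (D 1 t) = DD t"
 proof (rule A_lift2_eq[OF lin_o[OF D_lin D_lin] DD_lin TAM _ t])
  fix x y assume "x <: A" "y <: A"
  then show "D 0 (D 1 (te [x, y])) = DD (te [x, y])"
   by (simp add: D1_2 D0_ap DD_tens)
 qed
 have "DD (c t) = D 2 (C 1 (C 0 (D 1 t)))" unfolding DD_def D0c[OF t] ..
 also have "\<dots> = C 1 (C 2 (D 1 (C 0 (D 1 t))))" using C_tp[OF t3(1), of 0] by (intro D_shifts) simp
 also have "\<dots> = C 1 (C 2 (C 0 (C 1 (D 0 (D 1 t)))))" using D_shifts(2)[OF t3(1)] by simp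
 finally show ?thesis unfolding DDe .
qed

definition comm where "comm x y = x \<otimes> y \<ominus> mu (c (te [x, y]))"

lemma comm_closed: "x <: A ==> y <: A ==> comm x y <: A"
 unfolding comm_def using lin_cl[OF mu_lin] tp_T'[OF c_closed] by (simp add: A_ua)

text \<open>How far \<open>\<nabla> \<otimes> \<nabla>\<close> is from being invariant under the braiding of the first and of the last two factors.\<close>

definition Phi where "Phi s = N 0 (N 2 s) \<ominus>\<^sub>(T A) N 0 (N 2 (C 2 (C 0 s)))"

lemma Phi_lin: "Phi \<in> lin (T A) (T A)"
 unfolding Phi_def by (intro lin_sub TAM lin_o[OF N_lin N_lin]
  lin_o[OF N_lin lin_o[OF N_lin lin_o[OF C_lin C_lin]]])

text \<open>\<Delta> is multiplicative and compatible with the braidings. The outer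
  \<open>C 1\<close> in the braiding of \<open>A \<otimes> A\<close> cancels against the
  \<open>C 1\<close> in its product, so only the crossings of the first two and of the last two
  factors are left.\<close>

lemma Delta_comm:
 assumes x: "x <: A" and y: "y <: A"
 shows "\<Delta> (comm x y) = Phi (C 1 (\<Delta> x \<star> \<Delta> y))"
proof -
 have t: "te [x, y] \<in> tp A 2" using x y by simp
 have d4: "C 1 (DD (te [x, y])) \<in> tp A 4" using C_tp[OF DD_tp[OF t], of 1] by simp
 have i4: "C 2 (C 0 (C 1 (DD (te [x, y])))) \<in> tp A 4" using C_tp[OF C_tp[OF d4, of 0], of 2] by simp
 have "\<Delta> (mu (c (te [x, y]))) = N 0 (N 2 (C 1 (DD (c (te [x, y])))))"
  by (rule Delta_mu[OF c_tp[OF t]])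
 also have "C 1 (DD (c (te [x, y]))) = C 2 (C 0 (C 1 (DD (te [x, y]))))"
  unfolding DD_c[OF t] using CC[OF i4, of 1] by simp
 finally have 1: "\<Delta> (mu (c (te [x, y]))) = N 0 (N 2 (C 2 (C 0 (C 1 (DD (te [x, y]))))))" .
 show ?thesis
  unfolding comm_def Phi_def
  using lin_minus[OF Delta_lin AM TAM, of "x \<otimes> y" "mu (c (te [x, y]))"] 1 x y
   lin_cl[OF mu_lin tp_T'[OF c_tp[OF t]]]
  by (simp add: A_ua Delta_mult DD_tens)
qed

text \<open>The identity \<open>a \<otimes> b - a' \<otimes> b' = (a - a') \<otimes> b + a'
  \<otimes> (b - b')\<close>, where both differences are commutators.\<close>

lemma Phi_tens:
 assumes c: "p <: A" "r <: A" "q <: A" "u <: A"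
 shows "Phi (te [p] \<star> (te [r, q] \<star> te [u])) =
  te [comm p r, q \<otimes> u] \<oplus>\<^sub>(T A) te [mu (c (te [p, r])), comm q u]"
proof -
 let ?a = "p \<otimes> r" and ?b = "q \<otimes> u" and ?a' = "mu (c (te [p, r]))" and ?b' = "mu (c (te [q, u]))"
 have cl: "?a <: A" "?b <: A" "?a' <: A" "?b' <: A"
  using c lin_cl[OF mu_lin tp_T'[OF c_closed]] by (simp_all add: A_ua)
 have w: "c (te [p, r]) \<in> tp A 2" "c (te [q, u]) \<in> tp A 2" using c by simp_all
 have e: "te [p] \<star> (te [r, q] \<star> te [u]) = te [p, r] \<star> te [q, u]"
  using te_mid c by simp
 have "C 0 (te [p, r] \<star> te [q, u]) = c (te [p, r]) \<star> te [q, u]"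
  using c by (simp add: C0_ap)
 moreover have "C (2 + 0) (c (te [p, r]) \<star> te [q, u]) = c (te [p, r]) \<star> C 0 (te [q, u])"
  using c w by (intro C_shift) auto
 moreover have "N (2 + 0) (c (te [p, r]) \<star> c (te [q, u])) = c (te [p, r]) \<star> N 0 (c (te [q, u]))"
  using w tp_T' by (intro N_shift) auto
 moreover have "N 0 (c (te [p, r]) \<star> te [?b']) = te [?a'] \<star> te [?b']"
  using w cl by (simp add: N0_ap nabla_mu)
 ultimately have "N 0 (N 2 (C 2 (C 0 (te [p, r] \<star> te [q, u])))) = te [?a', ?b']"
  using c w cl by (simp add: C_0 N_0 nabla_mu te_prods)
 then have "Phi (te [p] \<star> (te [r, q] \<star> te [u])) = te [?a, ?b] \<ominus>\<^sub>(T A) te [?a', ?b']"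
  unfolding Phi_def NN_ap[OF c] unfolding e by simp
 also have "\<dots> = te [comm p r, ?b] \<oplus>\<^sub>(T A) te [?a', comm q u]"
 proof -
  have "te [comm p r, ?b] = te [?a, ?b] \<ominus>\<^sub>(T A) te [?a', ?b]"
   using lin_minus[OF A_tens2_lin(1) AM TAM] cl by (simp add: comm_def)
  moreover have "te [?a', comm q u] = te [?a', ?b] \<ominus>\<^sub>(T A) te [?a', ?b']"
   using lin_minus[OF A_tens2_lin(2) AM TAM] cl by (simp add: comm_def)
  ultimately show ?thesis using cl by (simp add: mod_minus mod_assoc)
 qed
 finally show ?thesis .
qed

end

section \<open>Compatibility of the coradical filtration with the braiding and the product\<close>

context irr_bialg
begin

lemma tprod_rightI:
 assumes t: "t \<in> tp A 2" and z: "tm2 A A (%x. x) (Q n) t = \<zero>\<^sub>(T A)"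
 shows "t \<in> tprod K A (carrier A) (G n)"
proof -
 have Rc: "y <: A ==> R i y <: A" for i y by (rule lin_cl[OF R_lin])
 have L: "(%t. tm2 A A (%x. x) (R n) t \<oplus>\<^sub>(T A) tm2 A A (%x. x) (Q n) t) \<in> lin (T A) (T A)"
  by (intro lin_plus TAM tm2_lin AM R_lin Q_lin lin_id)
 have "t = tm2 A A (%x. x) (R n) t \<oplus>\<^sub>(T A) tm2 A A (%x. x) (Q n) t"
 proof (rule A_lift2_eq[OF lin_id L TAM _ t])
  fix x y assume xy: "x <: A" "y <: A"
  have e: "R n y \<oplus> Q n y = y"
   using xy Rc by (simp add: Q_def mod_minus mod_lcomm[OF AM, of "R n y"] mod_rzero[OF AM])
  have "tm2 A A (%x. x) (R n) (te [x, y]) \<oplus>\<^sub>(T A) tm2 A A (%x. x) (Q n) (te [x, y]) = te [x, R n y \<oplus> Q n y]"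
   using xy Rc Q_closed
   by (simp add: tmA_tens[OF lin_id] R_lin Q_lin tens2_simps(2)[OF AM, of x "R n y" "Q n y"])
  then show "te [x, y] = tm2 A A (%x. x) (R n) (te [x, y]) \<oplus>\<^sub>(T A) tm2 A A (%x. x) (Q n) (te [x, y])"
   unfolding e by (rule sym)
 qed
 also have "\<dots> = tm2 A A (%x. x) (R n) t"
  using z lin_cl[OF tmA_lin[OF lin_id R_lin] tp_T'[OF t]] by simp
 also have "\<dots> \<in> tprod K A (carrier A) (G n)"
 proof (rule tmA_tprod[OF lin_id R_lin subset_refl subset_refl subset_refl G_simps(1)])
  show "t \<in> tprod K A (carrier A) (carrier A)" using t by (simp add: tprod_full)
 qed (use R_mem in auto)
 finally show ?thesis .
qed

lemma tprod_leftI: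
 assumes t: "t \<in> tp A 2" and z: "tm2 A A (Q n) (%x. x) t = \<zero>\<^sub>(T A)"
 shows "t \<in> tprod K A (G n) (carrier A)"
proof -
 have Rc: "y <: A ==> R i y <: A" for i y by (rule lin_cl[OF R_lin])
 have L: "(%t. tm2 A A (R n) (%x. x) t \<oplus>\<^sub>(T A) tm2 A A (Q n) (%x. x) t) \<in> lin (T A) (T A)"
  by (intro lin_plus TAM tm2_lin AM R_lin Q_lin lin_id)
 have "t = tm2 A A (R n) (%x. x) t \<oplus>\<^sub>(T A) tm2 A A (Q n) (%x. x) t"
 proof (rule A_lift2_eq[OF lin_id L TAM _ t])
  fix y x assume xy: "y <: A" "x <: A"
  have e: "R n y \<oplus> Q n y = y"
   using xy Rc by (simp add: Q_def mod_minus mod_lcomm[OF AM, of "R n y"] mod_rzero[OF AM])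
  have "tm2 A A (R n) (%x. x) (te [y, x]) \<oplus>\<^sub>(T A) tm2 A A (Q n) (%x. x) (te [y, x]) = te [R n y \<oplus> Q n y, x]"
   using xy Rc Q_closed
   by (simp add: tmA_tens[OF _ lin_id] R_lin Q_lin tens2_simps(1)[OF AM, of "R n y" "Q n y" x])
  then show "te [y, x] = tm2 A A (R n) (%x. x) (te [y, x]) \<oplus>\<^sub>(T A) tm2 A A (Q n) (%x. x) (te [y, x])"
   unfolding e by (rule sym)
 qed
 also have "\<dots> = tm2 A A (R n) (%x. x) t"
  using z lin_cl[OF tmA_lin[OF R_lin lin_id] tp_T'[OF t]] by simp
 also have "\<dots> \<in> tprod K A (G n) (carrier A)"
 proof (rule tmA_tprod[OF R_lin lin_id subset_refl subset_refl G_simps(1) subset_refl])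
  show "t \<in> tprod K A (carrier A) (carrier A)" using t by (simp add: tprod_full)
 qed (use R_mem in auto)
 finally show ?thesis .
qed

lemma c_scal:
 assumes "a \<in> G 1" "p <: A"
 shows "\<exists>k\<in>carrier K. a = k \<odot> \<one> \<and> c (te [a, p]) = k \<odot>\<^sub>(T A) te [p, \<one>] \<and> c (te [p, a]) = k \<odot>\<^sub>(T A) te [\<one>, p]"
proof -
 obtain k where k: "k <: K" "a = k \<odot> \<one>" using assms G1 by blast
 then show ?thesis using assms one_A
  by (intro bexI[of _ k]) (simp_all add: A_tens2_simps c_simps c_one)
qed

text \<open>Whether a factor of the braided tensor lies in \<open>G (Suc n)\<close> is tested after
  comultiplying this factor, by \<open>right_kernel\<close> and \<open>left_kernel\<close>. The
  braiding turns this into the comultiplication of \<open>x\<close>, whose summands in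
  \<open>A \<otimes> G n\<close> are covered by the induction hypothesis and those in
  \<open>G 1 \<otimes> A\<close> by the axioms for the unit.\<close>

lemma c_categorical:
 "t \<in> tprod K A (G n) (carrier A) ==> c t \<in> tprod K A (carrier A) (G n)"
 "t \<in> tprod K A (carrier A) (G n) ==> c t \<in> tprod K A (G n) (carrier A)"
proof (induct n arbitrary: t)
 case 0
 have z: "sub {\<zero>\<^sub>(T A)} (T A)" by (rule sub_0[OF TAM])
 have s: "sub (tprod K A (carrier A) (G 0)) (T A)" "sub (tprod K A (G 0) (carrier A)) (T A)"
  by (rule A_tprod_sub[OF subset_refl G_simps(1)], rule A_tprod_sub[OF G_simps(1) subset_refl])
 {
  case 1
  have "t \<in> {\<zero>\<^sub>(T A)}"
   by (rule A_tprod_image[OF G_simps(1) subset_refl lin_id TAM z _ 1]) (auto simp: G_0 A_tens2_zero)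
  then show ?case using c_simps(4) sub_zero[OF TAM s(1)] by simp
 next
  case 2
  have "t \<in> {\<zero>\<^sub>(T A)}"
   by (rule A_tprod_image[OF subset_refl G_simps(1) lin_id TAM z _ 2]) (auto simp: G_0 A_tens2_zero)
  then show ?case using c_simps(4) sub_zero[OF TAM s(2)] by simp
 }
next
 case (Suc n)
 have z: "sub {\<zero>\<^sub>(T A)} (T A)" by (rule sub_0[OF TAM])
 have s: "sub (tprod K A (carrier A) (G (Suc n))) (T A)" "sub (tprod K A (G (Suc n)) (carrier A)) (T A)"
  by (rule A_tprod_sub[OF subset_refl G_simps(1)], rule A_tprod_sub[OF G_simps(1) subset_refl])
 have QI: "tm2 A A f g u <: (T A)" if "u \<in> tp A 2" "f \<in> lin A A" "g \<in> lin A A" for u f g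
  using lin_cl[OF tmA_lin[OF that(2,3)]] tp_T'[OF that(1)] by blast
 {
  case 1
  have "C 0 t \<in> tprod K A (carrier A) (G (Suc n))"
  proof (rule A_tprod_image[OF G_simps(1) subset_refl C_lin TAM s(1) _ 1])
   fix x y assume x: "x \<in> G (Suc n)" and y: "y <: A"
   note xA = G_simps(2)[OF x]
   have t: "te [x, y] \<in> tp A 2" using xA y by simp
   let ?Q = "Q3 (%x. x) (Q 1) (Q n)"
   note QL = Q3_lin[OF lin_id Q_lin Q_lin, of 1 n]
   note q3 = tmA_L3[OF lin_id Q_lin Q_lin]
   have L: "(%s. ?Q (C 0 (C 1 (s \<star> te [y])))) \<in> lin (T A) (T A)"
    using y by (intro lin_o[OF QL lin_o[OF C_lin lin_o[OF C_lin lin_rmult[OF TA_ualg lin_id]]]]) simp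
   have LL: "(%w. ?Q (C 0 (te [a] \<star> w))) \<in> lin (T A) (T A)" if "a <: A" for a
    using that by (intro lin_o[OF QL lin_o[OF C_lin lin_lmult[OF TA_ualg lin_id]]]) simp
   have e: "C 1 (te [a, b] \<star> te [y]) = te [a] \<star> c (te [b, y])" if "a <: A" "b <: A" for a b
    using that y te3[symmetric] by (simp add: C1_ap')
   have "?Q (C 0 (C 1 (\<Delta> x \<star> te [y]))) \<in> {\<zero>\<^sub>(T A)}"
   proof (rule G_Delta_ind[OF x L TAM z])
    fix a b assume a: "a <: A" and b: "b \<in> G n"
    note bA = G_simps(2)[OF b]
    have w: "c (te [b, y]) \<in> tprod K A (carrier A) (G n)"
     using b y by (intro Suc.hyps(1) A_tprod_base[OF G_simps(1) subset_refl])
    have "?Q (C 0 (te [a] \<star> c (te [b, y]))) \<in> {\<zero>\<^sub>(T A)}"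
    proof (rule A_tprod_image[OF subset_refl G_simps(1) LL[OF a] TAM z _ w])
     fix p q assume "p <: A" "q \<in> G n"
     then show "?Q (C 0 (te [a] \<star> te [p, q])) \<in> {\<zero>\<^sub>(T A)}"
      using a G_simps(2)[of q n] QI[OF _ lin_id Q_lin]
      by (simp add: C0_3 q3 Q_G A_tens1_zero TA_ua)
    qed
    then show "?Q (C 0 (C 1 (te [a, b] \<star> te [y]))) \<in> {\<zero>\<^sub>(T A)}" using e[OF a bA] by simp
   next
    fix a b assume a: "a \<in> G 1" and b: "b <: A"
    note aA = G_simps(2)[OF a]
    have w: "c (te [b, y]) \<in> tprod K A (carrier A) (carrier A)" using b y by (simp add: tprod_full)
    have "?Q (C 0 (te [a] \<star> c (te [b, y]))) \<in> {\<zero>\<^sub>(T A)}"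
    proof (rule A_tprod_image[OF subset_refl subset_refl LL[OF aA] TAM z _ w])
     fix p q assume pq: "p <: A" "q <: A"
     obtain k where k: "k <: K" "c (te [a, p]) = k \<odot>\<^sub>(T A) te [p, \<one>]" using c_scal[OF a pq(1)] by blast
     have "tm2 A A (%x. x) (Q 1) (c (te [a, p])) = \<zero>\<^sub>(T A)"
      using k pq one_A by (simp add: lin_smult[OF tmA_lin[OF lin_id Q_lin]]
       tmA_tens[OF lin_id Q_lin] Q_G[OF one_G1] A_tens2_zero)
     then show "?Q (C 0 (te [a] \<star> te [p, q])) \<in> {\<zero>\<^sub>(T A)}"
      using aA pq Q_closed by (simp add: C0_3 q3 TA_ua)
    qed
    then show "?Q (C 0 (C 1 (te [a, b] \<star> te [y]))) \<in> {\<zero>\<^sub>(T A)}" using e[OF aA b] by simp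
   qed
   then have "?Q (D 1 (c (te [x, y]))) = \<zero>\<^sub>(T A)" using D1c[OF t] xA y by (simp add: D0_2)
   then have "tm2 A A (%x. x) (Q (Suc n)) (c (te [x, y])) = \<zero>\<^sub>(T A)"
    by (rule right_kernel[OF lin_id c_tp[OF t]])
   then show "C 0 (te [x, y]) \<in> tprod K A (carrier A) (G (Suc n))"
    using tprod_rightI[OF c_tp[OF t]] t by (simp add: C_0)
  qed
  then show ?case using C_0[OF tprod_tp[OF AM G_simps(1) subset_refl 1]] by simp
 next
  case 2
  have "C 0 t \<in> tprod K A (G (Suc n)) (carrier A)"
  proof (rule A_tprod_image[OF subset_refl G_simps(1) C_lin TAM s(2) _ 2])
   fix y x assume y: "y <: A" and x: "x \<in> G (Suc n)"
   note xA = G_simps(2)[OF x]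
   have t: "te [y, x] \<in> tp A 2" using xA y by simp
   let ?Q = "Q3 (Q 1) (Q n) (%x. x)"
   note QL = Q3_lin[OF Q_lin Q_lin lin_id, of 1 n]
   note q3 = tmA_L3[OF Q_lin Q_lin lin_id]
   have L: "(%s. ?Q (C 1 (C 0 (te [y] \<star> s)))) \<in> lin (T A) (T A)"
    using y by (intro lin_o[OF QL lin_o[OF C_lin lin_o[OF C_lin lin_lmult[OF TA_ualg lin_id]]]]) simp
   have LL: "(%w. ?Q (C 1 (w \<star> te [b]))) \<in> lin (T A) (T A)" if "b <: A" for b
    using that by (intro lin_o[OF QL lin_o[OF C_lin lin_rmult[OF TA_ualg lin_id]]]) simp
   have e: "C 0 (te [y] \<star> te [a, b]) = c (te [y, a]) \<star> te [b]" if "a <: A" "b <: A" for a b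
    using that y by (simp add: C0_3)
   have "?Q (C 1 (C 0 (te [y] \<star> \<Delta> x))) \<in> {\<zero>\<^sub>(T A)}"
   proof (rule G_Delta_ind[OF x L TAM z])
    fix a b assume a: "a <: A" and b: "b \<in> G n"
    note bA = G_simps(2)[OF b]
    have w: "c (te [y, a]) \<in> tprod K A (carrier A) (carrier A)"
     using a y by (simp add: tprod_full)
    have "?Q (C 1 (c (te [y, a]) \<star> te [b])) \<in> {\<zero>\<^sub>(T A)}"
    proof (rule A_tprod_image[OF subset_refl subset_refl LL[OF bA] TAM z _ w])
     fix p q assume pq: "p <: A" "q <: A"
     have w': "c (te [q, b]) \<in> tprod K A (G n) (carrier A)"
      using b pq by (intro Suc.hyps(2) A_tprod_base[OF subset_refl G_simps(1)])
     have "tm2 A A (Q n) (%x. x) (c (te [q, b])) \<in> {\<zero>\<^sub>(T A)}"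
      by (rule A_tprod_image[OF G_simps(1) subset_refl tmA_lin[OF Q_lin lin_id] TAM z _ w'])
       (use G_simps(2) in \<open>auto simp: tmA_tens[OF Q_lin lin_id] Q_G A_tens2_zero\<close>)
     then show "?Q (C 1 (te [p, q] \<star> te [b])) \<in> {\<zero>\<^sub>(T A)}"
      using a bA pq Q_closed by (simp add: te3[symmetric] C1_ap' q3 TA_ua)
    qed
    then show "?Q (C 1 (C 0 (te [y] \<star> te [a, b]))) \<in> {\<zero>\<^sub>(T A)}" using e[OF a bA] by simp
   next
    fix a b assume a: "a \<in> G 1" and b: "b <: A"
    note aA = G_simps(2)[OF a]
    obtain k where k: "k <: K" "c (te [y, a]) = k \<odot>\<^sub>(T A) te [\<one>, y]" using c_scal[OF a y] by blast
    have "?Q (C 1 (te [\<one>, y] \<star> te [b])) = \<zero>\<^sub>(T A)"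
     using one_A y b QI[OF c_closed Q_lin lin_id]
     by (simp add: te3[symmetric] C1_ap' q3 Q_G[OF one_G1] A_tens1_zero TA_ua)
    then have "?Q (C 1 (c (te [y, a]) \<star> te [b])) = \<zero>\<^sub>(T A)"
     using k one_A y b lin_smult[OF LL[OF b], of k "te [\<one>, y]"] by simp
    then show "?Q (C 1 (C 0 (te [y] \<star> te [a, b]))) \<in> {\<zero>\<^sub>(T A)}" using e[OF aA b] by simp
   qed
   then have "?Q (D 0 (c (te [y, x]))) = \<zero>\<^sub>(T A)" using D0c[OF t] xA y by (simp add: D1_2)
   then have "tm2 A A (Q (Suc n)) (%x. x) (c (te [y, x])) = \<zero>\<^sub>(T A)"
    by (rule left_kernel[OF lin_id c_tp[OF t]])
   then show "C 0 (te [y, x]) \<in> tprod K A (G (Suc n)) (carrier A)"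
    using tprod_leftI[OF c_tp[OF t]] t by (simp add: C_0)
  qed
  then show ?case using C_0[OF tprod_tp[OF AM subset_refl G_simps(1) 2]] by simp
 }
qed

lemma c_F: "x \<in> F i ==> y \<in> F j ==> c (te [x, y]) \<in> tprod K A (F j) (F i)"
proof -
 assume h: "x \<in> F i" "y \<in> F j"
 have "te [x, y] \<in> tprod K A (G (Suc i)) (carrier A)" "te [x, y] \<in> tprod K A (carrier A) (G (Suc j))"
  using h F_simps(2) G_simps(1) by (auto simp: G_Suc intro!: A_tprod_base)
 then have "c (te [x, y]) \<in> tprod K A (carrier A) (F i)" "c (te [x, y]) \<in> tprod K A (F j) (carrier A)"
  using c_categorical(1)[of _ "Suc i"] c_categorical(2)[of _ "Suc j"] by (simp_all add: G_Suc)
 then show ?thesis by (intro tprod_Int[OF AM F_sub F_sub])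
qed

lemma wedge_sub: "sub (tprod K A (carrier A) (G n) <+>\<^sub>(T A) tprod K A (G 1) (carrier A)) (T A)"
 by (intro sub_setadd(1)[OF TAM] A_tprod_sub subset_refl G_simps(1))

lemma wedgeI:
 "x <: A ==> y \<in> G n ==> te [x, y] \<in> tprod K A (carrier A) (G n) <+>\<^sub>(T A) tprod K A (G 1) (carrier A)"
 "x \<in> G 1 ==> y <: A ==> te [x, y] \<in> tprod K A (carrier A) (G n) <+>\<^sub>(T A) tprod K A (G 1) (carrier A)"
 by (intro sub_setadd(2,3)[OF TAM] A_tprod_sub A_tprod_base subset_refl G_simps(1); assumption)+

lemma F0_scal: "x \<in> F 0 ==> y <: A ==> \<exists>k\<in>carrier K. x = k \<odot> \<one> \<and> x \<otimes> y = k \<odot> y \<and> y \<otimes> x = k \<odot> y"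
 using F_0 one_A by (auto simp: A_ua)

text \<open>By \<open>G_DeltaI\<close> it is enough that the comultiplication of the product lies in
  the wedge of \<open>G 1\<close> and \<open>G (a + b)\<close>. In each of its summands either the
  first factor is a scalar multiple of the unit, or the second factor has total degree less than
  \<open>a + b\<close> and the induction hypothesis applies.\<close>

lemma F_mult: "x \<in> F a ==> y \<in> F b ==> x \<otimes> y \<in> F (a + b)"
proof (induct "a + b" arbitrary: a b x y rule: less_induct)
 case less
 note xA = F_simps(2)[OF less(2)] and yA = F_simps(2)[OF less(3)]
 show ?case
 proof (cases "a + b")
  case 0
  then show ?thesis using F0_scal[of x y] less(2,3) yA F_simps(5)[of _ y 0] by auto
 next
  case (Suc k)
  let ?Z = "tprod K A (carrier A) (G (a + b)) <+>\<^sub>(T A) tprod K A (G 1) (carrier A)"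
  have "NC (\<Delta> x) (\<Delta> y) \<in> ?Z"
  proof (rule Fil_image2[OF NC_lin(1)[OF Delta_T[OF yA]] TAM wedge_sub Delta_Fil[OF less(2)]])
   fix p q i j assume pq: "p \<in> F i" "q \<in> F j" "i + j = a"
   note pA = F_simps(2)[OF pq(1)] and qA = F_simps(2)[OF pq(2)]
   show "NC (te [p, q]) (\<Delta> y) \<in> ?Z"
   proof (rule Fil_image2[OF NC_lin(2) TAM wedge_sub Delta_Fil[OF less(3)]])
    show "te [p, q] <: (T A)" using pA qA by simp
    fix r u m l assume ru: "r \<in> F m" "u \<in> F l" "m + l = b"
    note rA = F_simps(2)[OF ru(1)] and uA = F_simps(2)[OF ru(2)]
    have L: "(%w. N 0 (N 2 (te [p] \<star> (w \<star> te [u])))) \<in> lin (T A) (T A)"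
     using pA uA by (intro lin_o[OF N_lin lin_o[OF N_lin lin_lmult[OF TA_ualg lin_rmult[OF TA_ualg lin_id]]]]) auto
    have "N 0 (N 2 (te [p] \<star> (c (te [q, r]) \<star> te [u]))) \<in> ?Z"
    proof (rule A_tprod_image[OF F_simps(1) F_simps(1) L TAM wedge_sub _ c_F[OF pq(2) ru(1)]])
     fix r' q' assume r': "r' \<in> F m" "q' \<in> F j"
     note rA' = F_simps(2)[OF r'(1)] and qA' = F_simps(2)[OF r'(2)]
     have "te [p \<otimes> r', q' \<otimes> u] \<in> ?Z"
     proof (cases "i + m")
      case 0
      then have "p \<otimes> r' \<in> F 0" using F0_scal[of p r'] pq(1) r'(1) rA' F_simps(5)[of _ r' 0] by auto
      then show ?thesis using G_Suc[of 0] qA' uA by (intro wedgeI) (auto simp: A_ua)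
     next
      case (Suc d)
      then have "q' \<otimes> u \<in> F (j + l)" using pq ru r' by (intro less(1)) auto
      then have "q' \<otimes> u \<in> G (a + b)" using G_mono[of "Suc (j + l)" "a + b"] Suc pq(3) ru(3) G_Suc[of "j + l"] by simp
      then show ?thesis using pA rA' by (intro wedgeI) (auto simp: A_ua)
     qed
     then show "N 0 (N 2 (te [p] \<star> (te [r', q'] \<star> te [u]))) \<in> ?Z"
      using NN_ap pA rA' qA' uA by simp
    qed
    then show "NC (te [p, q]) (te [r, u]) \<in> ?Z"
     using pA qA rA uA by (simp add: NC_def C1_mid)
   qed
  qed
  then have "x \<otimes> y \<in> G (Suc (a + b))"
   using xA yA by (intro G_DeltaI) (auto simp: A_ua Delta_NC)
  then show ?thesis by (simp add: G_Suc)
 qed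
qed

text \<open>The commutator drops the filtration degree, by induction: its comultiplication only involves commutators of lower
 degree, and commutators with scalars vanish.\<close>

lemma comm_F0: "x \<in> F 0 ==> y <: A ==> comm x y = \<zero>" "x \<in> F 0 ==> y <: A ==> comm y x = \<zero>"
proof -
 assume h: "x \<in> F 0" "y <: A"
 then obtain k where k: "k <: K" "x = k \<odot> \<one>" "c (te [x, y]) = k \<odot>\<^sub>(T A) te [y, \<one>]" "c (te [y, x]) = k \<odot>\<^sub>(T A) te [\<one>, y]"
  using c_scal[of x y] G_Suc[of 0] by auto
 show "comm x y = \<zero>" "comm y x = \<zero>"
  unfolding comm_def k(3,4) unfolding k(2) using k(1) h(2) one_A
  by (simp_all add: lin_smult[OF mu_lin] mu_tens A_ua)
qed

lemma comm_F: "x \<in> F m ==> y \<in> F n ==> comm x y \<in> G (m + n)"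
proof (induct "m + n" arbitrary: m n x y rule: less_induct)
 case less
 note xA = F_simps(2)[OF less(2)] and yA = F_simps(2)[OF less(3)]
 show ?case
 proof (cases "m = 0 \<or> n = 0")
  case True
  then show ?thesis using comm_F0 less(2,3) xA yA G_simps(3) by auto
 next
  case False
  \<comment> \<open>Both degrees are positive, so the total degree is at least two; membership in
    \<open>G (m + n)\<close> is then tested in the wedge of \<open>G 1\<close> and
    \<open>G (Suc k)\<close>.\<close>
  then obtain k where k: "m + n = Suc (Suc k)" by (metis Suc_pred add_Suc_right add_Suc_shift add_gr_0 not_gr_zero)
  let ?Z = "tprod K A (carrier A) (G (Suc k)) <+>\<^sub>(T A) tprod K A (G 1) (carrier A)"
  have PL: "(%s. Phi (C 1 (s \<star> t))) \<in> lin (T A) (T A)" "(%s. Phi (C 1 (t \<star> s))) \<in> lin (T A) (T A)"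
   if "t <: (T A)" for t
   using that by (auto intro!: lin_o[OF Phi_lin lin_o[OF C_lin lin_rmult[OF TA_ualg lin_id]]]
     lin_o[OF Phi_lin lin_o[OF C_lin lin_lmult[OF TA_ualg lin_id]]])
  have "Phi (C 1 (\<Delta> x \<star> \<Delta> y)) \<in> ?Z"
  proof (rule Fil_image2[OF PL(1)[OF Delta_T[OF yA]] TAM wedge_sub Delta_Fil[OF less(2)]])
   fix p q i j assume pq: "p \<in> F i" "q \<in> F j" "i + j = m"
   note pA = F_simps(2)[OF pq(1)] and qA = F_simps(2)[OF pq(2)]
   show "Phi (C 1 (te [p, q] \<star> \<Delta> y)) \<in> ?Z"
   proof (rule Fil_image2[OF PL(2) TAM wedge_sub Delta_Fil[OF less(3)]])
    show "te [p, q] <: (T A)" using pA qA by simp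
    fix r u d l assume ru: "r \<in> F d" "u \<in> F l" "d + l = n"
    note rA = F_simps(2)[OF ru(1)] and uA = F_simps(2)[OF ru(2)]
    have L: "(%w. Phi (te [p] \<star> (w \<star> te [u]))) \<in> lin (T A) (T A)"
     using pA uA by (intro lin_o[OF Phi_lin lin_lmult[OF TA_ualg lin_rmult[OF TA_ualg lin_id]]]) auto
    have "Phi (te [p] \<star> (c (te [q, r]) \<star> te [u])) \<in> ?Z"
    proof (rule A_tprod_image[OF F_simps(1) F_simps(1) L TAM wedge_sub _ c_F[OF pq(2) ru(1)]])
     fix r' q' assume r': "r' \<in> F d" "q' \<in> F j"
     note rA' = F_simps(2)[OF r'(1)] and qA' = F_simps(2)[OF r'(2)]
     let ?a' = "mu (c (te [p, r']))"
     have aA': "?a' <: A" using lin_cl[OF mu_lin tp_T'[OF c_closed]] pA rA' by simp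
     have cc: "comm p r' <: A" "comm q' u <: A" using comm_closed pA rA' qA' uA by auto
     have qu: "q' \<otimes> u <: A" using qA' uA by (simp add: A_ua)
     have "te [comm p r', q' \<otimes> u] \<in> ?Z \<and> te [?a', comm q' u] \<in> ?Z"
     proof (cases "i = 0 \<or> d = 0")
      case True
      then have z: "comm p r' = \<zero>" using comm_F0 pq(1) r'(1) pA rA' by auto
      have 1: "te [comm p r', q' \<otimes> u] \<in> ?Z" unfolding z
       using qu wedgeI(2)[OF G_simps(3) qu] by simp
      have 2: "te [?a', comm q' u] \<in> ?Z"
      proof (cases "i + d")
       case 0
       \<comment> \<open>With a vanishing commutator, the braided product \<open>?a'\<close> equals
         the product of \<open>p\<close> and \<open>r'\<close>, a scalar multiple of the
         unit.\<close>
       then have "comm p r' = \<zero>" "p \<otimes> r' \<in> F 0" using z F_mult[of p 0 r' 0] pq r' by auto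
       moreover have "p \<otimes> r' = ?a'" using mod_eqI[OF AM _ aA', of "p \<otimes> r'"] z pA rA' by (simp add: comm_def A_ua)
       ultimately have "?a' \<in> F 0" by simp
       then show ?thesis using cc G_Suc[of 0] by (intro wedgeI(2)) auto
      next
       case (Suc e)
       then have "comm q' u \<in> G (j + l)" using pq(3) ru r' by (intro less(1)) auto
       then have "comm q' u \<in> G (Suc k)" using G_mono[of "j + l" "Suc k"] Suc pq(3) ru(3) k by simp
       then show ?thesis using aA' by (intro wedgeI(1))
      qed
      show ?thesis using 1 2 by simp
     next
      \<comment> \<open>Now \<open>i\<close> and \<open>d\<close> are both positive, so
        \<open>j + l\<close> is at most \<open>k\<close>: the second factors lie in
        \<open>G (Suc k)\<close>, whatever the first factors are.\<close>
      case False
      have "q' \<otimes> u \<in> G (Suc (j + l))" using F_mult[OF r'(2) ru(2)] by (simp add: G_Suc)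
      then have "q' \<otimes> u \<in> G (Suc k)" using G_mono[of "Suc (j + l)" "Suc k"] False pq(3) ru(3) k by simp
      moreover have "comm q' u \<in> G (j + l)" using pq(3) ru r' False by (intro less(1)) auto
      then have "comm q' u \<in> G (Suc k)" using G_mono[of "j + l" "Suc k"] False pq(3) ru(3) k by simp
      ultimately show ?thesis using aA' cc by (intro conjI wedgeI(1))
     qed
     then show "Phi (te [p] \<star> (te [r', q'] \<star> te [u])) \<in> ?Z"
      unfolding Phi_tens[OF pA rA' qA' uA] using sub_add[OF TAM wedge_sub] by blast
    qed
    then show "Phi (C 1 (te [p, q] \<star> te [r, u])) \<in> ?Z"
     using pA qA rA uA by (simp add: C1_mid)
   qed
  qed
  then have "comm x y \<in> G (Suc (Suc k))"
   using xA yA by (intro G_DeltaI comm_closed) (auto simp: Delta_comm)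
  then show ?thesis using k by simp
 qed
qed

lemma c_symm_F: "x \<in> F m ==> y \<in> F n ==> x \<otimes> y \<ominus> mu (c (te [x, y])) \<in> G (m + n)"
 using comm_F by (simp add: comm_def)

end

section \<open>The associated graded algebra\<close>

context kfield
begin

subsection \<open>Cosets of submodules\<close>

context
 fixes M :: "('k, 'v) module" and X
 assumes M [simp]: "module K M" and X: "sub X M"
begin

lemma coset_mem: "x <: M ==> y \<in> X +>\<^sub>M x \<longleftrightarrow> y <: M \<and> y \<ominus>\<^sub>M x \<in> X"
proof
 assume x: "x <: M"
 show "y <: M \<and> y \<ominus>\<^sub>M x \<in> X" if "y \<in> X +>\<^sub>M x"
  using that x sub_mem[OF M X] by (auto simp: a_r_coset_def r_coset_def mod_minus mod_assoc)
 assume y: "y <: M \<and> y \<ominus>\<^sub>M x \<in> X"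
 then have "y = (y \<ominus>\<^sub>M x) \<oplus>\<^sub>M x" using x by (simp add: mod_minus mod_assoc)
 then show "y \<in> X +>\<^sub>M x" using y by (auto simp: a_r_coset_def r_coset_def)
qed

lemma coset_self: "x <: M ==> x \<in> X +>\<^sub>M x"
 by (simp add: coset_mem sub_zero[OF M X])

lemma coset_eq: "x <: M ==> y <: M ==> X +>\<^sub>M x = X +>\<^sub>M y \<longleftrightarrow> x \<ominus>\<^sub>M y \<in> X"
proof
 assume xy: "x <: M" "y <: M"
 show "x \<ominus>\<^sub>M y \<in> X" if "X +>\<^sub>M x = X +>\<^sub>M y"
  using coset_self[OF xy(1)] that coset_mem[OF xy(2)] by simp
 assume h: "x \<ominus>\<^sub>M y \<in> X"
 have a: "z \<ominus>\<^sub>M y = (z \<ominus>\<^sub>M x) \<oplus>\<^sub>M (x \<ominus>\<^sub>M y)" "z \<ominus>\<^sub>M x = (z \<ominus>\<^sub>M y) \<ominus>\<^sub>M (x \<ominus>\<^sub>M y)" if "z <: M" for z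
  using xy that by (simp_all add: mod_minus mod_assoc mod_negadd mod_comm[of M "\<ominus>\<^sub>M x"])
 then show "X +>\<^sub>M x = X +>\<^sub>M y"
  using h xy sub_add[OF M X] sub_minus[OF M X] by (auto simp: coset_mem) metis+
qed

lemma coset_zero: "X +>\<^sub>M \<zero>\<^sub>M = X"
 using sub_mem[OF M X] by (auto simp: coset_mem mod_minus)

lemma coset_eq0: "x <: M ==> X +>\<^sub>M x = X \<longleftrightarrow> x \<in> X"
 using coset_eq[of x "\<zero>\<^sub>M"] coset_zero by (simp add: mod_minus)

lemma coset_add: "x <: M ==> y <: M ==> (X +>\<^sub>M x) <+>\<^sub>M (X +>\<^sub>M y) = X +>\<^sub>M (x \<oplus>\<^sub>M y)"
proof
 assume xy: "x <: M" "y <: M"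
 have "(u \<oplus>\<^sub>M v) \<ominus>\<^sub>M (x \<oplus>\<^sub>M y) = (u \<ominus>\<^sub>M x) \<oplus>\<^sub>M (v \<ominus>\<^sub>M y)" if "u <: M" "v <: M" for u v
  using xy that by (simp add: mod_minus mod_negadd mod_ac)
 then show "(X +>\<^sub>M x) <+>\<^sub>M (X +>\<^sub>M y) \<subseteq> X +>\<^sub>M (x \<oplus>\<^sub>M y)"
  using xy sub_add[OF M X] by (auto simp: set_add_def set_mult_def coset_mem)
 show "X +>\<^sub>M (x \<oplus>\<^sub>M y) \<subseteq> (X +>\<^sub>M x) <+>\<^sub>M (X +>\<^sub>M y)"
 proof
  fix z assume "z \<in> X +>\<^sub>M (x \<oplus>\<^sub>M y)"
  then have z: "z <: M" "z \<ominus>\<^sub>M (x \<oplus>\<^sub>M y) \<in> X" using coset_mem[of "x \<oplus>\<^sub>M y"] xy by auto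
  then have "z \<ominus>\<^sub>M y \<in> X +>\<^sub>M x" using xy
   by (simp add: coset_mem mod_minus mod_negadd mod_assoc mod_comm[of M "\<ominus>\<^sub>M x"])
  moreover have "z = (z \<ominus>\<^sub>M y) \<oplus>\<^sub>M y" using xy z by (simp add: mod_minus mod_assoc)
  ultimately show "z \<in> (X +>\<^sub>M x) <+>\<^sub>M (X +>\<^sub>M y)"
   using coset_self[OF xy(2)] by (auto simp: set_add_def set_mult_def)
 qed
qed

lemma coset_smult: "a <: K ==> x <: M ==> (\<Union>z\<in>X +>\<^sub>M x. X +>\<^sub>M (a \<odot>\<^sub>M z)) = X +>\<^sub>M (a \<odot>\<^sub>M x)"
proof -
 assume ax: "a <: K" "x <: M"
 have ne: "X +>\<^sub>M x \<noteq> {}" using coset_self ax by auto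
 have "X +>\<^sub>M (a \<odot>\<^sub>M z) = X +>\<^sub>M (a \<odot>\<^sub>M x)" if z: "z \<in> X +>\<^sub>M x" for z
 proof -
  have z: "z <: M" "z \<ominus>\<^sub>M x \<in> X" using z coset_mem ax by auto
  have "a \<odot>\<^sub>M (z \<ominus>\<^sub>M x) = (a \<odot>\<^sub>M z) \<ominus>\<^sub>M (a \<odot>\<^sub>M x)"
   using z ax by (simp add: mod_minus mod_sadd mod_sneg)
  then show ?thesis using z ax sub_smult[OF M X, of a "z \<ominus>\<^sub>M x"] by (simp add: coset_eq)
 qed
 with ne show ?thesis by (rule SUP_eq_const)
qed

end

subsection \<open>Gradings and projections\<close>

text \<open>A grading together with the projections onto its homogeneous components; the form with
  unique finite decompositions is derived in \<open>graded_proj_grading\<close>.\<close>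

definition graded_proj :: "('k, 'v) module => (nat => 'v set) => (nat => 'v => 'v) => bool" where
 "graded_proj V Gr \<pi> \<longleftrightarrow> (\<forall>n. sub (Gr n) V) \<and> (\<forall>n. \<pi> n \<in> lin V V) \<and>
   (\<forall>m n x. x \<in> Gr n --> \<pi> m x = (if m = n then x else \<zero>\<^sub>V)) \<and> carrier V = span V (\<Union>n. Gr n)"

lemma graded_projD:
 assumes "graded_proj V Gr \<pi>"
 shows "sub (Gr n) V" "\<pi> n \<in> lin V V" "x \<in> Gr n ==> \<pi> m x = (if m = n then x else \<zero>\<^sub>V)" "carrier V = span V (\<Union>n. Gr n)"
 using assms by (auto simp: graded_proj_def)

context
 fixes V :: "('k, 'v) module" and Gr \<pi>
 assumes V [simp]: "module K V" and gp: "graded_proj V Gr \<pi>"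
begin

lemma Gr_carr: "(\<Union>n. Gr n) <<: V"
 using graded_projD(1)[OF gp] sub_mem[OF V] by blast

lemma graded_induct [consumes 1, case_names base add]:
 assumes "x <: V" "!!n x. x \<in> Gr n ==> P x"
  "!!x y. x <: V ==> y <: V ==> P x ==> P y ==> P (x \<oplus>\<^sub>V y)"
 shows "P x"
proof -
 have z: "P \<zero>\<^sub>V" using assms(2)[of "\<zero>\<^sub>V" 0] sub_zero[OF V graded_projD(1)[OF gp]] by blast
 let ?S = "{x. \<exists>n. x \<in> Gr n}"
 \<comment> \<open>Scalar multiples are carried along, because homogeneous components are closed
   under them while \<open>P\<close> is not assumed to be.\<close>
 have "P x \<and> (\<forall>a\<in>carrier K. P (a \<odot>\<^sub>V x))"
  using assms(1)[unfolded graded_projD(4)[OF gp]] V Gr_carr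
 proof (induct rule: span_induct)
  case (base s) then show ?case using assms(2) sub_smult[OF V graded_projD(1)[OF gp]] by blast
 next
  case zero then show ?case using z V by simp
 next
  case (add x y) then show ?case using assms(3) by (simp add: mod_sadd)
 next
  case (smult a x) then show ?case by (simp add: mod_smul)
 qed
 then show ?thesis ..
qed

lemma proj_fin: "x <: V ==> finite {n. \<pi> n x \<noteq> \<zero>\<^sub>V}"
proof (induct rule: graded_induct)
 case (base n x)
 show ?case by (rule finite_subset[of _ "{n}"]) (use base in \<open>auto simp: graded_projD(3)[OF gp]\<close>)
next
 case (add x y)
 show ?case
  by (rule finite_subset[of _ "{n. \<pi> n x \<noteq> \<zero>\<^sub>V} \<union> {n. \<pi> n y \<noteq> \<zero>\<^sub>V}"])
   (use add in \<open>auto simp: lin_add[OF graded_projD(2)[OF gp]]\<close>)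
qed

lemma proj_sum: "x <: V ==> (\<Oplus>\<^sub>V n\<in>{n. \<pi> n x \<noteq> \<zero>\<^sub>V}. \<pi> n x) = x"
proof -
 interpret V: module K V by (rule V)
 have L: "(%x. \<Oplus>\<^sub>V n\<in>{n. \<pi> n x \<noteq> \<zero>\<^sub>V}. \<pi> n x) \<in> lin V V" (is "?f \<in> _")
  by (rule lin_locfin_sum[OF V V graded_projD(2)[OF gp] proj_fin])
 show "x <: V ==> ?f x = x"
 proof (induct rule: graded_induct)
  case (base n x)
  have x: "x <: V" using base Gr_carr by blast
  have "?f x = (\<Oplus>\<^sub>V n\<in>{n}. \<pi> n x)"
   using base x by (intro finsum_superset) (auto simp: graded_projD(3)[OF gp] split: if_splits)
  then show ?case using base x by (simp add: graded_projD(3)[OF gp])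
 next
  case (add x y) then show ?case using lin_add[OF L] by simp
 qed
qed

lemma proj_mem: "x <: V ==> \<pi> n x \<in> Gr n"
proof (induct rule: graded_induct)
 case (base m x) then show ?case using graded_projD(3)[OF gp] sub_zero[OF V graded_projD(1)[OF gp]] by auto
next
 case (add x y) then show ?case by (simp add: lin_add[OF graded_projD(2)[OF gp]] sub_add[OF V graded_projD(1)[OF gp]])
qed

lemma graded_proj_grading: "grading K V Gr"
 unfolding grading_def
proof (intro conjI allI ballI)
 show "sub (Gr n) V" for n by (rule graded_projD(1)[OF gp])
 fix x assume x: "x <: V"
 show "\<exists>!a. (\<forall>n. a n \<in> Gr n) \<and> finite {n. a n \<noteq> \<zero>\<^sub>V} \<and> x = (\<Oplus>\<^sub>V n\<in>{n. a n \<noteq> \<zero>\<^sub>V}. a n)"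
 proof (rule ex1I[of _ "%n. \<pi> n x"])
  show "(\<forall>n. \<pi> n x \<in> Gr n) \<and> finite {n. \<pi> n x \<noteq> \<zero>\<^sub>V} \<and> x = (\<Oplus>\<^sub>V n\<in>{n. \<pi> n x \<noteq> \<zero>\<^sub>V}. \<pi> n x)"
   using x proj_mem proj_fin proj_sum by simp
  fix a assume a: "(\<forall>n. a n \<in> Gr n) \<and> finite {n. a n \<noteq> \<zero>\<^sub>V} \<and> x = (\<Oplus>\<^sub>V n\<in>{n. a n \<noteq> \<zero>\<^sub>V}. a n)"
  show "a = (%n. \<pi> n x)"
  proof
   fix m
   have ac: "a n <: V" for n using a Gr_carr by blast
   have pa: "\<pi> i (a n) = (if i = n then a n else \<zero>\<^sub>V)" for i n
    using a graded_projD(3)[OF gp, of "a n" n i] by simp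
   interpret V: module K V by (rule V)
   have "\<pi> m x = (\<Oplus>\<^sub>V n\<in>{n. a n \<noteq> \<zero>\<^sub>V}. \<pi> m (a n))"
    using a ac lin_finsum[OF graded_projD(2)[OF gp] V V, of "{n. a n \<noteq> \<zero>\<^sub>V}" a m] by simp
   also have "\<dots> = (\<Oplus>\<^sub>V n\<in>insert m {n. a n \<noteq> \<zero>\<^sub>V}. \<pi> m (a n))"
    using a ac lin_zero[OF graded_projD(2)[OF gp] V V] lin_cl[OF graded_projD(2)[OF gp]] by (intro finsum_superset) auto
   also have "\<dots> = (\<Oplus>\<^sub>V n\<in>{m}. \<pi> m (a n))"
    using a ac by (intro finsum_superset[symmetric]) (auto simp: pa)
   also have "\<dots> = a m" using ac by (simp add: pa)
   finally show "a m = \<pi> m x" by simp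
  qed
 qed
qed

text \<open>Operators that differ from degree to degree are glued into one; only finitely many
  components of a vector contribute.\<close>

lemma graded_lift:
 assumes N: "module K N" and g: "!!n. g n \<in> lin V N"
 shows "\<exists>f\<in>lin V N. \<forall>n. \<forall>x\<in>Gr n. f x = g n x"
proof -
 interpret N: module K N by (rule N)
 let ?h = "%n x. g n (\<pi> n x)"
 have h: "?h n \<in> lin V N" for n by (rule lin_o[OF g graded_projD(2)[OF gp]])
 have fin: "finite {n. ?h n x \<noteq> \<zero>\<^sub>N}" if "x <: V" for x
  by (rule finite_subset[OF _ proj_fin[OF that]]) (use lin_zero[OF g V N] in auto)
 let ?f = "%x. \<Oplus>\<^sub>N n\<in>{n. ?h n x \<noteq> \<zero>\<^sub>N}. ?h n x"
 have "?f x = g n x" if x: "x \<in> Gr n" for n x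
 proof -
  have xc: "x <: V" using x Gr_carr by blast
  have "?f x = (\<Oplus>\<^sub>N n\<in>{n}. ?h n x)"
   using x xc lin_zero[OF g V N] lin_cl[OF g] by (intro finsum_superset[OF N]) (auto simp: graded_projD(3)[OF gp] split: if_splits)
  then show ?thesis using x xc lin_cl[OF g xc] by (simp add: graded_projD(3)[OF gp])
 qed
 then show ?thesis using lin_locfin_sum[OF V N h fin] by (intro bexI[of _ ?f]) auto
qed

end

lemmas graded_ind = graded_induct[consumes 3, case_names base add]

end

context irr_bialg
begin

abbreviation B where "B == gr A F"
abbreviation cls where "cls == gr_class A F"

definition cl :: "(nat => 'a) => nat => 'a set" where "cl x = (%n. G n +>\<^sub>A x n)"

text \<open>Sequences of representatives of the elements of \<open>gr H\<close>. Almost all entries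
  represent zero, which means that they lie in \<open>G n\<close>, not that they are zero.\<close>

definition reps :: "(nat => 'a) set" where
 "reps = {x. (\<forall>n. x n \<in> F n) \<and> finite {n. x n \<notin> G n}}"

lemma repsD: "x \<in> reps ==> x n \<in> F n" "x \<in> reps ==> x n <: A" "x \<in> reps ==> finite {n. x n \<notin> G n}"
 using F_simps(2) by (auto simp: reps_def)

lemma G_F: "x \<in> G n ==> x \<in> F n"
 using GSucG by (simp add: G_Suc)

lemmas G_coset = coset_mem[OF AM G_sub] coset_self[OF AM G_sub] coset_eq[OF AM G_sub]
 coset_zero[OF AM G_sub] coset_eq0[OF AM G_sub] coset_add[OF AM G_sub] coset_smult[OF AM G_sub]

lemma cl_eq: "x \<in> reps ==> y \<in> reps ==> cl x = cl y \<longleftrightarrow> (\<forall>n. x n \<ominus> y n \<in> G n)"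
 by (auto simp: cl_def fun_eq_iff G_coset(3) repsD)

lemma F_coset0: "x \<in> F n ==> G n +>\<^sub>A x = G n \<longleftrightarrow> x \<in> G n"
 by (rule G_coset(5)[OF F_simps(2)])

lemma B_carrier: "carrier B = cl ` reps"
proof
 show "cl ` reps <<: B"
  by (auto simp: gr_def cl_def reps_def F_coset0)
 show "carrier B \<subseteq> cl ` reps"
 proof
  fix a assume a: "a <: B"
  then have "\<forall>n. \<exists>x. x \<in> F n \<and> a n = G n +>\<^sub>A x" by (auto simp: gr_def)
  then obtain x where x: "!!n. x n \<in> F n" "!!n. a n = G n +>\<^sub>A x n" by metis
  then have "finite {n. x n \<notin> G n}" using a by (auto simp: gr_def F_coset0)
  then have "x \<in> reps" "a = cl x" using x by (auto simp: reps_def cl_def)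
  then show "a \<in> cl ` reps" by blast
 qed
qed

lemma reps_zero: "(%n. \<zero>) \<in> reps" using F_simps(3) G_simps(3) by (auto simp: reps_def)

lemma reps_add: "x \<in> reps ==> y \<in> reps ==> (%n. x n \<oplus> y n) \<in> reps"
proof -
 assume h: "x \<in> reps" "y \<in> reps"
 have "finite {n. x n \<oplus> y n \<notin> G n}"
  by (rule finite_subset[of _ "{n. x n \<notin> G n} \<union> {n. y n \<notin> G n}"])
   (use G_simps(4) repsD(3)[OF h(1)] repsD(3)[OF h(2)] in auto)
 then show ?thesis using F_simps(4) repsD(1)[OF h(1)] repsD(1)[OF h(2)] by (simp add: reps_def)
qed

lemma reps_smult: "a <: K ==> x \<in> reps ==> (%n. a \<odot> x n) \<in> reps"
proof -
 assume h: "a <: K" "x \<in> reps"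
 have "finite {n. a \<odot> x n \<notin> G n}"
  by (rule finite_subset[of _ "{n. x n \<notin> G n}"]) (use G_simps(5) h(1) repsD(3)[OF h(2)] in auto)
 then show ?thesis using F_simps(5) h(1) repsD(1)[OF h(2)] by (simp add: reps_def)
qed

lemma B_zero: "\<zero>\<^sub>B = cl (%n. \<zero>)"
 by (simp add: gr_def cl_def G_coset(4))

lemma B_add: "x \<in> reps ==> y \<in> reps ==> cl x \<oplus>\<^sub>B cl y = cl (%n. x n \<oplus> y n)"
 by (simp add: gr_def cl_def G_coset(6) repsD)

lemma B_smult: "a <: K ==> x \<in> reps ==> a \<odot>\<^sub>B cl x = cl (%n. a \<odot> x n)"
 by (simp add: gr_def cl_def G_coset(7) repsD)

lemma BM [simp]: "module K B"
proof (rule moduleI)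
 show "cring K" by (rule is_cring)
 show "abelian_group B"
 proof (rule abelian_groupI)
  fix a assume "a <: B"
  then obtain x where x: "a = cl x" "x \<in> reps" by (auto simp: B_carrier)
  let ?y = "%n. (\<ominus>\<^sub>K \<one>\<^sub>K) \<odot> x n"
  have "?y \<in> reps" by (rule reps_smult) (use x in auto)
  moreover have "cl ?y \<oplus>\<^sub>B a = \<zero>\<^sub>B" using x calculation by (simp add: B_add B_zero mod_negs repsD)
  ultimately show "\<exists>y\<in>carrier B. y \<oplus>\<^sub>B a = \<zero>\<^sub>B" by (auto simp: B_carrier)
 qed (auto simp: B_carrier B_add B_zero reps_add reps_zero repsD mod_ac)
qed (auto simp: B_carrier B_add B_smult reps_add reps_smult repsD mod_adds mod_sadd mod_smul)

definition single where "single n x = (%m. if m = n then x else \<zero>)"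

lemma reps_single: "x \<in> F n ==> single n x \<in> reps"
 using F_simps(3) G_simps(3) by (auto simp: reps_def single_def intro!: finite_subset[OF _ finite.insertI[OF finite.emptyI, of n]])

lemma cls_cl: "cls n x = cl (single n x)"
 by (rule ext) (simp add: gr_class_def cl_def single_def G_coset(4))

lemma cls_closed: "x \<in> F n ==> cls n x <: B"
 by (simp add: cls_cl B_carrier reps_single)

lemma cls_add: "x \<in> F n ==> y \<in> F n ==> cls n (x \<oplus> y) = cls n x \<oplus>\<^sub>B cls n y"
 unfolding cls_cl by (simp add: B_add reps_single) (auto simp: single_def F_simps intro!: arg_cong[of _ _ cl])

lemma cls_smult: "a <: K ==> x \<in> F n ==> cls n (a \<odot> x) = a \<odot>\<^sub>B cls n x"
 unfolding cls_cl by (simp add: B_smult reps_single) (auto simp: single_def F_simps intro!: arg_cong[of _ _ cl])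

lemma cls_eq: "x \<in> F n ==> y \<in> F n ==> cls n x = cls n y \<longleftrightarrow> x \<ominus> y \<in> G n"
 unfolding cls_cl by (simp add: cl_eq reps_single) (auto simp: single_def G_simps(3))

lemma cls_zero: "x \<in> F n ==> cls n x = \<zero>\<^sub>B \<longleftrightarrow> x \<in> G n"
 using cls_eq[of x n "\<zero>"] F_simps(3) F_simps(2)
 by (simp add: B_zero cls_cl single_def mod_minus cong: if_cong)

lemma cls_span: "carrier B = span B {cls n x |n x. x \<in> F n}"
proof
 let ?S = "{cls n x |n x. x \<in> F n}"
 have Sc: "?S <<: B" using cls_closed by auto
 have S: "sub (span B ?S) B" by (rule span_sub[OF BM Sc])
 show "span B ?S <<: B" by (rule span_carr[OF BM Sc])
 have "x \<in> reps ==> (\<forall>n\<ge>k. x n \<in> G n) ==> cl x \<in> span B ?S" for x k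
 proof (induct k arbitrary: x)
  case 0
  then have "cl x = \<zero>\<^sub>B" unfolding B_zero by (subst cl_eq) (auto simp: reps_zero mod_minus repsD)
  then show ?case using sub_zero[OF BM S] by simp
 next
  case (Suc k)
  let ?y = "x(k := \<zero>)"
  have "finite {n. ?y n \<notin> G n}"
   by (rule finite_subset[of _ "{n. x n \<notin> G n}"]) (use G_simps(3) repsD(3)[OF Suc(2)] in auto)
  then have y: "?y \<in> reps" using repsD(1)[OF Suc(2)] F_simps(3) by (simp add: reps_def)
  have "\<forall>n\<ge>k. ?y n \<in> G n" using Suc(3) G_simps(3) by (auto simp: le_Suc_eq)
  then have 1: "cl ?y \<in> span B ?S" using Suc(1)[OF y] by blast
  have 2: "cls k (x k) \<in> span B ?S" using repsD[OF Suc(2)] by (intro span_base) auto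
  have "cl ?y \<oplus>\<^sub>B cls k (x k) = cl (%n. ?y n \<oplus> single k (x k) n)"
   unfolding cls_cl by (intro B_add y reps_single repsD(1)[OF Suc(2)])
  moreover have "(%n. ?y n \<oplus> single k (x k) n) = x" using repsD(2)[OF Suc(2)] by (auto simp: single_def)
  ultimately have "cl x = cl ?y \<oplus>\<^sub>B cls k (x k)" by simp
  then show ?case using sub_add[OF BM S 1 2] by simp
 qed
 moreover have "\<exists>k. \<forall>n\<ge>k. x n \<in> G n" if x: "x \<in> reps" for x
 proof -
  obtain k where "\<forall>n\<in>{n. x n \<notin> G n}. n < k" using finite_nat_set_iff_bounded repsD(3)[OF x] by meson
  then show ?thesis by (intro exI[of _ k]) auto
 qed
 ultimately show "carrier B \<subseteq> span B ?S" unfolding B_carrier by blast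
qed

lemma GF_mult:
 assumes h: "x \<in> G i" "y \<in> F j"
 shows "x \<otimes> y \<in> G (i + j)" "y \<otimes> x \<in> G (i + j)"
proof -
 have "x \<otimes> y \<in> G (i + j) \<and> y \<otimes> x \<in> G (i + j)"
 proof (cases i)
  case 0
  then show ?thesis using h F_simps(2)[OF h(2)] G_simps(3) by (simp add: G_0 A_ua)
 next
  case (Suc k)
  then show ?thesis
   using h F_mult[of x k y j] F_mult[of y j x k] by (simp add: G_Suc add.commute)
 qed
 then show "x \<otimes> y \<in> G (i + j)" "y \<otimes> x \<in> G (i + j)" by auto
qed

definition conv where "conv x y n = (\<Oplus> i\<in>{..n}. x i \<otimes> y (n - i))"

lemma conv_F: "(!!n. x n \<in> F n) ==> (!!n. y n \<in> F n) ==> conv x y n \<in> F n"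
proof -
 assume h: "!!n. x n \<in> F n" "!!n. y n \<in> F n"
 have "x i \<otimes> y (n - i) \<in> F n" if "i \<in> {..n}" for i
  using F_mult[OF h(1)[of i] h(2)[of "n - i"]] that by simp
 then show ?thesis unfolding conv_def by (rule sub_finsum[OF AM F_sub])
qed

text \<open>Independence of the representatives:
  \<open>x y - x' y' = (x - x') y + x' (y - y')\<close>, and a factor of lower degree lowers the
  degree of the product.\<close>

lemma conv_cong:
 assumes "!!n. x n \<in> F n" "!!n. y n \<in> F n" "!!n. x' n \<in> F n" "!!n. y' n \<in> F n"
  "!!n. x n \<ominus> x' n \<in> G n" "!!n. y n \<ominus> y' n \<in> G n"
 shows "conv x y n \<ominus> conv x' y' n \<in> G n"
proof -
 interpret A: module K A by simp
 have c: "x n <: A" "y n <: A" "x' n <: A" "y' n <: A" for n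
  using assms F_simps(2) by blast+
 let ?d = "%i. (x i \<otimes> y (n - i)) \<ominus> (x' i \<otimes> y' (n - i))"
 have "?d i \<in> G n" if "i \<in> {..n}" for i
 proof -
  have "?d i = (x i \<ominus> x' i) \<otimes> y (n - i) \<oplus> x' i \<otimes> (y (n - i) \<ominus> y' (n - i))"
   using c by (simp add: mod_minus A_ua mod_assoc)
  moreover have "(x i \<ominus> x' i) \<otimes> y (n - i) \<in> G n"
   using GF_mult(1)[OF assms(5)[of i] assms(2)[of "n - i"]] that by simp
  moreover have "x' i \<otimes> (y (n - i) \<ominus> y' (n - i)) \<in> G n"
   using GF_mult(2)[OF assms(6)[of "n - i"] assms(3)[of i]] that by simp
  ultimately show ?thesis using G_simps(4) by simp
 qed
 then have s: "(\<Oplus> i\<in>{..n}. ?d i) \<in> G n" by (rule sub_finsum[OF AM G_sub])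
 have "conv x y n = (\<Oplus> i\<in>{..n}. ?d i \<oplus> x' i \<otimes> y' (n - i))"
  unfolding conv_def using c by (intro A.M.finsum_cong') (auto simp: mod_minus A_ua mod_assoc)
 also have "\<dots> = (\<Oplus> i\<in>{..n}. ?d i) \<oplus> conv x' y' n"
  unfolding conv_def using c by (intro A.M.finsum_addf) (auto simp: A_ua)
 finally show ?thesis using s conv_F[OF assms(3,4), of n] F_simps(2) G_simps(2)[OF s]
  by (simp add: mod_minus mod_assoc)
qed

lemma cl_mem: "x \<in> reps ==> y n \<in> cl x n ==> y n \<in> F n \<and> y n \<ominus> x n \<in> G n"
proof -
 assume h: "x \<in> reps" "y n \<in> cl x n"
 then have y: "y n <: A" "y n \<ominus> x n \<in> G n" using G_coset(1) repsD(2)[OF h(1)] by (auto simp: cl_def)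
 have "y n = (y n \<ominus> x n) \<oplus> x n" using y repsD(2)[OF h(1)] by (simp add: mod_minus mod_assoc)
 then show ?thesis using y G_F[OF y(2)] repsD(1)[OF h(1)] F_simps(4) by metis
qed

lemma B_mult:
 assumes x: "x \<in> reps" and y: "y \<in> reps" shows "cl x \<otimes>\<^sub>B cl y = cl (conv x y)"
proof
 fix n
 \<comment> \<open>The product of \<open>gr H\<close> is a union over all systems of
   representatives, and all of them give the same coset.\<close>
 have "(\<Union>x'\<in>{x'. \<forall>i. x' i \<in> cl x i}. \<Union>y'\<in>{y'. \<forall>i. y' i \<in> cl y i}. G n +>\<^sub>A conv x' y' n) = G n +>\<^sub>A conv x y n"
 proof (intro SUP_eq_const)
  show "{x'. \<forall>i. x' i \<in> cl x i} \<noteq> {}" "{y'. \<forall>i. y' i \<in> cl y i} \<noteq> {}"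
   using G_coset(2) repsD(2)[OF x] repsD(2)[OF y] unfolding cl_def by blast+
  fix x' y' assume "x' \<in> {x'. \<forall>i. x' i \<in> cl x i}" "y' \<in> {y'. \<forall>i. y' i \<in> cl y i}"
  then have h: "!!n. x' n \<in> F n" "!!n. y' n \<in> F n" "!!n. x' n \<ominus> x n \<in> G n" "!!n. y' n \<ominus> y n \<in> G n"
   using cl_mem[OF x] cl_mem[OF y] by auto
  have "conv x' y' n \<ominus> conv x y n \<in> G n"
   using h repsD(1)[OF x] repsD(1)[OF y] by (intro conv_cong) auto
  moreover have "conv x' y' n <: A" "conv x y n <: A"
   using conv_F[OF h(1,2)] conv_F[OF repsD(1)[OF x] repsD(1)[OF y]] F_simps(2) by blast+
  ultimately show "G n +>\<^sub>A conv x' y' n = G n +>\<^sub>A conv x y n" by (simp add: G_coset(3))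
 qed
 then show "(cl x \<otimes>\<^sub>B cl y) n = cl (conv x y) n"
  by (simp add: gr_def cl_def conv_def)
qed

lemma conv_single:
 assumes "x \<in> F m" "y \<in> F n" shows "conv (single m x) (single n y) = single (m + n) (x \<otimes> y)"
proof
 interpret A: module K A by simp
 fix k
 have c: "x <: A" "y <: A" using assms F_simps(2) by auto
 have "conv (single m x) (single n y) k = (\<Oplus> i\<in>{..k}. if m = i then (if k = m + n then x \<otimes> y else \<zero>) else \<zero>)"
  unfolding conv_def single_def using c by (intro A.M.finsum_cong') (auto simp: A_ua)
 also have "\<dots> = single (m + n) (x \<otimes> y) k"
 proof (cases "m \<le> k")
  case True
  then show ?thesis using c by (subst A.M.finsum_singleton) (auto simp: single_def A_ua)
 next
  case False
  then have "(\<Oplus> i\<in>{..k}. if m = i then (if k = m + n then x \<otimes> y else \<zero>) else \<zero>) = (\<Oplus> i\<in>{..k}. \<zero>)"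
   by (intro A.M.finsum_cong') auto
  then show ?thesis using False by (auto simp: single_def)
 qed
 finally show "conv (single m x) (single n y) k = single (m + n) (x \<otimes> y) k" .
qed

lemma cls_mult: "x \<in> F m ==> y \<in> F n ==> cls m x \<otimes>\<^sub>B cls n y = cls (m + n) (x \<otimes> y)"
 unfolding cls_cl by (simp add: B_mult reps_single conv_single)

lemma one_F0: "\<one> \<in> F 0" using one_G1 G_Suc[of 0] by simp

lemma B_one: "\<one>\<^sub>B = cls 0 \<one>"
 by (auto simp: gr_def gr_class_def)

lemma reps_conv: assumes x: "x \<in> reps" and y: "y \<in> reps" shows "conv x y \<in> reps"
proof -
 obtain k where k: "\<forall>n\<in>{n. x n \<notin> G n}. n < k" using finite_nat_set_iff_bounded repsD(3)[OF x] by meson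
 obtain l where l: "\<forall>n\<in>{n. y n \<notin> G n}. n < l" using finite_nat_set_iff_bounded repsD(3)[OF y] by meson
 have "conv x y n \<in> G n" if n: "n \<ge> k + l" for n
 proof -
  have "x i \<otimes> y (n - i) \<in> G n" if "i \<in> {..n}" for i
  proof (cases "x i \<in> G i")
   case True then show ?thesis using GF_mult(1)[OF True repsD(1)[OF y, of "n - i"]] that by simp
  next
   case False
   then have "y (n - i) \<in> G (n - i)" using k l n that by fastforce
   then show ?thesis using GF_mult(2)[OF _ repsD(1)[OF x, of i], of "y (n - i)" "n - i"] that by simp
  qed
  then show ?thesis unfolding conv_def by (rule sub_finsum[OF AM G_sub])
 qed
 then have "{n. conv x y n \<notin> G n} \<subseteq> {..<k + l}" by (auto simp: not_le[symmetric])
 then have "finite {n. conv x y n \<notin> G n}" by (rule finite_subset) simp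
 then show ?thesis using conv_F[OF repsD(1)[OF x] repsD(1)[OF y]] by (simp add: reps_def)
qed

lemma B_bilin:
 assumes "x \<in> reps" "y \<in> reps" "z \<in> reps"
 shows "(cl x \<oplus>\<^sub>B cl y) \<otimes>\<^sub>B cl z = cl x \<otimes>\<^sub>B cl z \<oplus>\<^sub>B cl y \<otimes>\<^sub>B cl z"
  "cl z \<otimes>\<^sub>B (cl x \<oplus>\<^sub>B cl y) = cl z \<otimes>\<^sub>B cl x \<oplus>\<^sub>B cl z \<otimes>\<^sub>B cl y"
  "a <: K ==> (a \<odot>\<^sub>B cl x) \<otimes>\<^sub>B cl z = a \<odot>\<^sub>B (cl x \<otimes>\<^sub>B cl z)"
  "a <: K ==> cl z \<otimes>\<^sub>B (a \<odot>\<^sub>B cl x) = a \<odot>\<^sub>B (cl z \<otimes>\<^sub>B cl x)"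
proof -
 interpret A: module K A by simp
 have c: "x n <: A" "y n <: A" "z n <: A" for n using repsD(2) assms by auto
 have 1: "conv (%n. x n \<oplus> y n) z = (%n. conv x z n \<oplus> conv y z n)"
  "conv z (%n. x n \<oplus> y n) = (%n. conv z x n \<oplus> conv z y n)"
  unfolding conv_def using c by (auto simp: A_ua fun_eq_iff simp flip: A.M.finsum_addf)
 have 2: "conv (%n. a \<odot> x n) z = (%n. a \<odot> conv x z n)" "conv z (%n. a \<odot> x n) = (%n. a \<odot> conv z x n)"
  if "a <: K"
  unfolding conv_def using c that by (auto simp: A_ua fun_eq_iff A.finsum_smult_ldistr)
 show "(cl x \<oplus>\<^sub>B cl y) \<otimes>\<^sub>B cl z = cl x \<otimes>\<^sub>B cl z \<oplus>\<^sub>B cl y \<otimes>\<^sub>B cl z"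
  "cl z \<otimes>\<^sub>B (cl x \<oplus>\<^sub>B cl y) = cl z \<otimes>\<^sub>B cl x \<oplus>\<^sub>B cl z \<otimes>\<^sub>B cl y"
  "a <: K ==> (a \<odot>\<^sub>B cl x) \<otimes>\<^sub>B cl z = a \<odot>\<^sub>B (cl x \<otimes>\<^sub>B cl z)"
  "a <: K ==> cl z \<otimes>\<^sub>B (a \<odot>\<^sub>B cl x) = a \<odot>\<^sub>B (cl z \<otimes>\<^sub>B cl x)"
  using assms by (simp_all add: B_add B_mult B_smult reps_add reps_smult reps_conv 1 2)
qed

lemma B_ualg: "ualg B"
proof -
 have mc: "a \<otimes>\<^sub>B b <: B" if "a <: B" "b <: B" for a b
  using that reps_conv by (auto simp: B_carrier B_mult)
 have dist: "(a \<oplus>\<^sub>B b) \<otimes>\<^sub>B d = a \<otimes>\<^sub>B d \<oplus>\<^sub>B b \<otimes>\<^sub>B d" "d \<otimes>\<^sub>B (a \<oplus>\<^sub>B b) = d \<otimes>\<^sub>B a \<oplus>\<^sub>B d \<otimes>\<^sub>B b"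
  "k <: K ==> (k \<odot>\<^sub>B a) \<otimes>\<^sub>B d = k \<odot>\<^sub>B (a \<otimes>\<^sub>B d)" "k <: K ==> d \<otimes>\<^sub>B (k \<odot>\<^sub>B a) = k \<odot>\<^sub>B (d \<otimes>\<^sub>B a)"
  if "a <: B" "b <: B" "d <: B" for a b d k
  using that B_bilin by (auto simp: B_carrier)
 have z: "\<zero>\<^sub>B \<otimes>\<^sub>B d = \<zero>\<^sub>B" "d \<otimes>\<^sub>B \<zero>\<^sub>B = \<zero>\<^sub>B" if "d <: B" for d
  using dist(3)[of d d d "\<zero>\<^sub>K"] dist(4)[of d d d "\<zero>\<^sub>K"] that mc by auto
 have Sc: "{cls n x |n x. x \<in> F n} <<: B" using cls_closed by auto
 have ind: "P a" if "a <: B" "!!n x. x \<in> F n ==> P (cls n x)" "P \<zero>\<^sub>B"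
   "!!x y. x <: B ==> y <: B ==> P x ==> P y ==> P (x \<oplus>\<^sub>B y)"
   "!!k x. k <: K ==> x <: B ==> P x ==> P (k \<odot>\<^sub>B x)" for P a
  using that(1)[unfolded cls_span] BM Sc by (induct rule: span_induct) (use that in auto)
 \<comment> \<open>One factor after the other is expanded into homogeneous classes; for these,
   associativity is inherited from \<open>A\<close>.\<close>
 have as1: "cls m x \<otimes>\<^sub>B cls n y \<otimes>\<^sub>B d = cls m x \<otimes>\<^sub>B (cls n y \<otimes>\<^sub>B d)" if "x \<in> F m" "y \<in> F n" "d <: B" for x y d m n
  using that(3)
  by (rule ind) (use that F_simps(2) in \<open>auto simp: cls_mult F_mult A_ua mc dist z cls_closed add.assoc\<close>)
 have as2: "cls m x \<otimes>\<^sub>B b \<otimes>\<^sub>B d = cls m x \<otimes>\<^sub>B (b \<otimes>\<^sub>B d)" if "x \<in> F m" "b <: B" "d <: B" for x b d m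
  using that(2)
  by (rule ind) (use that in \<open>auto simp: as1 mc dist z cls_closed\<close>)
 have as3: "a \<otimes>\<^sub>B b \<otimes>\<^sub>B d = a \<otimes>\<^sub>B (b \<otimes>\<^sub>B d)" if "a <: B" "b <: B" "d <: B" for a b d
  using that(1)
  by (rule ind) (use that in \<open>auto simp: as2 mc dist z cls_closed\<close>)
 have one: "\<one>\<^sub>B \<otimes>\<^sub>B a = a" "a \<otimes>\<^sub>B \<one>\<^sub>B = a" "\<one>\<^sub>B <: B" if "a <: B" for a
 proof -
  show o: "\<one>\<^sub>B <: B" unfolding B_one by (rule cls_closed[OF one_F0])
  note one_F0 [simp]
  have s: "cls 0 \<one> \<otimes>\<^sub>B cls n x = cls n x" "cls n x \<otimes>\<^sub>B cls 0 \<one> = cls n x" if "x \<in> F n" for n x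
   using F_simps(2)[OF that] cls_mult[OF one_F0 that] cls_mult[OF that one_F0] by (simp_all add: A_ua)
  show "\<one>\<^sub>B \<otimes>\<^sub>B a = a" using that
   by (rule ind) (use o s in \<open>auto simp: B_one cls_mult A_ua F_simps dist z cls_closed\<close>)
  show "a \<otimes>\<^sub>B \<one>\<^sub>B = a" using that
   by (rule ind) (use o s in \<open>auto simp: B_one cls_mult A_ua F_simps dist z cls_closed\<close>)
 qed
 have "Group.monoid B" using mc as3 one one(3)[OF cls_closed[OF one_F0]] by (intro monoidI) auto
 then have "ring B" using dist by (intro ringI mod_ag[OF BM]) auto
 then show ?thesis using dist unfolding unital_algebra_def by simp
qed

definition gproj where "gproj n a = (%m. if m = n then a m else G m)"

lemma gproj_cl: "gproj n (cl x) = cl (single n (x n))"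
 by (rule ext) (simp add: gproj_def cl_def single_def G_coset(4))

lemma gr_grading_cls: "gr_grading A F n = {cls n x |x. x \<in> F n}"
proof
 show "gr_grading A F n \<subseteq> {cls n x |x. x \<in> F n}"
 proof
  fix a assume a: "a \<in> gr_grading A F n"
  then obtain x where x: "a = cl x" "x \<in> reps" by (auto simp: gr_grading_def B_carrier)
  have "a = gproj n a" using a by (auto simp: gr_grading_def gproj_def fun_eq_iff)
  then have "a = cls n (x n)" using x by (simp add: gproj_cl cls_cl)
  then show "a \<in> {cls n x |x. x \<in> F n}" using repsD(1)[OF x(2)] by blast
 qed
 show "{cls n x |x. x \<in> F n} \<subseteq> gr_grading A F n"
  using cls_closed by (auto simp: gr_grading_def gr_class_def)
qed

lemma gproj_lin: "gproj n \<in> lin B B"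
 by (rule linI)
  (auto simp: B_carrier gproj_cl reps_single repsD B_add B_smult reps_add reps_smult F_simps
   intro!: arg_cong[of _ _ cl], auto simp: single_def)

lemma B_graded: "graded_proj B (gr_grading A F) gproj"
 unfolding graded_proj_def
proof (intro conjI allI impI)
 show "sub (gr_grading A F n) B" for n
 proof (rule subI[OF BM])
  show "gr_grading A F n <<: B" by (auto simp: gr_grading_def)
  show "\<zero>\<^sub>B \<in> gr_grading A F n" using cls_zero[of "\<zero>" n] F_simps(3) G_simps(3) unfolding gr_grading_cls by force
  show "x \<oplus>\<^sub>B y \<in> gr_grading A F n" if "x \<in> gr_grading A F n" "y \<in> gr_grading A F n" for x y
   using that F_simps(4) unfolding gr_grading_cls by (auto simp flip: cls_add)
  show "k \<odot>\<^sub>B x \<in> gr_grading A F n" if "k <: K" "x \<in> gr_grading A F n" for x k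
   using that F_simps(5) unfolding gr_grading_cls by (auto simp flip: cls_smult)
 qed
 show "gproj n \<in> lin B B" for n by (rule gproj_lin)
 show "gproj m a = (if m = n then a else \<zero>\<^sub>B)" if "a \<in> gr_grading A F n" for m n a
  using that unfolding gr_grading_cls cls_cl B_zero by (auto simp: gproj_cl single_def)
 show "carrier B = span B (\<Union>n. gr_grading A F n)"
  unfolding cls_span gr_grading_cls by (rule arg_cong[of _ _ "span B"]) auto
qed

end

section \<open>Generators of tensor powers\<close>

context kfield
begin

lemma tp_gen_image:
 assumes V: "module K V" and S: "S <<: V" "carrier V = span V S" and N: "module K N" and Z: "sub Z N"
  and f: "f \<in> lin (tpow K V n) N"
  and fS: "!!vs. length vs = n ==> set vs \<subseteq> S ==> f (tens K V vs) \<in> Z" and t: "t \<in> tp V n"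
 shows "f t \<in> Z"
proof -
 \<comment> \<open>The entries of \<open>us\<close> are already generators; those of
   \<open>vs\<close> are replaced one by one.\<close>
 have "f (tens K V (us @ vs)) \<in> Z"
  if "set us \<subseteq> S" "set vs <<: V" "length us + length vs = n" for us vs
  using that
 proof (induct vs arbitrary: us)
  case Nil then show ?case using fS[of us] by simp
 next
  case (Cons v vs)
  have us: "set us <<: V" using Cons(2) S(1) by blast
  have L: "(%z. tens K V (us @ z # vs)) \<in> lin V (tpow K V n)"
   using us Cons(3,4) by (subst tpow_alt, intro lin_restr_cod tens_ins_lin[OF V] tens_tp[OF V]) auto
  have v: "v \<in> span V S" using Cons(3) S(2) by simp
  show ?case
  proof (rule lin_span_image[OF lin_o[OF f L] V N S(1) Z _ v])
   fix s assume "s \<in> S"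
   then show "f (tens K V (us @ s # vs)) \<in> Z"
    using Cons(1)[of "us @ [s]"] Cons(2-4) by simp
  qed
 qed
 from this[of "[]"] have g: "length vs = n ==> set vs <<: V ==> f (tens K V vs) \<in> Z" for vs by simp
 from V t show ?thesis
  by (induct rule: tp_ind) (use g lin_simps[OF f] lin_zero[OF f tpow_mod[OF V] N] sub_simps[OF N Z] in auto)
qed

lemma tp_lin_eq_gen:
 assumes V: "module K V" and S: "S <<: V" "carrier V = span V S" and N: "module K N"
  and f: "f \<in> lin (tpow K V n) N" and g: "g \<in> lin (tpow K V n) N"
  and eq: "!!vs. length vs = n ==> set vs \<subseteq> S ==> f (tens K V vs) = g (tens K V vs)" and t: "t \<in> tp V n"
 shows "f t = g t"
proof -
 have "(f t \<ominus>\<^sub>N g t) \<in> {\<zero>\<^sub>N}"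
 proof (rule tp_gen_image[OF V S N sub_0[OF N] lin_sub[OF N f g] _ t])
  fix vs assume vs: "length vs = n" "set vs \<subseteq> S"
  then have "tens K V vs \<in> tp V n" using S(1) by (intro tens_tp[OF V]) auto
  then show "(f (tens K V vs) \<ominus>\<^sub>N g (tens K V vs)) \<in> {\<zero>\<^sub>N}"
   using eq[OF vs] lin_cl[OF g] N by (simp add: mod_minus)
 qed
 then show ?thesis using mod_eqI[OF N lin_cl[OF f t] lin_cl[OF g t]] by simp
qed

subsection \<open>Homogeneous components of tensor products of graded families of maps\<close>

text \<open>The part of total degree \<open>n\<close> of
  \<open>\<kappa> v1 \<otimes> ... \<otimes> \<kappa> vr\<close>, where \<kappa> is the formal sum
  of all \<open>\<kappa> a\<close>. Applied to linear extensions of the class maps, it yields a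
  symbol map that is linear on the whole tensor algebra.\<close>

primrec gkl :: "('k, 'w) module => (nat => 'v => 'w) => 'v list => nat => ('w list => 'k) set" where
 "gkl W \<kappa> [] = (%n. if n = 0 then \<one>\<^sub>(T W) else \<zero>\<^sub>(T W))"
| "gkl W \<kappa> (v # vs) = (%n. \<Oplus>\<^sub>(T W)a\<in>{..n}. tens K W [\<kappa> a v] \<star>\<^sub>W gkl W \<kappa> vs (n - a))"

definition gk :: "('k, 'v) module => ('k, 'w) module => (nat => 'v => 'w) => nat => ('v list => 'k) set => ('w list => 'k) set" where
 "gk V W \<kappa> n = tlift V (T W) (%vs. gkl W \<kappa> vs n)"

context
 fixes V :: "('k, 'v) module" and W :: "('k, 'w) module" and \<kappa> :: "nat => 'v => 'w"
 assumes V [simp]: "module K V" and W [simp]: "module K W" and \<kappa>: "!!n. \<kappa> n \<in> lin V W"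
begin

lemmas TW = T_mod[OF W] and TW_ua = T_ua[OF W]

lemma gkl_tp: "set vs <<: V ==> gkl W \<kappa> vs n \<in> tp W (length vs)"
proof (induct vs arbitrary: n)
 case Nil
 then show ?case using tens_tp[OF W, of "[]" 0] sub_zero[OF TW tp_sub[OF W]] by (simp add: tens_Nil[OF W])
next
 case (Cons v vs)
 have "tens K W [\<kappa> a v] \<star>\<^sub>W gkl W \<kappa> vs (n - a) \<in> tp W (length vs + 1)" for a
  using Cons lin_cl[OF \<kappa>] by (subst add.commute) (intro tp_mult[OF W] tens_tp[OF W], auto)
 then show ?case by (auto intro!: sub_finsum[OF TW tp_sub[OF W]])
qed

lemma gkl_T: "set vs <<: V ==> gkl W \<kappa> vs n <: (T W)"
 using gkl_tp tp_T[OF W] by blast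

lemma gkl_lin: "set us <<: V ==> set vs <<: V ==> (%z. gkl W \<kappa> (us @ z # vs) n) \<in> lin V (T W)"
proof (induct us arbitrary: n)
 case Nil
 have "(%z. \<Oplus>\<^sub>(T W)a\<in>{..n}. tens K W [\<kappa> a z] \<star>\<^sub>W gkl W \<kappa> vs (n - a)) \<in> lin V (T W)"
  using Nil by (intro finsum_lin TW V lin_rmult[OF T_ualg[OF W]] lin_o[OF tens1_lin[OF W] \<kappa>] gkl_T) auto
 then show ?case by simp
next
 case (Cons u us)
 have "(%z. \<Oplus>\<^sub>(T W)a\<in>{..n}. tens K W [\<kappa> a u] \<star>\<^sub>W gkl W \<kappa> (us @ z # vs) (n - a)) \<in> lin V (T W)"
  using Cons lin_cl[OF \<kappa>] by (intro finsum_lin TW V lin_lmult[OF T_ualg[OF W]]) auto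
 then show ?case by simp
qed

lemma gkl_multilin: "multilin V (T W) (%vs. gkl W \<kappa> vs n)"
 using gkl_T lin_add[OF gkl_lin] lin_smult[OF gkl_lin] by (intro multilinI) auto

lemma gk_lin: "gk V W \<kappa> n \<in> lin (T V) (T W)"
 and gk_tens: "set vs <<: V ==> gk V W \<kappa> n (tens K V vs) = gkl W \<kappa> vs n"
 unfolding gk_def using tlift_lin[OF V TW gkl_multilin] tlift_tens[OF V TW gkl_multilin] by auto

lemma gkl_high: "list_all2 (%v a. v <: V \<and> (\<forall>b>a. \<kappa> b v = \<zero>\<^sub>W)) vs as ==> sum_list as < n ==> gkl W \<kappa> vs n = \<zero>\<^sub>(T W)"
proof (induct arbitrary: n rule: list_all2_induct)
 case (Cons v vs a as)
 have "set vs <<: V" using Cons(2) by (induct rule: list_all2_induct) auto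
 then have c: "gkl W \<kappa> vs m <: (T W)" for m by (rule gkl_T)
 have "tens K W [\<kappa> b v] \<star>\<^sub>W gkl W \<kappa> vs (n - b) \<in> {\<zero>\<^sub>(T W)}" if "b \<in> {..n}" for b
 proof (cases "b > a")
  case True then show ?thesis using Cons(1) c by (simp add: tens1_zero[OF W] TW_ua)
 next
  case False then show ?thesis using Cons(1) Cons(3)[of "n - b"] Cons(4) lin_cl[OF \<kappa>] by (simp add: TW_ua)
 qed
 then have "(\<Oplus>\<^sub>(T W)b\<in>{..n}. tens K W [\<kappa> b v] \<star>\<^sub>W gkl W \<kappa> vs (n - b)) \<in> {\<zero>\<^sub>(T W)}"
  by (rule sub_finsum[OF TW sub_0[OF TW]])
 then show ?case by simp
qed simp

lemma gkl_low: "list_all2 (%v a. v <: V \<and> (\<forall>b<a. \<kappa> b v = \<zero>\<^sub>W)) vs as ==> n < sum_list as ==> gkl W \<kappa> vs n = \<zero>\<^sub>(T W)"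
proof (induct arbitrary: n rule: list_all2_induct)
 case (Cons v vs a as)
 have "set vs <<: V" using Cons(2) by (induct rule: list_all2_induct) auto
 then have c: "gkl W \<kappa> vs m <: (T W)" for m by (rule gkl_T)
 have "tens K W [\<kappa> b v] \<star>\<^sub>W gkl W \<kappa> vs (n - b) \<in> {\<zero>\<^sub>(T W)}" if "b \<in> {..n}" for b
 proof (cases "b < a")
  case True then show ?thesis using Cons(1) c by (simp add: tens1_zero[OF W] TW_ua)
 next
  case False then show ?thesis using Cons(1) Cons(3)[of "n - b"] Cons(4) that lin_cl[OF \<kappa>] by (simp add: TW_ua)
 qed
 then have "(\<Oplus>\<^sub>(T W)b\<in>{..n}. tens K W [\<kappa> b v] \<star>\<^sub>W gkl W \<kappa> vs (n - b)) \<in> {\<zero>\<^sub>(T W)}"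
  by (rule sub_finsum[OF TW sub_0[OF TW]])
 then show ?case by simp
qed simp

text \<open>The entries of \<open>as\<close> bound the degrees of the vectors; any other
  distribution of the same total degree exceeds one of the bounds, so a single summand
  survives.\<close>

lemma gkl_top: "list_all2 (%v a. v <: V \<and> (\<forall>b>a. \<kappa> b v = \<zero>\<^sub>W)) vs as ==>
  gkl W \<kappa> vs (sum_list as) = tens K W (map2 (%v a. \<kappa> a v) vs as)"
proof (induct rule: list_all2_induct)
 case Nil then show ?case by (simp add: tens_Nil[OF W])
next
 case (Cons v vs a as)
 interpret TT: module K "T W" by (rule TW)
 have vs: "set vs <<: V" using Cons(2) by (induct rule: list_all2_induct) auto
 then have c: "gkl W \<kappa> vs m <: (T W)" for m by (rule gkl_T)
 have z: "tens K W [\<kappa> b v] \<star>\<^sub>W gkl W \<kappa> vs (a + sum_list as - b) = \<zero>\<^sub>(T W)" if "b \<in> {..a + sum_list as} - {a}" for b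
 proof (cases "b > a")
  case True then show ?thesis using Cons(1) c by (simp add: tens1_zero[OF W] TW_ua)
 next
  case False
  then have "gkl W \<kappa> vs (a + sum_list as - b) = \<zero>\<^sub>(T W)" using that by (intro gkl_high[OF Cons(2)]) auto
  then show ?thesis using Cons(1) lin_cl[OF \<kappa>] by (simp add: TW_ua)
 qed
 have "set (map2 (%v a. \<kappa> a v) vs as) <<: W"
  using Cons(2) lin_cl[OF \<kappa>] by (induct rule: list_all2_induct) auto
 then have "tens K W (map2 (%v a. \<kappa> a v) (v # vs) (a # as)) = tens K W [\<kappa> a v] \<star>\<^sub>W gkl W \<kappa> vs (sum_list as)"
  using Cons(1,3) lin_cl[OF \<kappa>] tens_append[OF W, of "[\<kappa> a v]" "map2 (%v a. \<kappa> a v) vs as"] by simp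
 also have "\<dots> = (\<Oplus>\<^sub>(T W)b\<in>{a}. tens K W [\<kappa> b v] \<star>\<^sub>W gkl W \<kappa> vs (a + sum_list as - b))"
  using Cons(1) c lin_cl[OF \<kappa>] by (simp add: TW_ua)
 also have "\<dots> = (\<Oplus>\<^sub>(T W)b\<in>{..a + sum_list as}. tens K W [\<kappa> b v] \<star>\<^sub>W gkl W \<kappa> vs (a + sum_list as - b))"
  using Cons(1) c lin_cl[OF \<kappa>] z by (intro finsum_superset[OF TW]) (auto simp: TW_ua)
 finally show ?case by simp
qed

end

lemma braided_algebraI:
 assumes A: "ualg A" and c: "c \<in> lin (tpow K A 2) (tpow K A 2)"
  and yb: "!!t. t \<in> tp A 3 ==> opat A 0 2 c (opat A 1 2 c (opat A 0 2 c t)) = opat A 1 2 c (opat A 0 2 c (opat A 1 2 c t))"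
  and n0: "!!t. t \<in> tp A 3 ==> c (opat A 0 2 (nabla K A) t) = opat A 1 2 (nabla K A) (opat A 0 2 c (opat A 1 2 c t))"
  and n1: "!!t. t \<in> tp A 3 ==> c (opat A 1 2 (nabla K A) t) = opat A 0 2 (nabla K A) (opat A 1 2 c (opat A 0 2 c t))"
  and u: "!!a. a <: A ==> c (tens K A [\<one>\<^sub>A, a]) = tens K A [a, \<one>\<^sub>A]"
   "!!a. a <: A ==> c (tens K A [a, \<one>\<^sub>A]) = tens K A [\<one>\<^sub>A, a]"
 shows "braided_algebra K A c"
proof -
 note V = ua_mod[OF A]
 have c': "c \<in> lin (tpow K A 2) (T A)" using c tp_T[OF V] by (auto simp: linear_maps_def Pi_iff)
 have ct: "c t \<in> tp A 2" if "t \<in> tp A 2" for t using lin_cl[OF c that] .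
 have C3: "opat A 0 2 c t \<in> tp A 3" "opat A 1 2 c t \<in> tp A 3" if "t \<in> tp A 3" for t
  using opat_tp[OF V c' ct, of t 0 1] opat_tp[OF V c' ct, of t 1 0] that by simp_all
 have b: "brd K A c 3 1 t = opat A 0 2 c t" "brd K A c 3 2 t = opat A 1 2 c t" if "t \<in> tp A 3" for t
  using amp_opat[OF V c', of t 0 1] amp_opat[OF V c', of t 1 0] that by (simp_all add: brd_def)
 have n: "amp K A 0 2 (nabla K A) 1 t = opat A 0 2 (nabla K A) t" "amp K A 1 2 (nabla K A) 0 t = opat A 1 2 (nabla K A) t"
  if "t \<in> tp A 3" for t
  using amp_opat[OF V nabla_lin[OF A], of t 0 1] amp_opat[OF V nabla_lin[OF A], of t 1 0] that by simp_all
 show ?thesis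
  unfolding braided_algebra_def braided_space_def
  using A V c yb n0 n1 u by (simp add: b n C3)
qed

end

context irr_bialg
begin

subsection \<open>The functor to graded tensors\<close>

abbreviation TB where "TB == T B"
abbreviation teB where "teB == tens K B"

text \<open>A linear extension of the class map from \<open>F n\<close>, where
  \<open>R (Suc n)\<close> is the identity, to all of \<open>A\<close>.\<close>

definition kap where "kap n x = cls n (R (Suc n) x)"
text \<open>A linear section of the class maps: \<open>Q n\<close> vanishes on \<open>G n\<close>
  and so removes the dependence on the chosen representative.\<close>

definition sg where "sg n a = Q n (SOME x. x \<in> a n)"

lemma RF: "x <: A ==> R (Suc n) x \<in> F n" "x \<in> F n ==> R (Suc n) x = x"
 using R_mem[of x "Suc n"] R_id[of x "Suc n"] by (auto simp: G_Suc)

lemma kap_lin: "kap n \<in> lin A B"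
 using lin_cl[OF R_lin] lin_add[OF R_lin] lin_smult[OF R_lin]
 by (intro linI) (simp_all add: kap_def cls_closed cls_add cls_smult RF(1))

lemma kap_F: "x \<in> F n ==> kap n x = cls n x"
 by (simp add: kap_def RF(2))

lemma kap_high: "x \<in> F a ==> a < b ==> kap b x = \<zero>\<^sub>B"
proof -
 assume h: "x \<in> F a" "a < b"
 then have "x \<in> G b" using G_mono[of "Suc a" b x] by (simp add: G_Suc)
 then show ?thesis using kap_F[OF G_F] cls_zero[OF G_F] by simp
qed

lemma sg_cl: assumes x: "x \<in> reps" shows "sg n (cl x) = Q n (x n)"
proof -
 define y where "y = (SOME y. y \<in> cl x n)"
 have "x n \<in> cl x n" unfolding cl_def using G_coset(2) repsD(2)[OF x] by simp
 then have "y \<in> cl x n" unfolding y_def by (rule someI)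
 then have y: "y <: A" "y \<ominus> x n \<in> G n" using G_coset(1) repsD(2)[OF x] by (auto simp: cl_def)
 then have "Q n y \<ominus> Q n (x n) = \<zero>"
  using Q_G[OF y(2)] lin_minus[OF Q_lin AM AM y(1) repsD(2)[OF x]] by simp
 then have "Q n y = Q n (x n)" using mod_eqI[OF AM Q_closed[OF y(1)] Q_closed[OF repsD(2)[OF x]]] by simp
 then show ?thesis unfolding sg_def y_def .
qed

lemma sg_lin: "sg n \<in> lin B A"
 by (rule linI) (auto simp: B_carrier sg_cl B_add B_smult reps_add reps_smult repsD Q_closed lin_add[OF Q_lin] lin_smult[OF Q_lin])

lemma sg_cls: "x \<in> F a ==> sg n (cls a x) = (if n = a then Q a x else \<zero>)"
 unfolding cls_cl using lin_zero[OF Q_lin AM AM] by (simp add: sg_cl reps_single) (simp add: single_def)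

lemma sg_bound: "b <: B ==> \<exists>k. \<forall>n>k. sg n b = \<zero>"
proof -
 assume "b <: B"
 then obtain x where x: "b = cl x" "x \<in> reps" by (auto simp: B_carrier)
 obtain k where "\<forall>n\<in>{n. x n \<notin> G n}. n < k" using finite_nat_set_iff_bounded repsD(3)[OF x(2)] by meson
 then have "\<forall>n>k. sg n b = \<zero>" unfolding x(1) sg_cl[OF x(2)] using Q_G by fastforce
 then show ?thesis ..
qed

text \<open>The symbol in degree \<open>n\<close>: on \<open>Fil p n\<close> it is the quotient map
  to the associated graded tensors, and it kills the lower filtration steps. \<open>Sg n\<close>
  lifts the component of degree \<open>n\<close> back.\<close>

definition Kg where "Kg n = gk A B kap n"
definition Sg where "Sg n = gk B A sg n"

lemma Kg_lin: "Kg n \<in> lin (T A) TB" and Sg_lin: "Sg n \<in> lin TB (T A)"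
 unfolding Kg_def Sg_def using gk_lin[OF AM BM kap_lin] gk_lin[OF BM AM sg_lin] by auto

lemma TBM: "module K TB" by (rule T_mod[OF BM])
lemmas TB_ua = T_ua[OF BM]

abbreviation clsL where "clsL xs as == map2 (%x a. cls a x) xs as"

abbreviation inF where "inF xs as == list_all2 (%x a. x \<in> F a) xs as"

lemma inF_kap: "inF xs as ==> list_all2 (%v a. v <: A \<and> (\<forall>b>a. kap b v = \<zero>\<^sub>B)) xs as"
 by (erule list_all2_mono) (auto simp: F_simps(2) kap_high)

lemma clsL_closed: "inF xs as ==> set (clsL xs as) <<: B"
 by (induct rule: list_all2_induct) (auto simp: cls_closed)

lemma Kg_cls: assumes "inF xs as" shows "Kg (sum_list as) (te xs) = teB (clsL xs as)"
proof -
 have "map2 (%v a. kap a v) xs as = clsL xs as" using assms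
  by (induct rule: list_all2_induct) (auto simp: kap_F)
 with gkl_top[OF AM BM kap_lin inF_kap[OF assms]] gk_tens[OF AM BM kap_lin list_all2_F[OF assms]]
 show ?thesis by (simp only: Kg_def)
qed

lemma Kg_low: assumes "t \<in> Fil p m" "m < n" shows "Kg n t = \<zero>\<^sub>TB"
proof -
 have "Kg n t \<in> {\<zero>\<^sub>TB}"
 proof (rule Fil_image[OF Kg_lin TBM sub_0[OF TBM] assms(1)])
  fix vs as assume "inF vs as" "sum_list as = m"
  then show "Kg n (te vs) \<in> {\<zero>\<^sub>TB}"
   using gkl_high[OF AM BM kap_lin inF_kap] list_all2_F assms(2) by (simp add: Kg_def gk_tens[OF AM BM kap_lin])
 qed
 then show ?thesis by simp
qed

lemma Sg_cls: assumes "inF xs as"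
 shows "Sg n (teB (clsL xs as)) = (if n = sum_list as then te (map2 (%x a. Q a x) xs as) else \<zero>\<^sub>(T A))"
proof -
 have h: "list_all2 (%v a. v <: B \<and> (\<forall>b>a. sg b v = \<zero>)) (clsL xs as) as"
  "list_all2 (%v a. v <: B \<and> (\<forall>b<a. sg b v = \<zero>)) (clsL xs as) as"
  "map2 (%v a. sg a v) (clsL xs as) as = map2 (%x a. Q a x) xs as"
  using assms by (induct rule: list_all2_induct) (auto simp: cls_closed sg_cls)
 show ?thesis
  using gkl_high[OF BM AM sg_lin h(1), of n] gkl_low[OF BM AM sg_lin h(2), of n]
   gkl_top[OF BM AM sg_lin h(1)] clsL_closed[OF assms] h(3)
  by (cases "n < sum_list as") (auto simp: Sg_def gk_tens[OF BM AM sg_lin] not_less)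
qed

lemma Sg_fin: assumes t: "t <: TB" shows "finite {n. Sg n t \<noteq> \<zero>\<^sub>(T A)}"
 using BM t
proof (induct rule: T_ind)
 case (tens bs)
 have "\<exists>as. list_all2 (%v a. v <: B \<and> (\<forall>b>a. sg b v = \<zero>)) bs as" using tens
 proof (induct bs)
  case (Cons b bs)
  then obtain as k where "list_all2 (%v a. v <: B \<and> (\<forall>b>a. sg b v = \<zero>)) bs as" "\<forall>n>k. sg n b = \<zero>"
   using sg_bound[of b] by auto
  then show ?case using Cons(2) by (intro exI[of _ "k # as"]) auto
 qed auto
 then obtain as where as: "list_all2 (%v a. v <: B \<and> (\<forall>b>a. sg b v = \<zero>)) bs as" ..
 have "Sg n (teB bs) = \<zero>\<^sub>(T A)" if "n > sum_list as" for n
  using gkl_high[OF BM AM sg_lin as that] tens by (simp add: Sg_def gk_tens[OF BM AM sg_lin])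
 then have "{n. Sg n (teB bs) \<noteq> \<zero>\<^sub>(T A)} \<subseteq> {..sum_list as}" by (auto simp: not_less[symmetric])
 then show ?case by (rule finite_subset) simp
next
 case zero then show ?case using lin_zero[OF Sg_lin TBM TAM] by simp
next
 case (add f g)
 have "Sg n (f \<oplus>\<^sub>TB g) = Sg n f \<oplus>\<^sub>(T A) Sg n g" for n using add by (intro lin_add[OF Sg_lin])
 then have "{n. Sg n (f \<oplus>\<^sub>TB g) \<noteq> \<zero>\<^sub>(T A)} \<subseteq> {n. Sg n f \<noteq> \<zero>\<^sub>(T A)} \<union> {n. Sg n g \<noteq> \<zero>\<^sub>(T A)}" using TAM by auto
 then show ?case by (rule finite_subset) (use add in blast)
next
 case (smult a f)
 have "Sg n (a \<odot>\<^sub>TB f) = a \<odot>\<^sub>(T A) Sg n f" for n using smult by (intro lin_smult[OF Sg_lin])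
 then have "{n. Sg n (a \<odot>\<^sub>TB f) \<noteq> \<zero>\<^sub>(T A)} \<subseteq> {n. Sg n f \<noteq> \<zero>\<^sub>(T A)}" using TAM smult(1) by auto
 then show ?case by (rule finite_subset) (use smult in blast)
qed

text \<open>The map induced by \<open>f\<close> on the associated graded tensors: lift each
  component, apply \<open>f\<close>, take the symbol in the same degree.\<close>

definition grm where "grm f t = (\<Oplus>\<^sub>TB n\<in>{n. Kg n (f (Sg n t)) \<noteq> \<zero>\<^sub>TB}. Kg n (f (Sg n t)))"

lemma grm_lin: "f \<in> lin (T A) (T A) ==> grm f \<in> lin TB TB"
 and grm_cls: "f \<in> lin (T A) (T A) ==> inF xs as ==>
  grm f (teB (clsL xs as)) = Kg (sum_list as) (f (te (map2 (%x a. Q a x) xs as)))"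
proof -
 assume f: "f \<in> lin (T A) (T A)"
 interpret TT: module K TB by (rule TBM)
 have h: "(%t. Kg n (f (Sg n t))) \<in> lin TB TB" for n by (rule lin_o[OF Kg_lin lin_o[OF f Sg_lin]])
 have z: "Kg n (f \<zero>\<^sub>(T A)) = \<zero>\<^sub>TB" for n using lin_zero[OF f TAM TAM] lin_zero[OF Kg_lin TAM TBM] by simp
 have "finite {n. Kg n (f (Sg n t)) \<noteq> \<zero>\<^sub>TB}" if "t <: TB" for t
  by (rule finite_subset[OF _ Sg_fin[OF that]]) (use z in auto)
 then show "grm f \<in> lin TB TB" unfolding grm_def by (rule lin_locfin_sum[OF TBM TBM h])
 assume x: "inF xs as"
 let ?t = "teB (clsL xs as)"
 have t: "?t <: TB" using tens_closed[OF BM clsL_closed[OF x]] .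
 have "grm f ?t = (\<Oplus>\<^sub>TB n\<in>{sum_list as}. Kg n (f (Sg n ?t)))"
  unfolding grm_def
 proof (rule finsum_superset[OF TBM])
  show "Kg n (f (Sg n ?t)) <: TB" for n using lin_cl[OF h t] .
 qed (use z in \<open>auto simp: Sg_cls[OF x] split: if_splits\<close>)
 also have "\<dots> = Kg (sum_list as) (f (te (map2 (%x a. Q a x) xs as)))"
  using lin_cl[OF h t, of "sum_list as"] by (simp add: Sg_cls[OF x])
 finally show "grm f ?t = Kg (sum_list as) (f (te (map2 (%x a. Q a x) xs as)))" .
qed

definition Low where "Low p n = span (T A) {te vs |vs. length vs = p \<and> (\<exists>as. inF vs as \<and> sum_list as < n)}"

lemma Low_gens: "{te vs |vs. length vs = p \<and> (\<exists>as. inF vs as \<and> sum_list as < n)} <<: (T A)"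
 using list_all2_F by (auto intro!: tens_closed')

lemma Low_sub: "sub (Low p n) (T A)"
 unfolding Low_def by (rule span_sub[OF TAM Low_gens])

lemma Low_base: "inF vs as ==> sum_list as < n ==> te vs \<in> Low (length vs) n"
 unfolding Low_def by (rule span_base) auto

lemma Low_mult: assumes v: "v \<in> F a" and t: "t \<in> Low p n" shows "te [v] \<star> t \<in> Low (p + 1) (a + n)"
 using lin_lmult[OF TA_ualg lin_id] TAM TAM Low_gens Low_sub _ t[unfolded Low_def]
proof (rule lin_span_image)
 show "te [v] <: (T A)" using F_simps(2)[OF v] by simp
 fix s assume "s \<in> {te vs |vs. length vs = p \<and> (\<exists>as. inF vs as \<and> sum_list as < n)}"
 then obtain vs as where s: "s = te vs" "length vs = p" "inF vs as" "sum_list as < n" by blast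
 then have "te (v # vs) \<in> Low (length (v # vs)) (a + n)" using v by (intro Low_base[of "v # vs" "a # as"]) auto
 then show "te [v] \<star> s \<in> Low (p + 1) (a + n)"
  using s F_simps(2)[OF v] list_all2_F[OF s(3)] tens_append[OF AM, of "[v]" vs] by simp
qed

lemma Q_F: "x \<in> F a ==> Q a x \<in> F a"
 using R_mem[of x a] F_simps(2)[of x a] G_F F_simps(7) by (simp add: Q_def)

text \<open>\<open>Q a x\<close> differs from \<open>x\<close> by \<open>R a x\<close>, which has
  lower degree. Lifting the symbol of a tensor therefore recovers it up to terms of lower total
  degree.\<close>

lemma Q_low: "inF xs as ==> te (map2 (%x a. Q a x) xs as) \<ominus>\<^sub>(T A) te xs \<in> Low (length xs) (sum_list as)"
proof (induct rule: list_all2_induct)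
 case Nil then show ?case using sub_zero[OF TAM Low_sub] by simp
next
 case (Cons x xs a as)
 let ?qs = "map2 (%x a. Q a x) xs as"
 note xA = F_simps(2)[OF Cons(1)] and xsA = list_all2_F[OF Cons(2)]
 have qs: "set ?qs <<: A" using Cons(2) by (induct rule: list_all2_induct) (auto simp: Q_closed F_simps(2))
 have RA: "R a x <: A" by (rule lin_cl[OF R_lin xA])
 have t: "te ?qs <: (T A)" "te xs <: (T A)" using qs xsA by auto
 have Qx: "te [Q a x] = te [x] \<ominus>\<^sub>(T A) te [R a x]"
  using lin_minus[OF A_tens1_lin AM TAM xA RA] by (simp add: Q_def)
 have e1: "te (Q a x # ?qs) = te [Q a x] \<star> te ?qs" "te (x # xs) = te [x] \<star> te xs" "te (R a x # xs) = te [R a x] \<star> te xs"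
  using tens_append[OF AM, of "[Q a x]" ?qs] tens_append[OF AM, of "[x]" xs] tens_append[OF AM, of "[R a x]" xs]
    qs xsA xA RA Q_closed[OF xA] by simp_all
 have "te [Q a x] \<star> (te ?qs \<ominus>\<^sub>(T A) te xs) = te (Q a x # ?qs) \<ominus>\<^sub>(T A) (te (x # xs) \<ominus>\<^sub>(T A) te (R a x # xs))"
  unfolding e1 using xA RA Q_closed[OF xA] t TAM by (simp add: mod_minus TA_ua Qx mod_negadd mod_sadd)
 moreover have "te (R a x # xs) \<in> Low (length xs + 1) (a + sum_list as)"
 proof (cases a)
  case 0
  then have "te (R a x # xs) = \<zero>\<^sub>(T A)" using R_mem[OF xA, of 0] t unfolding e1 by (simp add: G_0 A_tens1_zero TA_ua)
  then show ?thesis using sub_zero[OF TAM Low_sub] by simp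
 next
  case (Suc b)
  have "te (R a x # xs) \<in> Low (length (R a x # xs)) (a + sum_list as)"
   using R_mem[OF xA, of a] Suc Cons(2) by (intro Low_base[of _ "b # as"]) (auto simp: G_Suc)
  then show ?thesis by simp
 qed
 moreover have "te [Q a x] \<star> (te ?qs \<ominus>\<^sub>(T A) te xs) \<in> Low (length xs + 1) (a + sum_list as)"
  by (rule Low_mult[OF Q_F[OF Cons(1)] Cons(3)])
 ultimately have "(te (Q a x # ?qs) \<ominus>\<^sub>(T A) (te (x # xs) \<ominus>\<^sub>(T A) te (R a x # xs))) \<ominus>\<^sub>(T A) te (R a x # xs) \<in> Low (length xs + 1) (a + sum_list as)"
  by (simp only: sub_minus[OF TAM Low_sub])
 moreover have "(te (Q a x # ?qs) \<ominus>\<^sub>(T A) (te (x # xs) \<ominus>\<^sub>(T A) te (R a x # xs))) \<ominus>\<^sub>(T A) te (R a x # xs) = te (Q a x # ?qs) \<ominus>\<^sub>(T A) te (x # xs)"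
  using xA RA xsA qs Q_closed[OF xA] TAM tens_closed'[of "Q a x # ?qs"] tens_closed'[of "x # xs"] tens_closed'[of "R a x # xs"]
  by (simp add: mod_minus mod_negadd mod_assoc)
 ultimately show ?case by simp
qed

definition filtered where "filtered p q f \<longleftrightarrow> f \<in> lin (tpow K A p) (T A) \<and> (\<forall>n t. t \<in> Fil p n --> f t \<in> Fil q n)"

text \<open>The lift of a symbol differs from the original tensor by terms of lower degree;
  \<open>f\<close> does not raise their degree, and \<open>Kg n\<close> kills them.\<close>

lemma grm_Kg:
 assumes f: "f \<in> lin (T A) (T A)" and fil: "filtered p q f" and t: "t \<in> Fil p n"
 shows "grm f (Kg n t) = Kg n (f t)"
 using t
proof (induct rule: Fil_induct)
 case (tens vs as)
 let ?u = "te (map2 (%x a. Q a x) vs as)" and ?t = "te vs"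
 have qs: "set (map2 (%x a. Q a x) vs as) <<: A"
  using tens(2) by (induct rule: list_all2_induct) (auto simp: Q_closed F_simps(2))
 have c: "?u <: (T A)" "?t <: (T A)" using qs list_all2_F[OF tens(2)] by auto
 have low: "Kg n (f s) \<in> {\<zero>\<^sub>TB}" if "s \<in> Low p n" for s
  using lin_o[OF Kg_lin f] TAM TBM Low_gens sub_0[OF TBM] _ that[unfolded Low_def]
 proof (rule lin_span_image)
  fix s assume "s \<in> {te vs |vs. length vs = p \<and> (\<exists>as. inF vs as \<and> sum_list as < n)}"
  then obtain vs as where s: "s = te vs" "length vs = p" "inF vs as" "sum_list as < n" by blast
  then have "f s \<in> Fil q (sum_list as)" using fil Fil_base[OF s(3)] by (simp add: filtered_def)
  then show "Kg n (f s) \<in> {\<zero>\<^sub>TB}" using Kg_low s(4) by blast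
 qed
 have "Kg n (f (?u \<ominus>\<^sub>(T A) ?t)) = \<zero>\<^sub>TB" using low[of "?u \<ominus>\<^sub>(T A) ?t"] Q_low[OF tens(2)] tens(1,3) by simp
 then have "Kg n (f ?u) \<ominus>\<^sub>TB Kg n (f ?t) = \<zero>\<^sub>TB"
  using lin_minus[OF lin_o[OF Kg_lin f] TAM TBM c] by simp
 then have "Kg n (f ?u) = Kg n (f ?t)"
  using mod_eqI[OF TBM] lin_cl[OF lin_o[OF Kg_lin f]] c by blast
 then show ?case using grm_cls[OF f tens(2)] Kg_cls[OF tens(2)] tens(3) by simp
next
 case zero
 then show ?case using lin_zero[OF grm_lin[OF f] TBM TBM] lin_zero[OF Kg_lin TAM TBM] lin_zero[OF f TAM TAM] by simp
qed (use lin_simps[OF grm_lin[OF f]] lin_simps[OF Kg_lin] lin_simps[OF f] Fil_T in auto)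

lemma Kg_mult: "s \<in> Fil p m ==> t \<in> Fil q n ==> Kg (m + n) (s \<star> t) = Kg m s \<otimes>\<^sub>TB Kg n t"
proof (induct rule: Fil_induct)
 case (tens us as)
 from tens(4) show ?case
 proof (induct rule: Fil_induct)
  case (tens vs bs)
  note u = \<open>inF us as\<close> \<open>sum_list as = m\<close>
  have "inF (us @ vs) (as @ bs)" using u tens by (intro list_all2_appendI)
  from Kg_cls[OF this] have "Kg (m + n) (te (us @ vs)) = teB (clsL us as @ clsL vs bs)"
   using u tens list_all2_lengthD[OF u(1)] by simp
  also have "\<dots> = teB (clsL us as) \<otimes>\<^sub>TB teB (clsL vs bs)"
   by (rule tens_append[OF BM clsL_closed[OF u(1)] clsL_closed[OF tens(2)]])
  finally show ?case using u tens Kg_cls[OF u(1)] Kg_cls[OF tens(2)] list_all2_F[OF u(1)] list_all2_F[OF tens(2)]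
   by (simp add: A_tens_append)
 qed (use list_all2_F[OF tens(2)] lin_simps[OF Kg_lin] TAM TBM in \<open>auto simp: TA_ua TB_ua Fil_T\<close>)
qed (use lin_simps[OF Kg_lin] TAM TBM in \<open>auto simp: TA_ua TB_ua Fil_T\<close>)

text \<open>\<open>g\<close> is the map that \<open>f\<close> induces on symbols. Such pairs are
  stable under \<open>opat\<close> (\<open>gr_pair_opat\<close>), and symbols span, so operator
  identities in \<open>A\<close> descend to \<open>gr H\<close> by \<open>B_tp_eq\<close>.\<close>

definition gr_pair where "gr_pair p q f g \<longleftrightarrow> filtered p q f \<and> g \<in> lin (tpow K B p) TB \<and> (\<forall>n t. t \<in> Fil p n --> g (Kg n t) = Kg n (f t))"

lemma Kg_tp: "t \<in> Fil p n ==> Kg n t \<in> tp B p"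
proof (rule Fil_image[OF Kg_lin TBM tp_sub[OF BM]])
 fix vs as assume "length vs = p" "inF vs as" "sum_list as = n"
 then show "Kg n (te vs) \<in> tp B p" using Kg_cls[of vs as] clsL_closed[of vs as] list_all2_lengthD[of _ vs as]
  by (auto intro!: tens_tp[OF BM])
qed

lemma gr_pair_opat:
 assumes fg: "gr_pair p q f g" and t: "t \<in> Fil r n" and i: "i + p \<le> r"
 shows "opat A i p f t \<in> Fil (r - p + q) n" "opat B i p g (Kg n t) = Kg n (opat A i p f t)"
proof -
 have f: "f \<in> lin (tpow K A p) (T A)" and g: "g \<in> lin (tpow K B p) TB"
  and ff: "!!n t. t \<in> Fil p n ==> f t \<in> Fil q n" and fk: "!!n t. t \<in> Fil p n ==> g (Kg n t) = Kg n (f t)"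
  using fg by (auto simp: gr_pair_def filtered_def)
 note L = lin_simps[OF A_opat_lin[OF f, of i]] lin_simps[OF opat_lin[OF BM g, of i]] lin_simps[OF Kg_lin]
 have "opat A i p f t \<in> Fil (r - p + q) n \<and> opat B i p g (Kg n t) = Kg n (opat A i p f t)"
  using t
 proof (induct rule: Fil_induct)
  case (tens vs as)
  let ?u = "take i vs" and ?a = "take i as" and ?w = "take p (drop i vs)" and ?b = "take p (drop i as)"
   and ?v = "drop (i + p) vs" and ?d = "drop (i + p) as"
  have vs: "vs = ?u @ ?w @ ?v" and as: "as = ?a @ ?b @ ?d" by (metis add.commute append_take_drop_id drop_drop)+
  have in': "inF ?u ?a" "inF ?w ?b" "inF ?v ?d" using tens(2) by (auto intro!: list_all2_takeI list_all2_dropI)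
  have n: "n = sum_list ?a + (sum_list ?b + sum_list ?d)" unfolding tens(3)[symmetric] by (subst as) simp
  have len: "length ?u = i" "length ?w = p" "length ?v = r - p - i" using tens(1) i by auto
  have F3: "te ?u \<in> Fil i (sum_list ?a)" "te ?w \<in> Fil p (sum_list ?b)" "te ?v \<in> Fil (r - p - i) (sum_list ?d)"
   using Fil_base[OF in'(1)] Fil_base[OF in'(2)] Fil_base[OF in'(3)] len by simp_all
  have e: "te vs = te ?u \<star> (te ?w \<star> te ?v)"
   using in'[THEN list_all2_F] by (subst vs) (simp add: A_tens_append)
  have o: "opat A i p f (te vs) = te ?u \<star> (f (te ?w) \<star> te ?v)"
   unfolding e by (rule A_opat_mult[OF f Fil_tp[OF F3(1)] Fil_tp[OF F3(2)] Fil_T[OF F3(3)]])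
  have NN: "i + (q + (r - p - i)) = r - p + q" using i by simp
  have w': "f (te ?w) \<star> te ?v \<in> Fil (q + (r - p - i)) (sum_list ?b + sum_list ?d)"
   by (rule Fil_mult[OF ff[OF F3(2)] F3(3)])
  have w: "te ?w \<star> te ?v \<in> Fil (p + (r - p - i)) (sum_list ?b + sum_list ?d)"
   by (rule Fil_mult[OF F3(2,3)])
  have "opat A i p f (te vs) \<in> Fil (r - p + q) n"
   unfolding o n using Fil_mult[OF F3(1) w'] unfolding NN .
  moreover have "Kg n (te vs) = Kg (sum_list ?a) (te ?u) \<otimes>\<^sub>TB (Kg (sum_list ?b) (te ?w) \<otimes>\<^sub>TB Kg (sum_list ?d) (te ?v))"
   unfolding e n by (simp only: Kg_mult[OF F3(1) w] Kg_mult[OF F3(2,3)])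
  moreover have "Kg n (opat A i p f (te vs)) = Kg (sum_list ?a) (te ?u) \<otimes>\<^sub>TB (Kg (sum_list ?b) (f (te ?w)) \<otimes>\<^sub>TB Kg (sum_list ?d) (te ?v))"
   unfolding o n by (simp only: Kg_mult[OF F3(1) w'] Kg_mult[OF ff[OF F3(2)] F3(3)])
  ultimately show ?case
   using opat_mult[OF BM g Kg_tp[OF F3(1)] Kg_tp[OF F3(2)] tp_T[OF BM Kg_tp[OF F3(3)]]] fk[OF F3(2)] by simp
 next
  case zero
  then show ?case using sub_zero[OF TAM Fil_sub] TAM TBM by (simp add: L)
 next
  case (add s t)
  then show ?case using sub_add[OF TAM Fil_sub] Fil_T lin_cl[OF Kg_lin] by (simp add: L)
 next
  case (smult a s)
  then show ?case using sub_smult[OF TAM Fil_sub] Fil_T lin_cl[OF Kg_lin] by (simp add: L)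
 qed
 then show "opat A i p f t \<in> Fil (r - p + q) n" "opat B i p g (Kg n t) = Kg n (opat A i p f t)" by auto
qed

lemma cls_gens: "{cls n x |n x. x \<in> F n} <<: B"
 using cls_closed by auto

lemma gen_lists: "set bs \<subseteq> {cls n x |n x. x \<in> F n} ==> \<exists>xs as. inF xs as \<and> bs = clsL xs as"
proof (induct bs)
 case (Cons b bs)
 then obtain n x xs as where "b = cls n x" "x \<in> F n" "inF xs as" "bs = clsL xs as" by auto
 then show ?case by (intro exI[of _ "x # xs"] exI[of _ "n # as"]) auto
qed auto

lemma B_tp_eq:
 assumes M: "module K M" and f: "f \<in> lin (tpow K B p) M" and g: "g \<in> lin (tpow K B p) M"
  and eq: "!!n t. t \<in> Fil p n ==> f (Kg n t) = g (Kg n t)" and t: "t \<in> tp B p"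
 shows "f t = g t"
proof (rule tp_lin_eq_gen[OF BM cls_gens cls_span M f g _ t])
 fix bs :: "(nat => 'a set) list" assume bs: "length bs = p" "set bs \<subseteq> {cls n x |n x. x \<in> F n}"
 from gen_lists[OF bs(2)] obtain xs as where x: "inF xs as" "bs = clsL xs as" by (elim exE conjE)
 have "length xs = p" using x bs list_all2_lengthD[OF x(1)] by simp
 then show "f (teB bs) = g (teB bs)"
  using eq[of "te xs" "sum_list as"] Fil_base[OF x(1)] Kg_cls[OF x(1)] x(2) by simp
qed

end

subsection \<open>The associated graded bialgebra\<close>

context irr_bialg
begin

abbreviation cB where "cB == gr_braiding K A F c"

lemma gr_pairI:
 assumes f: "f \<in> lin (tpow K A p) (T A)" and g: "g \<in> lin (tpow K B p) TB"
  and fg: "!!vs as. length vs = p ==> inF vs as ==> f (te vs) \<in> Fil q (sum_list as) \<and> g (teB (clsL vs as)) = Kg (sum_list as) (f (te vs))"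
 shows "gr_pair p q f g"
proof -
 note L = lin_simps[OF f] lin_simps[OF g] lin_simps[OF Kg_lin]
 have "f t \<in> Fil q n \<and> g (Kg n t) = Kg n (f t)" if "t \<in> Fil p n" for t n
  using that
 proof (induct rule: Fil_induct)
  case (tens vs as) then show ?case using fg[OF tens(1,2)] Kg_cls[OF tens(2)] by simp
 next
  case zero
  then show ?case using lin_zero[OF f tpow_mod TAM] lin_zero[OF g tpow_mod TBM] lin_zero[OF Kg_lin TAM TBM]
   sub_zero[OF TAM Fil_sub] by simp
 next
  case (add s t)
  then show ?case using lin_add[OF f] lin_add[OF g] lin_add[OF Kg_lin] Fil_T Fil_tp Kg_tp sub_add[OF TAM Fil_sub]
   Fil_T[of "f s" q n] Fil_T[of "f t" q n] by simp
 next
  case (smult a s)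
  then show ?case using lin_smult[OF f] lin_smult[OF g] lin_smult[OF Kg_lin] Fil_T Fil_tp Kg_tp sub_smult[OF TAM Fil_sub]
   Fil_T[of "f s" q n] by simp
 qed
 then show ?thesis using f g by (simp add: gr_pair_def filtered_def)
qed

lemma gr_pairI2:
 assumes "f \<in> lin (tpow K A 2) (T A)" "g \<in> lin (tpow K B 2) TB"
  and fg: "!!x y i j. x \<in> F i ==> y \<in> F j ==> f (te [x, y]) \<in> Fil q (i + j) \<and> g (teB [cls i x, cls j y]) = Kg (i + j) (f (te [x, y]))"
 shows "gr_pair 2 q f g"
proof (rule gr_pairI[OF assms(1,2)])
 fix vs as assume "length vs = 2" "inF vs as"
 then show "f (te vs) \<in> Fil q (sum_list as) \<and> g (teB (clsL vs as)) = Kg (sum_list as) (f (te vs))"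
  using fg by (auto simp: len2 list_all2_Cons1)
qed

lemma Kg_te2: "x \<in> F i ==> y \<in> F j ==> Kg (i + j) (te [x, y]) = teB [cls i x, cls j y]"
 using Kg_cls[of "[x, y]" "[i, j]"] by simp

lemma Kg_te1: "x \<in> F i ==> Kg i (te [x]) = teB [cls i x]"
 using Kg_cls[of "[x]" "[i]"] by simp

lemma Fil_te1: "x \<in> F i ==> te [x] \<in> Fil 1 i"
 using Fil_base[of "[x]" "[i]"] by simp

lemma F_carr: "F n <<: A" using F_simps(2) by blast

lemma Kg_tprod: assumes t: "t \<in> tprod K A (F n) (F m)" shows "Kg (n + m) t = tm2 A B (kap n) (kap m) t"
 using A_tprod_eq[OF F_carr F_carr Kg_lin tm2_lin[OF AM BM kap_lin kap_lin] TBM _ t]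
 by (simp add: Kg_te2 tm2_tens[OF AM BM kap_lin kap_lin] F_simps(2) kap_F)

lemma c_F_Fil: "x \<in> F m ==> y \<in> F n ==> c (te [x, y]) \<in> Fil 2 (m + n)"
 using tprod_Fil[OF c_F[of x m y n]] by (simp add: add.commute)

text \<open>\<open>c\<close> maps \<open>F m \<otimes> F n\<close> to
  \<open>F n \<otimes> F m\<close>, and there the symbol in degree \<open>m + n\<close> is the
  tensor product of the two class maps. The prescribed values are therefore those of the map induced
  by \<open>C 0\<close>.\<close>

lemma cB: "cB = restrict (grm (C 0)) (tp B 2)" and cB_tp: "t \<in> tp B 2 ==> cB t \<in> tp B 2"
 and cB_cls: "x \<in> F m ==> y \<in> F n ==> cB (teB [cls m x, cls n y]) = Kg (m + n) (c (te [x, y]))"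
proof -
 have fil: "filtered 2 2 (C 0)"
  unfolding filtered_def
 proof (intro conjI allI impI)
  show "C 0 \<in> lin (tpow K A 2) (T A)" by (rule A_lin_tp[OF C_lin])
  show "C 0 t \<in> Fil 2 n" if "t \<in> Fil 2 n" for n t
   by (rule Fil_image2[OF C_lin TAM Fil_sub that]) (use c_F_Fil C_0 F_simps(2) in auto)
 qed
 note gl = grm_lin[OF C_lin, of 0]
 have gc: "grm (C 0) (teB [cls m x, cls n y]) = Kg (m + n) (c (te [x, y]))" if "x \<in> F m" "y \<in> F n" for x y m n
  using grm_Kg[OF C_lin fil Fil_base2[OF that]] that by (simp add: Kg_te2 C_0 F_simps(2))
 have gt: "grm (C 0) t \<in> tp B 2" if "t \<in> tp B 2" for t
 proof (rule tp_gen_image[OF BM cls_gens cls_span TBM tp_sub[OF BM] lin_tp[OF BM gl] _ that])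
  fix bs :: "(nat => 'a set) list" assume "length bs = 2" "set bs \<subseteq> {cls n x |n x. x \<in> F n}"
  then show "grm (C 0) (teB bs) \<in> tp B 2" using gc Kg_tp[OF c_F_Fil] by (auto simp: len2)
 qed
 have t2: "teB [cls m x, cls n y] \<in> tp B 2" if "x \<in> F m" "y \<in> F n" for x y m n
  using that by (intro tens_tp[OF BM]) (auto simp: cls_closed)
 show c: "cB = restrict (grm (C 0)) (tp B 2)"
  unfolding gr_braiding_def
 proof (rule the_linear_eq)
  show "grm (C 0) \<in> lin (tpow K B 2) (tpow K B 2)"
   using gt by (subst (2) tpow_alt, intro lin_restr_cod lin_tp[OF BM gl]) auto
  show "\<forall>m n. \<forall>x\<in>F m. \<forall>y\<in>F n. restrict (grm (C 0)) (tp B 2) (teB [cls m x, cls n y]) = tmap K A (F n) (F m) B (cls n) (cls m) (c (te [x, y]))"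
  proof (intro allI ballI)
   fix m n x y assume h: "x \<in> F m" "y \<in> F n"
   have "tmap K A (F n) (F m) B (cls n) (cls m) (c (te [x, y])) = tm2 A B (kap n) (kap m) (c (te [x, y]))"
    by (rule tmap_tm2[OF AM BM kap_lin kap_lin F_sub F_sub _ _ c_F[OF h]]) (simp_all add: kap_F)
   also have "\<dots> = Kg (m + n) (c (te [x, y]))" using Kg_tprod[OF c_F[OF h]] by (simp add: add.commute)
   finally show "restrict (grm (C 0)) (tp B 2) (teB [cls m x, cls n y]) = tmap K A (F n) (F m) B (cls n) (cls m) (c (te [x, y]))"
    using gc[OF h] t2[OF h] by simp
  qed
  fix h t assume h: "h \<in> lin (tpow K B 2) (tpow K B 2)" and t: "t \<in> tp B 2"
   and "\<forall>m n. \<forall>x\<in>F m. \<forall>y\<in>F n. h (teB [cls m x, cls n y]) = tmap K A (F n) (F m) B (cls n) (cls m) (c (te [x, y]))"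
  then have hc: "h (teB [cls m x, cls n y]) = Kg (m + n) (c (te [x, y]))" if "x \<in> F m" "y \<in> F n" for x y m n
   using that tmap_tm2[OF AM BM kap_lin kap_lin F_sub F_sub _ _ c_F[OF that]] Kg_tprod[OF c_F[OF that]]
   by (simp add: kap_F add.commute)
  have h': "h \<in> lin (tpow K B 2) TB" using h tp_T[OF BM] by (auto simp: linear_maps_def Pi_iff)
  show "h t = grm (C 0) t"
  proof (rule tp_lin_eq_gen[OF BM cls_gens cls_span TBM h' lin_tp[OF BM gl] _ t])
   fix bs :: "(nat => 'a set) list" assume "length bs = 2" "set bs \<subseteq> {cls n x |n x. x \<in> F n}"
   then show "h (teB bs) = grm (C 0) (teB bs)" using hc gc by (auto simp: len2)
  qed
 qed simp_all
 show "t \<in> tp B 2 ==> cB t \<in> tp B 2" "x \<in> F m ==> y \<in> F n ==> cB (teB [cls m x, cls n y]) = Kg (m + n) (c (te [x, y]))"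
  using gt gc t2 by (simp_all add: c)
qed

lemma cB_lin: "cB \<in> lin (tpow K B 2) TB"
 unfolding cB by (rule lin_restrict[OF lin_tp[OF BM grm_lin[OF C_lin]], simplified])

lemma gp_c: "gr_pair 2 2 c cB"
 using c_F_Fil cB_cls by (intro gr_pairI2 c_lin cB_lin) auto

lemma gp_nabla: "gr_pair 2 1 (nabla K A) (nabla K B)"
proof (rule gr_pairI2[OF nabla_lin' nabla_lin[OF B_ualg]])
 fix x y i j assume "x \<in> F i" "y \<in> F j"
 then show "nabla K A (te [x, y]) \<in> Fil 1 (i + j) \<and> nabla K B (teB [cls i x, cls j y]) = Kg (i + j) (nabla K A (te [x, y]))"
  using Fil_te1[OF F_mult[of x i y j]] Kg_te1[OF F_mult[of x i y j]]
  by (simp add: nabla_tens' nabla_tens[OF B_ualg] F_simps(2) cls_closed cls_mult)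
qed

text \<open>The comultiplication induced on \<open>gr H\<close>. With the counit
  \<open>epsB\<close>, concentrated in degree zero, it provides the bialgebra structure behind the
  Adams operation.\<close>

definition DeltaB where "DeltaB b = grm (D 0) (teB [b])"
definition epsB where "epsB b = \<epsilon> (sg 0 b)"

lemma DeltaB_lin: "DeltaB \<in> lin B TB"
 unfolding DeltaB_def by (rule lin_o[OF grm_lin[OF D_lin] tens1_lin[OF BM]])

lemma D0_te1: "x <: A ==> D 0 (te [x]) = \<Delta> x"
 using A_opat_0[OF l1_lin, of "te [x]"] l1_tens by simp

lemma DeltaB_cls: "x \<in> F n ==> DeltaB (cls n x) = Kg n (\<Delta> x)"
proof -
 assume x: "x \<in> F n"
 have "filtered 1 2 (D 0)"
  unfolding filtered_def
 proof (intro conjI allI impI)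
  show "D 0 \<in> lin (tpow K A 1) (T A)" by (rule A_lin_tp[OF D_lin])
  show "D 0 t \<in> Fil 2 n" if "t \<in> Fil 1 n" for n t
   by (rule Fil_image[OF D_lin TAM Fil_sub that]) (auto simp: len1 list_all2_Cons1 D0_te1 F_simps(2) Delta_Fil)
 qed
 from grm_Kg[OF D_lin this Fil_te1[OF x]] show ?thesis
  using x by (simp add: DeltaB_def Kg_te1 D0_te1 F_simps(2))
qed

lemma B_lin_eq:
 assumes "module K M" "f \<in> lin B M" "g \<in> lin B M" "!!n x. x \<in> F n ==> f (cls n x) = g (cls n x)" "b <: B"
 shows "f b = g b"
 by (rule lin_eq_span[OF assms(2,3) BM assms(1) cls_gens]) (use assms(4,5) cls_span in auto)

lemma B_lin_image:
 assumes "f \<in> lin B M" "module K M" "sub Z M" "!!n x. x \<in> F n ==> f (cls n x) \<in> Z" "b <: B"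
 shows "f b \<in> Z"
 by (rule lin_span_image[OF assms(1) BM assms(2) cls_gens assms(3)]) (use assms(4,5) cls_span in auto)

lemma DeltaB_tp: "b <: B ==> DeltaB b \<in> tp B 2"
 by (erule B_lin_image[OF DeltaB_lin TBM tp_sub[OF BM], rotated]) (simp add: DeltaB_cls Kg_tp[OF Delta_Fil])

lemmas l1B_lin = lift1_lin[OF BM DeltaB_lin] and l1B_tens = lift1_tens[OF BM DeltaB_lin]

lemma gp_D: "gr_pair 1 2 (lift1 K A \<Delta>) (lift1 K B DeltaB)"
 by (rule gr_pairI[OF l1_lin l1B_lin])
  (auto simp: len1 list_all2_Cons1 l1_tens l1B_tens F_simps(2) cls_closed Delta_Fil DeltaB_cls)

abbreviation CB where "CB i == opat B i 2 cB"
abbreviation NB where "NB i == opat B i 2 (nabla K B)"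
abbreviation DB where "DB i == opat B i 1 (lift1 K B DeltaB)"

lemmas CB_lin = opat_lin[OF BM cB_lin] and NB_lin = opat_lin[OF BM nabla_lin[OF B_ualg]] and DB_lin = opat_lin[OF BM l1B_lin]

lemma CF: assumes "t \<in> Fil r n" "i + 2 \<le> r" shows "C i t \<in> Fil r n" "CB i (Kg n t) = Kg n (C i t)"
proof -
 have "r - 2 + 2 = r" using assms(2) by simp
 with gr_pair_opat[OF gp_c assms] show "C i t \<in> Fil r n" "CB i (Kg n t) = Kg n (C i t)" by metis+
qed

lemma NF: assumes "t \<in> Fil s n" "i + 2 \<le> s" "s = r + 1" shows "N i t \<in> Fil r n" "NB i (Kg n t) = Kg n (N i t)"
proof -
 have "s - 2 + 1 = r" using assms(2,3) by simp
 with gr_pair_opat[OF gp_nabla assms(1,2)] show "N i t \<in> Fil r n" "NB i (Kg n t) = Kg n (N i t)" by metis+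
qed

lemma DF: assumes "t \<in> Fil r n" "i + 1 \<le> r" "s = r + 1" shows "D i t \<in> Fil s n" "DB i (Kg n t) = Kg n (D i t)"
proof -
 have "r - 1 + 2 = s" using assms(2,3) by simp
 with gr_pair_opat[OF gp_D assms(1,2)] show "D i t \<in> Fil s n" "DB i (Kg n t) = Kg n (D i t)" by metis+
qed

text \<open>Rules that replace an operator on symbols by the symbol of the corresponding operator on
  \<open>A\<close>; with them an axiom for \<open>gr H\<close> reduces to the same axiom for
  \<open>A\<close>.\<close>

lemmas tr = CF[where r = 2] CF[where r = 3] CF[where r = 4] NF[where s = 2 and r = 1] NF[where s = 3 and r = 2] NF[where s = 4 and r = 3]
 DF[where r = 1 and s = 2] DF[where r = 2 and s = 3] DF[where r = 3 and s = 4] Fil_tp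

lemma B_braided: "braided_algebra K B cB"
proof (rule braided_algebraI[OF B_ualg])
 show "cB \<in> lin (tpow K B 2) (tpow K B 2)"
  using cB_tp by (subst (2) tpow_alt, intro lin_restr_cod cB_lin) auto
 note L = lin_tp[OF BM] lin_o[OF CB_lin] lin_o[OF NB_lin] CB_lin NB_lin
 show "CB 0 (CB 1 (CB 0 t)) = CB 1 (CB 0 (CB 1 t))" if "t \<in> tp B 3" for t
  by (rule B_tp_eq[OF TBM L(1) L(1) _ that]) (intro L, intro L, simp add: tr YB)
 have b: "cB t = CB 0 t" if "t \<in> tp B 2" for t using opat_0[OF BM cB_lin that] by simp
 have n: "NB i t \<in> tp B 2" if "t \<in> tp B 3" "i + 1 \<le> 2" for i t
  using opat_tp[OF BM nabla_lin[OF B_ualg] nabla_tp[OF B_ualg], of t i "1 - i"] that by simp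
 have cN: "C 0 (N i t) = c (N i t)" if "t \<in> tp A 3" "i + 1 \<le> 2" for i t
  using C_0 N_tp[of t 2 i] that by simp
 show "cB (NB 0 t) = NB 1 (CB 0 (CB 1 t))" if "t \<in> tp B 3" for t
  unfolding b[OF n[OF that, of 0, simplified]]
  by (rule B_tp_eq[OF TBM L(1) L(1) _ that]) (intro L, intro L, simp add: tr cN cN0)
 show "cB (NB 1 t) = NB 0 (CB 1 (CB 0 t))" if "t \<in> tp B 3" for t
  unfolding b[OF n[OF that, of 1, simplified]]
  by (rule B_tp_eq[OF TBM L(1) L(1) _ that]) (intro L, intro L, simp add: tr cN cN1)
 note oB = ua_simps(4)[OF B_ualg]
 have "(%b. teB [\<one>\<^sub>B, b]) \<in> lin B (tpow K B 2)" "(%b. teB [b, \<one>\<^sub>B]) \<in> lin B (tpow K B 2)"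
  using oB by (subst tpow_alt, intro lin_restr_cod tens2_lin[OF BM] tens_tp[OF BM], auto)+
 note L1 = lin_o[OF cB_lin this(1)] lin_o[OF cB_lin this(2)]
 show "cB (teB [\<one>\<^sub>B, b]) = teB [b, \<one>\<^sub>B]" "cB (teB [b, \<one>\<^sub>B]) = teB [\<one>\<^sub>B, b]" if "b <: B" for b
  using B_lin_eq[OF TBM L1(1) tens2_lin(1)[OF BM oB] _ that] B_lin_eq[OF TBM L1(2) tens2_lin(2)[OF BM oB] _ that]
   cB_cls[OF one_F0] cB_cls[OF _ one_F0] Kg_te2[OF one_F0] Kg_te2[OF _ one_F0]
  by (simp_all add: B_one c_one F_simps(2))
qed

sublocale BA: braided_alg K B cB
 by unfold_locales (rule B_braided)

lemma epsB_cls: "x \<in> F n ==> epsB (cls n x) = (if n = 0 then \<epsilon> x else \<zero>\<^sub>K)"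
 using R_mem[of x 0] F_simps(2)[of x n] by (auto simp: epsB_def sg_cls Q_def G_0 mod_minus eps_simps)

lemma epsB_simps: "a <: B ==> epsB a <: K"
 "a <: B ==> b <: B ==> epsB (a \<oplus>\<^sub>B b) = epsB a \<oplus>\<^sub>K epsB b"
 "k <: K ==> a <: B ==> epsB (k \<odot>\<^sub>B a) = k \<otimes>\<^sub>K epsB a"
 using lin_cl[OF sg_lin] by (auto simp: epsB_def lin_add[OF sg_lin] lin_smult[OF sg_lin] eps_add eps_smult)

abbreviation e0B where "e0B == lift2 B B (%x y. epsB x \<odot>\<^sub>B y)"
abbreviation e1B where "e1B == lift2 B B (%x y. epsB y \<odot>\<^sub>B x)"

lemma epsB_lin: "b <: B ==> (%x. epsB x \<odot>\<^sub>B b) \<in> lin B B" "b <: B ==> (%x. epsB b \<odot>\<^sub>B x) \<in> lin B B"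
 by (auto intro!: linI simp: epsB_simps mod_adds mod_sadd mod_smul m_comm)

lemma eB_lin: "e0B \<in> lin TB B" "e1B \<in> lin TB B"
 and eB_tens: "a <: B ==> b <: B ==> e0B (teB [a, b]) = epsB a \<odot>\<^sub>B b"
  "a <: B ==> b <: B ==> e1B (teB [a, b]) = epsB b \<odot>\<^sub>B a"
 using lift2_lin[OF BM BM epsB_lin(1,2)] lift2_lin[OF BM BM epsB_lin(2,1)]
  lift2_tens[OF BM BM epsB_lin(1,2)] lift2_tens[OF BM BM epsB_lin(2,1)] by auto

text \<open>If the factor under the counit has positive degree, both sides vanish: the counit of
  \<open>gr H\<close> kills its class, and the other factor has degree below
  \<open>n\<close>.\<close>

lemma eB_Kg: assumes t: "t \<in> Fil 2 n" shows "e0B (Kg n t) = kap n (e0 t)" "e1B (Kg n t) = kap n (e1 t)"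
proof -
 have "e0B (Kg n t) \<ominus>\<^sub>B kap n (e0 t) \<in> {\<zero>\<^sub>B}"
 proof (rule Fil_image2[OF lin_sub[OF BM lin_o[OF eB_lin(1) Kg_lin] lin_o[OF kap_lin e0_lin]] BM sub_0[OF BM] t])
  fix x y i j assume h: "x \<in> F i" "y \<in> F j" "i + j = n"
  then have "kap n (\<epsilon> x \<odot> y) = (if i = 0 then \<epsilon> x else \<zero>\<^sub>K) \<odot>\<^sub>B cls j y"
   using F_simps(2)[OF h(1)] F_simps(2)[OF h(2)] cls_closed[OF h(2)]
   by (auto simp: lin_smult[OF kap_lin] kap_F kap_high[of y j])
  then show "e0B (Kg n (te [x, y])) \<ominus>\<^sub>B kap n (e0 (te [x, y])) \<in> {\<zero>\<^sub>B}"
   using h F_simps(2)[OF h(1)] F_simps(2)[OF h(2)] cls_closed[OF h(1)] cls_closed[OF h(2)] Kg_te2[OF h(1,2)]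
   by (simp add: eB_tens e0_tens epsB_cls mod_minus)
 qed
 then show "e0B (Kg n t) = kap n (e0 t)"
  using mod_eqI[OF BM] lin_cl[OF lin_o[OF eB_lin(1) Kg_lin]] lin_cl[OF lin_o[OF kap_lin e0_lin]] Fil_T[OF t] by simp
 have "e1B (Kg n t) \<ominus>\<^sub>B kap n (e1 t) \<in> {\<zero>\<^sub>B}"
 proof (rule Fil_image2[OF lin_sub[OF BM lin_o[OF eB_lin(2) Kg_lin] lin_o[OF kap_lin e1_lin]] BM sub_0[OF BM] t])
  fix x y i j assume h: "x \<in> F i" "y \<in> F j" "i + j = n"
  then have "kap n (\<epsilon> y \<odot> x) = (if j = 0 then \<epsilon> y else \<zero>\<^sub>K) \<odot>\<^sub>B cls i x"
   using F_simps(2)[OF h(1)] F_simps(2)[OF h(2)] cls_closed[OF h(1)]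
   by (auto simp: lin_smult[OF kap_lin] kap_F kap_high[of x i])
  then show "e1B (Kg n (te [x, y])) \<ominus>\<^sub>B kap n (e1 (te [x, y])) \<in> {\<zero>\<^sub>B}"
   using h F_simps(2)[OF h(1)] F_simps(2)[OF h(2)] cls_closed[OF h(1)] cls_closed[OF h(2)] Kg_te2[OF h(1,2)]
   by (simp add: eB_tens e1_tens epsB_cls mod_minus)
 qed
 then show "e1B (Kg n t) = kap n (e1 t)"
  using mod_eqI[OF BM] lin_cl[OF lin_o[OF eB_lin(2) Kg_lin]] lin_cl[OF lin_o[OF kap_lin e1_lin]] Fil_T[OF t] by simp
qed

lemma B_bialg: "symm_bialg K B cB DeltaB epsB"
proof unfold_locales
 show "DeltaB \<in> lin B TB" by (rule DeltaB_lin)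
 show "DeltaB b \<in> tp B 2" if "b <: B" for b using that by (rule DeltaB_tp)
 show "epsB \<one>\<^sub>B = \<one>\<^sub>K" using one_F0 by (simp add: B_one epsB_cls eps_one)
 show "DeltaB \<one>\<^sub>B = teB [\<one>\<^sub>B, \<one>\<^sub>B]" using DeltaB_cls[OF one_F0] Kg_te2[OF one_F0 one_F0] by (simp add: B_one Delta_one)
 note L = lin_tp[OF BM] lin_o[OF CB_lin] lin_o[OF NB_lin] lin_o[OF DB_lin] CB_lin NB_lin DB_lin
 note op0 = opat_0[OF BM cB_lin] opat_0[OF BM l1B_lin]
 have D1C: "D 1 (C 0 t) = C 0 (C 1 (D 0 t))" if "t \<in> tp A 2" for t using D1c C_0 that by simp
 show "DB 1 (cB t) = CB 0 (CB 1 (DB 0 t))" if "t \<in> tp B 2" for t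
 proof -
  have "DB 1 (CB 0 t) = CB 0 (CB 1 (DB 0 t))"
   by (rule B_tp_eq[OF TBM L(1) L(1) _ that]) (intro L, intro L, simp add: tr D1C)
  then show ?thesis using that by (simp add: op0)
 qed
 show "cB (cB t) = t" if "t \<in> tp B 2" for t
 proof -
  have "CB 0 (CB 0 t) = t"
   by (rule B_tp_eq[OF TBM L(1) L(1) _ that]) (intro L, rule lin_id, simp add: tr CC[where n = 2])
  then show ?thesis using that cB_tp by (simp add: op0)
 qed
 show "e0B (cB t) = e1B t" if "t \<in> tp B 2" for t
  by (rule B_tp_eq[OF BM lin_o[OF eB_lin(1) cB_lin] lin_tp[OF BM eB_lin(2)] _ that])
   (use gp_c in \<open>simp add: gr_pair_def filtered_def eB_Kg c_eps Fil_tp\<close>)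
 show "e0B (DeltaB b) = b" "e1B (DeltaB b) = b" if "b <: B" for b
  using B_lin_eq[OF BM lin_o[OF eB_lin(1) DeltaB_lin] lin_id _ that] B_lin_eq[OF BM lin_o[OF eB_lin(2) DeltaB_lin] lin_id _ that]
  by (auto simp: DeltaB_cls eB_Kg Delta_Fil counit F_simps(2) kap_F)
 show "DeltaB (a \<otimes>\<^sub>B b) = NB 0 (NB 2 (CB 1 (DeltaB a \<otimes>\<^sub>TB DeltaB b)))" if ab: "a <: B" "b <: B" for a b
 proof -
  have D0: "DB 0 (teB [a]) = DeltaB a" if "a <: B" for a
   using op0(2)[of "teB [a]"] that l1B_tens tens_tp[OF BM, of "[a]" 1] by simp
  have t2: "teB [a, b] \<in> tp B 2" using ab by (intro tens_tp[OF BM]) auto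
  \<comment> \<open>Multiplicativity of \<Delta> is written as an identity between operators on
    tensors of length two, the form that passes to symbols.\<close>
  have DN: "D 0 (N 0 t) = N 0 (N 2 (C 1 (D 2 (D 0 t))))" if t: "t \<in> tp A 2" for t
   using Delta_mu[OF t] t lin_cl[OF mu_lin] by (simp add: N_0 nabla_mu D0_te1 DD_def tp_T')
  have "DB 0 (NB 0 (teB [a, b])) = NB 0 (NB 2 (CB 1 (DB 2 (DB 0 (teB [a, b])))))"
   by (rule B_tp_eq[OF TBM L(1) L(1) _ t2]) (intro L, intro L, simp add: tr DN)
  moreover have "NB 0 (teB [a, b]) = teB [a \<otimes>\<^sub>B b]"
   using opat_0[OF BM nabla_lin[OF B_ualg] t2] nabla_tens[OF B_ualg ab] by simp
  moreover have "DB 0 (teB [a, b]) = DeltaB a \<otimes>\<^sub>TB teB [b]"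
   using opat_app[OF BM l1B_lin, of "[]" 0 "teB [a]" "[b]"] ab l1B_tens[OF ab(1)] tens_tp[OF BM, of "[a]" 1]
    tens_append[OF BM, of "[a]" "[b]"] tens_closed[OF BM, of "[b]"] tens_closed[OF BM, of "[a, b]"] lin_cl[OF DeltaB_lin ab(1)]
   by (simp add: TB_ua)
  moreover have "DB (2 + 0) (DeltaB a \<otimes>\<^sub>TB teB [b]) = DeltaB a \<otimes>\<^sub>TB DB 0 (teB [b])"
   using ab tens_closed[OF BM, of "[b]"] by (intro opat_left[OF BM l1B_lin] DeltaB_tp) auto
  ultimately show ?thesis using ab D0 ua_simps[OF B_ualg] by simp
 qed
 show "epsB (a \<otimes>\<^sub>B b) = epsB a \<otimes>\<^sub>K epsB b" if ab: "a <: B" "b <: B" for a b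
  using BM B_graded ab(1)
 proof (induct rule: graded_ind)
  case (base m a)
  then obtain x where x: "a = cls m x" "x \<in> F m" by (auto simp: gr_grading_cls)
  have a: "a <: B" using x cls_closed by simp
  from BM B_graded ab(2) show ?case
  proof (induct rule: graded_ind)
   case (base n b)
   then obtain y where y: "b = cls n y" "y \<in> F n" by (auto simp: gr_grading_cls)
   show ?case using x y F_simps(2)[of x m] F_simps(2)[of y n] by (simp add: cls_mult F_mult epsB_cls eps_mult)
  qed (use a in \<open>simp add: epsB_simps ua_simps[OF B_ualg] r_distr\<close>)
 qed (use ab(2) in \<open>simp add: epsB_simps ua_simps[OF B_ualg] l_distr\<close>)
qed (simp_all add: epsB_simps)

sublocale BS: symm_bialg K B cB DeltaB epsB
 by (rule B_bialg)

abbreviation GB where "GB == gr_grading A F"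

lemma mu_F: "t \<in> Fil 2 n ==> mu t \<in> F n"
 by (erule Fil_image2[OF mu_lin AM F_sub]) (use F_mult F_simps(2) in \<open>auto simp: mu_tens\<close>)

lemma muB_Kg: assumes t: "t \<in> Fil 2 n" shows "BA.mu (Kg n t) = cls n (mu t)"
proof -
 have "BA.mu (Kg n t) \<ominus>\<^sub>B kap n (mu t) \<in> {\<zero>\<^sub>B}"
  by (rule Fil_image2[OF lin_sub[OF BM lin_o[OF BA.mu_lin Kg_lin] lin_o[OF kap_lin mu_lin]] BM sub_0[OF BM] t])
   (use F_mult F_simps(2) in \<open>auto simp: mu_tens BA.mu_tens Kg_te2 cls_closed cls_mult kap_F mod_minus\<close>)
 then show ?thesis
  using mod_eqI[OF BM] lin_cl[OF lin_o[OF BA.mu_lin Kg_lin]] lin_cl[OF lin_o[OF kap_lin mu_lin]] Fil_T[OF t] cls_closed[OF mu_F[OF t]]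
  by (simp add: kap_F mu_F[OF t])
qed

text \<open>By \<open>c_symm_F\<close> the commutator of two representatives lies one step below
  their product, so the two products have the same class.\<close>

lemma B_comm: "t \<in> tp B 2 ==> BA.mu (cB t) = BA.mu t"
proof (rule B_tp_eq[OF BM lin_o[OF BA.mu_lin cB_lin] lin_tp[OF BM BA.mu_lin]])
 fix n t assume t: "t \<in> Fil 2 n"
 have ct: "c t \<in> Fil 2 n" and Kt: "cB (Kg n t) = Kg n (c t)" using gp_c t by (auto simp: gr_pair_def filtered_def)
 have "mu t \<ominus> mu (C 0 t) \<in> G n"
  by (rule Fil_image2[OF lin_sub[OF AM mu_lin lin_o[OF mu_lin C_lin]] AM G_sub t])
   (use c_symm_F F_simps(2) in \<open>auto simp: mu_tens C_0\<close>)
 then have "cls n (mu t) = cls n (mu (c t))" using cls_eq[OF mu_F[OF t] mu_F[OF ct]] by (simp add: C_0 Fil_tp[OF t])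
 then show "BA.mu (cB (Kg n t)) = BA.mu (Kg n t)" by (simp add: Kt muB_Kg t ct)
qed

lemma GB_F: "GB n = {cls n x |x. x \<in> F n}" by (rule gr_grading_cls)

lemma GB_0: "GB 0 = {a \<odot>\<^sub>B \<one>\<^sub>B |a. a <: K}"
proof -
 have "cls 0 (a \<odot> \<one>) = a \<odot>\<^sub>B cls 0 \<one>" if "a <: K" for a by (rule cls_smult[OF that one_F0])
 then show ?thesis unfolding GB_F B_one F_0 by (auto, metis)
qed

lemma GB_mult: "a \<in> GB m ==> b \<in> GB n ==> a \<otimes>\<^sub>B b \<in> GB (m + n)"
 unfolding GB_F using F_mult by (auto simp: cls_mult)

lemma GB_one: "\<one>\<^sub>B \<in> GB 0" unfolding GB_F B_one using one_F0 by auto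

lemma GB_Psi: "b \<in> GB n ==> BA.mu (DeltaB b) \<in> GB n"
 unfolding GB_F using mu_F[OF Delta_Fil] by (auto simp: DeltaB_cls muB_Kg Delta_Fil)

lemma GB_eps: "b \<in> GB n ==> n > 0 ==> epsB b = \<zero>\<^sub>K"
 unfolding GB_F by (auto simp: epsB_cls)

lemma GB_sub: "sub (GB n) B" by (rule graded_projD(1)[OF B_graded])

lemma GB_cat: assumes a: "a \<in> GB m" and b: "b <: B"
 shows "cB (teB [a, b]) \<in> tprod K B (carrier B) (GB m)" "cB (teB [b, a]) \<in> tprod K B (GB m) (carrier B)"
proof -
 note c = sub_carr[OF BM GB_sub]
 obtain x where x: "a = cls m x" "x \<in> F m" using a unfolding GB_F by blast
 have "(%b. teB [a, b]) \<in> lin B (tpow K B 2)" "(%b. teB [b, a]) \<in> lin B (tpow K B 2)"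
  using a c by (subst tpow_alt, intro lin_restr_cod tens2_lin[OF BM] tens_tp[OF BM], auto)+
 note L = lin_o[OF cB_lin this(1)] lin_o[OF cB_lin this(2)]
 note S = tprod_sub[OF BM subset_refl c] tprod_sub[OF BM c subset_refl]
 have k: "kap i z \<in> GB i" "kap i z <: B" if "z \<in> F i" for i z using that by (auto simp: GB_F kap_F cls_closed)
 note tm = tm2_tprod[OF AM BM kap_lin kap_lin F_carr F_carr]
 show "cB (teB [a, b]) \<in> tprod K B (carrier B) (GB m)"
 proof (rule B_lin_image[OF L(1) TBM S(1) _ b])
  fix n y assume y: "y \<in> F n"
  have "tm2 A B (kap n) (kap m) (c (te [x, y])) \<in> tprod K B (carrier B) (GB m)"
   by (rule tm[OF subset_refl c _ _ c_F[OF x(2) y]]) (rule k, assumption)+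
  then show "cB (teB [a, cls n y]) \<in> tprod K B (carrier B) (GB m)"
   using cB_cls[OF x(2) y] Kg_tprod[OF c_F[OF x(2) y]] by (simp add: x add.commute)
 qed
 show "cB (teB [b, a]) \<in> tprod K B (GB m) (carrier B)"
 proof (rule B_lin_image[OF L(2) TBM S(2) _ b])
  fix n y assume y: "y \<in> F n"
  have "tm2 A B (kap m) (kap n) (c (te [y, x])) \<in> tprod K B (GB m) (carrier B)"
   by (rule tm[OF c subset_refl _ _ c_F[OF y x(2)]]) (rule k, assumption)+
  then show "cB (teB [cls n y, a]) \<in> tprod K B (GB m) (carrier B)"
   using cB_cls[OF y x(2)] Kg_tprod[OF c_F[OF y x(2)]] by (simp add: x add.commute)
 qed
qed

end

section \<open>The Leray idempotent\<close>

context kfield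
begin

definition nk :: "nat => 'k" where "nk n = [n] \<cdot>\<^sub>K \<one>\<^sub>K"

lemma nk_closed [simp]: "nk n <: K" by (simp add: nk_def)

lemma nk_simps: "nk 0 = \<zero>\<^sub>K" "nk 1 = \<one>\<^sub>K" "nk (m + n) = nk m \<oplus>\<^sub>K nk n" "nk (m * n) = nk m \<otimes>\<^sub>K nk n"
proof -
 show a: "nk (m + n) = nk m \<oplus>\<^sub>K nk n" for m n by (simp add: nk_def add.nat_pow_mult)
 show z: "nk 0 = \<zero>\<^sub>K" by (simp add: nk_def)
 show o: "nk 1 = \<one>\<^sub>K" unfolding nk_def One_nat_def by (simp only: add.nat_pow_Suc add.nat_pow_0) simp
 show "nk (m * n) = nk m \<otimes>\<^sub>K nk n"
 proof (induct m)
  case (Suc m)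
  have "nk (Suc m * n) = nk n \<oplus>\<^sub>K nk (m * n)" by (simp add: a)
  also have "\<dots> = (nk m \<oplus>\<^sub>K nk 1) \<otimes>\<^sub>K nk n" by (simp add: Suc o l_distr a_comm)
  also have "nk m \<oplus>\<^sub>K nk 1 = nk (Suc m)" using a[of m 1] by (simp only: Suc_eq_plus1)
  finally show ?case .
 qed (simp add: z)
qed

lemma nk_inj: assumes "char_zero K" "nk m = nk n" shows "m = n"
proof -
 have "i = j" if "i \<le> j" "nk i = nk j" for i j
 proof (rule ccontr)
  assume "i \<noteq> j"
  have "nk j = nk i \<oplus>\<^sub>K nk (j - i)" using nk_simps(3)[of i "j - i"] that by simp
  then have "nk (j - i) = \<zero>\<^sub>K" using that by (simp add: add.l_cancel_one')
  then show False using assms(1) \<open>i \<noteq> j\<close> that by (auto simp: char_zero_def nk_def)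
 qed
 then show ?thesis using assms(2) by (metis nat_le_linear)
qed

end

text \<open>What the Leray argument uses about \<open>gr H\<close>: it is graded, connected and
  commutative in the braided sense, and the braiding respects the grading on either side. The
  interplay of \<Delta> with the grading takes the form that the Adams operation preserves
  degrees.\<close>

locale pbw_alg = symm_bialg K A c \<Delta> \<epsilon> for K :: "('k, 'r) ring_scheme" and A :: "('k, 'a) module" (structure) and c \<Delta> \<epsilon> +
 fixes Gr :: "nat => 'a set" and \<pi>
 assumes gp: "graded_proj A Gr \<pi>" and GrC: "!!t. t \<in> tp A 2 ==> mu (c t) = mu t"
  and Gr0: "!!x. x \<in> Gr 0 ==> \<exists>a\<in>carrier K. x = a \<odot> \<one>" and Gr1: "\<one> \<in> Gr 0"
  and GrM: "!!x y m n. x \<in> Gr m ==> y \<in> Gr n ==> x \<otimes> y \<in> Gr (m + n)"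
  and GrPsi: "!!x n. x \<in> Gr n ==> mu (\<Delta> x) \<in> Gr n"
  and Greps: "!!x n. x \<in> Gr n ==> n > 0 ==> \<epsilon> x = \<zero>\<^sub>K"
  and Grcat: "!!x y m. x \<in> Gr m ==> y <: A ==> c (te [x, y]) \<in> tprod K A (carrier A) (Gr m)"
  and Grcat2: "!!x y m. x \<in> Gr m ==> y <: A ==> c (te [y, x]) \<in> tprod K A (Gr m) (carrier A)"
  and char0: "char_zero K"
begin

lemmas gpD = graded_projD[OF gp]

lemma Gr_sub: "sub (Gr n) A" by (rule gpD(1))

lemma Gr_A: "x \<in> Gr n ==> x <: A" by (rule sub_mem[OF AM Gr_sub])

lemma one_A: "\<one> <: A" by (rule A_ua(4))

lemmas A_ind = graded_ind[OF AM gp, consumes 1, case_names base add]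

text \<open>The elements without components in degrees below \<open>n\<close>; \<open>U 1\<close> is
  the augmentation ideal.\<close>

definition U where "U n = span A (\<Union>d\<in>{n..}. Gr d)"

lemma U_gens: "(\<Union>d\<in>{n..}. Gr d) <<: A" using Gr_A by blast

lemma U_sub: "sub (U n) A" unfolding U_def by (rule span_sub[OF AM U_gens])

lemmas U_simps = sub_simps[OF AM U_sub]

lemma U_base: "x \<in> Gr d ==> n \<le> d ==> x \<in> U n" unfolding U_def by (rule span_base) auto

lemma U_image:
 assumes "f \<in> lin A M" "module K M" "sub Z M" "!!d x. n \<le> d ==> x \<in> Gr d ==> f x \<in> Z" "x \<in> U n"
 shows "f x \<in> Z"
 by (rule lin_span_image[OF assms(1) AM assms(2) U_gens assms(3) _ assms(5)[unfolded U_def]]) (use assms(4) in auto)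

lemma U_0: "U 0 = carrier A"
 using gpD(4) by (simp add: U_def)

lemma U_mult: assumes x: "x \<in> U m" and y: "y \<in> U n" shows "x \<otimes> y \<in> U (m + n)"
proof (rule U_image[OF lin_rmult[OF A_ualg lin_id] AM U_sub _ x])
 show "y <: A" using U_simps(2)[OF y] .
 fix d x assume x: "m \<le> d" "x \<in> Gr d"
 show "x \<otimes> y \<in> U (m + n)"
 proof (rule U_image[OF lin_lmult[OF A_ualg lin_id Gr_A[OF x(2)]] AM U_sub _ y])
  fix e y assume y: "n \<le> e" "y \<in> Gr e"
  show "x \<otimes> y \<in> U (m + n)" by (rule U_base[OF GrM[OF x(2) y(2)]]) (use x y in simp)
 qed
qed

lemma U_Gr: assumes "x \<in> U n" "x \<in> Gr d" "d < n" shows "x = \<zero>"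
proof -
 have "\<pi> d x \<in> {\<zero>}"
  by (rule U_image[OF gpD(2) AM sub_0[OF AM] _ assms(1)])
   (use assms(3) in \<open>auto simp: gpD(3)\<close>)
 then show ?thesis using assms(2) by (simp add: gpD(3))
qed

text \<open>The projection onto the augmentation ideal along the unit.\<close>

definition j where "j x = x \<ominus> (\<epsilon> x \<odot> \<one>)"

lemma j_lin: "j \<in> lin A A"
 unfolding j_def by (rule lin_sub[OF AM lin_id eps_lin(1)[OF one_A]])

lemma j_U: "x <: A ==> j x \<in> U 1"
proof (induct rule: A_ind)
 case (base n x)
 show ?case
 proof (cases n)
  case 0
  then obtain a where "a <: K" "x = a \<odot> \<one>" using Gr0 base by blast
  then show ?thesis using one_A U_simps(3) by (simp add: j_def eps_smult eps_one mod_minus)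
 next
  case (Suc m)
  then show ?thesis using base Greps[of x n] Gr_A[OF base] U_base[OF base, of 1] one_A by (simp add: j_def mod_minus)
 qed
next
 case (add x y) then show ?case by (simp add: lin_add[OF j_lin] U_simps(4))
qed

lemma eps_U: assumes x: "x \<in> U 1" shows "\<epsilon> x = \<zero>\<^sub>K"
proof -
 have "e0 (te [x, \<one>]) \<in> {\<zero>}"
  by (rule U_image[OF lin_o[OF e0_lin A_tens2_lin(1)[OF one_A]] AM sub_0[OF AM] _ x])
   (use Greps Gr_A one_A in \<open>auto simp: e0_tens\<close>)
 then have z: "\<epsilon> x \<odot> \<one> = \<zero>" using one_A U_simps(2)[OF x] by (simp add: e0_tens)
 have "\<epsilon> x = \<epsilon> (\<epsilon> x \<odot> \<one>)" using U_simps(2)[OF x] one_A by (simp add: eps_smult eps_one)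
 then show ?thesis by (simp add: z eps_simps)
qed

lemma j_id: "x \<in> U 1 ==> j x = x"
 using U_simps(2) one_A by (simp add: j_def eps_U mod_minus)

lemma U1_decomp: "x <: A ==> x = j x \<oplus> (\<epsilon> x \<odot> \<one>)"
 using one_A by (simp add: j_def mod_minus mod_assoc)

subsection \<open>The powers of the augmentation ideal\<close>

primrec P where
 "P 0 = carrier A"
| "P (Suc n) = span A {x \<otimes> y |x y. x \<in> U 1 \<and> y \<in> P n}"

lemmas P_unfold = P.simps(2)
declare P_unfold [simp del]

lemma P_sub: "sub (P n) A" and P_gens: "{x \<otimes> y |x y. x \<in> U 1 \<and> y \<in> P n} <<: A"
proof -
 have g: "{x \<otimes> y |x y. x \<in> U 1 \<and> y \<in> P n} <<: A" if "sub (P n) A" for n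
  using sub_mem[OF AM that] U_simps(2) A_ua(3) by auto
 show s: "sub (P n) A"
  by (induct n) (use sub_carrier[OF AM] span_sub[OF AM g] in \<open>auto simp: P_unfold\<close>)
 show "{x \<otimes> y |x y. x \<in> U 1 \<and> y \<in> P n} <<: A" by (rule g[OF s])
qed

lemmas P_simps = sub_simps[OF AM P_sub]

lemma P_base: "x \<in> U 1 ==> y \<in> P n ==> x \<otimes> y \<in> P (Suc n)"
 unfolding P_unfold by (auto intro: span_base)

lemma P_image:
 assumes "f \<in> lin A M" "module K M" "sub Z M" "!!x y. x \<in> U 1 ==> y \<in> P n ==> f (x \<otimes> y) \<in> Z" "z \<in> P (Suc n)"
 shows "f z \<in> Z"
 by (rule lin_span_image[OF assms(1) AM assms(2) P_gens assms(3) _ assms(5)[unfolded P_unfold]]) (use assms(4) in auto)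

lemma P_left: assumes a: "a <: A" and z: "z \<in> P n" shows "a \<otimes> z \<in> P n"
proof (cases n)
 case 0 then show ?thesis using assms by (simp add: A_ua)
next
 case (Suc m)
 have "a \<otimes> z \<in> P (Suc m)"
 proof (rule P_image[OF lin_lmult[OF A_ualg lin_id a] AM P_sub _ z[unfolded Suc]])
  fix x y assume xy: "x \<in> U 1" "y \<in> P m"
  have "a \<otimes> x \<in> U 1" using U_mult[of a 0 x 1] a xy by (simp add: U_0)
  then have "(a \<otimes> x) \<otimes> y \<in> P (Suc m)" using xy(2) by (rule P_base)
  then show "a \<otimes> (x \<otimes> y) \<in> P (Suc m)" using a U_simps(2)[OF xy(1)] P_simps(2)[OF xy(2)] by (simp add: A_ua)
 qed
 then show ?thesis using Suc by simp
qed

lemma P_mult: "x \<in> P m ==> y \<in> P n ==> x \<otimes> y \<in> P (m + n)"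
proof (induct m arbitrary: x)
 case 0 then show ?case using P_left by simp
next
 case (Suc m)
 have "x \<otimes> y \<in> P (Suc (m + n))"
 proof (rule P_image[OF lin_rmult[OF A_ualg lin_id P_simps(2)[OF Suc(3)]] AM P_sub _ Suc(2)])
  fix a b assume ab: "a \<in> U 1" "b \<in> P m"
  have "a \<otimes> (b \<otimes> y) \<in> P (Suc (m + n))" using ab Suc by (intro P_base) auto
  then show "a \<otimes> b \<otimes> y \<in> P (Suc (m + n))"
   using U_simps(2)[OF ab(1)] P_simps(2)[OF ab(2)] P_simps(2)[OF Suc(3)] by (simp add: A_ua)
 qed
 then show ?case by simp
qed

text \<open>Products of \<open>n\<close> elements of positive degree have degree at least
  \<open>n\<close>. So each fixed degree is free of high powers of the ideal, and finite products of
  operators suffice there.\<close>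

lemma P_U: "x \<in> P n ==> x \<in> U n"
proof (induct n arbitrary: x)
 case 0 then show ?case by (simp add: U_0)
next
 case (Suc n)
 have "a \<otimes> b \<in> U (Suc n)" if "a \<in> U 1" "b \<in> P n" for a b using U_mult[OF that(1) Suc(1)[OF that(2)]] unfolding plus_1_eq_Suc .
 then show ?case by (rule P_image[OF lin_id AM U_sub _ Suc(2)])
qed

lemma P_1: "x \<in> P 1 \<longleftrightarrow> x \<in> U 1"
proof
 show "x \<in> P 1 ==> x \<in> U 1" by (rule P_U)
 show "x \<in> U 1 ==> x \<in> P 1" using P_base[of x "\<one>" 0] one_A U_simps(2)[of x 1] by (simp add: A_ua)
qed

lemma P_2: "x \<in> U 1 ==> y \<in> U 1 ==> x \<otimes> y \<in> P 2"
 using P_mult[of x 1 y 1] P_1 by simp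

lemma P_Suc: assumes "x \<in> P (Suc n)" shows "x \<in> P n"
 by (rule P_image[OF lin_id AM P_sub _ assms]) (use P_left U_simps(2) in blast)

subsection \<open>The Adams operation\<close>

definition Psi where "Psi x = mu (\<Delta> x)"

lemma Psi_lin: "Psi \<in> lin A A" unfolding Psi_def by (rule lin_o[OF mu_lin Delta_lin])

text \<open>The product of \<open>A \<otimes> A\<close> braids the two inner factors before
  multiplying. Multiplying all four factors together cancels this crossing, since
  \<open>mu (c w) = mu w\<close>. Commutativity thus makes the Adams operation
  multiplicative.\<close>

lemma mu_NC:
 assumes s: "s \<in> tp A 2" and t: "t \<in> tp A 2" shows "mu (NC s t) = mu s \<otimes> mu t"
proof -
 have mc: "mu t <: A" if "t \<in> tp A 2" for t using lin_cl[OF mu_lin tp_T'[OF that]] .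
 have "mu (NC (te [a, b]) t) = mu (te [a, b]) \<otimes> mu t" if ab: "a <: A" "b <: A" and t: "t \<in> tp A 2" for a b t
 proof (rule A_lift2_eq[OF lin_o[OF mu_lin NC_lin(2)] lin_lmult[OF A_ualg mu_lin] AM _ t])
  fix x y assume xy: "x <: A" "y <: A"
  have "mu (N 0 (N 2 (te [a] \<star> (w \<star> te [y])))) = a \<otimes> mu w \<otimes> y" if w: "w \<in> tp A 2" for w
  proof (rule A_lift2_eq[OF _ _ AM _ w])
   show "(%w. mu (N 0 (N 2 (te [a] \<star> (w \<star> te [y]))))) \<in> lin (T A) A"
    using ab xy by (intro lin_o[OF mu_lin] lin_o[OF N_lin] lin_lmult[OF TA_ualg] lin_rmult[OF TA_ualg] lin_id) auto
   show "(%w. a \<otimes> mu w \<otimes> y) \<in> lin (T A) A"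
    using ab xy by (intro lin_rmult[OF A_ualg] lin_lmult[OF A_ualg] mu_lin)
  qed (use ab xy in \<open>simp add: NN_ap mu_tens A_ua\<close>)
  then show "mu (NC (te [a, b]) (te [x, y])) = mu (te [a, b]) \<otimes> mu (te [x, y])"
   using ab xy by (simp add: NC_def C1_mid GrC mu_tens A_ua)
 qed (use ab mc t in auto)
 note * = this
 show ?thesis
  by (rule A_lift2_eq[OF lin_o[OF mu_lin NC_lin(1)] lin_rmult[OF A_ualg mu_lin mc[OF t]] AM _ s]) (use * t tp_T' in auto)
qed

lemma Psi_mult: "x <: A ==> y <: A ==> Psi (x \<otimes> y) = Psi x \<otimes> Psi y"
 by (simp add: Psi_def Delta_NC mu_NC Delta_tp)

lemma Psi_closed: "x <: A ==> Psi x <: A" by (rule lin_cl[OF Psi_lin])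

definition Th where "Th n x = Psi x \<ominus> nk (2 ^ n) \<odot> x"

lemma Th_lin: "Th n \<in> lin A A"
 unfolding Th_def by (intro lin_sub[OF AM Psi_lin] lin_sm[OF AM lin_id]) simp_all

lemma Psi_Th: "x <: A ==> Psi x = Th n x \<oplus> nk (2 ^ n) \<odot> x"
 using Psi_closed by (simp add: Th_def mod_minus mod_assoc)

text \<open>For \<open>x\<close> in the ideal, the summands of \<Delta> x with a unit on one side
  contribute \<open>2 x\<close> to \<open>Psi x\<close>; the other summands have both factors in the
  ideal, and multiplication sends them to its square.\<close>

lemma Th_1: assumes x: "x \<in> U 1" shows "Th 1 x \<in> P 2"
proof -
 have xA: "x <: A" by (rule U_simps(2)[OF x])
 \<comment> \<open>This is \<open>mu (tm2 A A j j t)\<close> expanded: on a pure tensor, \<open>x y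
   - (\<epsilon> x y + \<epsilon> y x) + \<epsilon> x \<epsilon> y\<close>.\<close>
 have L: "(%t. mu t \<ominus> (e0 t \<oplus> e1 t) \<oplus> (\<epsilon> (e0 t) \<odot> \<one>)) \<in> lin (T A) A"
  by (intro lin_plus[OF AM] lin_sub[OF AM] mu_lin e0_lin e1_lin lin_o[OF eps_lin(1)[OF one_A] e0_lin])
 have "mu (tm2 A A j j t) = mu t \<ominus> (e0 t \<oplus> e1 t) \<oplus> (\<epsilon> (e0 t) \<odot> \<one>)" if t: "t \<in> tp A 2" for t
 proof (rule A_lift2_eq[OF lin_o[OF mu_lin tmA_lin[OF j_lin j_lin]] L AM _ t])
  fix x y assume xy: "x <: A" "y <: A"
  then show "mu (tm2 A A j j (te [x, y])) = mu (te [x, y]) \<ominus> (e0 (te [x, y]) \<oplus> e1 (te [x, y])) \<oplus> (\<epsilon> (e0 (te [x, y])) \<odot> \<one>)"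
   using one_A by (simp add: tmA_tens[OF j_lin j_lin] lin_cl[OF j_lin] mu_tens e0_tens e1_tens)
    (simp add: j_def mod_minus A_ua mod_negadd mod_ac eps_smult mod_smul mod_adds mod_sadd mod_sneg m_comm)
 qed
 from this[OF Delta_tp[OF xA]] have "mu (tm2 A A j j (\<Delta> x)) = Th 1 x"
  using xA one_A Psi_closed[OF xA] nk_simps(3)[of 1 1] by (simp add: counit eps_U[OF x] Th_def Psi_def mod_adds nk_simps(2))
 moreover have "mu (tm2 A A j j (\<Delta> x)) \<in> P 2"
  by (rule A_tprod_image[OF _ _ lin_o[OF mu_lin tmA_lin[OF j_lin j_lin]] AM P_sub])
   (use Delta_tp[OF xA] j_U in \<open>auto simp: tprod_full tmA_tens[OF j_lin j_lin] mu_tens lin_cl[OF j_lin] P_2\<close>)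
 ultimately show ?thesis by simp
qed

text \<open>Induction by the product rule \<open>Psi (x y) - 2^(n+1) x y = (Psi x - 2 x) (Psi y) + 2
  x (Psi y - 2^n y)\<close>.\<close>

lemma Th_P: "n > 0 ==> x \<in> P n ==> Th n x \<in> P (Suc n)"
proof (induct n arbitrary: x rule: nat_induct_non_zero)
 case 1 then show ?case using Th_1 P_1 by simp
next
 case (Suc n)
 show ?case
 proof (rule P_image[OF Th_lin AM P_sub _ Suc(3)])
  fix x y assume xy: "x \<in> U 1" "y \<in> P n"
  let ?a = "Th 1 x" and ?b = "Th n y" and ?s = "nk (2 ^ n)"
  note c = U_simps(2)[OF xy(1)] P_simps(2)[OF xy(2)]
  have c': "?a <: A" "?b <: A" "Psi y <: A" using c lin_cl[OF Th_lin] Psi_closed by auto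
  have "Th (Suc n) (x \<otimes> y) = (?a \<oplus> nk 2 \<odot> x) \<otimes> Psi y \<ominus> (nk 2 \<otimes>\<^sub>K ?s) \<odot> (x \<otimes> y)"
   using c Psi_Th[OF c(1), of 1] by (simp add: Th_def Psi_mult nk_simps(4)[symmetric])
  also have "\<dots> = ?a \<otimes> Psi y \<oplus> (nk 2 \<odot> x) \<otimes> (Psi y \<ominus> ?s \<odot> y)"
   using c c' by (simp add: A_ua mod_minus mod_assoc mod_smul mod_sadd mod_sneg m_comm)
  finally have e: "Th (Suc n) (x \<otimes> y) = ?a \<otimes> Psi y \<oplus> (nk 2 \<odot> x) \<otimes> ?b" by (simp add: Th_def)
  have "Psi y \<in> P n"
   using Psi_Th[OF c(2), of n] P_Suc[OF Suc(2)[OF xy(2)]] P_simps(4,5) xy(2) by simp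
  then have "?a \<otimes> Psi y \<in> P (Suc (Suc n))" using P_mult[OF Th_1[OF xy(1)]] by simp
  moreover have "(nk 2 \<odot> x) \<otimes> ?b \<in> P (Suc (Suc n))" using Suc(2)[OF xy(2)] U_simps(5) xy(1) by (intro P_base) auto
  ultimately show "Th (Suc n) (x \<otimes> y) \<in> P (Suc (Suc n))" unfolding e by (rule P_simps(4))
 qed
qed

subsection \<open>Operators commuting with the braiding\<close>

text \<open>Operators that slide along one strand through a crossing. Sliding along the other strand
  follows from the symmetry of the braiding (\<open>cmD2\<close>).\<close>

definition cm where "cm f \<longleftrightarrow> f \<in> lin A A \<and> (\<forall>t\<in>tp A 2. tm2 A A f (%x. x) (c t) = c (tm2 A A (%x. x) f t))"

lemmas L0 = lin_id[of A]

lemma cm_lin: "cm f ==> f \<in> lin A A"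
 and cmD: "cm f ==> t \<in> tp A 2 ==> tm2 A A f (%x. x) (c t) = c (tm2 A A (%x. x) f t)"
 by (auto simp: cm_def)

lemma cmD2: assumes f: "cm f" and t: "t \<in> tp A 2" shows "tm2 A A (%x. x) f (c t) = c (tm2 A A f (%x. x) t)"
proof -
 note tt = tmA_tp[OF L0 cm_lin[OF f]] tmA_tp[OF cm_lin[OF f] L0]
 have "tm2 A A f (%x. x) (c (c t)) = c (tm2 A A (%x. x) f (c t))" by (rule cmD[OF f c_tp[OF t]])
 then show ?thesis using c_symm t tt(1)[OF c_tp[OF t]] by simp
qed

lemma cm_comp: assumes f: "cm f" and g: "cm g" shows "cm (%x. f (g x))"
 unfolding cm_def
proof (intro conjI ballI)
 note l = cm_lin[OF f] cm_lin[OF g]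
 show "(%x. f (g x)) \<in> lin A A" by (rule lin_o[OF l])
 fix t assume t: "t \<in> tp A 2"
 have "tm2 A A (%x. f (g x)) (%x. x) (c t) = tm2 A A f (%x. x) (c (tm2 A A (%x. x) g t))"
  using tmA_comp[OF AM l(2) L0 l(1) L0 c_tp[OF t]] cmD[OF g t] by simp
 also have "\<dots> = c (tm2 A A (%x. x) f (tm2 A A (%x. x) g t))" by (rule cmD[OF f tmA_tp[OF L0 l(2) t]])
 also have "\<dots> = c (tm2 A A (%x. x) (%x. f (g x)) t)"
  using tmA_comp[OF AM L0 l(2) L0 l(1) t] by simp
 finally show "tm2 A A (%x. f (g x)) (%x. x) (c t) = c (tm2 A A (%x. x) (%x. f (g x)) t)" .
qed

lemma cmI:
 assumes f: "f \<in> lin A A" and "!!x y. x <: A ==> y <: A ==> tm2 A A f (%x. x) (c (te [x, y])) = c (te [x, f y])"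
 shows "cm f"
 unfolding cm_def
proof (intro conjI ballI f)
 fix t assume t: "t \<in> tp A 2"
 have "tm2 A A f (%x. x) (C 0 t) = C 0 (tm2 A A (%x. x) f t)"
  by (rule A_lift2_eq[OF lin_o[OF tmA_lin[OF f L0] C_lin] lin_o[OF C_lin tmA_lin[OF L0 f]] TAM _ t])
   (use assms lin_cl[OF f] in \<open>simp add: C_0 tmA_tens[OF L0 f]\<close>)
 then show "tm2 A A f (%x. x) (c t) = c (tm2 A A (%x. x) f t)"
  using t tmA_tp[OF L0 f t] by (simp add: C_0)
qed

lemma tm2_cong:
 assumes "f \<in> lin A A" "g \<in> lin A A" "h \<in> lin A A" "!!x. x <: A ==> f x = g x" "t \<in> tp A 2"
 shows "tm2 A A f h t = tm2 A A g h t"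
 by (rule A_lift2_eq[OF tmA_lin[OF assms(1,3)] tmA_lin[OF assms(2,3)] TAM _ assms(5)])
  (use assms(4) in \<open>simp add: tmA_tens[OF assms(1,3)] tmA_tens[OF assms(2,3)]\<close>)

lemma cm_cong: assumes f: "cm f" and g: "g \<in> lin A A" and eq: "!!x. x <: A ==> g x = f x" shows "cm g"
proof (rule cmI[OF g])
 fix x y assume "x <: A" "y <: A"
 then show "tm2 A A g (%x. x) (c (te [x, y])) = c (te [x, g y])"
  using tm2_cong[OF g cm_lin[OF f] L0 eq c_closed] cmD[OF f] eq by (simp add: tmA_tens[OF L0 cm_lin[OF f]])
qed

lemma cm_id: "cm (%x. x)"
 by (rule cmI[OF L0]) (use A_lift2_eq[OF tmA_lin[OF L0 L0] lin_id TAM _ c_closed] in \<open>simp add: tmA_tens[OF L0 L0]\<close>)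

lemma cm_lincomb: assumes f: "cm f" and g: "cm g" and a: "a <: K" shows "cm (%x. f x \<ominus> a \<odot> g x)"
proof (rule cmI)
 note l = cm_lin[OF f] cm_lin[OF g]
 show L: "(%x. f x \<ominus> a \<odot> g x) \<in> lin A A" by (intro lin_sub[OF AM l(1)] lin_sm[OF AM l(2) a])
 have *: "tm2 A A (%x. f x \<ominus> a \<odot> g x) (%x. x) w = tm2 A A f (%x. x) w \<ominus>\<^sub>(T A) a \<odot>\<^sub>(T A) tm2 A A g (%x. x) w" if w: "w \<in> tp A 2" for w
 proof (rule A_lift2_eq[OF tmA_lin[OF L L0] lin_sub[OF TAM tmA_lin[OF l(1) L0] lin_sm[OF TAM tmA_lin[OF l(2) L0] a]] TAM _ w])
  fix x y assume xy: "x <: A" "y <: A"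
  then have "te [f x \<ominus> a \<odot> g x, y] = te [f x, y] \<ominus>\<^sub>(T A) a \<odot>\<^sub>(T A) te [g x, y]"
   using lin_cl[OF l(1)] lin_cl[OF l(2)] a
   by (simp add: lin_minus[OF A_tens2_lin(1) AM TAM] lin_smult[OF A_tens2_lin(1)])
  then show "tm2 A A (%x. f x \<ominus> a \<odot> g x) (%x. x) (te [x, y]) = tm2 A A f (%x. x) (te [x, y]) \<ominus>\<^sub>(T A) a \<odot>\<^sub>(T A) tm2 A A g (%x. x) (te [x, y])"
   using xy by (simp add: tmA_tens[OF _ L0] l L)
 qed
 fix x y assume xy: "x <: A" "y <: A"
 note fg = lin_cl[OF l(1) xy(2)] lin_cl[OF l(2) xy(2)]
 have L2: "(%z. c (te [x, z])) \<in> lin A (T A)"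
 proof (rule lin_o[OF c_lin])
  show "(%z. te [x, z]) \<in> lin A (tpow K A 2)"
   using xy by (subst tpow_alt, intro lin_restr_cod A_tens2_lin) auto
 qed
 show "tm2 A A (%x. f x \<ominus> a \<odot> g x) (%x. x) (c (te [x, y])) = c (te [x, f y \<ominus> a \<odot> g y])"
  using xy fg a *[OF c_closed[OF xy]] cmD[OF f] cmD[OF g]
  by (simp add: tmA_tens[OF L0] l lin_minus[OF L2 AM TAM] lin_smult[OF L2])
qed

text \<open>Both the comultiplication and the product pass through a crossing: \<open>D0c\<close>
  doubles the strand, and \<open>cN1\<close> joins it again.\<close>

lemma cm_Psi: "cm Psi"
proof (rule cmI[OF Psi_lin])
 have n0: "N 0 (D 0 t) = tm2 A A Psi (%x. x) t" if "t \<in> tp A 2" for t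
  by (rule A_lift2_eq[OF lin_o[OF N_lin D_lin] tmA_lin[OF Psi_lin L0] TAM _ that])
   (simp add: D0_2 N0_ap Delta_tp nabla_mu tmA_tens[OF Psi_lin L0] te2[of "Psi _"] Psi_closed, simp add: Psi_def)
 have n1: "N 1 (D 1 t) = tm2 A A (%x. x) Psi t" if "t \<in> tp A 2" for t
  by (rule A_lift2_eq[OF lin_o[OF N_lin D_lin] tmA_lin[OF L0 Psi_lin] TAM _ that])
   (simp add: D1_2 N1_ap' Delta_tp nabla_mu tmA_tens[OF L0 Psi_lin] te2[of _ "Psi _"] Psi_closed, simp add: Psi_def)
 fix x y assume xy: "x <: A" "y <: A"
 have d3: "D 1 (te [x, y]) \<in> tp A 3" using D_tp[of "te [x, y]" 2 1] xy by simp
 have "tm2 A A Psi (%x. x) (c (te [x, y])) = N 0 (C 1 (C 0 (D 1 (te [x, y]))))"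
  using n0[OF c_closed[OF xy]] D0c[OF t2_tp[OF xy]] by simp
 also have "\<dots> = c (N 1 (D 1 (te [x, y])))" by (rule cN1[OF d3, symmetric])
 finally show "tm2 A A Psi (%x. x) (c (te [x, y])) = c (te [x, Psi y])"
  using n1[OF t2_tp[OF xy]] xy by (simp add: tmA_tens[OF L0 Psi_lin])
qed

lemma cm_j: "cm j"
proof -
 have L: "(%x. \<epsilon> x \<odot> \<one>) \<in> lin A A" by (rule eps_lin(1)[OF one_A])
 have *: "tm2 A A (%x. \<epsilon> x \<odot> \<one>) (%x. x) w = te [\<one>, e0 w]" if "w \<in> tp A 2" for w
  by (rule A_lift2_eq[OF tmA_lin[OF L L0] lin_o[OF A_tens2_lin(2)[OF one_A] e0_lin] TAM _ that])
   (use one_A in \<open>simp add: tmA_tens[OF L L0] e0_tens A_tens2_simps\<close>)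
 have "cm (%x. \<epsilon> x \<odot> \<one>)"
  by (rule cmI[OF L]) (use one_A in \<open>simp add: * c_eps e1_tens A_tens2_simps c_one c_simps\<close>)
 from cm_lincomb[OF cm_id this, of "\<one>\<^sub>K"] show ?thesis
 proof (rule cm_cong[OF _ j_lin])
  fix x assume "x <: A"
  then show "j x = x \<ominus> \<one>\<^sub>K \<odot> (\<epsilon> x \<odot> \<one>)" using one_A unfolding j_def by simp
 qed simp
qed

subsection \<open>The idempotent\<close>

text \<open>The inverse of the value \<open>2 - 2^(n+2)\<close> that \<open>Th (n + 2)\<close> takes
  on the eigenspace of \<open>2\<close>. The offset occurs because the factors belong to the
  eigenvalues \<open>4, 8, ...\<close>.\<close>

definition ek where "ek n = inv\<^bsub>K\<^esub> (nk 2 \<ominus>\<^sub>K nk (2 ^ (n + 2)))"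

text \<open>\<open>Psi\<close> acts on \<open>P k / P (k + 1)\<close> as \<open>2\<^sup>k\<close>, and \<open>P (d + 1)\<close> vanishes in degree \<open>d\<close>. Hence the product of the
 normalised operators \<open>Psi - 2\<^sup>k\<close> for \<open>2 \<le> k \<le> d\<close> is, in degree \<open>d\<close>, the projection onto the eigenspace of \<open>2\<close>.\<close>

primrec Ed where
 "Ed 0 x = x"
| "Ed (Suc n) x = ek n \<odot> Th (n + 2) (Ed n x)"

lemma ek: "ek n <: K" "ek n \<otimes>\<^sub>K (nk 2 \<ominus>\<^sub>K nk (2 ^ (n + 2))) = \<one>\<^sub>K"
proof -
 have "(1::nat) \<le> 2 ^ n" by simp
 then have "nk 2 \<noteq> nk (2 ^ (n + 2))" using nk_inj[OF char0, of 2 "2 ^ (n + 2)"] by auto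
 then have "nk 2 \<ominus>\<^sub>K nk (2 ^ (n + 2)) \<noteq> \<zero>\<^sub>K" by (metis a_minus_def add.inv_closed add.inv_equality minus_minus nk_closed)
 then show "ek n <: K" "ek n \<otimes>\<^sub>K (nk 2 \<ominus>\<^sub>K nk (2 ^ (n + 2))) = \<one>\<^sub>K"
  unfolding ek_def using field_Units by auto
qed

lemma Ed_lin: "Ed n \<in> lin A A"
proof (induct n)
 case (Suc n)
 have "(%x. ek n \<odot> Th (n + 2) (Ed n x)) \<in> lin A A"
  by (intro lin_sm[OF AM] lin_o[OF Th_lin Suc] ek)
 then show ?case by simp
qed (simp add: lin_id)

lemma Ed_Gr: "x \<in> Gr d ==> Ed n x \<in> Gr d"
proof (induct n)
 case (Suc n)
 have "Th (n + 2) (Ed n x) \<in> Gr d"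
  unfolding Th_def Psi_def using Suc GrPsi sub_smult[OF AM Gr_sub] by (intro sub_minus[OF AM Gr_sub]) auto
 then show ?case using sub_smult[OF AM Gr_sub ek(1)] by simp
qed simp

text \<open>Each factor \<open>Th (n + 2)\<close> raises the power of the ideal by one.\<close>

lemma Ed_kill: "x \<in> P 2 ==> Ed n x \<in> P (n + 2)"
proof (induct n)
 case (Suc n)
 then have "Th (n + 2) (Ed n x) \<in> P (Suc (n + 2))" by (intro Th_P) simp_all
 then show ?case using P_simps(5) ek(1) by simp
qed simp

text \<open>On the ideal modulo its square, \<open>Psi\<close> is multiplication by
  \<open>2\<close>, so each normalised factor acts as the identity there.\<close>

lemma Ed_mod: assumes x: "x \<in> U 1" shows "Ed n x \<ominus> x \<in> P 2"
proof (induct n)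
 case 0 show ?case using U_simps(2)[OF x] P_simps(3) by (simp add: mod_minus)
next
 case (Suc n)
 note xA = U_simps(2)[OF x]
 let ?k = "nk 2 \<ominus>\<^sub>K nk (2 ^ (n + 2))" and ?w = "Ed n x" and ?h = "ek n"
 have k: "?k <: K" by simp
 have wA: "?w <: A" by (rule lin_cl[OF Ed_lin xA])
 note tA = lin_cl[OF Th_lin wA, of 1]
 have "?w = (?w \<ominus> x) \<oplus> x" using wA xA by (simp add: mod_minus mod_assoc)
 then have "?w \<in> P 1" using P_simps(4)[OF P_Suc[of "?w \<ominus> x" 1], of x] Suc P_1 x by simp
 then have t: "Th 1 ?w \<in> P 2" using Th_1 P_1 by blast
 have s: "?h \<odot> (?k \<odot> ?w) = ?w" using mod_smul[OF AM ek(1)[of n] k wA] ek(2)[of n] wA by simp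
 have "Th (n + 2) ?w = Th 1 ?w \<oplus> ?k \<odot> ?w"
  using wA Psi_closed[OF wA] by (simp add: Th_def mod_minus mod_assoc a_minus_def mod_adds mod_negs)
 then have "Ed (Suc n) x = ?h \<odot> Th 1 ?w \<oplus> ?w"
  using mod_sadd[OF AM ek(1) tA mod_closed(5)[OF AM k wA]] s by simp
 then have "Ed (Suc n) x \<ominus> x = ?h \<odot> Th 1 ?w \<oplus> (?w \<ominus> x)"
  using wA xA tA ek(1) by (simp add: mod_minus mod_assoc)
 then show ?case using P_simps(4)[OF P_simps(5)[OF ek(1) t] Suc] by simp
qed

lemma cm_zero: "cm (%x. \<zero>)"
 by (rule cm_cong[OF cm_lincomb[OF cm_id cm_id, of "\<one>\<^sub>K"] lin_0[OF AM]]) (simp_all add: mod_minus)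

lemma Ed_cm: "cm (Ed n)"
proof (induct n)
 case 0 show ?case by (rule cm_cong[OF cm_id Ed_lin]) simp
next
 case (Suc n)
 have 1: "cm (%x. Th (n + 2) (Ed n x))"
  by (rule cm_comp[OF _ Suc]) (unfold Th_def, rule cm_lincomb[OF cm_Psi cm_id], simp)
 have k: "\<ominus>\<^sub>K ek n <: K" using ek(1) by simp
 show ?case
  by (rule cm_cong[OF cm_lincomb[OF cm_zero 1 k] Ed_lin])
   (use ek(1) lin_cl[OF Th_lin] lin_cl[OF Ed_lin] in \<open>simp add: mod_minus mod_negs\<close>)
qed

text \<open>In degree \<open>m + 1\<close> the operator \<open>Ed m\<close> maps the square of the
  ideal into its power \<open>m + 2\<close>, which has nothing in this degree. The value in degree
  zero makes the projection kill the unit.\<close>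

definition E where "E n = (case n of 0 => (%x. \<zero>) | Suc m => Ed m)"

lemma E_lin: "E n \<in> lin A A" and cm_E: "cm (E n)" and E_deg: "x \<in> Gr d ==> E n x \<in> Gr d"
 using Ed_lin Ed_cm Ed_Gr cm_zero lin_0[OF AM] sub_zero[OF AM Gr_sub] by (auto simp: E_def split: nat.split)

definition pe where "pe = (SOME f. f \<in> lin A A \<and> (\<forall>n. \<forall>x\<in>Gr n. f x = E n x))"

lemma pe_lin: "pe \<in> lin A A" and pe_Gr: "x \<in> Gr n ==> pe x = E n x"
proof -
 have "\<exists>f. f \<in> lin A A \<and> (\<forall>n. \<forall>x\<in>Gr n. f x = E n x)" using graded_lift[where g = E, OF AM gp AM E_lin] by blast
 from someI_ex[OF this] show "pe \<in> lin A A" "x \<in> Gr n ==> pe x = E n x"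
  unfolding pe_def by auto
qed

lemmas pe_closed = lin_cl[OF pe_lin]

lemma pe_deg: "x \<in> Gr n ==> pe x \<in> Gr n"
 by (simp add: pe_Gr E_deg)

lemma pe_one: "pe \<one> = \<zero>" using pe_Gr[OF Gr1] by (simp add: E_def)

lemma pe_U: "x <: A ==> pe x \<in> U 1"
proof (induct rule: A_ind)
 case (base n x)
 then show ?case using pe_deg[OF base] U_base[of "pe x" n 1] pe_Gr[OF base] U_simps(3) by (cases n) (auto simp: E_def)
qed (simp add: lin_add[OF pe_lin] U_simps(4))

lemma pe_mod: assumes x: "x \<in> U 1" shows "pe x \<ominus> x \<in> P 2"
 by (rule U_image[OF lin_sub[OF AM pe_lin lin_id] AM P_sub _ x]) (use Ed_mod U_base in \<open>auto simp: pe_Gr E_def split: nat.split\<close>)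

lemma pe_kill: "x \<in> Gr d ==> x \<in> P 2 ==> pe x = \<zero>"
 using U_Gr[OF P_U[OF Ed_kill[of x]] Ed_Gr] by (auto simp: pe_Gr E_def split: nat.split)

lemma pe_kill2: assumes x: "x \<in> U 1" and y: "y \<in> U 1" shows "pe (x \<otimes> y) = \<zero>"
proof -
 have "pe (x \<otimes> y) \<in> {\<zero>}"
 proof (rule U_image[OF lin_o[OF pe_lin lin_rmult[OF A_ualg lin_id U_simps(2)[OF y]]] AM sub_0[OF AM] _ x])
  fix d x assume x: "1 \<le> d" "x \<in> Gr d"
  show "pe (x \<otimes> y) \<in> {\<zero>}"
  proof (rule U_image[OF lin_o[OF pe_lin lin_lmult[OF A_ualg lin_id Gr_A[OF x(2)]]] AM sub_0[OF AM] _ y])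
   fix i y assume y: "1 \<le> i" "y \<in> Gr i"
   show "pe (x \<otimes> y) \<in> {\<zero>}"
    using pe_kill[OF GrM[OF x(2) y(2)]] P_2 U_base x y by simp
  qed
 qed
 then show ?thesis by simp
qed

text \<open>In positive degree \<open>pe x - x\<close> is homogeneous and lies in the square of the
  ideal, where \<open>pe\<close> vanishes.\<close>

lemma pe_idem: "x <: A ==> pe (pe x) = pe x"
proof (induct rule: A_ind)
 case (base n x)
 show ?case
 proof (cases "n = 0")
  case True then show ?thesis using pe_Gr[OF base] lin_zero[OF pe_lin AM AM] by (simp add: E_def)
 next
  case False
  have "pe x \<ominus> x \<in> Gr n" using pe_deg[OF base] base by (rule sub_minus[OF AM Gr_sub])
  then have "pe (pe x \<ominus> x) = \<zero>" using pe_kill pe_mod U_base[OF base, of 1] False by simp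
  then show ?thesis
   using lin_minus[OF pe_lin AM AM] mod_eqI[OF AM] pe_closed Gr_A[OF base] by simp
 qed
qed (simp add: lin_add[OF pe_lin] pe_closed)

text \<open>\<open>pe\<close> is a derivation over \<epsilon>, because it kills the unit and the
  products of two elements of the ideal: write each factor as its \<open>j\<close>-part plus a
  multiple of the unit.\<close>

lemma pe_mult: assumes "x <: A" "y <: A"
 shows "pe (x \<otimes> y) = \<epsilon> y \<odot> pe x \<oplus> \<epsilon> x \<odot> pe y"
proof -
 note jc = lin_cl[OF j_lin assms(1)] lin_cl[OF j_lin assms(2)]
 have "pe (j x) = pe x" if "x <: A" for x
  using that one_A unfolding j_def by (simp add: lin_minus[OF pe_lin AM AM] lin_smult[OF pe_lin] pe_one, simp add: pe_closed mod_minus)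
 moreover have "(a \<oplus> r \<odot> \<one>) \<otimes> (b \<oplus> s \<odot> \<one>) = a \<otimes> b \<oplus> (s \<odot> a \<oplus> (r \<odot> b \<oplus> (r \<otimes>\<^sub>K s) \<odot> \<one>))"
  if "a <: A" "b <: A" "r <: K" "s <: K" for a b r s
  using that one_A by (simp add: A_ua mod_ac mod_smul mod_sadd m_comm)
 from this[OF jc, of "\<epsilon> x" "\<epsilon> y"] have "pe (x \<otimes> y) = pe (j x \<otimes> j y \<oplus> (\<epsilon> y \<odot> j x \<oplus> (\<epsilon> x \<odot> j y \<oplus> (\<epsilon> x \<otimes>\<^sub>K \<epsilon> y) \<odot> \<one>)))"
  using assms by (simp only: U1_decomp[symmetric] eps_closed)
 ultimately show ?thesis
  using jc assms one_A by (simp add: lin_add[OF pe_lin] lin_smult[OF pe_lin] pe_one pe_kill2 j_U A_ua pe_closed)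
qed

text \<open>\<open>pe\<close> is a different operator in each degree. For homogeneous
  \<open>y\<close> the braiding leaves the factor that comes from \<open>y\<close> in the same
  degree, so \<open>pe\<close> may be replaced by the single operator \<open>E n\<close>, which
  passes through the crossing.\<close>

lemma cm_pe: "cm pe"
proof (rule cmI[OF pe_lin])
 fix x y assume x: "x <: A" and "y <: A"
 have L2: "f \<in> lin A (tpow K A 2) ==> (%z. c (f z)) \<in> lin A (T A)" for f by (rule lin_o[OF c_lin])
 have t: "(%z. te [x, z]) \<in> lin A (tpow K A 2)"
  using x by (subst tpow_alt, intro lin_restr_cod A_tens2_lin) auto
 from \<open>y <: A\<close> show "tm2 A A pe (%x. x) (c (te [x, y])) = c (te [x, pe y])"
 proof (induct rule: A_ind)
  case (base n y)
  note yA = Gr_A[OF base]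
  from Grcat2[OF base x] have "tm2 A A pe (%x. x) (c (te [x, y])) = tm2 A A (E n) (%x. x) (c (te [x, y]))"
   by (rule A_tprod_eq[OF sub_carr[OF AM Gr_sub] subset_refl tmA_lin[OF pe_lin L0] tmA_lin[OF E_lin L0] TAM, rotated])
    (simp add: tmA_tens[OF pe_lin L0] tmA_tens[OF E_lin L0] Gr_A pe_Gr)
  also have "\<dots> = c (te [x, E n y])" using cmD[OF cm_E t2_tp[OF x yA]] x yA by (simp add: tmA_tens[OF L0 E_lin])
  finally show ?case using pe_Gr[OF base] by simp
 next
  case (add y z)
  then show ?case
   using x lin_add[OF lin_o[OF tmA_lin[OF pe_lin L0] L2[OF t]]] lin_add[OF L2[OF t]] lin_add[OF pe_lin] pe_closed by simp
 qed
qed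

end

context kfield
begin

subsection \<open>Functoriality of the tensor algebra\<close>

definition Tm where "Tm V W f = tlift V (T W) (%vs. tens K W (map f vs))"

context
 fixes V :: "('k, 'v) module" and W :: "('k, 'w) module" and f
 assumes V [simp]: "module K V" and W [simp]: "module K W" and f: "f \<in> lin V W"
begin

lemma map_f: "set vs <<: V ==> set (map f vs) <<: W"
 using lin_cl[OF f] by auto

lemma Tm_lin: "Tm V W f \<in> lin (T V) (T W)"
 and Tm_tens: "set vs <<: V ==> Tm V W f (tens K V vs) = tens K W (map f vs)"
proof -
 have "multilin V (T W) (%vs. tens K W (map f vs))"
  using map_f lin_cl[OF f] lin_add[OF f] lin_smult[OF f]
  by (intro multilinI) (simp_all add: tens_closed[OF W] tens_add[OF W] tens_smult[OF W])
 from tlift_lin[OF V T_mod[OF W] this] tlift_tens[OF V T_mod[OF W] this]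
 show "Tm V W f \<in> lin (T V) (T W)" "set vs <<: V ==> Tm V W f (tens K V vs) = tens K W (map f vs)"
  unfolding Tm_def by auto
qed

lemma Tm_mult: assumes s: "s <: (T V)" and t: "t <: (T V)"
 shows "Tm V W f (s \<star>\<^sub>V t) = Tm V W f s \<star>\<^sub>W Tm V W f t"
proof -
 note TV = T_ualg[OF V] and TW = T_ualg[OF W]
 have 1: "Tm V W f (tens K V us \<star>\<^sub>V t) = tens K W (map f us) \<star>\<^sub>W Tm V W f t" if us: "set us <<: V" and t: "t <: (T V)" for us t
  by (rule T_lin_eq[OF V lin_o[OF Tm_lin lin_lmult[OF TV lin_id]] lin_lmult[OF TW Tm_lin] T_mod[OF W] _ t])
   (use us map_f in \<open>auto simp: Tm_tens tens_append[OF W] simp flip: tens_append[OF V] intro!: tens_closed[OF V] tens_closed[OF W]\<close>)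
 show ?thesis
  by (rule T_lin_eq[OF V lin_o[OF Tm_lin lin_rmult[OF TV lin_id t]] lin_rmult[OF TW Tm_lin lin_cl[OF Tm_lin t]] T_mod[OF W] _ s])
   (simp add: 1 t Tm_tens)
qed

lemma Tm_tp: assumes t: "t \<in> tp V n" shows "Tm V W f t \<in> tp W n"
 using V t by (induct rule: tp_ind)
  (use map_f sub_simps[OF T_mod[OF W] tp_sub[OF W]] in \<open>simp_all add: Tm_tens lin_simps[OF Tm_lin] lin_zero[OF Tm_lin] tp_T[OF V] tens_tp[OF W]\<close>)

lemma Tm_tm2: "t \<in> tp V 2 ==> Tm V W f t = tm2 V W f f t"
 by (rule lift2_eq[OF V Tm_lin tm2_lin[OF V W f f] T_mod[OF W]]) (simp_all add: Tm_tens tm2_tens[OF V W f f])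

lemma Tm_opat:
 assumes g: "g \<in> lin (tpow K V p) (T V)" and h: "h \<in> lin (tpow K W p) (T W)"
  and gh: "!!t. t \<in> tp V p ==> Tm V W f (g t) = h (Tm V W f t)" and t: "t <: (T V)"
 shows "Tm V W f (opat V i p g t) = opat W i p h (Tm V W f t)"
proof (rule T_lin_eq[OF V lin_o[OF Tm_lin opat_lin[OF V g]] lin_o[OF opat_lin[OF W h] Tm_lin] T_mod[OF W] _ t])
 fix vs assume vs: "set vs <<: V"
 show "Tm V W f (opat V i p g (tens K V vs)) = opat W i p h (Tm V W f (tens K V vs))"
 proof (cases "i + p \<le> length vs")
  case True
  have s: "set (take i vs) <<: V" "set (take p (drop i vs)) <<: V" "set (drop (i + p) vs) <<: V"
   using vs set_take_subset set_drop_subset by (metis order_trans)+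
  have w: "tens K V (take p (drop i vs)) \<in> tp V p" using s True by (intro tens_tp[OF V]) auto
  note gc = lin_cl[OF g w]
  show ?thesis using True vs s gc map_f[OF vs] gh[OF w]
   by (simp add: opat_tens[OF V g] opat_tens[OF W h] Tm_tens Tm_mult ua_simps[OF T_ualg[OF V]] take_map drop_map)
 next
  case False
  then show ?thesis using vs map_f[OF vs] lin_zero[OF Tm_lin T_mod[OF V] T_mod[OF W]]
   by (simp add: opat_tens[OF V g] opat_tens[OF W h] Tm_tens)
 qed
qed

end

text \<open>The left inverse \<open>g\<close> induces a left inverse on tensors. Through this,
  identities between tensors over \<open>V\<close> are checked over \<open>W\<close>.\<close>

lemma Tm_inj:
 assumes V: "module K V" and W: "module K W" and f: "f \<in> lin V W" and g: "g \<in> lin W V"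
  and gf: "!!x. x <: V ==> g (f x) = x" and s: "s <: (T V)" "t <: (T V)" and eq: "Tm V W f s = Tm V W f t"
 shows "s = t"
proof -
 have "Tm W V g (Tm V W f t) = t" if "t <: (T V)" for t
 proof (rule T_lin_eq[OF V lin_o[OF Tm_lin[OF W V g] Tm_lin[OF V W f]] lin_id T_mod[OF V] _ that])
  fix vs assume vs: "set vs <<: V"
  then have "map g (map f vs) = vs" using gf by (induct vs) auto
  then show "Tm W V g (Tm V W f (tens K V vs)) = tens K V vs"
   using vs map_f[OF V W f vs] Tm_tens[OF V W f vs] Tm_tens[OF W V g, of "map f vs"] by simp
 qed
 then show ?thesis using s eq by metis
qed

end

subsection \<open>The space of generators\<close>

context pbw_alg
begin

definition VA where "VA = pe ` carrier A"

definition "V = A\<lparr>carrier := VA\<rparr>"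

lemma VA_sub: "sub VA A" unfolding VA_def by (rule sub_image[OF pe_lin AM AM sub_carrier[OF AM]])

lemma V_sel [simp]: "carrier V = VA" "add V = add A" "smult V = smult A" "zero V = zero A" "one V = one A" "mult V = mult A"
 by (simp_all add: V_def)

lemma VM [simp]: "module K V" unfolding V_def by (rule sub_module[OF AM VA_sub])

lemma VA_A: "x \<in> VA ==> x <: A" by (rule sub_mem[OF AM VA_sub])

lemma VA_pe: "x \<in> VA ==> pe x = x" using pe_idem by (auto simp: VA_def)

lemma VA_U: "x \<in> VA ==> x \<in> U 1" using pe_U by (auto simp: VA_def)

lemma pe_V: "pe \<in> lin A V" unfolding V_def VA_def by (rule lin_restr_cod[OF pe_lin]) simp

lemma id_V: "(%x. x) \<in> lin V A" unfolding V_def by (rule lin_restr[OF lin_id]) (use VA_A in blast)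

abbreviation io where "io == Tm V A (%x. x)"

lemmas io_lin = Tm_lin[OF VM AM id_V] and io_tens = Tm_tens[OF VM AM id_V, simplified]
 and io_tp = Tm_tp[OF VM AM id_V] and io_tm2 = Tm_tm2[OF VM AM id_V]

text \<open>The restriction of the braiding to \<open>V\<close>. Projecting by \<open>pe\<close> in
  both factors changes no value (\<open>io_cV\<close>); it only turns tensors over \<open>A\<close>
  into tensors over \<open>V\<close>.\<close>

definition cV where "cV t = tm2 A V pe pe (c (tm2 V A (%x. x) (%x. x) t))"

lemma pe2_c: assumes w: "w \<in> tp A 2" shows "tm2 A A pe pe (c w) = c (tm2 A A pe pe w)"
proof -
 have d: "tm2 A A pe pe w = tm2 A A pe (%x. x) (tm2 A A (%x. x) pe w)" "tm2 A A pe pe w = tm2 A A (%x. x) pe (tm2 A A pe (%x. x) w)"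
  if "w \<in> tp A 2" for w
  using tmA_comp[OF AM L0 pe_lin pe_lin L0 that] tmA_comp[OF AM pe_lin L0 L0 pe_lin that] by simp_all
 have "tm2 A A pe pe (c w) = tm2 A A pe (%x. x) (c (tm2 A A pe (%x. x) w))" using d(1)[OF c_tp[OF w]] cmD2[OF cm_pe w] by simp
 also have "\<dots> = c (tm2 A A (%x. x) pe (tm2 A A pe (%x. x) w))" by (rule cmD[OF cm_pe tmA_tp[OF pe_lin L0 w]])
 finally show ?thesis using d(2)[OF w] by simp
qed

lemma io_cV: assumes t: "t \<in> tp V 2" shows "io (cV t) = c (io t)"
proof -
 have it: "io t \<in> tp A 2" by (rule io_tp[OF t])
 have "io (cV t) = tm2 V A (%x. x) (%x. x) (tm2 A V pe pe (c (io t)))"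
  unfolding cV_def io_tm2[OF t, symmetric] by (rule io_tm2[OF tm2_tp[OF AM VM pe_V pe_V c_tp[OF it]]])
 also have "\<dots> = tm2 A A pe pe (c (io t))" by (rule tm2_comp[OF AM VM AM pe_V pe_V id_V id_V c_tp[OF it]])
 also have "\<dots> = c (tm2 A A pe pe (io t))" by (rule pe2_c[OF it])
 also have "tm2 A A pe pe (io t) = io t"
  by (rule lift2_eq[OF VM lin_o[OF tmA_lin[OF pe_lin pe_lin] io_lin] io_lin TAM _ t])
   (simp add: io_tens tmA_tens[OF pe_lin pe_lin] VA_A VA_pe)
 finally show ?thesis .
qed

lemma cV_lin: "cV \<in> lin (tpow K V 2) (T V)" and cV_tp: "t \<in> tp V 2 ==> cV t \<in> tp V 2"
proof -
 show "t \<in> tp V 2 ==> cV t \<in> tp V 2"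
  unfolding cV_def by (intro tm2_tp[OF AM VM pe_V pe_V] c_tp tm2_tp[OF VM AM id_V id_V])
 have "tm2 V A (%x. x) (%x. x) \<in> lin (tpow K V 2) (tpow K A 2)"
  by (subst (2) tpow_alt, intro lin_restr_cod lin_tp[OF VM] tm2_lin[OF VM AM id_V id_V] tm2_tp[OF VM AM id_V id_V]) auto
 then show "cV \<in> lin (tpow K V 2) (T V)"
  unfolding cV_def by (intro lin_o[OF tm2_lin[OF AM VM pe_V pe_V]] lin_o[OF c_lin])
qed

subsection \<open>The symmetric algebra and multiplication\<close>

abbreviation J where "J == sym_ideal K V cV"
abbreviation S where "S == sym_algebra K V cV"
abbreviation pj where "pj == sym_proj K V cV"
abbreviation tv where "tv == tens K V"

lemmas TVM = T_mod[OF VM] and TV_ualg = T_ualg[OF VM] and TV_ua = T_ua[OF VM]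

lemma J_gens: "(%t. t \<ominus>\<^sub>(T V) cV t) ` tp V 2 <<: (T V)"
 using cV_tp tp_T[OF VM] TVM by (auto intro!: mod_closed(4)[OF TVM])

lemma J_ideal: "ideal J (T V)"
 unfolding sym_ideal_def by (rule ring.genideal_ideal[OF ua_ring[OF TV_ualg] J_gens])

lemmas Sq = quot_simps[OF TV_ualg J_ideal, folded sym_algebra_def, folded sym_proj_def]

lemmas S_ualg = Sq(1) and pj_lin = Sq(2) and S_carr = Sq(3) and pj_mult = Sq(4) and S_one = Sq(5) and S_zero = Sq(6)
 and pj_eq0 = Sq(10)

lemma SM [simp]: "module K S" by (rule ua_mod[OF S_ualg])

lemmas S_ua = ua_simps[OF S_ualg]

lemma pj_closed: "t <: (T V) ==> pj t <: S" using lin_cl[OF pj_lin] by simp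

lemma pj_c: assumes t: "t \<in> tp V 2" shows "pj (cV t) = pj t"
proof -
 have c: "t <: (T V)" "cV t <: (T V)" using t cV_tp tp_T[OF VM] by auto
 have "t \<ominus>\<^sub>(T V) cV t \<in> J"
  unfolding sym_ideal_def by (rule subsetD[OF ring.genideal_self[OF ua_ring[OF TV_ualg] J_gens]]) (use t in blast)
 then show ?thesis using Sq(9)[OF c] by simp
qed

primrec pr where
 "pr [] = \<one>"
| "pr (v # vs) = v \<otimes> pr vs"

lemma pr_closed: "set vs <<: A ==> pr vs <: A"
 by (induct vs) (auto simp: A_ua)

lemma pr_append: "set us <<: A ==> set vs <<: A ==> pr (us @ vs) = pr us \<otimes> pr vs"
 by (induct us) (auto simp: A_ua pr_closed)

lemma VA_set: "set vs \<subseteq> VA ==> set vs <<: A" using VA_A by blast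

definition mV where "mV = tlift V A pr"

lemma mV_lin: "mV \<in> lin (T V) A" and mV_tens: "set vs \<subseteq> VA ==> mV (tv vs) = pr vs"
proof -
 have "multilin V A pr"
  using VA_A VA_set by (intro multilinI) (simp_all add: pr_append pr_closed A_ua)
 from tlift_lin[OF VM AM this] tlift_tens[OF VM AM this]
 show "mV \<in> lin (T V) A" "set vs \<subseteq> VA ==> mV (tv vs) = pr vs" by (simp_all add: mV_def)
qed

lemmas mV_closed = lin_cl[OF mV_lin]

lemma mV_mult: assumes s: "s <: (T V)" and t: "t <: (T V)" shows "mV (s \<star>\<^sub>V t) = mV s \<otimes> mV t"
proof -
 have 1: "mV (tv us \<star>\<^sub>V t) = pr us \<otimes> mV t" if us: "set us \<subseteq> VA" and t: "t <: (T V)" for us t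
  by (rule T_lin_eq[OF VM lin_o[OF mV_lin lin_lmult[OF TV_ualg lin_id]] lin_lmult[OF A_ualg mV_lin] AM _ t])
   (use us VA_set in \<open>auto simp: mV_tens pr_append pr_closed simp flip: tens_append[OF VM] intro!: tens_closed[OF VM]\<close>)
 show ?thesis
  by (rule T_lin_eq[OF VM lin_o[OF mV_lin lin_rmult[OF TV_ualg lin_id t]] lin_rmult[OF A_ualg mV_lin mV_closed[OF t]] AM _ s])
   (simp add: 1 t mV_tens)
qed

lemma mV_one: "mV \<one>\<^sub>(T V) = \<one>" using mV_tens[of "[]"] by (simp add: tens_Nil[OF VM])

lemma mV_io: "t \<in> tp V 2 ==> mV t = mu (io t)"
 by (rule lift2_eq[OF VM mV_lin lin_o[OF mu_lin io_lin] AM]) (simp_all add: mV_tens io_tens mu_tens VA_A A_ua)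

text \<open>The kernel of \<open>mV\<close> is an ideal, and it contains the generators of
  \<open>J\<close> because the product is invariant under the braiding.\<close>

lemma mV_J: assumes t: "t \<in> J" shows "mV t = \<zero>"
proof -
 let ?N = "{t \<in> carrier (T V). mV t \<in> {\<zero>}}"
 have "ideal ?N (T V)"
  by (rule submodule_ideal[OF TV_ualg sub_vimage[OF mV_lin TVM AM sub_0[OF AM]]])
   (auto simp: mV_mult TV_ua mV_closed A_ua)
 moreover have "(%t. t \<ominus>\<^sub>(T V) cV t) ` tp V 2 \<subseteq> ?N"
 proof
  fix s assume "s \<in> (%t. t \<ominus>\<^sub>(T V) cV t) ` tp V 2"
  then obtain t where t: "s = t \<ominus>\<^sub>(T V) cV t" "t \<in> tp V 2" by blast
  have tc: "t <: (T V)" and "cV t <: (T V)" using t(2) cV_tp tp_T[OF VM] by auto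
  moreover have "mV (cV t) = mV t" using t(2) cV_tp io_tp by (simp add: mV_io io_cV GrC)
  ultimately have "t \<ominus>\<^sub>(T V) cV t <: (T V)" "mV (t \<ominus>\<^sub>(T V) cV t) = mV t \<ominus> mV t"
   using mod_closed(4)[OF TVM] lin_minus[OF mV_lin TVM AM, of t "cV t"] by auto
  then show "s \<in> ?N" using mV_closed[OF tc] unfolding t(1) by (simp add: mod_minus)
 qed
 ultimately show ?thesis
  using ring.genideal_minimal[OF ua_ring[OF TV_ualg]] t unfolding sym_ideal_def by blast
qed

subsection \<open>The coordinate maps\<close>

definition pv where "pv x = pj (tv [pe x])"

lemma pe_VA: "x <: A ==> pe x \<in> VA" by (simp add: VA_def)

lemma pv_lin: "pv \<in> lin A S"
 unfolding pv_def by (rule lin_o[OF pj_lin[unfolded sym_proj_def[symmetric]] lin_o[OF tens1_lin[OF VM] pe_V]])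

lemmas pv_closed = lin_cl[OF pv_lin]

lemma pv_pe: "x <: A ==> pv (pe x) = pv x" by (simp add: pv_def pe_idem)

abbreviation B2 where "B2 f == lift2 A S (%x y. pv x \<otimes>\<^sub>S f y)"

lemma B2: assumes f: "f \<in> lin A S"
 shows B2_lin: "B2 f \<in> lin (T A) S" and B2_tens: "x <: A ==> y <: A ==> B2 f (te [x, y]) = pv x \<otimes>\<^sub>S f y"
proof -
 have "(%x. pv x \<otimes>\<^sub>S f y) \<in> lin A S" "(%x. pv y \<otimes>\<^sub>S f x) \<in> lin A S" if "y <: A" for y
  using that lin_rmult[OF S_ualg pv_lin lin_cl[OF f]] lin_lmult[OF S_ualg f pv_closed] by auto
 from lift2_lin[OF AM SM this] lift2_tens[OF AM SM this]
 show "B2 f \<in> lin (T A) S" "x <: A ==> y <: A ==> B2 f (te [x, y]) = pv x \<otimes>\<^sub>S f y" by auto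
qed

text \<open>\<open>ps n\<close> takes a product of \<open>n\<close> elements of \<open>V\<close> to \<open>n!\<close> times their product in \<open>S\<close> and kills
 longer products; this makes the multiplication map \<open>S \<rightarrow> A\<close> injective.\<close>

primrec ps where
 "ps 0 = (%a. \<epsilon> a \<odot>\<^sub>S \<one>\<^sub>S)"
| "ps (Suc n) = (%a. B2 (ps n) (\<Delta> a))"

lemma ps_lin: "ps n \<in> lin A S"
proof (induct n)
 case 0
 show ?case using S_ua(4) by (auto intro!: linI simp: eps_add eps_smult mod_adds mod_smul)
next
 case (Suc n) then show ?case using lin_o[OF B2_lin[OF Suc] Delta_lin] by simp
qed

lemmas ps_closed = lin_cl[OF ps_lin] and Bn_lin = B2_lin[OF ps_lin] and Bn_tens = B2_tens[OF ps_lin]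

abbreviation el where "el == tm2 A A pe (%x. x)"

lemmas el_lin = tmA_lin[OF pe_lin L0] and el_tens = tmA_tens[OF pe_lin L0]

text \<open>A derivation with values in \<open>V \<otimes> A\<close> (\<open>Dv_mult\<close>); for
  an ordinary polynomial algebra it is the total differential.\<close>

definition Dv where "Dv a = el (\<Delta> a)"

lemma Dv_lin: "Dv \<in> lin A (T A)" unfolding Dv_def by (rule lin_o[OF el_lin Delta_lin])

lemma tprod2: "X <<: A ==> Y <<: A ==> sub (tprod K A X Y) (T A)" by (rule A_tprod_sub)

lemma VA_c: "VA <<: A" and U_c: "U n <<: A" and P_c: "P n <<: A"
 using VA_A U_simps(1) P_simps(1) by auto

lemma Dv_tprod: "a <: A ==> Dv a \<in> tprod K A VA (carrier A)"
 unfolding Dv_def using Delta_tp A_tprod_full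
 by (intro tmA_tprod[OF pe_lin L0 subset_refl subset_refl VA_c subset_refl]) (auto simp: pe_VA)

lemma ps_D: "a <: A ==> ps (Suc n) a = B2 (ps n) (Dv a)"
proof -
 assume a: "a <: A"
 have "B2 (ps n) (el t) = B2 (ps n) t" if "t \<in> tp A 2" for t
  by (rule A_lift2_eq[OF lin_o[OF Bn_lin el_lin] Bn_lin SM _ that]) (simp add: el_tens Bn_tens pe_closed pv_pe)
 then show ?thesis using a Delta_tp by (simp add: Dv_def)
qed

lemma N1_3: "x <: A ==> y <: A ==> z <: A ==> N 1 (te [x, y] \<star> te [z]) = te [x, y \<otimes> z]"
 using N1_ap'[of x "te [y, z]"] te2[of x "y \<otimes> z"] by (simp add: te3 nabla_tens' A_ua)

text \<open>By \<open>pe_mult\<close>, \<open>pe\<close> acts as a derivation on the first factor of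
  the product. In one summand it hits the first factor of \<open>s\<close>, in the other the first
  factor of \<open>t\<close>, which has been braided past the second factor of \<open>s\<close>;
  there it slides back through the crossing by \<open>cm_pe\<close>.\<close>

lemma el_NC:
 assumes s: "s \<in> tp A 2" and t: "t \<in> tp A 2"
 shows "el (NC s t) = N 1 (el s \<star> te [e0 t]) \<oplus>\<^sub>(T A) N 1 (C 0 (te [e0 s] \<star> el t))"
proof -
 note TL = TA_ualg
 note l1 = A_tens1_lin
 have sc: "s <: (T A)" and tc: "t <: (T A)" using s t tp_T' by auto
 have e0c: "e0 t <: A" if "t <: (T A)" for t using that by (rule lin_cl[OF e0_lin])
 have elc: "el t <: (T A)" if "t <: (T A)" for t using that by (rule lin_cl[OF el_lin])
 \<comment> \<open>\<open>w\<close> stands for the two inner factors after the crossing, which are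
   in general not a pure tensor.\<close>
 have mid: "el (N 0 (N 2 (te [a] \<star> (w \<star> te [q])))) = te [pe a, e0 w \<otimes> q] \<oplus>\<^sub>(T A) \<epsilon> a \<odot>\<^sub>(T A) N 1 (el w \<star> te [q])"
  if aq: "a <: A" "q <: A" and w: "w \<in> tp A 2" for a q w
 proof (rule A_lift2_eq[OF _ _ TAM _ w])
  show "(%w. el (N 0 (N 2 (te [a] \<star> (w \<star> te [q]))))) \<in> lin (T A) (T A)"
   using aq by (intro lin_o[OF el_lin] lin_o[OF N_lin] lin_lmult[OF TL] lin_rmult[OF TL] lin_id) auto
  show "(%w. te [pe a, e0 w \<otimes> q] \<oplus>\<^sub>(T A) \<epsilon> a \<odot>\<^sub>(T A) N 1 (el w \<star> te [q])) \<in> lin (T A) (T A)"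
   using aq by (intro lin_plus[OF TAM] lin_sm[OF TAM] lin_o[OF A_tens2_lin(2)] lin_rmult[OF A_ualg e0_lin] lin_o[OF N_lin] lin_rmult[OF TL] el_lin pe_closed) auto
  fix u v assume uv: "u <: A" "v <: A"
  have n: "N 1 (te [pe u, v] \<star> te [q]) = te [pe u, v \<otimes> q]"
   using aq uv pe_closed by (simp add: N1_3)
  show "el (N 0 (N 2 (te [a] \<star> (te [u, v] \<star> te [q])))) = te [pe a, e0 (te [u, v]) \<otimes> q] \<oplus>\<^sub>(T A) \<epsilon> a \<odot>\<^sub>(T A) N 1 (el (te [u, v]) \<star> te [q])"
   using aq uv pe_closed by (simp add: NN_ap el_tens pe_mult e0_tens A_ua n A_tens2_simps)
 qed
 have 1: "el (NC (te [a, b]) t) = N 1 (el (te [a, b]) \<star> te [e0 t]) \<oplus>\<^sub>(T A) N 1 (C 0 (te [e0 (te [a, b])] \<star> el t))"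
  if ab: "a <: A" "b <: A" for a b
 proof (rule A_lift2_eq[OF _ _ TAM _ t])
  show "(%t. el (NC (te [a, b]) t)) \<in> lin (T A) (T A)" using ab by (intro lin_o[OF el_lin] NC_lin) auto
  show "(%t. N 1 (el (te [a, b]) \<star> te [e0 t]) \<oplus>\<^sub>(T A) N 1 (C 0 (te [e0 (te [a, b])] \<star> el t))) \<in> lin (T A) (T A)"
   using ab by (intro lin_plus[OF TAM] lin_o[OF N_lin] lin_o[OF C_lin] lin_lmult[OF TL] lin_o[OF l1 e0_lin] el_lin elc) (auto simp: e0c)
  fix p q assume pq: "p <: A" "q <: A"
  have e: "e0 (c (te [b, p])) = \<epsilon> p \<odot> b" using ab pq by (simp add: c_eps e1_tens)
  have cc: "el (c (te [b, p])) = c (te [b, pe p])" using cmD[OF cm_pe t2_tp[OF ab(2) pq(1)]] ab pq by (simp add: tmA_tens[OF L0 pe_lin])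
  have n: "N 1 (te [pe a, b] \<star> te [\<epsilon> p \<odot> q]) = te [pe a, \<epsilon> p \<odot> (b \<otimes> q)]"
   using ab pq pe_closed by (simp add: N1_3 A_ua)
  have m: "C 0 (te [\<epsilon> a \<odot> b] \<star> te [pe p, q]) = \<epsilon> a \<odot>\<^sub>(T A) (c (te [b, pe p]) \<star> te [q])"
   using ab pq pe_closed by (simp add: C0_3 A_tens2_simps c_simps TA_ua)
  have cT: "c (te [b, pe p]) \<star> te [q] <: (T A)" using ab pq pe_closed tp_T'[OF c_closed] by (simp add: TA_ua)
  show "el (NC (te [a, b]) (te [p, q])) = N 1 (el (te [a, b]) \<star> te [e0 (te [p, q])]) \<oplus>\<^sub>(T A) N 1 (C 0 (te [e0 (te [a, b])] \<star> el (te [p, q])))"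
   using ab pq mid[OF ab(1) pq(2) c_closed[OF ab(2) pq(1)]] pe_closed lin_smult[OF N_lin _ cT]
   by (simp add: NC_def C1_mid e cc n m e0_tens el_tens A_ua)
 qed
 show ?thesis
 proof (rule A_lift2_eq[OF _ _ TAM _ s])
  show "(%s. el (NC s t)) \<in> lin (T A) (T A)" by (intro lin_o[OF el_lin] NC_lin tc)
  show "(%s. N 1 (el s \<star> te [e0 t]) \<oplus>\<^sub>(T A) N 1 (C 0 (te [e0 s] \<star> el t))) \<in> lin (T A) (T A)"
   by (intro lin_plus[OF TAM] lin_o[OF N_lin] lin_o[OF C_lin] lin_rmult[OF TL] lin_o[OF l1 e0_lin] el_lin elc tc) (auto simp: e0c tc)
 qed (rule 1)
qed

lemma Dv_mult: "x <: A ==> y <: A ==> Dv (x \<otimes> y) = N 1 (Dv x \<star> te [y]) \<oplus>\<^sub>(T A) N 1 (C 0 (te [x] \<star> Dv y))"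
 using el_NC[OF Delta_tp Delta_tp, of x y] by (simp add: Dv_def Delta_NC counit)

lemma N1_tprod:
 assumes X: "X <<: A" and Y: "Y <<: A" and Z: "Z <<: A" and z: "z <: A" and r: "r \<in> tprod K A X Y"
  and YZ: "!!y. y \<in> Y ==> y \<otimes> z \<in> Z"
 shows "N 1 (r \<star> te [z]) \<in> tprod K A X Z"
proof (rule A_tprod_image[OF X Y lin_o[OF N_lin lin_rmult[OF TA_ualg lin_id]] TAM tprod2[OF X Z] _ r])
 show "te [z] <: (T A)" using z by simp
 fix x y assume "x \<in> X" "y \<in> Y"
 then show "N 1 (te [x, y] \<star> te [z]) \<in> tprod K A X Z"
  using X Y z YZ A_tprod_base[OF X Z] by (subst N1_3) auto
qed

lemma c_VA:
 assumes q: "q \<in> VA" and v: "v \<in> VA" shows "c (te [q, v]) \<in> tprod K A VA VA"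
proof -
 have "tm2 A A pe pe (c (te [q, v])) = c (te [q, v])"
  using pe2_c[OF t2_tp[OF VA_A[OF q] VA_A[OF v]]] q v by (simp add: tmA_tens[OF pe_lin pe_lin] VA_A VA_pe)
 moreover have "tm2 A A pe pe (c (te [q, v])) \<in> tprod K A VA VA"
  using c_closed[OF VA_A[OF q] VA_A[OF v]] A_tprod_full
  by (intro tmA_tprod[OF pe_lin pe_lin subset_refl subset_refl VA_c VA_c]) (auto simp: pe_VA)
 ultimately show ?thesis by simp
qed

lemma c_UVA:
 assumes x: "x \<in> U 1" and v: "v \<in> VA" shows "c (te [x, v]) \<in> tprod K A VA (U 1)"
proof -
 note xv = U_simps(2)[OF x] VA_A[OF v]
 note ct = c_closed[OF xv]
 have e: "el (c (te [x, v])) = c (te [x, v])"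
  using cmD[OF cm_pe t2_tp[OF xv]] xv v by (simp add: tmA_tens[OF L0 pe_lin] VA_pe)
 have jj: "tm2 A A (%x. x) j (c (te [x, v])) = c (te [x, v])"
  using cmD2[OF cm_j t2_tp[OF xv]] xv x by (simp add: tmA_tens[OF j_lin L0] j_id)
 have "tm2 A A pe j (c (te [x, v])) = c (te [x, v])"
  using tmA_comp[OF AM L0 j_lin pe_lin L0 ct] by (simp add: e jj)
 moreover have "tm2 A A pe j (c (te [x, v])) \<in> tprod K A VA (U 1)"
  using ct A_tprod_full
  by (intro tmA_tprod[OF pe_lin j_lin subset_refl subset_refl VA_c U_c]) (auto simp: pe_VA j_U)
 ultimately show ?thesis by simp
qed

text \<open>By the Leibniz rule, differentiating a product lowers the power of the ideal by at most
  one. In the second term the braiding interchanges the ideal with \<open>V\<close>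
  (\<open>c_UVA\<close>).\<close>

lemma Dv_P: "y \<in> P (Suc m) ==> Dv y \<in> tprod K A VA (P m)"
proof (induct m arbitrary: y)
 case 0
 then show ?case using Dv_tprod[OF P_simps(2)[OF 0]] by simp
next
 case (Suc m)
 show ?case
 proof (rule P_image[OF Dv_lin TAM tprod2[OF VA_c P_c] _ Suc(2)])
  fix x y assume xy: "x \<in> U 1" "y \<in> P (Suc m)"
  note xA = U_simps(2)[OF xy(1)] and yA = P_simps(2)[OF xy(2)]
  have 1: "N 1 (Dv x \<star> te [y]) \<in> tprod K A VA (P (Suc m))"
   by (rule N1_tprod[OF VA_c subset_refl P_c yA Dv_tprod[OF xA]]) (rule P_left[OF _ xy(2)])
  have 2: "N 1 (C 0 (te [x] \<star> Dv y)) \<in> tprod K A VA (P (Suc m))"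
  proof (rule A_tprod_image[OF VA_c P_c _ TAM tprod2[OF VA_c P_c] _ Suc(1)[OF xy(2)]])
   show "(%t. N 1 (C 0 (te [x] \<star> t))) \<in> lin (T A) (T A)"
    using xA by (intro lin_o[OF N_lin] lin_o[OF C_lin] lin_lmult[OF TA_ualg lin_id]) auto
   fix v w assume vw: "v \<in> VA" "w \<in> P m"
   have "N 1 (c (te [x, v]) \<star> te [w]) \<in> tprod K A VA (P (Suc m))"
    by (rule N1_tprod[OF VA_c U_c P_c P_simps(2)[OF vw(2)] c_UVA[OF xy(1) vw(1)]]) (rule P_base[OF _ vw(2)])
   then show "N 1 (C 0 (te [x] \<star> te [v, w])) \<in> tprod K A VA (P (Suc m))"
    using xA VA_A[OF vw(1)] P_simps(2)[OF vw(2)] by (simp add: C0_3)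
  qed
  show "Dv (x \<otimes> y) \<in> tprod K A VA (P (Suc m))"
   unfolding Dv_mult[OF xA yA] by (rule sub_add[OF TAM tprod2[OF VA_c P_c] 1 2])
 qed
qed

lemma B2_zero:
 assumes "f \<in> lin A S" "t \<in> tprod K A VA Y" "Y <<: A" "!!y. y \<in> Y ==> f y = \<zero>\<^sub>S" shows "B2 f t = \<zero>\<^sub>S"
proof -
 have "B2 f t \<in> {\<zero>\<^sub>S}"
  by (rule A_tprod_image[OF VA_c assms(3) B2_lin[OF assms(1)] SM sub_0[OF SM] _ assms(2)])
   (use assms VA_A pv_closed in \<open>auto simp: B2_tens[OF assms(1)] S_ua\<close>)
 then show ?thesis by simp
qed

lemma ps_kill: "x \<in> P (Suc n) ==> ps n x = \<zero>\<^sub>S"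
proof (induct n arbitrary: x)
 case 0 then show ?case using eps_U[of x] P_1[of x] S_ua(4) by simp
next
 case (Suc n)
 show ?case unfolding ps_D[OF P_simps(2)[OF Suc(2)]]
  by (rule B2_zero[OF ps_lin Dv_P[OF Suc(2)] P_c Suc(1)])
qed

text \<open>By the counit, the part of \<Delta> q with a scalar in the second factor gives
  \<open>pe q = q\<close>; the rest is \<open>(pe \<otimes> j) (\<Delta> q)\<close>.\<close>

lemma Dv_VA: assumes q: "q \<in> VA"
 shows "\<exists>r\<in>tprod K A VA (U 1). Dv q = te [q, \<one>] \<oplus>\<^sub>(T A) r"
proof (rule bexI)
 let ?r = "tm2 A A pe j (\<Delta> q)"
 note qA = VA_A[OF q]
 have "tm2 A A pe j t = el t \<ominus>\<^sub>(T A) te [pe (e1 t), \<one>]" if "t \<in> tp A 2" for t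
 proof (rule A_lift2_eq[OF tmA_lin[OF pe_lin j_lin] lin_sub[OF TAM el_lin lin_o[OF A_tens2_lin(1)[OF one_A] lin_o[OF pe_lin e1_lin]]] TAM _ that])
  fix x y assume xy: "x <: A" "y <: A"
  have "te [pe x, j y] = te [pe x, y] \<ominus>\<^sub>(T A) te [pe x, \<epsilon> y \<odot> \<one>]"
   using lin_minus[OF A_tens2_lin(2)[OF pe_closed[OF xy(1)]] AM TAM] xy one_A by (simp add: j_def)
  then show "tm2 A A pe j (te [x, y]) = el (te [x, y]) \<ominus>\<^sub>(T A) te [pe (e1 (te [x, y])), \<one>]"
   using xy one_A pe_closed by (simp add: tmA_tens[OF pe_lin j_lin] el_tens e1_tens lin_smult[OF pe_lin] A_tens2_simps)
 qed
 from this[OF Delta_tp[OF qA]] have "?r = Dv q \<ominus>\<^sub>(T A) te [q, \<one>]" using qA q by (simp add: Dv_def counit VA_pe)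
 then show "Dv q = te [q, \<one>] \<oplus>\<^sub>(T A) ?r"
  using qA one_A lin_cl[OF Dv_lin qA] TAM by (simp add: mod_minus mod_ac)
 show "?r \<in> tprod K A VA (U 1)"
  using Delta_tp[OF qA] A_tprod_full
  by (intro tmA_tprod[OF pe_lin j_lin subset_refl subset_refl VA_c U_c]) (auto simp: pe_VA j_U)
qed

definition PJ where "PJ = B2 pv"

text \<open>Here the defining relation of the symmetric algebra enters: braiding two elements of
  \<open>V\<close> does not change their product in \<open>S\<close>.\<close>

lemma PJ_c: assumes q: "q \<in> VA" and v: "v \<in> VA" shows "PJ (c (te [q, v])) = pv q \<otimes>\<^sub>S pv v"
proof -
 have pp: "pj (tv [x, y]) = pj (tv [x]) \<otimes>\<^sub>S pj (tv [y])" if "x \<in> VA" "y \<in> VA" for x y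
  using that tens_append[OF VM, of "[x]" "[y]"] by (simp add: pj_mult)
 have "PJ t = pj (tm2 A V pe pe t)" if "t \<in> tp A 2" for t
  unfolding PJ_def
  by (rule A_lift2_eq[OF B2_lin[OF pv_lin] lin_o[OF pj_lin tm2_lin[OF AM VM pe_V pe_V]] SM _ that])
   (simp add: B2_tens[OF pv_lin] tm2_tens[OF AM VM pe_V pe_V], simp add: pv_def pp pe_VA)
 then have "PJ (c (te [q, v])) = pj (tm2 A V pe pe (c (te [q, v])))" using c_closed VA_A q v by simp
 also have "tm2 A V pe pe (c (te [q, v])) = cV (tv [q, v])"
  using q v by (simp add: cV_def tm2_tens[OF VM AM id_V id_V])
 also have "pj (cV (tv [q, v])) = pj (tv [q, v])" using q v by (intro pj_c tens_tp[OF VM]) auto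
 finally show ?thesis using q v by (simp add: pp pv_def VA_pe)
qed

text \<open>The Leibniz rule for the product of \<open>q\<close> and \<open>z\<close>:
  differentiating \<open>q\<close> gives the result once, up to terms that \<open>ps m\<close> kills
  because they lie in the next power of the ideal; differentiating \<open>z\<close> gives it
  \<open>m\<close> times by the hypothesis.\<close>

lemma ps_step:
 assumes q: "q \<in> VA" and z: "z \<in> P m" and h: "B2 (ps m) (N 1 (C 0 (te [q] \<star> Dv z))) = nk m \<odot>\<^sub>S (pv q \<otimes>\<^sub>S ps m z)"
 shows "ps (Suc m) (q \<otimes> z) = nk (Suc m) \<odot>\<^sub>S (pv q \<otimes>\<^sub>S ps m z)"
proof -
 note qA = VA_A[OF q] and zA = P_simps(2)[OF z]
 obtain r where r: "r \<in> tprod K A VA (U 1)" "Dv q = te [q, \<one>] \<oplus>\<^sub>(T A) r" using Dv_VA[OF q] by blast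
 have rT: "r <: (T A)" by (rule sub_mem[OF TAM tprod2[OF VA_c U_c] r(1)])
 have r0: "N 1 (r \<star> te [z]) \<in> tprod K A VA (P (Suc m))"
  by (rule N1_tprod[OF VA_c U_c P_c zA r(1)]) (rule P_base[OF _ z])
 have "N 1 (Dv q \<star> te [z]) = te [q, z] \<oplus>\<^sub>(T A) N 1 (r \<star> te [z])"
  using qA zA one_A rT lin_add[OF N_lin] by (simp add: r(2) TA_ua N1_3 A_ua)
 then have 1: "B2 (ps m) (N 1 (Dv q \<star> te [z])) = pv q \<otimes>\<^sub>S ps m z"
  using qA zA rT B2_zero[OF ps_lin r0 P_c ps_kill] pv_closed ps_closed lin_cl[OF N_lin]
  by (simp add: lin_add[OF Bn_lin] Bn_tens S_ua TA_ua)
 have c: "N 1 (Dv q \<star> te [z]) <: (T A)" "N 1 (C 0 (te [q] \<star> Dv z)) <: (T A)"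
  using qA zA lin_cl[OF Dv_lin] by (auto intro!: lin_cl[OF N_lin] lin_cl[OF C_lin] simp: TA_ua)
 have "nk (Suc m) = \<one>\<^sub>K \<oplus>\<^sub>K nk m" using nk_simps(3)[of 1 m] unfolding nk_simps(2) plus_1_eq_Suc .
 then show ?thesis
  using qA zA c pv_closed ps_closed by (simp add: ps_D A_ua Dv_mult lin_add[OF Bn_lin] 1 h mod_adds S_ua del: ps.simps)
qed

text \<open>Differentiating \<open>z\<close> splits off an element \<open>v\<close> of
  \<open>V\<close>, which the braiding moves across \<open>q\<close>. The induction hypothesis turns
  the braided pair into a product in \<open>S\<close>, where \<open>PJ_c\<close> undoes the
  crossing; together with the term from \<open>ps_step\<close> the count goes up by one.\<close>

lemma ps_star: "q \<in> VA ==> z \<in> P m ==> ps (Suc m) (q \<otimes> z) = nk (Suc m) \<odot>\<^sub>S (pv q \<otimes>\<^sub>S ps m z)"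
proof (induct m arbitrary: q z)
 case (0 q z)
 note qA = VA_A[OF 0(1)] and zA = P_simps(2)[OF 0(2)]
 \<comment> \<open>After the crossing the second factor contains an element of \<open>V\<close>, so
   it lies in the ideal, and \<open>ps 0\<close>, the counit, kills it.\<close>
 have "N 1 (C 0 (te [q] \<star> Dv z)) \<in> tprod K A VA (U 1)"
 proof (rule A_tprod_image[OF VA_c subset_refl _ TAM tprod2[OF VA_c U_c] _ Dv_tprod[OF zA]])
  show "(%t. N 1 (C 0 (te [q] \<star> t))) \<in> lin (T A) (T A)"
   using qA by (intro lin_o[OF N_lin] lin_o[OF C_lin] lin_lmult[OF TA_ualg lin_id]) auto
  fix v w assume vw: "v \<in> VA" "w <: A"
  have "N 1 (c (te [q, v]) \<star> te [w]) \<in> tprod K A VA (U 1)"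
   by (rule N1_tprod[OF VA_c VA_c U_c vw(2) c_VA[OF 0(1) vw(1)]]) (use U_mult[of _ 1 w 0] VA_U vw in \<open>simp add: U_0\<close>)
  then show "N 1 (C 0 (te [q] \<star> te [v, w])) \<in> tprod K A VA (U 1)"
   using qA VA_A[OF vw(1)] vw(2) by (simp add: C0_3)
 qed
 from B2_zero[OF ps_lin this U_c, of 0] have "B2 (ps 0) (N 1 (C 0 (te [q] \<star> Dv z))) = \<zero>\<^sub>S"
  using S_ua(4) by (simp add: eps_U)
 then show ?case using 0 qA zA pv_closed ps_closed by (intro ps_step) (simp_all add: nk_simps S_ua del: ps.simps)
next
 case (Suc k q z)
 note qA = VA_A[OF Suc(2)] and zA = P_simps(2)[OF Suc(3)]
 note lm = lin_lmult[OF TA_ualg lin_id] and rm = lin_rmult[OF TA_ualg lin_id]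
 have "B2 (ps (Suc k)) (N 1 (C 0 (te [q] \<star> s))) = nk (Suc k) \<odot>\<^sub>S (pv q \<otimes>\<^sub>S B2 (ps k) s)" if s: "s \<in> tprod K A VA (P k)" for s
 proof (rule A_tprod_eq[OF VA_c P_c _ _ SM _ s])
  show "(%s. B2 (ps (Suc k)) (N 1 (C 0 (te [q] \<star> s)))) \<in> lin (T A) S"
   using qA by (intro lin_o[OF Bn_lin] lin_o[OF N_lin] lin_o[OF C_lin] lm) auto
  show "(%s. nk (Suc k) \<odot>\<^sub>S (pv q \<otimes>\<^sub>S B2 (ps k) s)) \<in> lin (T A) S"
   using qA by (intro lin_sm[OF SM] lin_lmult[OF S_ualg Bn_lin] pv_closed) simp_all
  fix v w assume vw: "v \<in> VA" "w \<in> P k"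
  note vA = VA_A[OF vw(1)] and wA = P_simps(2)[OF vw(2)]
  have "B2 (ps (Suc k)) (N 1 (u \<star> te [w])) = nk (Suc k) \<odot>\<^sub>S (PJ u \<otimes>\<^sub>S ps k w)" if u: "u \<in> tprod K A VA VA" for u
  proof (rule A_tprod_eq[OF VA_c VA_c _ _ SM _ u])
   show "(%u. B2 (ps (Suc k)) (N 1 (u \<star> te [w]))) \<in> lin (T A) S"
    using wA by (intro lin_o[OF Bn_lin] lin_o[OF N_lin] rm) auto
   show "(%u. nk (Suc k) \<odot>\<^sub>S (PJ u \<otimes>\<^sub>S ps k w)) \<in> lin (T A) S"
    unfolding PJ_def using wA by (intro lin_sm[OF SM] lin_rmult[OF S_ualg B2_lin[OF pv_lin]] ps_closed) simp_all
   fix a b assume ab: "a \<in> VA" "b \<in> VA"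
   then show "B2 (ps (Suc k)) (N 1 (te [a, b] \<star> te [w])) = nk (Suc k) \<odot>\<^sub>S (PJ (te [a, b]) \<otimes>\<^sub>S ps k w)"
    using VA_A wA vw(2) Suc(1)[OF ab(2) vw(2)] pv_closed ps_closed
    by (simp add: N1_3 Bn_tens A_ua PJ_def B2_tens[OF pv_lin] S_ua del: ps.simps)
  qed
  from this[OF c_VA[OF Suc(2) vw(1)]]
  show "B2 (ps (Suc k)) (N 1 (C 0 (te [q] \<star> te [v, w]))) = nk (Suc k) \<odot>\<^sub>S (pv q \<otimes>\<^sub>S B2 (ps k) (te [v, w]))"
   using qA vA wA vw(1) Suc(2) pv_closed ps_closed by (simp add: C0_3 PJ_c Bn_tens S_ua del: ps.simps)
 qed
 from this[OF Dv_P[OF Suc(3)]] show ?case using Suc(2,3) zA by (intro ps_step) (simp_all add: ps_D del: ps.simps)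
qed

lemma pr_P: "set vs \<subseteq> VA ==> pr vs \<in> P (length vs)"
proof (induct vs)
 case (Cons v vs)
 then have "v \<otimes> pr vs \<in> P (Suc (length vs))" by (intro P_base) (auto simp: VA_U)
 then show ?case unfolding length_Cons pr.simps .
qed (simp add: one_A)

lemma ps_pr: "set vs \<subseteq> VA ==> ps (length vs) (pr vs) = nk (fact (length vs)) \<odot>\<^sub>S pj (tv vs)"
proof (induct vs)
 case Nil
 then show ?case using S_ua(4) by (simp add: eps_one nk_simps S_one tens_Nil[OF VM])
next
 case (Cons v vs)
 then have c: "pv v <: S" "pj (tv vs) <: S" and v: "v \<in> VA"
  using VA_A pv_closed pj_closed by auto
 have "ps (Suc (length vs)) (v \<otimes> pr vs) = nk (Suc (length vs)) \<odot>\<^sub>S (pv v \<otimes>\<^sub>S ps (length vs) (pr vs))"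
  using Cons pr_P by (intro ps_star) auto
 also have "\<dots> = nk (fact (Suc (length vs))) \<odot>\<^sub>S (pv v \<otimes>\<^sub>S pj (tv vs))"
  using Cons c by (simp add: S_ua mod_smul del: fact_Suc flip: nk_simps(4)) (simp add: fact_Suc)
 also have "pv v \<otimes>\<^sub>S pj (tv vs) = pj (tv (v # vs))"
  using Cons v tens_append[OF VM, of "[v]" vs] by (simp add: pv_def VA_pe pj_mult)
 finally show ?case unfolding length_Cons pr.simps .
qed

lemma ps_mV: assumes t: "t \<in> tp V n" shows "ps n (mV t) = nk (fact n) \<odot>\<^sub>S pj t" "mV t \<in> P n"
proof -
 show "ps n (mV t) = nk (fact n) \<odot>\<^sub>S pj t"
  by (rule tp_lin_eq[OF VM lin_tp[OF VM lin_o[OF ps_lin mV_lin]] lin_tp[OF VM lin_sm[OF SM pj_lin]] SM _ t])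
   (use ps_pr in \<open>auto simp: mV_tens\<close>)
 from VM t show "mV t \<in> P n"
  by (induct rule: tp_ind) (use pr_P P_simps lin_simps[OF mV_lin] lin_zero[OF mV_lin TVM AM] tp_T[OF VM] in \<open>auto simp: mV_tens\<close>)
qed

definition Wk where "Wk k n = span (T V) {tv vs |vs. set vs \<subseteq> VA \<and> k \<le> length vs \<and> length vs < n}"

lemma Wk_gens: "{tv vs |vs. set vs \<subseteq> VA \<and> k \<le> length vs \<and> length vs < n} <<: (T V)"
 by auto

lemma Wk_sub: "sub (Wk k n) (T V)" unfolding Wk_def by (rule span_sub[OF TVM Wk_gens])

lemma Wk_split: assumes t: "t \<in> Wk k n" shows "\<exists>a\<in>tp V k. \<exists>b\<in>Wk (Suc k) n. t = a \<oplus>\<^sub>(T V) b"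
proof -
 have "{tv vs |vs. set vs \<subseteq> VA \<and> k \<le> length vs \<and> length vs < n} \<subseteq> tp V k <+>\<^sub>(T V) Wk (Suc k) n"
 proof
  fix s assume "s \<in> {tv vs |vs. set vs \<subseteq> VA \<and> k \<le> length vs \<and> length vs < n}"
  then obtain vs where s: "s = tv vs" "set vs \<subseteq> VA" "k \<le> length vs" "length vs < n" by blast
  show "s \<in> tp V k <+>\<^sub>(T V) Wk (Suc k) n"
  proof (cases "length vs = k")
   case True
   then show ?thesis using s by (intro sub_setadd(2)[OF TVM tp_sub[OF VM] Wk_sub]) (auto intro!: tens_tp[OF VM])
  next
   case False
   then have "s \<in> Wk (Suc k) n" unfolding Wk_def using s by (intro span_base) auto
   then show ?thesis by (rule sub_setadd(3)[OF TVM tp_sub[OF VM] Wk_sub])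
  qed
 qed
 from span_minimal[OF sub_setadd(1)[OF TVM tp_sub[OF VM] Wk_sub] this] t
 have "t \<in> tp V k <+>\<^sub>(T V) Wk (Suc k) n" unfolding Wk_def by blast
 then show ?thesis using sub_setadd(4)[OF TVM tp_sub[OF VM] Wk_sub] by blast
qed

lemma Wk_P: assumes t: "t \<in> Wk k n" shows "mV t \<in> P k"
proof (rule lin_span_image[OF mV_lin TVM AM Wk_gens P_sub _ t[unfolded Wk_def]])
 fix s assume "s \<in> {tv vs |vs. set vs \<subseteq> VA \<and> k \<le> length vs \<and> length vs < n}"
 then obtain vs where s: "s = tv vs" "set vs \<subseteq> VA" "k \<le> length vs" by blast
 have "P (k + i) \<subseteq> P k" for i by (induct i) (auto dest: P_Suc)
 from this[of "length vs - k"] show "mV s \<in> P k" using s pr_P[OF s(2)] by (auto simp: mV_tens)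
qed

text \<open>The component of shortest length \<open>k\<close> is removed first: \<open>ps k\<close>
  kills the products of more than \<open>k\<close> generators and multiplies the class of this
  component by \<open>k!\<close>, which is invertible. The induction runs over the range of lengths
  that are left.\<close>

lemma mV_inj_Wk: "t \<in> Wk k n ==> mV t = \<zero> ==> pj t = \<zero>\<^sub>S"
proof (induct "n - k" arbitrary: k t)
 case 0
 then have "{tv vs |vs. set vs \<subseteq> VA \<and> k \<le> length vs \<and> length vs < n} = {}" by auto
 with 0(2) have "t \<in> span (T V) {}" unfolding Wk_def by simp
 then have "t = \<zero>\<^sub>(T V)" using span_minimal[OF sub_0[OF TVM], of "{}"] by blast
 then show ?case using lin_zero[OF pj_lin TVM SM] by simp
next
 case (Suc d)
 obtain a b where ab: "a \<in> tp V k" "b \<in> Wk (Suc k) n" "t = a \<oplus>\<^sub>(T V) b" using Wk_split[OF Suc(3)] by blast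
 note aT = tp_T[OF VM ab(1)] and bT = sub_mem[OF TVM Wk_sub ab(2)]
 have pa: "pj a <: S" "pj b <: S" using aT bT pj_closed by auto
 have m: "mV t = mV a \<oplus> mV b" using ab aT bT lin_add[OF mV_lin] by simp
 have "\<zero>\<^sub>S = ps k (mV t)" using Suc(4) lin_zero[OF ps_lin AM SM] by simp
 also have "\<dots> = nk (fact k) \<odot>\<^sub>S pj a"
  using mV_closed aT bT ps_kill[OF Wk_P[OF ab(2)]] ps_mV[OF ab(1)] pa by (simp add: m lin_add[OF ps_lin] del: ps.simps)
 finally have z: "nk (fact k) \<odot>\<^sub>S pj a = \<zero>\<^sub>S" by simp
 have "nk (fact k) \<noteq> \<zero>\<^sub>K" using nk_inj[OF char0, of "fact k" 0] by (auto simp: nk_simps)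
 then have "nk (fact k) \<in> Units K" using field_Units by simp
 then have "pj a = inv\<^bsub>K\<^esub> nk (fact k) \<odot>\<^sub>S (nk (fact k) \<odot>\<^sub>S pj a)" using pa by (simp add: mod_smul)
 then have a0: "pj a = \<zero>\<^sub>S" using \<open>nk (fact k) \<in> Units K\<close> by (simp add: z)
 then have "a \<in> J" using pj_eq0 aT S_zero by simp
 then have "mV b = \<zero>" using m Suc(4) mV_J mV_closed[OF bT] by simp
 then have "pj b = \<zero>\<^sub>S" using Suc(1)[of "Suc k" b] Suc(2) ab(2) by simp
 then show ?case using a0 ab aT bT by (simp add: lin_add[OF pj_lin])
qed

lemma mV_inj: assumes t: "t <: (T V)" "mV t = \<zero>" shows "pj t = \<zero>\<^sub>S"
proof -
 have "\<exists>n. t \<in> Wk 0 n"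
  using VM t(1)
 proof (induct rule: T_ind)
  case (tens vs)
  then show ?case unfolding Wk_def by (intro exI[of _ "Suc (length vs)"] span_base) auto
 next
  case zero show ?case using sub_zero[OF TVM Wk_sub] by blast
 next
  case (add f g)
  then obtain m n where mn: "f \<in> Wk 0 m" "g \<in> Wk 0 n" by blast
  have "Wk 0 i \<subseteq> Wk 0 (max m n)" if "i \<le> max m n" for i unfolding Wk_def using that by (intro span_mono) auto
  from this[of m] this[of n] have "f \<in> Wk 0 (max m n)" "g \<in> Wk 0 (max m n)" using mn by auto
  then show ?case using sub_add[OF TVM Wk_sub] by blast
 next
  case (smult a f) then show ?case using sub_smult[OF TVM Wk_sub] by blast
 qed
 then show ?thesis using mV_inj_Wk t(2) by blast
qed

text \<open>Induction on the degree: in positive degree a homogeneous \<open>x\<close> differs from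
  \<open>pe x\<close>, an element of \<open>V\<close>, by an element of the square of the ideal, and
  this is a sum of products of elements of smaller degree.\<close>

lemma mV_surj: "a <: A ==> a \<in> mV ` carrier (T V)"
proof -
 let ?X = "mV ` carrier (T V)"
 have X: "sub ?X A" by (rule sub_image[OF mV_lin TVM AM sub_carrier[OF TVM]])
 note Xs = sub_simps[OF AM X]
 have Xm: "x \<otimes> y \<in> ?X" if xy: "x \<in> ?X" "y \<in> ?X" for x y
 proof -
  obtain s t where "s <: (T V)" "t <: (T V)" "x = mV s" "y = mV t" using xy by blast
  then show ?thesis using mV_mult TV_ua(3) by (intro image_eqI[of _ _ "s \<star>\<^sub>V t"]) auto
 qed
 have XV: "v \<in> ?X" if "v \<in> VA" for v
  using that mV_tens[of "[v]"] VA_A by (intro image_eqI[of _ _ "tv [v]"]) (auto simp: A_ua)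
 have XG: "Gr d \<subseteq> ?X" for d
 proof (induct d rule: less_induct)
  case (less d)
  show ?case
  proof
   fix x assume x: "x \<in> Gr d"
   show "x \<in> ?X"
   proof (cases "d = 0")
    case True
    then obtain a where "a <: K" "x = a \<odot> \<one>" using Gr0 x by blast
    moreover have "\<one> \<in> ?X" using mV_one TV_ua(4) by (metis image_eqI)
    ultimately show ?thesis using Xs(5) by simp
   next
    case False
    note xA = Gr_A[OF x]
    \<comment> \<open>Even a homogeneous element of the square of the ideal is given as a sum of
      products of various degrees. Its component in degree \<open>d\<close> involves only products
      of two factors of smaller positive degree.\<close>
    have "\<pi> d w \<in> ?X" if w: "w \<in> P 2" for w
    proof -
     have w1: "w \<in> P (Suc 1)" using w by simp
     show ?thesis
     proof (rule P_image[OF gpD(2) AM X _ w1])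
      fix a b assume a: "a \<in> U 1" and "b \<in> P 1"
      then have b: "b \<in> U 1" by (simp add: P_1)
      show "\<pi> d (a \<otimes> b) \<in> ?X"
      proof (rule U_image[OF lin_o[OF gpD(2) lin_rmult[OF A_ualg lin_id U_simps(2)[OF b]]] AM X _ a])
       fix i a assume a: "1 \<le> i" "a \<in> Gr i"
       show "\<pi> d (a \<otimes> b) \<in> ?X"
       proof (rule U_image[OF lin_o[OF gpD(2) lin_lmult[OF A_ualg lin_id Gr_A[OF a(2)]]] AM X _ b])
        fix k b assume b: "1 \<le> k" "b \<in> Gr k"
        show "\<pi> d (a \<otimes> b) \<in> ?X"
        proof (cases "d = i + k")
         case True
         then have "a \<in> ?X" "b \<in> ?X" using less[of i] less[of k] a b by auto
         then show ?thesis using gpD(3)[OF GrM[OF a(2) b(2)], of d] True Xm by simp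
        next
         case False
         then show ?thesis using gpD(3)[OF GrM[OF a(2) b(2)], of d] Xs(3) by simp
        qed
       qed
      qed
     qed
    qed
    moreover have "x \<in> U 1" using U_base[OF x, of 1] False by simp
    ultimately have "\<pi> d (pe x \<ominus> x) \<in> ?X" using pe_mod by blast
    moreover have "\<pi> d (pe x \<ominus> x) = pe x \<ominus> x"
     using gpD(3)[OF sub_minus[OF AM Gr_sub pe_deg[OF x] x], of d] by simp
    ultimately have "pe x \<ominus> (pe x \<ominus> x) \<in> ?X"
     using sub_minus[OF AM X XV[OF pe_VA[OF xA]]] by simp
    then show ?thesis using xA pe_closed by (simp add: mod_minus mod_negadd mod_assoc)
   qed
  qed
 qed
 show "a <: A ==> a \<in> ?X"
  by (induct rule: A_ind) (use XG Xs(4) in auto)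
qed

end

section \<open>The comparison isomorphism\<close>

context kfield
begin

context
 fixes V :: "('k, 'v) module" and W :: "('k, 'w) module" and f g cV cW
 assumes V [simp]: "module K V" and W [simp]: "module K W" and f: "f \<in> lin V W" and g: "g \<in> lin W V"
  and gf: "!!x. x <: V ==> g (f x) = x"
  and cV: "cV \<in> lin (tpow K V 2) (T V)" "!!t. t \<in> tp V 2 ==> cV t \<in> tp V 2" and cW: "cW \<in> lin (tpow K W 2) (T W)"
  and fc: "!!t. t \<in> tp V 2 ==> Tm V W f (cV t) = cW (Tm V W f t)"
begin

lemmas Tm_C = Tm_opat[OF V W f cV(1) cW fc] and Tm_eqI = Tm_inj[OF V W f g gf]

lemma YB_transport:
 assumes "!!t. t \<in> tp W 3 ==> opat W 0 2 cW (opat W 1 2 cW (opat W 0 2 cW t)) = opat W 1 2 cW (opat W 0 2 cW (opat W 1 2 cW t))"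
  and t: "t \<in> tp V 3"
 shows "opat V 0 2 cV (opat V 1 2 cV (opat V 0 2 cV t)) = opat V 1 2 cV (opat V 0 2 cV (opat V 1 2 cV t))"
 using tp_T[OF V t] assms(1)[OF Tm_tp[OF V W f t]]
 by (intro Tm_eqI) (simp_all add: Tm_C opat_closed[OF V cV(1)])

text \<open>The map that \<open>f\<close> induces on tensors is injective and commutes with the
  braidings and the products, so each axiom can be checked over \<open>W\<close>.\<close>

lemma braided_algebra_transport:
 assumes A: "ualg V" and B: "braided_algebra K W cW" and m: "!!x y. x <: V ==> y <: V ==> f (x \<otimes>\<^sub>V y) = f x \<otimes>\<^sub>W f y"
  and o: "f \<one>\<^sub>V = \<one>\<^sub>W"
 shows "braided_algebra K V cV"
proof -
 interpret B: braided_alg K W cW by unfold_locales (rule B)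
 note AW = B.A_ualg
 have fn: "Tm V W f (nabla K V t) = nabla K W (Tm V W f t)" if t: "t \<in> tp V 2" for t
 proof -
  have "Tm V W f (opat V 0 2 (nabla K V) t) = B.N 0 (Tm V W f t)"
  proof (rule lift2_eq[OF V lin_o[OF Tm_lin[OF V W f] opat_lin[OF V nabla_lin[OF A]]] lin_o[OF B.N_lin Tm_lin[OF V W f]] T_mod[OF W] _ t])
   fix x y assume xy: "x <: V" "y <: V"
   then have t2: "tens K V [x, y] \<in> tp V 2" by (intro tens_tp[OF V]) auto
   show "Tm V W f (opat V 0 2 (nabla K V) (tens K V [x, y])) = B.N 0 (Tm V W f (tens K V [x, y]))"
    using xy lin_cl[OF f]
    by (simp add: opat_0[OF V nabla_lin[OF A] t2] nabla_tens[OF A] Tm_tens[OF V W f] ua_simps[OF A] B.N_0 nabla_tens[OF AW] m)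
  qed
  then show ?thesis using opat_0[OF V nabla_lin[OF A] t] B.N_0[OF Tm_tp[OF V W f t]] by simp
 qed
 note Tm_N = Tm_opat[OF V W f nabla_lin[OF A] nabla_lin[OF AW] fn]
 note cl = opat_closed[OF V cV(1)] opat_closed[OF V nabla_lin[OF A]]
 have b: "cV t = opat V 0 2 cV t" if "t \<in> tp V 2" for t using opat_0[OF V cV(1) that] by simp
 have nt: "opat V i 2 (nabla K V) t \<in> tp V 2" if "t \<in> tp V 3" "i < 2" for i t
  using opat_tp[OF V nabla_lin[OF A] nabla_tp[OF A], of t i "1 - i"] that by simp
 have nt': "B.C 0 (B.N i t) = cW (B.N i t)" if "t \<in> tp W 3" "i < 2" for i t
  using B.C_0 B.N_tp[of t 2 i] that by simp
 show ?thesis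
 proof (rule braided_algebraI[OF A])
  show "cV \<in> lin (tpow K V 2) (tpow K V 2)" using cV by (auto simp: linear_maps_def)
  fix t assume t: "t \<in> tp V 3"
  note tT = tp_T[OF V t] and tW = Tm_tp[OF V W f t]
  show "opat V 0 2 cV (opat V 1 2 cV (opat V 0 2 cV t)) = opat V 1 2 cV (opat V 0 2 cV (opat V 1 2 cV t))"
   by (rule YB_transport[OF B.YB t])
  show "cV (opat V 0 2 (nabla K V) t) = opat V 1 2 (nabla K V) (opat V 0 2 cV (opat V 1 2 cV t))"
   unfolding b[OF nt[OF t, of 0, simplified]] by (rule Tm_eqI) (use tT tW in \<open>simp_all add: Tm_C Tm_N cl nt' B.cN0\<close>)
  show "cV (opat V 1 2 (nabla K V) t) = opat V 0 2 (nabla K V) (opat V 1 2 cV (opat V 0 2 cV t))"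
   unfolding b[OF nt[OF t, of 1, simplified]] by (rule Tm_eqI) (use tT tW in \<open>simp_all add: Tm_C Tm_N cl nt' B.cN1\<close>)
 next
  fix a assume a: "a <: V"
  have t2: "tens K V [\<one>\<^sub>V, a] \<in> tp V 2" "tens K V [a, \<one>\<^sub>V] \<in> tp V 2"
   using a ua_simps(4)[OF A] by (auto intro!: tens_tp[OF V])
  note c2 = cV(2)[OF t2(1)] cV(2)[OF t2(2)]
  show "cV (tens K V [\<one>\<^sub>V, a]) = tens K V [a, \<one>\<^sub>V]" "cV (tens K V [a, \<one>\<^sub>V]) = tens K V [\<one>\<^sub>V, a]"
   by (rule Tm_eqI; use t2 c2 a lin_cl[OF f a] ua_simps(4)[OF A] in \<open>simp add: fc tp_T[OF V] Tm_tens[OF V W f] o B.c_one\<close>)+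
 qed
qed

end

lemma categorical_cong:
 assumes V: "module K V" and X: "categorical_subspace K V c X" and eq: "!!t. t \<in> tp V 2 ==> c' t = c t"
 shows "categorical_subspace K V c' X"
proof -
 have "sub X V" using X by (simp add: categorical_subspace_def)
 note tt = tprod_tp[OF V sub_carr[OF V this] subset_refl] tprod_tp[OF V subset_refl sub_carr[OF V this]]
 show ?thesis using X tt eq by (auto simp: categorical_subspace_def image_subset_iff)
qed

lemma braided_spaceI:
 assumes V: "module K V" and c: "c \<in> lin (tpow K V 2) (T V)" "!!t. t \<in> tp V 2 ==> c t \<in> tp V 2"
  and yb: "!!t. t \<in> tp V 3 ==> opat V 0 2 c (opat V 1 2 c (opat V 0 2 c t)) = opat V 1 2 c (opat V 0 2 c (opat V 1 2 c t))"
 shows "braided_space K V c"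
proof -
 have C3: "opat V 0 2 c t \<in> tp V 3" "opat V 1 2 c t \<in> tp V 3" if "t \<in> tp V 3" for t
  using opat_tp[OF V c, of t 0 1] opat_tp[OF V c, of t 1 0] that by simp_all
 have b: "brd K V c 3 1 t = opat V 0 2 c t" "brd K V c 3 2 t = opat V 1 2 c t" if "t \<in> tp V 3" for t
  using amp_opat[OF V c(1), of t 0 1] amp_opat[OF V c(1), of t 1 0] that by (simp_all add: brd_def)
 have "c \<in> lin (tpow K V 2) (tpow K V 2)" using c by (auto simp: linear_maps_def)
 then show ?thesis unfolding braided_space_def using V yb by (simp add: b C3)
qed

end

context pbw_alg
begin

subsection \<open>Transport of the braiding\<close>

text \<open>Transport of the braiding along a pair of maps. It serves for the retract
  \<open>V\<close> of \<open>A\<close> and, once the isomorphism of algebras is known, for the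
  symmetric algebra.\<close>

definition ctr :: "('k, 'w) module => ('a => 'w) => ('w => 'a) => ('w list => 'k) set => ('w list => 'k) set"
 where "ctr W f g t = tm2 A W f f (c (tm2 W A g g t))"

context
 fixes W :: "('k, 'w) module" and f g
 assumes W [simp]: "module K W" and f: "f \<in> lin A W" and g: "g \<in> lin W A"
begin

lemma ctr_lin: "ctr W f g \<in> lin (tpow K W 2) (T W)" and ctr_tp: "t \<in> tp W 2 ==> ctr W f g t \<in> tp W 2"
proof -
 show "t \<in> tp W 2 ==> ctr W f g t \<in> tp W 2"
  unfolding ctr_def by (intro tm2_tp[OF AM W f f] c_tp tm2_tp[OF W AM g g])
 have "tm2 W A g g \<in> lin (tpow K W 2) (tpow K A 2)"
  by (subst (2) tpow_alt, intro lin_restr_cod lin_tp[OF W] tm2_lin[OF W AM g g] tm2_tp[OF W AM g g]) auto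
 then show "ctr W f g \<in> lin (tpow K W 2) (T W)"
  unfolding ctr_def by (intro lin_o[OF tm2_lin[OF AM W f f]] lin_o[OF c_lin])
qed

lemma ctr_cat:
 assumes X: "sub X W" and gX: "!!x. x \<in> X ==> g x \<in> Gr n" and fX: "!!x. x \<in> Gr n ==> f x \<in> X"
 shows "categorical_subspace K W (ctr W f g) X"
proof -
 note Xc = sub_carr[OF W X] and Gc = sub_carr[OF AM Gr_sub]
 have L: "(%t. tm2 A W f f (C 0 (tm2 W A g g t))) \<in> lin (T W) (T W)"
  by (intro lin_o[OF tm2_lin[OF AM W f f]] lin_o[OF C_lin tm2_lin[OF W AM g g]])
 have e: "ctr W f g t = tm2 A W f f (C 0 (tm2 W A g g t))" if "t \<in> tp W 2" for t
  using tm2_tp[OF W AM g g that] by (simp add: ctr_def C_0)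
 note tt = tprod_tp[OF W Xc subset_refl] tprod_tp[OF W subset_refl Xc]
 have 1: "ctr W f g t \<in> tprod K W (carrier W) X" if t: "t \<in> tprod K W X (carrier W)" for t
  unfolding e[OF tt(1)[OF t]]
 proof (rule tprod_image[OF W Xc subset_refl L T_mod[OF W] tprod_sub[OF W subset_refl Xc] _ t])
  fix x y assume xy: "x \<in> X" "y <: W"
  note gxy = gX[OF xy(1)] lin_cl[OF g xy(2)]
  have "tm2 A W f f (c (te [g x, g y])) \<in> tprod K W (carrier W) X"
   by (rule tm2_tprod[OF AM W f f subset_refl Gc subset_refl Xc _ fX Grcat[OF gxy]]) (rule lin_cl[OF f])
  then show "tm2 A W f f (C 0 (tm2 W A g g (tens K W [x, y]))) \<in> tprod K W (carrier W) X"
   using xy gxy Xc Gr_A by (simp add: tm2_tens[OF W AM g g] C_0 subset_iff)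
 qed
 have 2: "ctr W f g t \<in> tprod K W X (carrier W)" if t: "t \<in> tprod K W (carrier W) X" for t
  unfolding e[OF tt(2)[OF t]]
 proof (rule tprod_image[OF W subset_refl Xc L T_mod[OF W] tprod_sub[OF W Xc subset_refl] _ t])
  fix y x assume xy: "y <: W" "x \<in> X"
  note gxy = gX[OF xy(2)] lin_cl[OF g xy(1)]
  have "tm2 A W f f (c (te [g y, g x])) \<in> tprod K W X (carrier W)"
   by (rule tm2_tprod[OF AM W f f Gc subset_refl Xc subset_refl fX _ Grcat2[OF gxy]]) (assumption, rule lin_cl[OF f])
  then show "tm2 A W f f (C 0 (tm2 W A g g (tens K W [y, x]))) \<in> tprod K W X (carrier W)"
   using xy gxy Xc Gr_A by (simp add: tm2_tens[OF W AM g g] C_0 subset_iff)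
 qed
 show ?thesis unfolding categorical_subspace_def using X 1 2 by auto
qed

end

lemma cV_ctr: "cV = ctr V pe (%x. x)" by (simp add: fun_eq_iff cV_def ctr_def)

definition GV where "GV n = VA \<inter> Gr n"

lemma GV_sub: "sub (GV n) V"
 unfolding GV_def using sub_simps[OF AM sub_Int[OF AM VA_sub Gr_sub]] by (intro subI[OF VM]) auto

lemma pe_GV: "x \<in> Gr n ==> pe x \<in> GV n"
 using pe_deg pe_VA Gr_A by (simp add: GV_def)

lemma V_graded: "graded_proj V GV \<pi>"
 unfolding graded_proj_def
proof (intro conjI allI impI)
 show "sub (GV n) V" for n by (rule GV_sub)
 note pl = gpD(2) and pg = gpD(3)
 have pp: "pe (\<pi> n x) = \<pi> n (pe x)" if "x <: A" for n x
  using that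
 proof (induct rule: A_ind)
  case (base m x)
  then show ?case using pe_deg[OF base] lin_zero[OF pe_lin AM AM] by (simp add: pg)
 qed (simp add: lin_add[OF pl] lin_add[OF pe_lin] lin_cl[OF pl] pe_closed)
 show "\<pi> n \<in> lin V V" for n
 proof -
  have "\<pi> n x \<in> VA" if "x \<in> VA" for x
   using pp[OF VA_A[OF that], of n] VA_pe[OF that] pe_VA[OF lin_cl[OF pl VA_A[OF that], of n]] by simp
  then show ?thesis using lin_restr_cod[OF lin_restr[OF pl VA_c], of n VA] by (simp add: V_def)
 qed
 show "\<pi> m x = (if m = n then x else \<zero>\<^sub>V)" if "x \<in> GV n" for m n x using that pg[of x n m] by (simp add: GV_def)
 have g: "(\<Union>n. GV n) <<: V" by (auto simp: GV_def)
 note s = span_sub[OF VM g]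
 have "pe x \<in> span V (\<Union>n. GV n)" if "x <: A" for x
  using that
 proof (induct rule: A_ind)
  case (base n x) then show ?case using pe_GV by (intro span_base) auto
 next
  case (add x y) then show ?case using sub_add[OF VM s] by (simp add: lin_add[OF pe_lin])
 qed
 then show "carrier V = span V (\<Union>n. GV n)" using span_carr[OF VM g] by (auto simp: VA_def)
qed

lemma V_braided: "braided_graded_space K V cV GV"
 unfolding braided_graded_space_def
proof (intro conjI allI)
 show "braided_space K V cV"
  by (rule braided_spaceI[OF VM cV_lin cV_tp YB_transport[OF VM AM id_V pe_V _ cV_lin cV_tp c_lin io_cV YB]]) (simp_all add: VA_pe)
 show "grading K V GV" by (rule graded_proj_grading[OF VM V_graded])
 show "categorical_subspace K V cV (GV n)" for n
  unfolding cV_ctr by (rule ctr_cat[OF VM pe_V id_V GV_sub]) (use pe_GV in \<open>auto simp: GV_def\<close>)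
qed

subsection \<open>The isomorphism of algebras\<close>

definition gS where "gS = (SOME g. g \<in> lin S A \<and> (\<forall>t\<in>carrier (T V). g (pj t) = mV t))"

lemma gS_lin: "gS \<in> lin S A" and gS_pj: "t <: (T V) ==> gS (pj t) = mV t"
proof -
 have "\<exists>g. g \<in> lin S A \<and> (\<forall>t\<in>carrier (T V). g (pj t) = mV t)"
  using quot_lift[OF TV_ualg J_ideal AM mV_lin mV_J, folded sym_algebra_def, folded sym_proj_def] by blast
 from someI_ex[OF this] show "gS \<in> lin S A" "t <: (T V) ==> gS (pj t) = mV t" unfolding gS_def by auto
qed

lemma S_cases: assumes "s <: S" obtains t where "t <: (T V)" "s = pj t"
 using assms S_carr by auto

lemma gS_inj: assumes s: "s <: S" "s' <: S" and eq: "gS s = gS s'" shows "s = s'"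
proof -
 have c: "s \<ominus>\<^sub>S s' <: S" using s by simp
 have "gS (s \<ominus>\<^sub>S s') = \<zero>" using lin_minus[OF gS_lin SM AM s] eq lin_cl[OF gS_lin s(2)] by (simp add: mod_minus)
 then have "s \<ominus>\<^sub>S s' = \<zero>\<^sub>S" using S_cases[OF c] mV_inj gS_pj by metis
 then show ?thesis using mod_eqI[OF SM s] by simp
qed

definition fS where "fS a = pj (SOME t. t <: (T V) \<and> mV t = a)"

lemma fS: "a <: A ==> fS a <: S" "a <: A ==> gS (fS a) = a"
proof -
 assume "a <: A"
 then have "\<exists>t. t <: (T V) \<and> mV t = a" using mV_surj by blast
 from someI_ex[OF this] show "fS a <: S" "gS (fS a) = a" unfolding fS_def using pj_closed gS_pj by auto
qed

lemma fS_gS: "s <: S ==> fS (gS s) = s"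
 using gS_inj fS lin_cl[OF gS_lin] by simp

text \<open>As the inverse of the injective linear map \<open>gS\<close>, it inherits
  linearity.\<close>

lemma fS_lin: "fS \<in> lin A S"
 by (rule linI; (rule gS_inj)?) (simp_all add: fS lin_add[OF gS_lin] lin_smult[OF gS_lin])

lemma fS_mV: "t <: (T V) ==> fS (mV t) = pj t"
 using fS_gS[OF pj_closed] gS_pj by simp

lemma gS_mult: "s <: S ==> s' <: S ==> gS (s \<otimes>\<^sub>S s') = gS s \<otimes> gS s'"
 by (elim S_cases) (simp add: gS_pj mV_mult TV_ua(3) pj_mult)

lemma gS_one: "gS \<one>\<^sub>S = \<one>"
 using gS_pj[OF TV_ua(4)] by (simp add: S_one mV_one)

lemma fS_mult: "a <: A ==> b <: A ==> fS (a \<otimes> b) = fS a \<otimes>\<^sub>S fS b"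
 by (rule gS_inj) (simp_all add: fS A_ua S_ua gS_mult)

lemma fS_one: "fS \<one> = \<one>\<^sub>S" using fS_gS[OF S_ua(4)] by (simp add: gS_one)

abbreviation GS where "GS == sym_grading K V cV GV"

lemma pr_Gr: "list_all2 (%v n. v \<in> GV n) vs ns ==> pr vs \<in> Gr (sum_list ns)"
 by (induct rule: list_all2_induct) (auto simp: Gr1 GrM GV_def)

lemma GV_list: "list_all2 (%v n. v \<in> GV n) vs ns ==> set vs \<subseteq> VA"
 by (induct rule: list_all2_induct) (auto simp: GV_def)

lemma GS_gens: "{pj (tv vs) |vs ns. list_all2 (%v n. v \<in> GV n) vs ns \<and> sum_list ns = d} <<: S"
 using GV_list by (auto intro!: pj_closed tens_closed[OF VM]; blast)

text \<open>Words in homogeneous generators multiply to homogeneous elements, which gives one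
  inclusion. For the other, \<open>fS (\<pi> d (mV t))\<close> is computed on such words, where it
  is the class of the word or zero, and these words span.\<close>

lemma GS_fS: "GS d = fS ` Gr d"
proof
 have "{pj (tv vs) |vs ns. list_all2 (%v n. v \<in> GV n) vs ns \<and> sum_list ns = d} \<subseteq> fS ` Gr d"
 proof
  fix s assume "s \<in> {pj (tv vs) |vs ns. list_all2 (%v n. v \<in> GV n) vs ns \<and> sum_list ns = d}"
  then obtain vs ns where s: "s = pj (tv vs)" "list_all2 (%v n. v \<in> GV n) vs ns" "sum_list ns = d" by blast
  then show "s \<in> fS ` Gr d"
   using GV_list[OF s(2)] pr_Gr[OF s(2)] fS_mV[of "tv vs"] by (intro image_eqI[of _ _ "pr vs"]) (auto simp: mV_tens)
 qed
 then show "GS d \<subseteq> fS ` Gr d"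
  unfolding sym_grading_def by (rule span_minimal[OF sub_image[OF fS_lin AM SM Gr_sub]])
 have S: "sub (GS d) S" unfolding sym_grading_def by (rule span_sub[OF SM GS_gens])
 note pl = gpD(2)
 have L: "(%t. fS (\<pi> d (mV t))) \<in> lin (T V) S" by (intro lin_o[OF fS_lin] lin_o[OF pl mV_lin])
 have U: "(\<Union>n. GV n) <<: V" by (auto simp: GV_def)
 have "fS (\<pi> d (mV t)) \<in> GS d" if "t <: (T V)" for t
  using VM that
 proof (induct rule: T_ind)
  case (tens vs)
  then have "tv vs \<in> tp V (length vs)" by (intro tens_tp[OF VM]) auto
  then show ?case
  proof (rule tp_gen_image[OF VM U graded_projD(4)[OF V_graded] SM S lin_tp[OF VM L], rotated])
   fix us assume "set us \<subseteq> (\<Union>n. GV n)"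
   then have "\<exists>ns. list_all2 (%v n. v \<in> GV n) us ns"
   proof (induct us)
    case (Cons u us)
    then obtain n ns where "u \<in> GV n" "list_all2 (%v n. v \<in> GV n) us ns" by auto
    then show ?case by (intro exI[of _ "n # ns"]) simp
   qed auto
   then obtain ns where ns: "list_all2 (%v n. v \<in> GV n) us ns" ..
   note uV = GV_list[OF ns] and pG = pr_Gr[OF ns]
   show "fS (\<pi> d (mV (tv us))) \<in> GS d"
   proof (cases "d = sum_list ns")
    case True
    have "fS (\<pi> d (mV (tv us))) = pj (tv us)"
     using gpD(3)[OF pG, of d] True uV fS_mV[of "tv us"] by (simp add: mV_tens)
    then show ?thesis unfolding sym_grading_def using ns True by (intro span_base) auto
   next
    case False
    then show ?thesis using gpD(3)[OF pG, of d] uV lin_zero[OF fS_lin AM SM] sub_zero[OF SM S] by (simp add: mV_tens)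
   qed
  qed
 next
  case zero then show ?case using lin_zero[OF L TVM SM] sub_zero[OF SM S] by simp
 qed (use lin_add[OF L] lin_smult[OF L] sub_add[OF SM S] sub_smult[OF SM S] in auto)
 then have "fS (\<pi> d x) \<in> GS d" if "x <: A" for x using mV_surj[OF that] by auto
 then show "fS ` Gr d \<subseteq> GS d" using gpD(3) Gr_A by force
qed

lemma GS_graded: "graded_proj S GS (%n s. fS (\<pi> n (gS s)))"
 unfolding graded_proj_def GS_fS
proof (intro conjI allI impI)
 note pl = gpD(2)
 show "sub (fS ` Gr n) S" for n by (rule sub_image[OF fS_lin AM SM Gr_sub])
 show "(%s. fS (\<pi> n (gS s))) \<in> lin S S" for n by (intro lin_o[OF fS_lin] lin_o[OF pl gS_lin])
 show "fS (\<pi> m (gS s)) = (if m = n then s else \<zero>\<^sub>S)" if "s \<in> fS ` Gr n" for m n s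
  using that Gr_A lin_zero[OF fS_lin AM SM] by (auto simp: fS gpD(3))
 have g: "(\<Union>n. fS ` Gr n) <<: S" using Gr_A fS by auto
 note s = span_sub[OF SM g]
 have "fS x \<in> span S (\<Union>n. fS ` Gr n)" if "x <: A" for x
  using that by (induct rule: A_ind) (auto intro!: span_base simp: lin_add[OF fS_lin] sub_add[OF SM s])
 then show "carrier S = span S (\<Union>n. fS ` Gr n)" using span_carr[OF SM g] fS_gS lin_cl[OF gS_lin] by (auto, metis)
qed

abbreviation cS where "cS == ctr S fS gS"

lemma gS_cS: assumes t: "t \<in> tp S 2" shows "Tm S A gS (cS t) = c (Tm S A gS t)"
proof -
 note gt = tm2_tp[OF SM AM gS_lin gS_lin t]
 have "Tm S A gS (cS t) = tm2 S A gS gS (tm2 A S fS fS (c (tm2 S A gS gS t)))"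
  using Tm_tm2[OF SM AM gS_lin ctr_tp[OF SM fS_lin gS_lin t]] by (simp add: ctr_def)
 also have "\<dots> = tm2 A A (%x. gS (fS x)) (%x. gS (fS x)) (c (tm2 S A gS gS t))"
  by (rule tm2_comp[OF AM SM AM fS_lin fS_lin gS_lin gS_lin c_tp[OF gt]])
 also have "\<dots> = c (tm2 S A gS gS t)"
  by (rule A_lift2_eq[OF tmA_lin[OF lin_o[OF gS_lin fS_lin] lin_o[OF gS_lin fS_lin]] lin_id TAM _ c_tp[OF gt]])
   (simp add: tmA_tens[OF lin_o[OF gS_lin fS_lin] lin_o[OF gS_lin fS_lin]] fS)
 finally show ?thesis using Tm_tm2[OF SM AM gS_lin t] by simp
qed

subsection \<open>The braiding of the tensor algebra\<close>

abbreviation CV where "CV i == opat V i 2 cV"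

lemmas CV_lin = opat_lin[OF VM cV_lin]

text \<open>With crossings for \<open>C'\<close>, this moves the factor at position
  \<open>l + n\<close> to the left past \<open>n\<close> factors, and \<open>BR\<close> does so for
  \<open>m\<close> factors in turn. The result is \<open>braid_nm\<close> with positions counted
  from zero and without reference to the tensor degree.\<close>

definition SH where "SH C' l n = foldr C' [l..<l + n]"
definition BR where "BR C' n m = fold (%l. SH C' l n) [0..<m]"

lemma SH_lin: assumes "!!i. C' i \<in> lin M M" shows "SH C' l n \<in> lin M M"
proof -
 have "foldr C' is \<in> lin M M" for "is" by (induct "is") (use lin_o[OF assms] lin_id[of M] in \<open>auto simp: id_def comp_def\<close>)
 then show ?thesis by (simp add: SH_def)
qed

lemma BR_lin: assumes "!!i. C' i \<in> lin M M" shows "BR C' n m \<in> lin M M"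
proof -
 have "fold (%l. SH C' l n) ls \<in> lin M M" for ls
 proof (induct ls)
  case (Cons l ls) show ?case using lin_o[OF Cons SH_lin[where C' = C', OF assms]] by (simp add: comp_def)
 qed (simp add: id_def lin_id)
 then show ?thesis by (simp add: BR_def)
qed

lemma CV_tp: "t \<in> tp V n ==> i + 2 \<le> n ==> CV i t \<in> tp V n"
proof -
 assume h: "t \<in> tp V n" "i + 2 \<le> n"
 then have e: "i + 2 + (n - i - 2) = n" by simp
 from opat_tp[OF VM cV_lin cV_tp, of t i "n - i - 2"] h(1) show "CV i t \<in> tp V n" unfolding e by blast
qed

lemma braid_BR: assumes t: "t \<in> tp V (n + m)" shows "braid_nm K V cV n m t = BR CV n m t" "BR CV n m t \<in> tp V (n + m)"
proof -
 have b: "brd K V cV (n + m) (Suc i) s = CV i s" if "i + 2 \<le> n + m" "s \<in> tp V (n + m)" for i s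
 proof -
  have e: "i + 2 + (n + m - i - 2) = n + m" "n + m - Suc i - 1 = n + m - i - 2" using that by simp_all
  from amp_opat[OF VM cV_lin, of s i "n + m - i - 2"] that(2) show ?thesis unfolding brd_def e diff_Suc_1 by blast
 qed
 have 1: "foldr (brd K V cV (n + m)) (map Suc is) s = foldr CV is s \<and> foldr CV is s \<in> tp V (n + m)"
  if "\<forall>i\<in>set is. i + 2 \<le> n + m" "s \<in> tp V (n + m)" for "is" s
  using that by (induct "is") (auto simp: b CV_tp)
 have 2: "foldr (brd K V cV (n + m)) [Suc l..<Suc l + n] s = SH CV l n s \<and> SH CV l n s \<in> tp V (n + m)"
  if "l < m" "s \<in> tp V (n + m)" for l s
 proof -
  have "[Suc l..<Suc l + n] = map Suc [l..<l + n]" by (simp only: map_Suc_upt add_Suc)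
  then show ?thesis using 1[of "[l..<l + n]" s] that by (simp add: SH_def)
 qed
 have 3: "fold (%l. foldr (brd K V cV (n + m)) [l..<l + n]) (map Suc ls) s = fold (%l. SH CV l n) ls s \<and> fold (%l. SH CV l n) ls s \<in> tp V (n + m)"
  if "\<forall>l\<in>set ls. l < m" "s \<in> tp V (n + m)" for ls s
  using that
 proof (induct ls arbitrary: s)
  case (Cons l ls)
  then show ?case using 2[of l s] by (simp del: upt_Suc)
 qed simp
 have "[1..<m + 1] = map Suc [0..<m]" by (metis One_nat_def Suc_eq_plus1 map_Suc_upt)
 with 3[of "[0..<m]" t] t show "braid_nm K V cV n m t = BR CV n m t" "BR CV n m t \<in> tp V (n + m)"
  by (simp_all add: braid_nm_def BR_def)
qed

lemma io_BR: "t <: (T V) ==> io (BR CV n m t) = BR C n m (io t)"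
proof -
 have o: "io (CV i t) = C i (io t)" if "t <: (T V)" for i t
  by (rule Tm_opat[OF VM AM id_V cV_lin c_lin io_cV that])
 have 1: "io (SH CV l n t) = SH C l n (io t) \<and> SH CV l n t <: (T V)" if "t <: (T V)" for l n t
 proof -
  have "io (foldr CV is t) = foldr C is (io t) \<and> foldr CV is t <: (T V)" for "is"
   by (induct "is") (auto simp: that o lin_cl[OF CV_lin])
  then show ?thesis by (simp add: SH_def)
 qed
 have "io (fold (%l. SH CV l n) ls t) = fold (%l. SH C l n) ls (io t)" if "t <: (T V)" for ls
  using that by (induct ls arbitrary: t) (simp_all add: 1)
 then show "t <: (T V) ==> io (BR CV n m t) = BR C n m (io t)" by (simp add: BR_def)
qed

abbreviation TT where "TT == T (T V)"
abbreviation tt where "tt == tens K (T V)"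

lemmas TTM = T_mod[OF TVM]

lemma split_multilin:
 assumes M: "module K M" and W: "module K W" and f: "multilin W M f" and g: "multilin W M g"
 shows "multilin W (T M) (%ws. tens K M [f (take m ws), g (drop m ws)])"
proof (rule multilinI)
 have s: "set (take m ws) <<: W" "set (drop m ws) <<: W" if "set ws <<: W" for ws m
  using that set_take_subset set_drop_subset by (metis order_trans)+
 note fD = multilinD[OF f] and gD = multilinD[OF g]
 show "tens K M [f (take m ws), g (drop m ws)] <: (T M)" if "set ws <<: W" for ws
  using fD(1) gD(1) s[OF that] by (intro tens_closed[OF M]) simp
 have c: "length us < m ==> take m (us @ x # vs) = us @ x # take (m - length us - 1) vs \<and> drop m (us @ x # vs) = drop (m - length us - 1) vs"
  "\<not> length us < m ==> take m (us @ x # vs) = take m us \<and> drop m (us @ x # vs) = drop m us @ x # vs" for us vs and x :: 'd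
  by (auto simp: take_Cons' drop_Cons')
 fix us vs x assume u: "set us <<: W" "set vs <<: W" and x: "x <: W"
 have cl: "f ws <: M" "g ws <: M" if "set ws <<: W" for ws using that fD(1) gD(1) by auto
 have ac: "set (us @ x # vs) <<: W" if "x <: W" "set us <<: W" "set vs <<: W" for x us vs using that by auto
 { fix y assume y: "y <: W"
  show "tens K M [f (take m (us @ (x \<oplus>\<^sub>W y) # vs)), g (drop m (us @ (x \<oplus>\<^sub>W y) # vs))] =
   tens K M [f (take m (us @ x # vs)), g (drop m (us @ x # vs))] \<oplus>\<^sub>(T M) tens K M [f (take m (us @ y # vs)), g (drop m (us @ y # vs))]"
   using u x y by (cases "length us < m") (simp_all add: c fD(2) gD(2) s cl ac tens2_simps[OF M] del: set_append take_append drop_append) }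
 fix a assume a: "a <: K"
 show "tens K M [f (take m (us @ (a \<odot>\<^sub>W x) # vs)), g (drop m (us @ (a \<odot>\<^sub>W x) # vs))] = a \<odot>\<^sub>(T M) tens K M [f (take m (us @ x # vs)), g (drop m (us @ x # vs))]"
  using u x a by (cases "length us < m") (simp_all add: c fD(3) gD(3) s cl ac tens2_simps[OF M] del: set_append take_append drop_append)
qed

definition ts where "ts m = tlift V TT (%ws. tt [tv (take m ws), tv (drop m ws)])"

lemma ts_lin: "ts m \<in> lin (T V) TT"
 and ts_tens: "set ws \<subseteq> VA ==> ts m (tv ws) = tt [tv (take m ws), tv (drop m ws)]"
 unfolding ts_def using tlift_lin[OF VM TTM split_multilin[OF TVM VM tens_multilin[OF VM] tens_multilin[OF VM]]]
  tlift_tens[OF VM TTM split_multilin[OF TVM VM tens_multilin[OF VM] tens_multilin[OF VM]]] by auto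

lemma ts_tp: assumes t: "t \<in> tp V n" shows "ts m t \<in> tp (T V) 2"
 using VM t
proof (induct rule: tp_ind)
 case (tens vs)
 then have "set (take m vs) \<subseteq> VA" "set (drop m vs) \<subseteq> VA" using set_take_subset set_drop_subset by (metis V_sel(1) order_trans)+
 then show ?case using tens by (simp add: ts_tens tens_tp[OF TVM] tens_closed[OF VM])
qed (use lin_simps[OF ts_lin] lin_zero[OF ts_lin TVM TTM] sub_simps[OF TTM tp_sub[OF TVM]] tp_T[OF VM] in auto)

lemma tsplit_ts: assumes t: "t \<in> tp V (m + n)" shows "tsplit K V m n t = ts m t"
proof -
 have P: "ts m (u \<star>\<^sub>V v) = tt [u, v]" if u: "u \<in> tp V m" and v: "v \<in> tp V n" for u v
 proof (rule tp_lin_eq[OF VM lin_tp[OF VM lin_o[OF ts_lin lin_rmult[OF TV_ualg lin_id]]] lin_tp[OF VM tens2_lin(1)[OF TVM]] TTM _ u])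
  show vT: "v <: (T V)" "v <: (T V)" using tp_T[OF VM v] by auto
  fix us assume us: "length us = m" "set us <<: V"
  show "ts m (tv us \<star>\<^sub>V v) = tt [tv us, v]"
   by (rule tp_lin_eq[OF VM lin_tp[OF VM lin_o[OF ts_lin lin_lmult[OF TV_ualg lin_id]]] lin_tp[OF VM tens2_lin(2)[OF TVM]] TTM _ v])
    (use us in \<open>auto simp: ts_tens simp flip: tens_append[OF VM]\<close>)
 qed
 have "tsplit K V m n = restrict (ts m) (tp V (m + n))"
  unfolding tsplit_def
 proof (rule the_linear_eq)
  show "ts m \<in> lin (tpow K V (m + n)) (tpow K (T V) 2)"
   using ts_tp by (subst (2) tpow_alt, intro lin_restr_cod lin_tp[OF VM ts_lin]) auto
  show "\<forall>u\<in>tp V m. \<forall>v\<in>tp V n. restrict (ts m) (tp V (m + n)) (u \<star>\<^sub>V v) = tt [u, v]"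
   using P tp_mult[OF VM] by simp
  fix h t assume h: "h \<in> lin (tpow K V (m + n)) (tpow K (T V) 2)" "\<forall>u\<in>tp V m. \<forall>v\<in>tp V n. h (u \<star>\<^sub>V v) = tt [u, v]"
   and t: "t \<in> tp V (m + n)"
  have h': "h \<in> lin (tpow K V (m + n)) TT" using h(1) tp_T[OF TVM] by (auto simp: linear_maps_def Pi_iff)
  show "h t = ts m t"
  proof (rule tp_lin_eq[OF VM h' lin_tp[OF VM ts_lin] TTM _ t])
   fix vs assume vs: "length vs = m + n" "set vs <<: V"
   have s: "set (take m vs) <<: V" "set (drop m vs) <<: V" using vs(2) set_take_subset set_drop_subset by (metis order_trans)+
   then have "h (tv (take m vs) \<star>\<^sub>V tv (drop m vs)) = tt [tv (take m vs), tv (drop m vs)]"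
    using h(2) vs(1) tens_tp[OF VM _ s(1), of m] tens_tp[OF VM _ s(2), of n] by simp
   then show "h (tv vs) = ts m (tv vs)" using vs ts_tens[of vs m] tens_append[OF VM s] by simp
  qed
 qed simp_all
 then show ?thesis using t by simp
qed

definition bt where "bt us vs = ts (length vs) (BR CV (length us) (length vs) (tv (us @ vs)))"

lemma bt_closed: "set us \<subseteq> VA ==> set vs \<subseteq> VA ==> bt us vs \<in> tp (T V) 2"
 unfolding bt_def by (intro ts_tp[of _ "length us + length vs"] braid_BR(2) tens_tp[OF VM]) auto

lemma bt_lin: assumes "set us \<subseteq> VA" "set vs \<subseteq> VA" "set ws \<subseteq> VA"
 shows "(%x. bt (us @ x # vs) ws) \<in> lin V TT" "(%x. bt ws (us @ x # vs)) \<in> lin V TT"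
proof -
 have L: "f \<in> lin V (T V) ==> (%x. ts m (BR CV i k (f x))) \<in> lin V TT" for m i k f
  by (rule lin_o[OF ts_lin lin_o[OF BR_lin[OF CV_lin]]])
 show "(%x. bt (us @ x # vs) ws) \<in> lin V TT" "(%x. bt ws (us @ x # vs)) \<in> lin V TT"
  using L[OF tens_ins_lin[OF VM, of us "vs @ ws"]] L[OF tens_ins_lin[OF VM, of "ws @ us" vs]] assms
  unfolding bt_def by simp_all
qed

lemma multilin_of_lin:
 assumes "!!vs. set vs <<: W ==> f vs <: M" "!!us vs. set us <<: W ==> set vs <<: W ==> (%x. f (us @ x # vs)) \<in> lin W M"
 shows "multilin W M f"
 using assms lin_add[OF assms(2)] lin_smult[OF assms(2)] by (intro multilinI) auto

text \<open>The braiding of two words is first extended linearly in the left argument; the result is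
  still multilinear in the right word, so \<open>hB\<close> can extend it once more.\<close>

definition hb where "hb vs = tlift V TT (%us. bt us vs)"
definition hB where "hB x = tlift V TT (%vs. hb vs x)"

lemma hb: assumes "set vs \<subseteq> VA"
 shows hb_lin: "hb vs \<in> lin (T V) TT" and hb_tens: "set us \<subseteq> VA ==> hb vs (tv us) = bt us vs"
proof -
 have "multilin V TT (%us. bt us vs)"
  by (rule multilin_of_lin) (use assms in \<open>simp_all add: tp_T[OF TVM bt_closed] bt_lin(1)\<close>)
 from tlift_lin[OF VM TTM this] tlift_tens[OF VM TTM this]
 show "hb vs \<in> lin (T V) TT" "set us \<subseteq> VA ==> hb vs (tv us) = bt us vs" by (simp_all add: hb_def)
qed

lemma hB: assumes x: "x <: (T V)"
 shows hB_lin: "hB x \<in> lin (T V) TT" and hB_tens: "set vs \<subseteq> VA ==> hB x (tv vs) = hb vs x"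
proof -
 have "multilin V TT (%vs. hb vs x)"
 proof (rule multilin_of_lin)
  show "hb vs x <: TT" if "set vs <<: V" for vs using that lin_cl[OF hb_lin x] by simp
  fix us vs assume u: "set us <<: V" "set vs <<: V"
  have hc: "(%x. hb (us @ v # vs) x) \<in> lin (T V) TT" if "v \<in> VA" for v using hb_lin[of "us @ v # vs"] u that by simp
  show "(%v. hb (us @ v # vs) x) \<in> lin V TT"
  proof (rule linI)
   fix v w a assume vw: "v <: V" "w <: V"
   have vwA: "v \<oplus>\<^sub>V w \<in> VA" using vw mod_closed(1)[OF VM] by (simp only: V_sel(1)[symmetric])
   show "hb (us @ (v \<oplus>\<^sub>V w) # vs) x = hb (us @ v # vs) x \<oplus>\<^sub>TT hb (us @ w # vs) x"
    by (rule T_lin_eq[OF VM hc[OF vwA] lin_plus[OF TTM hc hc] TTM _ x])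
     (use vw vwA u lin_add[OF bt_lin(2)] in \<open>auto simp: hb_tens\<close>)
  next
   fix a v assume av: "a <: K" "v <: V"
   have avA: "a \<odot>\<^sub>V v \<in> VA" using av mod_closed(5)[OF VM] by (simp only: V_sel(1)[symmetric])
   show "hb (us @ (a \<odot>\<^sub>V v) # vs) x = a \<odot>\<^sub>TT hb (us @ v # vs) x"
    by (rule T_lin_eq[OF VM hc[OF avA] lin_sm[OF TTM hc] TTM _ x])
     (use av avA u lin_smult[OF bt_lin(2)] in \<open>auto simp: hb_tens\<close>)
  qed (use lin_cl[OF hc x] in simp)
 qed
 from tlift_lin[OF VM TTM this] tlift_tens[OF VM TTM this]
 show "hB x \<in> lin (T V) TT" "set vs \<subseteq> VA ==> hB x (tv vs) = hb vs x" by (simp_all add: hB_def)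
qed

lemma hB_lin1: assumes y: "y <: (T V)" shows "(%x. hB x y) \<in> lin (T V) TT"
 using VM y
proof (induct rule: T_ind)
 case (tens vs)
 show ?case by (rule lin_cong[OF hb_lin[of vs] TVM]) (use tens in \<open>simp_all add: hB_tens\<close>)
next
 case zero show ?case by (rule lin_cong[OF lin_0[OF TTM] TVM]) (simp add: lin_zero[OF hB_lin TVM TTM])
next
 case (add f g) show ?case by (rule lin_cong[OF lin_plus[OF TTM add(3,4)] TVM]) (use add in \<open>simp add: lin_add[OF hB_lin]\<close>)
next
 case (smult a f) show ?case by (rule lin_cong[OF lin_sm[OF TTM smult(3,1)] TVM]) (use smult in \<open>simp add: lin_smult[OF hB_lin]\<close>)
qed

abbreviation tbl where "tbl == lift2 (T V) TT hB"

lemma tbl_lin: "tbl \<in> lin TT TT"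
 and tbl_tens: "x <: (T V) ==> y <: (T V) ==> tbl (tt [x, y]) = hB x y"
 using lift2_lin[OF TVM TTM hB_lin1 hB_lin] lift2_tens[OF TVM TTM hB_lin1 hB_lin] by auto

lemma tbl_tv: "set us \<subseteq> VA ==> set vs \<subseteq> VA ==> tbl (tt [tv us, tv vs]) = bt us vs"
 using tbl_tens tens_closed[OF VM] by (simp add: hB_tens hb_tens)

lemma T_gens: "tv ` {vs. set vs \<subseteq> VA} <<: (T V)" "carrier (T V) = span (T V) (tv ` {vs. set vs \<subseteq> VA})"
 using T_span[OF VM] tens_closed[OF VM] by auto

lemma tbl_tp: "t \<in> tp (T V) 2 ==> tbl t \<in> tp (T V) 2"
 by (rule tp_gen_image[OF TVM T_gens TTM tp_sub[OF TVM] lin_tp[OF TVM tbl_lin]]) (auto simp: len2 tbl_tv bt_closed)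

text \<open>The values are prescribed on pairs of tensors of fixed lengths. By linearity pairs of
  words suffice, and there both sides are the same composition of crossings followed by the same
  cut.\<close>

lemma tensor_braiding_tbl: assumes t: "t \<in> tp (T V) 2" shows "tensor_braiding K V cV t = tbl t"
proof -
 have t2: "tt [x, y] \<in> tp (T V) 2" if "x <: (T V)" "y <: (T V)" for x y using that by (intro tens_tp[OF TVM]) auto
 have P: "tbl (tt [x, y]) = tsplit K V m n (braid_nm K V cV n m (x \<star>\<^sub>V y))" if x: "x \<in> tp V n" and y: "y \<in> tp V m" for n m x y
 proof -
  note xT = tp_T[OF VM x] and yT = tp_T[OF VM y]
  have L: "f \<in> lin M (T V) ==> (%x. ts m (BR CV n m (f x))) \<in> lin M TT" for f and M :: "('k, ('a list => 'k) set) module"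
   by (rule lin_o[OF ts_lin lin_o[OF BR_lin[OF CV_lin]]])
  have "hB x y = ts m (BR CV n m (x \<star>\<^sub>V y))"
  proof (rule tp_lin_eq[OF VM lin_tp[OF VM hB_lin1[OF yT]] lin_tp[OF VM L[OF lin_rmult[OF TV_ualg lin_id yT]]] TTM _ x])
   fix us assume us: "length us = n" "set us <<: V"
   then have uT: "tv us <: (T V)" by simp
   show "hB (tv us) y = ts m (BR CV n m (tv us \<star>\<^sub>V y))"
    by (rule tp_lin_eq[OF VM lin_tp[OF VM hB_lin[OF uT]] lin_tp[OF VM L[OF lin_lmult[OF TV_ualg lin_id uT]]] TTM _ y])
     (use us uT in \<open>auto simp: hB_tens hb_tens bt_def tens_append[OF VM]\<close>)
  qed
  then show ?thesis
   using tbl_tens[OF xT yT] braid_BR[OF tp_mult[OF VM x y]] by (simp add: tsplit_ts add.commute)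
 qed
 have "tensor_braiding K V cV = restrict tbl (tp (T V) 2)"
  unfolding tensor_braiding_def
 proof (rule the_linear_eq)
  show "tbl \<in> lin (tpow K (T V) 2) (tpow K (T V) 2)"
   using tbl_tp by (subst (2) tpow_alt, intro lin_restr_cod lin_tp[OF TVM tbl_lin]) auto
  show "\<forall>n m. \<forall>x\<in>tp V n. \<forall>y\<in>tp V m. restrict tbl (tp (T V) 2) (tt [x, y]) = tsplit K V m n (braid_nm K V cV n m (x \<star>\<^sub>V y))"
   using P t2 tp_T[OF VM] by simp
  fix h t assume h: "h \<in> lin (tpow K (T V) 2) (tpow K (T V) 2)"
    "\<forall>n m. \<forall>x\<in>tp V n. \<forall>y\<in>tp V m. h (tt [x, y]) = tsplit K V m n (braid_nm K V cV n m (x \<star>\<^sub>V y))"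
   and t: "t \<in> tp (T V) 2"
  have h': "h \<in> lin (tpow K (T V) 2) TT" using h(1) tp_T[OF TVM] by (auto simp: linear_maps_def Pi_iff)
  have "h (tt [tv us, tv vs]) = tbl (tt [tv us, tv vs])" if "set us \<subseteq> VA" "set vs \<subseteq> VA" for us vs
   using that h(2) P[of "tv us" "length us" "tv vs" "length vs"] tens_tp[OF VM, of us] tens_tp[OF VM, of vs] by simp
  then show "h t = tbl t"
   by (intro tp_lin_eq_gen[OF TVM T_gens TTM h' lin_tp[OF TVM tbl_lin] _ t]) (auto simp: len2)
 qed simp_all
 then show ?thesis using t by simp
qed

subsection \<open>The braiding of products\<close>

text \<open>Cuts a word after \<open>m\<close> letters and multiplies out both pieces; this compares
  the braiding of words with the braiding of their products.\<close>

definition Jm where "Jm m = tlift A (T A) (%ws. te [pr (take m ws), pr (drop m ws)])"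

lemma pr_multilin: "multilin A A pr"
 by (intro multilinI) (simp_all add: pr_append pr_closed A_ua)

lemma Jm_lin: "Jm m \<in> lin (T A) (T A)"
 and Jm_tens: "set ws <<: A ==> Jm m (te ws) = te [pr (take m ws), pr (drop m ws)]"
 unfolding Jm_def using tlift_lin[OF AM TAM split_multilin[OF AM AM pr_multilin pr_multilin]]
  tlift_tens[OF AM TAM split_multilin[OF AM AM pr_multilin pr_multilin]] by auto

lemma SH_Suc: assumes u: "u <: A" and t: "t <: (T A)"
 shows "SH C (Suc l) n (te [u] \<star> t) = te [u] \<star> SH C l n t"
proof -
 have s: "C (Suc i) (te [u] \<star> t) = te [u] \<star> C i t" if "t <: (T A)" for i t
  using C_shift[OF t1_tp(1)[OF u] that, of i] unfolding plus_1_eq_Suc .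
 have "foldr C (map Suc is) (te [u] \<star> t) = te [u] \<star> foldr C is t \<and> foldr C is t <: (T A)" for "is"
  using t by (induct "is") (auto simp: s lin_cl[OF C_lin])
 moreover have "[Suc l..<Suc l + n] = map Suc [l..<l + n]" by (simp only: map_Suc_upt add_Suc)
 ultimately show ?thesis by (simp add: SH_def del: upt_Suc)
qed

lemma SH_0: "SH C 0 (Suc n) t = C 0 (SH C (Suc 0) n t)"
proof -
 have "[0..<Suc n] = 0 # [Suc 0..<Suc n]" by (rule upt_conv_Cons) simp
 then show ?thesis by (simp only: SH_def add_0 add_Suc foldr_Cons o_apply)
qed

lemma td1: "take 1 (w # ws) = [w]" "drop 1 (w # ws) = ws"
 by (simp_all add: take_Cons' drop_Cons')

lemma SH_right: assumes t: "t \<in> tp A (Suc n)" and v: "v <: (T A)"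
 shows "SH C 0 n (t \<star> v) = SH C 0 n t \<star> v" "SH C 0 n t \<in> tp A (Suc n)"
proof -
 have "foldr C is (t \<star> v) = foldr C is t \<star> v \<and> foldr C is t \<in> tp A (Suc n)" if "\<forall>i\<in>set is. i < n" for "is"
  using that t by (induct "is") (auto simp: A_opat_right[OF c_lin _ v] intro!: C_tp)
 from this[of "[0..<n]"] show "SH C 0 n (t \<star> v) = SH C 0 n t \<star> v" "SH C 0 n t \<in> tp A (Suc n)" by (auto simp: SH_def)
qed

lemma J1_C: assumes u: "u <: A" and s: "s \<in> tp A (Suc k)"
 shows "Jm 1 (C 0 (te [u] \<star> s)) = N 1 (C 0 (te [u] \<star> Jm 1 s))"
proof (rule A_tp_lin_eq[OF _ _ TAM _ s])
 have uT: "te [u] <: (T A)" using u by simp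
 show "(%s. Jm 1 (C 0 (te [u] \<star> s))) \<in> lin (tpow K A (Suc k)) (T A)"
  by (intro A_lin_tp lin_o[OF Jm_lin] lin_o[OF C_lin] lin_lmult[OF TA_ualg lin_id] uT)
 show "(%s. N 1 (C 0 (te [u] \<star> Jm 1 s))) \<in> lin (tpow K A (Suc k)) (T A)"
  by (intro A_lin_tp lin_o[OF N_lin] lin_o[OF C_lin] lin_lmult[OF TA_ualg Jm_lin] uT)
 fix vs assume "length vs = Suc k" "set vs <<: A"
 then obtain w ws where vs: "vs = w # ws" "w <: A" "set ws <<: A" by (cases vs) auto
 have J: "Jm 1 (r \<star> te ws) = N 1 (r \<star> te [pr ws])" if r: "r \<in> tp A 2" for r
 proof (rule A_lift2_eq[OF _ _ TAM _ r])
  show "(%r. Jm 1 (r \<star> te ws)) \<in> lin (T A) (T A)" "(%r. N 1 (r \<star> te [pr ws])) \<in> lin (T A) (T A)"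
   using vs pr_closed by (auto intro!: lin_o[OF Jm_lin] lin_o[OF N_lin] lin_rmult[OF TA_ualg lin_id])
  fix a b assume "a <: A" "b <: A"
  then show "Jm 1 (te [a, b] \<star> te ws) = N 1 (te [a, b] \<star> te [pr ws])"
   using vs pr_closed tens_append[OF AM, of "[a, b]" ws] Jm_tens[of "a # b # ws" 1] by (simp add: N1_3 A_ua td1)
 qed
 have "C 0 (te [u] \<star> te (w # ws)) = c (te [u, w]) \<star> te ws"
  using u vs C0_ap[OF t2_tp[OF u vs(2)], of "te ws"] tens_append[OF AM, of "[u]" "w # ws"] tens_append[OF AM, of "[u, w]" ws] by simp
 moreover have "C 0 (te [u] \<star> te [w, pr ws]) = c (te [u, w]) \<star> te [pr ws]"
  using u vs pr_closed by (simp add: C0_3)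
 moreover have "Jm 1 (te (w # ws)) = te [w, pr ws]" using vs Jm_tens[of "w # ws" 1] by (simp add: A_ua td1)
 ultimately show "Jm 1 (C 0 (te [u] \<star> te vs)) = N 1 (C 0 (te [u] \<star> Jm 1 (te vs)))"
  using J[OF c_closed[OF u vs(2)]] vs by simp
qed

text \<open>One letter is moved past a product, one crossing at a time; in each step the axiom
  \<open>cN0\<close> absorbs a further letter into the product.\<close>

lemma J1_SH: "set us <<: A ==> v <: A ==> Jm 1 (SH C 0 (length us) (te (us @ [v]))) = c (te [pr us, v])"
proof (induct us)
 case Nil
 then show ?case using Jm_tens[of "[v]" 1] by (simp add: SH_def c_one A_ua)
next
 case (Cons u us)
 then have uA: "u <: A" "set us <<: A" by auto
 have t: "te (us @ [v]) \<in> tp A (Suc (length us))" using Cons(3) uA by (intro A_tens_tp) auto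
 note pA = pr_closed[OF uA(2)]
 have "SH C 0 (Suc (length us)) (te (u # us @ [v])) = C 0 (te [u] \<star> SH C 0 (length us) (te (us @ [v])))"
  using SH_Suc[OF uA(1) tp_T'[OF t], of 0] uA Cons(3) tens_append[OF AM, of "[u]" "us @ [v]"] by (simp add: SH_0)
 then have "Jm 1 (SH C 0 (Suc (length us)) (te (u # us @ [v]))) = N 1 (C 0 (te [u] \<star> c (te [pr us, v])))"
  using J1_C[OF uA(1) SH_right(2)[OF t tp_T'[OF t]]] Cons(1)[OF uA(2) Cons(3)] by simp
 also have "te [u] \<star> c (te [pr us, v]) = C 1 (te [u, pr us] \<star> te [v])"
  using uA pA Cons(3) C1_ap'[OF uA(1) t2_tp[OF pA Cons(3)]] by (simp add: te3)
 also have "N 1 (C 0 (C 1 (te [u, pr us] \<star> te [v]))) = c (N 0 (te [u, pr us] \<star> te [v]))"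
  using uA pA Cons(3) tp_mult[OF AM t2_tp[OF uA(1) pA] t1_tp(1)[OF Cons(3)]] by (intro cN0[symmetric]) simp
 also have "N 0 (te [u, pr us] \<star> te [v]) = te [pr (u # us), v]"
  using uA pA Cons(3) N0_ap[OF t2_tp[OF uA(1) pA], of "te [v]"] by (simp add: nabla_tens' te2[of "u \<otimes> pr us"] A_ua)
 finally show ?case unfolding length_Cons append_Cons .
qed

lemma fold_SH: assumes v: "v <: A" and t: "t <: (T A)"
 shows "fold (%l. SH C l n) (map Suc ls) (te [v] \<star> t) = te [v] \<star> fold (%l. SH C l n) ls t"
 using t by (induct ls arbitrary: t) (use v in \<open>auto simp: SH_Suc lin_cl[OF SH_lin[OF C_lin]]\<close>)

text \<open>Induction on the right word: its first letter crosses all of \<open>us\<close> and then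
  stays in front, while the remaining crossings are shifted by one position. \<open>J1_SH\<close>
  evaluates the first move, and the axiom \<open>cN1\<close> puts the two parts together.\<close>

lemma Jm_BR: "set us <<: A ==> set vs <<: A ==>
 Jm (length vs) (BR C (length us) (length vs) (te (us @ vs))) = c (te [pr us, pr vs])"
proof (induct vs arbitrary: us)
 case Nil
 then show ?case using Jm_tens[of us 0] pr_closed[of us] by (simp add: BR_def c_one)
next
 case (Cons v vs)
 let ?n = "length us" and ?m = "length vs" and ?s = "SH C 0 (length us) (te (us @ [v]))"
 let ?f = "fold (%l. SH C l ?n) (map Suc [0..<?m])"
 have vA: "v <: A" "set vs <<: A" using Cons(3) by auto
 note pu = pr_closed[OF Cons(2)] and pv' = pr_closed[OF vA(2)]
 have t: "te (us @ [v]) \<in> tp A (Suc ?n)" using Cons(2) vA by (intro A_tens_tp) auto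
 have vT: "te vs <: (T A)" using vA by simp
 have "[0..<Suc ?m] = 0 # map Suc [0..<?m]" by (simp add: upt_conv_Cons map_Suc_upt del: upt_Suc)
 moreover have "te (us @ v # vs) = te (us @ [v]) \<star> te vs" using Cons(2) vA tens_append[OF AM, of "us @ [v]" vs] by simp
 ultimately have 1: "BR C ?n (Suc ?m) (te (us @ v # vs)) = ?f (?s \<star> te vs)"
  by (simp add: BR_def SH_right(1)[OF t vT] del: upt_Suc)
 have fl: "?f \<in> lin (T A) (T A)"
 proof -
  have "fold (%l. SH C l ?n) ls \<in> lin (T A) (T A)" for ls
  proof (induct ls)
   case (Cons l ls) show ?case using lin_o[OF Cons SH_lin[OF C_lin]] by (simp add: comp_def)
  qed (simp add: id_def lin_id)
  then show ?thesis .
 qed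
 \<comment> \<open>The tensor \<open>?s\<close> after the first move is replaced by an arbitrary
   \<open>s\<close>, so that by linearity only words \<open>w # us'\<close> remain, whose first
   letter \<open>?f\<close> does not touch.\<close>
 have "Jm (Suc ?m) (?f (s \<star> te vs)) = N 0 (C 1 (Jm 1 s \<star> te [pr vs]))" if s: "s \<in> tp A (Suc ?n)" for s
 proof (rule A_tp_lin_eq[OF _ _ TAM _ s])
  show "(%s. Jm (Suc ?m) (?f (s \<star> te vs))) \<in> lin (tpow K A (Suc ?n)) (T A)"
   by (intro A_lin_tp lin_o[OF Jm_lin] lin_o[OF fl] lin_rmult[OF TA_ualg lin_id] vT)
  show "(%s. N 0 (C 1 (Jm 1 s \<star> te [pr vs]))) \<in> lin (tpow K A (Suc ?n)) (T A)"
   using pv' by (intro A_lin_tp lin_o[OF N_lin] lin_o[OF C_lin] lin_rmult[OF TA_ualg Jm_lin]) simp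
  fix ws assume "length ws = Suc ?n" "set ws <<: A"
  then obtain w us' where ws: "ws = w # us'" "length us' = ?n" "w <: A" "set us' <<: A" by (cases ws) auto
  note pu' = pr_closed[OF ws(4)]
  have J: "Jm (Suc ?m) (te [w] \<star> X) = N 0 (te [w] \<star> Jm ?m X)" if X: "X <: (T A)" for X
  proof (rule T_lin_eq[OF AM _ _ TAM _ X])
   show "(%X. Jm (Suc ?m) (te [w] \<star> X)) \<in> lin (T A) (T A)" "(%X. N 0 (te [w] \<star> Jm ?m X)) \<in> lin (T A) (T A)"
    using ws(3) by (auto intro!: lin_o[OF Jm_lin] lin_o[OF N_lin] lin_lmult[OF TA_ualg] lin_id Jm_lin)
   fix xs assume xs: "set xs <<: A"
   then have "set (take ?m xs) <<: A" "set (drop ?m xs) <<: A" using set_take_subset set_drop_subset by (metis order_trans)+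
   note p = this[THEN pr_closed]
   show "Jm (Suc ?m) (te [w] \<star> te xs) = N 0 (te [w] \<star> Jm ?m (te xs))"
    using ws(3) xs p Jm_tens[of "w # xs" "Suc ?m"] tens_append[OF AM, of "[w]" xs] N0_ap[OF t2_tp[OF ws(3) p(1)], of "te [pr (drop ?m xs)]"]
    Jm_tens[OF xs, of ?m] by (simp add: te3 nabla_tens' te2[of "w \<otimes> _"] A_ua)
  qed
  have X: "te (us' @ vs) <: (T A)" using ws vA by simp
  have "?f (te (w # us') \<star> te vs) = te [w] \<star> BR C ?n ?m (te (us' @ vs))"
   using ws vA fold_SH[OF ws(3) X, of ?n "[0..<?m]"] tens_append[OF AM, of "w # us'" vs] tens_append[OF AM, of "[w]" "us' @ vs"]
   by (simp add: BR_def)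
  moreover have "Jm ?m (BR C ?n ?m (te (us' @ vs))) = c (te [pr us', pr vs])" using Cons(1)[OF ws(4) vA(2)] ws(2) by simp
  moreover have "BR C ?n ?m (te (us' @ vs)) <: (T A)" by (rule lin_cl[OF BR_lin[OF C_lin] X])
  moreover have "Jm 1 (te (w # us')) = te [w, pr us']" using ws Jm_tens[of "w # us'" 1] by (simp add: A_ua td1)
  moreover have "C 1 (te [w, pr us'] \<star> te [pr vs]) = te [w] \<star> c (te [pr us', pr vs])"
   using ws(3) pu' pv' C1_ap'[OF ws(3) t2_tp[OF pu' pv']] by (simp add: te3)
  ultimately show "Jm (Suc ?m) (?f (te ws \<star> te vs)) = N 0 (C 1 (Jm 1 (te ws) \<star> te [pr vs]))"
   using J ws(1) by simp
 qed
 from this[OF SH_right(2)[OF t vT]] 1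
 have "Jm (Suc ?m) (BR C ?n (Suc ?m) (te (us @ v # vs))) = N 0 (C 1 (c (te [pr us, v]) \<star> te [pr vs]))"
  using J1_SH[OF Cons(2) vA(1)] by simp
 also have "c (te [pr us, v]) \<star> te [pr vs] = C 0 (te [pr us, v] \<star> te [pr vs])"
  using pv' by (intro C0_ap[symmetric] t2_tp pu vA) simp
 also have "N 0 (C 1 (C 0 (te [pr us, v] \<star> te [pr vs]))) = c (N 1 (te [pr us, v] \<star> te [pr vs]))"
  using tp_mult[OF AM t2_tp[OF pu vA(1)] t1_tp(1)[OF pv']] by (intro cN1[symmetric]) simp
 also have "N 1 (te [pr us, v] \<star> te [pr vs]) = te [pr us, pr (v # vs)]" using pu vA pv' by (simp add: N1_3)
 finally show ?case unfolding length_Cons .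
qed

abbreviation m2 where "m2 == tm2 (T V) A mV mV"

lemmas m2_lin = tm2_lin[OF TVM AM mV_lin mV_lin] and m2_tens = tm2_tens[OF TVM AM mV_lin mV_lin]
 and m2_tp = tm2_tp[OF TVM AM mV_lin mV_lin]

lemma m2_ts: "t <: (T V) ==> m2 (ts m t) = Jm m (io t)"
proof (rule T_lin_eq[OF VM lin_o[OF m2_lin ts_lin] lin_o[OF Jm_lin io_lin] TAM])
 fix vs assume vs: "set vs <<: V"
 then have s: "set (take m vs) \<subseteq> VA" "set (drop m vs) \<subseteq> VA" using set_take_subset set_drop_subset by (metis V_sel(1) order_trans)+
 show "m2 (ts m (tv vs)) = Jm m (io (tv vs))"
  using vs s VA_set[OF s(1)] VA_set[OF s(2)] VA_set[of vs]
  by (simp add: ts_tens m2_tens mV_tens io_tens Jm_tens)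
qed

text \<open>By linearity \<open>tbl\<close> is evaluated on two words, where \<open>Jm_BR\<close>
  compares the crossings of letters with the single crossing of the two products.\<close>

lemma m2_tbl: assumes t: "t \<in> tp (T V) 2" shows "m2 (tbl t) = c (m2 t)"
proof -
 have "m2 (tbl t) = C 0 (m2 t)"
 proof (rule tp_lin_eq_gen[OF TVM T_gens TAM lin_tp[OF TVM lin_o[OF m2_lin tbl_lin]] lin_tp[OF TVM lin_o[OF C_lin m2_lin]] _ t])
  fix xs :: "('a list => 'k) set list" assume "length xs = 2" "set xs \<subseteq> tv ` {vs. set vs \<subseteq> VA}"
  then obtain us vs where xs: "xs = [tv us, tv vs]" and u: "set us \<subseteq> VA" "set vs \<subseteq> VA" by (auto simp: len2)
  note uA = VA_set[OF u(1)] VA_set[OF u(2)]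
  have T: "tv (us @ vs) <: (T V)" using u by simp
  have "m2 (bt us vs) = c (te [pr us, pr vs])"
   using u m2_ts[OF lin_cl[OF BR_lin[OF CV_lin] T]] io_BR[OF T] Jm_BR[OF uA] by (simp add: bt_def io_tens)
  then show "m2 (tbl (tt xs)) = C 0 (m2 (tt xs))"
   using u uA pr_closed by (simp add: xs tbl_tv m2_tens mV_tens C_0)
 qed
 then show ?thesis using m2_tp[OF t] by (simp add: C_0)
qed

text \<open>The induced braiding is prescribed on classes of tensors. Since \<open>gS\<close> and
  \<open>fS\<close> translate between these classes and the values of \<open>mV\<close>, the
  requirement on \<open>cS\<close> becomes \<open>m2_tbl\<close>, the compatibility of
  multiplication with the braidings.\<close>

lemma sym_braiding_cS: assumes t: "t \<in> tp S 2" shows "sym_braiding K V cV t = cS t"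
proof -
 note sp = sub_carrier[OF TVM]
 have pp: "tmap K (T V) (carrier (T V)) (carrier (T V)) S pj pj t = tm2 (T V) S pj pj t" if "t \<in> tp (T V) 2" for t
  using that by (intro tmap_tm2[OF TVM SM pj_lin pj_lin sp sp]) (simp_all add: tprod_full[OF TVM])
 note p2_tens = tm2_tens[OF TVM SM pj_lin pj_lin] and p2_tp = tm2_tp[OF TVM SM pj_lin pj_lin]
 have fm: "tm2 A S fS fS (m2 t) = tm2 (T V) S pj pj t" if "t \<in> tp (T V) 2" for t
  by (rule lift2_eq[OF TVM lin_o[OF tm2_lin[OF AM SM fS_lin fS_lin] m2_lin] tm2_lin[OF TVM SM pj_lin pj_lin] T_mod[OF SM] _ that])
   (simp add: m2_tens tm2_tens[OF AM SM fS_lin fS_lin] mV_closed fS_mV p2_tens)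
 have gp2: "tm2 S A gS gS (tm2 (T V) S pj pj t) = m2 t" if "t \<in> tp (T V) 2" for t
  by (rule lift2_eq[OF TVM lin_o[OF tm2_lin[OF SM AM gS_lin gS_lin] tm2_lin[OF TVM SM pj_lin pj_lin]] m2_lin TAM _ that])
   (simp add: m2_tens tm2_tens[OF SM AM gS_lin gS_lin] pj_closed gS_pj p2_tens)
 have P: "cS (tm2 (T V) S pj pj t) = tm2 (T V) S pj pj (tbl t)" if "t \<in> tp (T V) 2" for t
  using that tbl_tp by (simp add: ctr_def gp2 m2_tbl[symmetric] fm)
 note cl = ctr_lin[OF SM fS_lin gS_lin] and ct = ctr_tp[OF SM fS_lin gS_lin]
 have "sym_braiding K V cV = restrict cS (tp S 2)"
  unfolding sym_braiding_def Let_def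
 proof (rule the_linear_eq)
  show "cS \<in> lin (tpow K S 2) (tpow K S 2)" using cl ct by (auto simp: linear_maps_def)
  show "\<forall>t\<in>tp (T V) 2. restrict cS (tp S 2) (tmap K (T V) (carrier (T V)) (carrier (T V)) S pj pj t) =
   tmap K (T V) (carrier (T V)) (carrier (T V)) S pj pj (tensor_braiding K V cV t)"
   using P p2_tp tbl_tp by (simp add: tensor_braiding_tbl pp)
  fix h t assume h: "h \<in> lin (tpow K S 2) (tpow K S 2)" "\<forall>t\<in>tp (T V) 2. h (tmap K (T V) (carrier (T V)) (carrier (T V)) S pj pj t) =
   tmap K (T V) (carrier (T V)) (carrier (T V)) S pj pj (tensor_braiding K V cV t)" and t: "t \<in> tp S 2"
  have h': "h \<in> lin (tpow K S 2) (T S)" using h(1) tp_T[OF SM] by (auto simp: linear_maps_def Pi_iff)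
  show "h t = cS t"
  proof (rule tp_lin_eq[OF SM h' cl T_mod[OF SM] _ t])
   fix ss assume "length ss = 2" "set ss <<: S"
   then obtain a b where ss: "ss = [pj a, pj b]" "a <: (T V)" "b <: (T V)" using S_carr by (auto simp: len2)
   then have ab: "tt [a, b] \<in> tp (T V) 2" by (intro tens_tp[OF TVM]) auto
   then show "h (tens K S ss) = cS (tens K S ss)"
    using h(2) ss P[OF ab] tbl_tp by (auto simp: pp tensor_braiding_tbl p2_tens dest!: bspec[OF _ ab])
  qed
 qed simp_all
 then show ?thesis using t by simp
qed

lemma tm2_the: assumes "module K M" "module K W" "f \<in> lin M W" "t \<in> tp M 2"
 shows "tmap K M (carrier M) (carrier M) W f f t = tm2 M W f f t"
 using assms tprod_full[OF assms(1)] by (intro tmap_tm2[OF assms(1,2,3,3) sub_carrier[OF assms(1)] sub_carrier[OF assms(1)]]) simp_all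

lemma A_graded_braided: "braided_graded_algebra K A c Gr"
 unfolding braided_graded_algebra_def braided_graded_space_def
proof (intro conjI allI ballI)
 show "braided_algebra K A c" by (rule braided_algebra)
 show "braided_space K A c" by (rule A_space)
 show "grading K A Gr" by (rule graded_proj_grading[OF AM gp])
 have "ctr A (%x. x) (%x. x) t = c t" if t: "t \<in> tp A 2" for t
 proof -
  have "tm2 A A (%x. x) (%x. x) t = t" if "t \<in> tp A 2" for t
   by (rule A_lift2_eq[OF tmA_lin[OF L0 L0] lin_id TAM _ that]) (simp add: tmA_tens[OF L0 L0])
  then show ?thesis using t c_tp by (simp add: ctr_def)
 qed
 then have e: "c t = ctr A (%x. x) (%x. x) t" if "t \<in> tp A 2" for t using that by simp
 show "categorical_subspace K A c (Gr n)" for n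
  by (rule categorical_cong[OF AM ctr_cat[OF AM L0 L0 Gr_sub] e])
qed (auto simp: Gr1 GrM)

lemma S_graded_braided: "braided_graded_algebra K S (sym_braiding K V cV) GS"
 unfolding braided_graded_algebra_def braided_graded_space_def
proof (intro conjI allI ballI)
 note cl = ctr_lin[OF SM fS_lin gS_lin] and ct = ctr_tp[OF SM fS_lin gS_lin]
 have sl: "sym_braiding K V cV \<in> lin (tpow K S 2) (T S)"
  by (rule lin_cong[OF cl tpow_mod[OF SM]]) (rule sym_braiding_cS)
 show b: "braided_algebra K S (sym_braiding K V cV)"
  by (rule braided_algebra_transport[OF SM AM gS_lin fS_lin fS_gS sl _ c_lin _ S_ualg braided_algebra gS_mult gS_one])
   (simp_all add: sym_braiding_cS ct gS_cS)
 then show "braided_space K S (sym_braiding K V cV)" by (simp add: braided_algebra_def)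
 show "grading K S GS" by (rule graded_proj_grading[OF SM GS_graded])
 have "categorical_subspace K S cS (GS n)" for n
  by (rule ctr_cat[OF SM fS_lin gS_lin]) (use graded_projD(1)[OF GS_graded] Gr_A in \<open>auto simp: GS_fS fS\<close>)
 then show "categorical_subspace K S (sym_braiding K V cV) (GS n)" for n
  by (rule categorical_cong[OF SM _ sym_braiding_cS])
 show "\<one>\<^sub>S \<in> GS 0" using Gr1 fS_one unfolding GS_fS by (metis image_eqI)
 show "x \<otimes>\<^sub>S y \<in> GS (m + n)" if "x \<in> GS m" "y \<in> GS n" for m n x y
  using that GrM Gr_A unfolding GS_fS by (auto simp flip: fS_mult)
qed

lemma S_iso: "braided_graded_algebra_iso K A c Gr S (sym_braiding K V cV) GS"
proof -
 note sb = sym_braiding_cS and cl = ctr_lin[OF SM fS_lin gS_lin] and ct = ctr_tp[OF SM fS_lin gS_lin]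
 have fcS: "cS (tm2 A S fS fS t) = tm2 A S fS fS (c t)" if t: "t \<in> tp A 2" for t
 proof -
  have "tm2 S A gS gS (tm2 A S fS fS t) = t"
   by (rule A_lift2_eq[OF lin_o[OF tm2_lin[OF SM AM gS_lin gS_lin] tm2_lin[OF AM SM fS_lin fS_lin]] lin_id TAM _ t])
    (simp add: tm2_tens[OF AM SM fS_lin fS_lin] tm2_tens[OF SM AM gS_lin gS_lin] fS)
  then show ?thesis by (simp add: ctr_def)
 qed
 have "fS \<in> braided_graded_algebra_hom K A c Gr S (sym_braiding K V cV) GS"
  unfolding braided_graded_algebra_hom_def braided_hom_def
  using fcS sb tm2_tp[OF AM SM fS_lin fS_lin] c_tp
  by (auto simp: ring_hom_def fS fS_mult fS_one lin_add[OF fS_lin] fS_lin GS_fS tm2_the[OF AM SM fS_lin])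
 moreover have "gS \<in> braided_graded_algebra_hom K S (sym_braiding K V cV) GS A c Gr"
  unfolding braided_graded_algebra_hom_def braided_hom_def
  using gS_cS ct Tm_tm2[OF SM AM gS_lin] Gr_A
  by (auto simp: ring_hom_def gS_mult gS_one lin_cl[OF gS_lin] lin_add[OF gS_lin] gS_lin GS_fS fS sb tm2_the[OF SM AM gS_lin])
 ultimately show ?thesis unfolding braided_graded_algebra_iso_def using A_graded_braided S_graded_braided fS fS_gS by blast
qed

end

context irr_bialg
begin

text \<open>The space of generators is a subspace of \<open>gr H\<close>, so the witness has the
  required type of elements.\<close>

lemma pbw: assumes "char_zero K" shows "pbw_type K A \<Delta> c"
proof -
 interpret P: pbw_alg K B cB DeltaB epsB GB gproj
 proof unfold_locales
  show "graded_proj B GB gproj" by (rule B_graded)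
 qed (use B_comm GB_0 GB_one GB_mult GB_Psi GB_eps GB_cat assms in auto)
 show ?thesis unfolding pbw_type_def Let_def using P.V_braided P.S_iso by blast
qed

end

theorem theorem1p14:
  fixes K :: "('k, 'r) ring_scheme"
    and H :: "('k, 'h) module"
    and \<Delta> :: "'h \<Rightarrow> ('h list \<Rightarrow> 'k) set"
    and \<epsilon> :: "'h \<Rightarrow> 'k"
    and c :: "('h list \<Rightarrow> 'k) set \<Rightarrow> ('h list \<Rightarrow> 'k) set"
  assumes "field K"
    and "char_zero K"
    and "braided_bialgebra K H \<Delta> \<epsilon> c"
    and "symmetric_braiding K H c"
    and "irreducible_bialgebra K H \<Delta>"
  shows "pbw_type K H \<Delta> c"
proof -
 interpret S: symm_bialg K H c \<Delta> \<epsilon> by (rule symm_bialg_of_bialgebra) fact+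
 interpret irr_bialg K H c \<Delta> \<epsilon>
 proof unfold_locales
  fix x assume x: "x <: H"
  have "amp K H 0 1 (lift1 K H \<Delta>) 1 (\<Delta> x) = amp K H 1 1 (lift1 K H \<Delta>) 0 (\<Delta> x)"
   using assms(3) x by (auto simp: braided_bialgebra_def braided_coalgebra_def coalgebra_def)
  then show "S.D 0 (\<Delta> x) = S.D 1 (\<Delta> x)"
   using S.amp_opat[OF S.AM S.l1_lin, of "\<Delta> x" 0 1] S.amp_opat[OF S.AM S.l1_lin, of "\<Delta> x" 1 0] S.Delta_tp[OF x] by simp
 qed (use assms(5) in \<open>simp add: irreducible_bialgebra_def\<close>)
 show ?thesis by (rule pbw) fact
qed

end
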